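(* Let $n\ge 1$, $0\le p\le n+2$, and let $\phi:\Sigma^n\to\mathbb{S}^{n+1}_{p,1}$ be a real diagonalizable immersion, with non-degenerate induced metric, of an oriented $n$-manifold, with unit normal vector field $N$, $\epsilon=\langle N,N\rangle_p\in\{-1,1\}$, and principal curvatures $k_1,\dots,k_n$. Let $\Phi=\phi\wedge N:\Sigma\to L^{\pm}(\mathbb{S}^{n+1}_{p,1})$ be its Gauss map. Restricting to the open set of non-umbilic points of $\phi$, the following hold. (i) Suppose $\Phi$ is an immersion with non-degenerate induced metric $\Phi^*G$. Then $\Phi$ is Hamiltonian minimal with respect to the (para-)Kähler Einstein structure $(G,\mathbb{J})$ if and only if $\phi$ is a critical point of the functional $$\mathcal{W}(\phi)=\int_\Sigma\sqrt{\prod_{i=1}^n|\epsilon+k_i^2|}\;dV .$$ (ii) For $n=2$, suppose $\Phi$ is an immersion with non-degenerate induced metric $\Phi^*G'$. Then $\Phi$ is a Hamiltonian minimal surface in $(L^{\pm}(\mathbb{S}^3_{p,1}),G',\mathbb{J}')$ if and only if $\phi$ is a critical point of the functional $$\mathcal{W}'(\phi)=\int_\Sigma|k_1-k_2|\;dA .$$ Here $dV$, $dA$ denote the volume (area) element of the induced metric $\phi^*g$.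
   Context: Space form: $\mathbb{R}^{n+2}$ carries $\langle\cdot,\cdot\rangle_p=-\sum_{i=1}^p dx_i^2+\sum_{i=p+1}^{n+2}dx_i^2$, and $\mathbb{S}^{n+1}_{p,1}=\{x\in\mathbb{R}^{n+2}:\langle x,x\rangle_p=1\}$ with the induced metric $g$ (signature $(p,n+1-p)$, constant sectional curvature $1$). Real diagonalizable: an immersion $\phi$ is real diagonalizable if locally there are an orthonormal frame $(e_1,\dots,e_n)$ for $\phi^*g$ (i.e. $g(e_i,e_j)=\pm\delta_{ij}$) and real functions $k_1,\dots,k_n$ (principal curvatures) with $Ae_i=k_ie_i$, where $A=-dN$ is the shape operator. Umbilic points are those where all $k_i$ coincide. Space of oriented geodesics: $L^{\pm}(\mathbb{S}^{n+1}_{p,1})=\{x\wedge y\in\Lambda^2(\mathbb{R}^{n+2}) : x\in\mathbb{S}^{n+1}_{p,1},\ y\in T_x\mathbb{S}^{n+1}_{p,1},\ \langle y,y\rangle_p=\epsilon\}$, with $\epsilon=1$ for $L^+$ and $\epsilon=-1$ for $L^-$. The metric $G$ is the one induced by $\langle\langle x_1\wedge y_1,x_2\wedge y_2\rangle\rangle=\langle x_1,x_2\rangle_p\langle y_1,y_2\rangle_p-\langle x_1,y_2\rangle_p\langle x_2,y_1\rangle_p$ on $\Lambda^2(\mathbb{R}^{n+2})$. Tangent vectors at $x\wedge y$ (with $\langle x,x\rangle_p=1$, $\langle y,y\rangle_p=\epsilon$, $\langle x,y\rangle_p=0$) have the form $x\wedge X+y\wedge Y$ with $X,Y$ orthogonal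 to the plane spanned by $x,y$. The (para)complex structure is $\mathbb{J}(x\wedge X+y\wedge Y)=y\wedge X-\epsilon\, x\wedge Y$ (so $\mathbb{J}^2=-\epsilon\,\mathrm{Id}$), and the symplectic form is $\Omega(\cdot,\cdot)=\epsilon G(\mathbb{J}\cdot,\cdot)$. The structure $(G,\mathbb{J},\Omega)$ is Kähler for $L^+$, para-Kähler for $L^-$, and $G$ is Einstein. Second structure for $n=2$: the plane $(x\wedge y)^\perp\subset\mathbb{R}^4$ is oriented compatibly with $x\wedge y$ (positively oriented bases $(e_1,e_2)$ make $(x,y,e_1,e_2)$ positively oriented) and carries a canonical complex (metric definite) or paracomplex (metric indefinite) structure $J'$: for a positively oriented orthonormal basis $(e_1,e_2)$ with $\epsilon_i=\langle e_i,e_i\rangle_p$ (and $\epsilon_1=1$ in the indefinite case), $J'e_1=e_2$, $J'e_2=-\epsilon_1\epsilon_2e_1$. Define $\mathbb{J}'(x\wedge X+y\wedge Y)=x\wedge J'X+y\wedge J'Y$ and $G'(\cdot,\cdot)=\Omega(\cdot,\mathbb{J}'\cdot)=-\epsilon G(\cdot,\mathbb{J}\circ\mathbb{J}'\cdot)$. Then $(G',\mathbb{J}',\Omega)$ is a (para-)Kähler structure with $G'$ of neutral signature and locally conformally flat. Gauss map: $\Phi=\phi\wedge N$; it is Lagrangian for $\Omega$ when it is an immersion. Hamiltonian minimality: let $\Phi$ be a Lagrangian immersion into a (para-)Kähler manifold $(M,J,h,\omega)$ with non-degenerate induced metric $\Phi^*h$. A compactly supported variation $(\Phi_t)$ of $\Phi$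 is Hamiltonian if the normal component of $\partial_t\Phi_t|_{t=0}$ equals $J\,d\Phi(\nabla u)$ for some compactly supported $u\in C^\infty(\Sigma)$, with $\nabla$ the gradient of $\Phi^*h$. $\Phi$ is Hamiltonian minimal if $\frac{d}{dt}\big|_{t=0}\mathrm{Vol}(\Phi_t)=0$ for every Hamiltonian variation, where $\mathrm{Vol}$ is the volume for $|\det\Phi_t^*h|^{1/2}$ (computed on a compact set containing the support of the variation). Equivalently $\operatorname{div}(JH)=0$, with $H$ the mean curvature vector. Critical point: $\phi$ is a critical point of a functional if its first variation at $\phi$ vanishes along every compactly supported smooth variation $(\phi_t)$ of $\phi$ (integrals taken over a compact set containing the support). Along such a variation the integrand of $\mathcal{W}$ is $\sqrt{|\det(\epsilon\,\mathrm{Id}+A_t^2)|}$, where $A_t$ is the shape operator of $\phi_t$; this equals $\sqrt{\prod|\epsilon+k_i^2|}$ when $\phi_t$ is real diagonalizable. *)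

theory Defs
  imports "HOL-Analysis.Analysis"
begin

section \<open>Smooth maps, oriented manifolds, induced metrics\<close>

text \<open>Used for open \<open>S\<close> only: all iterated directional derivatives up to order \<open>k\<close> exist, are
  differentiable up to order \<open>k - 1\<close>, and those of order \<open>k\<close> are continuous.\<close>

primrec Ck_on ::
  "nat \<Rightarrow> 'a::real_normed_vector set \<Rightarrow> ('a \<Rightarrow> 'b::real_normed_vector) \<Rightarrow> bool" where
  "Ck_on 0 S f \<longleftrightarrow> continuous_on S f"
| "Ck_on (Suc k) S f \<longleftrightarrow>
     (\<forall>x\<in>S. f differentiable (at x)) \<and> (\<forall>v. Ck_on k S (\<lambda>x. frechet_derivative f (at x) v))"

definition smooth_on ::
  "'a::real_normed_vector set \<Rightarrow> ('a \<Rightarrow> 'b::real_normed_vector) \<Rightarrow> bool" where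
  "smooth_on S f \<longleftrightarrow> (\<forall>k. Ck_on k S f)"

text \<open>A chart is a pair of its domain and its coordinate map. The underlying space of an atlas is
  the union of the chart domains, an open subset of the ambient topological space. Tangent vectors
  at a point are represented by their coordinates in a chart around that point.\<close>

type_synonym ('a, 'n) chart = "'a set \<times> ('a \<Rightarrow> real ^ 'n)"

definition carrier :: "('a, 'n) chart set \<Rightarrow> 'a set" where
  "carrier A = (\<Union>c\<in>A. fst c)"

definition chart_inv :: "('a, 'n) chart \<Rightarrow> real ^ 'n \<Rightarrow> 'a" where
  "chart_inv c = inv_into (fst c) (snd c)"

definition chart_range :: "('a, 'n) chart \<Rightarrow> (real ^ 'n) set" where
  "chart_range c = snd c ` fst c"

definition oriented_manifold ::
  "('a::{t2_space,second_countable_topology}, 'n::finite) chart set \<Rightarrow> bool" where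
  "oriented_manifold A \<longleftrightarrow>
     (\<forall>c\<in>A. open (fst c) \<and> open (chart_range c) \<and>
        homeomorphism (fst c) (chart_range c) (snd c) (chart_inv c)) \<and>
     (\<forall>c\<in>A. \<forall>d\<in>A. smooth_on (snd c ` (fst c \<inter> fst d)) (snd d \<circ> chart_inv c) \<and>
        (\<forall>x \<in> fst c \<inter> fst d.
           det (matrix (frechet_derivative (snd d \<circ> chart_inv c) (at (snd c x)))) > 0))"

definition restrict_atlas :: "('a, 'n) chart set \<Rightarrow> 'a set \<Rightarrow> ('a, 'n) chart set" where
  "restrict_atlas A W = (\<lambda>(U, \<psi>). (U \<inter> W, \<psi>)) ` A"

definition smooth_map ::
  "('a, 'n::finite) chart set \<Rightarrow> ('a \<Rightarrow> 'e::real_normed_vector) \<Rightarrow> bool" where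
  "smooth_map A f \<longleftrightarrow> (\<forall>c\<in>A. smooth_on (chart_range c) (f \<circ> chart_inv c))"

definition differential ::
  "('a, 'n::finite) chart \<Rightarrow> ('a \<Rightarrow> 'e::real_normed_vector) \<Rightarrow> 'a \<Rightarrow> real ^ 'n \<Rightarrow> 'e" where
  "differential c f x = frechet_derivative (f \<circ> chart_inv c) (at (snd c x))"

definition immersion ::
  "('a, 'n::finite) chart set \<Rightarrow> ('a \<Rightarrow> 'e::real_normed_vector) \<Rightarrow> bool" where
  "immersion A f \<longleftrightarrow> smooth_map A f \<and> (\<forall>c\<in>A. \<forall>x\<in>fst c. inj (differential c f x))"

text \<open>A pseudo-Riemannian metric on a submanifold of a vector space \<open>'e\<close> is a map \<open>h\<close> such that
  \<open>h P\<close> is a bilinear form, whose values only matter on vectors tangent at \<open>P\<close>.\<close>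

definition induced_metric ::
  "('e \<Rightarrow> 'e \<Rightarrow> 'e \<Rightarrow> real) \<Rightarrow> ('a, 'n::finite) chart \<Rightarrow> ('a \<Rightarrow> 'e::real_normed_vector) \<Rightarrow>
    'a \<Rightarrow> real ^ 'n \<Rightarrow> real ^ 'n \<Rightarrow> real" where
  "induced_metric h c f x v w = h (f x) (differential c f x v) (differential c f x w)"

definition nondegenerate_metric ::
  "('a, 'n::finite) chart set \<Rightarrow> ('e \<Rightarrow> 'e \<Rightarrow> 'e \<Rightarrow> real) \<Rightarrow>
    ('a \<Rightarrow> 'e::real_normed_vector) \<Rightarrow> bool" where
  "nondegenerate_metric A h f \<longleftrightarrow>
     (\<forall>c\<in>A. \<forall>x\<in>fst c. \<forall>v. (\<forall>w. induced_metric h c f x v w = 0) \<longrightarrow> v = 0)"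

definition volume_density ::
  "('e \<Rightarrow> 'e \<Rightarrow> 'e \<Rightarrow> real) \<Rightarrow> ('a, 'n::finite) chart \<Rightarrow> ('a \<Rightarrow> 'e::real_normed_vector) \<Rightarrow>
    'a \<Rightarrow> real" where
  "volume_density h c f x =
     sqrt \<bar>det (\<chi> i j. induced_metric h c f x (axis i 1) (axis j 1))\<bar>"

text \<open>The Borel measure on the manifold that has density \<open>sqrt \<bar>det f\<^sup>*h\<bar>\<close> in every chart; it exists
  by the change of variables formula, and is unique because countably many charts suffice to cover
  the manifold.\<close>

definition volume_measure ::
  "('a::topological_space, 'n::finite) chart set \<Rightarrow> ('e \<Rightarrow> 'e \<Rightarrow> 'e \<Rightarrow> real) \<Rightarrow>
    ('a \<Rightarrow> 'e::real_normed_vector) \<Rightarrow> 'a measure" where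
  "volume_measure A h f = (THE \<mu>. sets \<mu> = sets (restrict_space borel (carrier A)) \<and>
     (\<forall>c\<in>A. \<forall>B\<in>sets borel. B \<subseteq> fst c \<longrightarrow>
        emeasure \<mu> B =
          (\<integral>\<^sup>+u\<in>snd c ` B. ennreal (volume_density h c f (chart_inv c u)) \<partial>lborel)))"

section \<open>Variations and Hamiltonian minimality\<close>

text \<open>\<open>L\<close> is the target submanifold, and \<open>K\<close> a compact set containing the support.\<close>

definition variation ::
  "('a::topological_space, 'n::finite) chart set \<Rightarrow> 'e::real_normed_vector set \<Rightarrow> ('a \<Rightarrow> 'e) \<Rightarrow>
    real \<Rightarrow> 'a set \<Rightarrow> (real \<Rightarrow> 'a \<Rightarrow> 'e) \<Rightarrow> bool" where
  "variation A L f \<delta> K F \<longleftrightarrow>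
     \<delta> > 0 \<and> compact K \<and> K \<subseteq> carrier A \<and>
     (\<forall>c\<in>A. smooth_on ({-\<delta><..<\<delta>} \<times> chart_range c) (\<lambda>(t, u). F t (chart_inv c u))) \<and>
     (\<forall>t\<in>{-\<delta><..<\<delta>}. \<forall>x\<in>carrier A. F t x \<in> L) \<and>
     (\<forall>x\<in>carrier A. F 0 x = f x) \<and>
     (\<forall>t\<in>{-\<delta><..<\<delta>}. \<forall>x\<in>carrier A - K. F t x = f x)"

text \<open>The functional is evaluated on compact subsets of the manifold.\<close>

definition critical_point ::
  "('a::topological_space, 'n::finite) chart set \<Rightarrow> 'e::real_normed_vector set \<Rightarrow>
    ('a set \<Rightarrow> ('a \<Rightarrow> 'e) \<Rightarrow> real) \<Rightarrow> ('a \<Rightarrow> 'e) \<Rightarrow> bool" where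
  "critical_point A L E f \<longleftrightarrow>
     (\<forall>\<delta> K F. variation A L f \<delta> K F \<longrightarrow> ((\<lambda>t. E K (F t)) has_real_derivative 0) (at 0))"

definition lagrangian ::
  "('a, 'n::finite) chart set \<Rightarrow> ('e \<Rightarrow> 'e \<Rightarrow> 'e \<Rightarrow> real) \<Rightarrow>
    ('a \<Rightarrow> 'e::real_normed_vector) \<Rightarrow> bool" where
  "lagrangian A \<omega> f \<longleftrightarrow>
     (\<forall>c\<in>A. \<forall>x\<in>fst c. \<forall>v w. \<omega> (f x) (differential c f x v) (differential c f x w) = 0)"

definition induced_gradient ::
  "('e \<Rightarrow> 'e \<Rightarrow> 'e \<Rightarrow> real) \<Rightarrow> ('a, 'n::finite) chart \<Rightarrow> ('a \<Rightarrow> 'e::real_normed_vector) \<Rightarrow>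
    ('a \<Rightarrow> real) \<Rightarrow> 'a \<Rightarrow> real ^ 'n" where
  "induced_gradient h c f u x =
     (THE w. \<forall>v. induced_metric h c f x w v = differential c u x v)"

definition is_normal_component ::
  "('e \<Rightarrow> 'e \<Rightarrow> 'e \<Rightarrow> real) \<Rightarrow> ('a, 'n::finite) chart \<Rightarrow> ('a \<Rightarrow> 'e::real_normed_vector) \<Rightarrow>
    'a \<Rightarrow> 'e \<Rightarrow> 'e \<Rightarrow> bool" where
  "is_normal_component h c f x V V' \<longleftrightarrow>
     V - V' \<in> range (differential c f x) \<and> (\<forall>w. h (f x) V' (differential c f x w) = 0)"

definition hamiltonian_variation ::
  "('a::topological_space, 'n::finite) chart set \<Rightarrow> 'e::real_normed_vector set \<Rightarrow>
    ('e \<Rightarrow> 'e \<Rightarrow> 'e \<Rightarrow> real) \<Rightarrow> ('e \<Rightarrow> 'e \<Rightarrow> 'e) \<Rightarrow> ('a \<Rightarrow> 'e) \<Rightarrow>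
    real \<Rightarrow> 'a set \<Rightarrow> (real \<Rightarrow> 'a \<Rightarrow> 'e) \<Rightarrow> bool" where
  "hamiltonian_variation A L h J f \<delta> K F \<longleftrightarrow>
     variation A L f \<delta> K F \<and>
     (\<exists>u :: 'a \<Rightarrow> real. smooth_map A u \<and>
        (\<exists>K'. compact K' \<and> K' \<subseteq> carrier A \<and> (\<forall>x\<in>carrier A - K'. u x = 0)) \<and>
        (\<forall>c\<in>A. \<forall>x\<in>fst c.
           is_normal_component h c f x (vector_derivative (\<lambda>t. F t x) (at 0))
             (J (f x) (differential c f x (induced_gradient h c f u x)))))"

definition hamiltonian_minimal ::
  "('a::topological_space, 'n::finite) chart set \<Rightarrow> 'e::real_normed_vector set \<Rightarrow>
    ('e \<Rightarrow> 'e \<Rightarrow> 'e \<Rightarrow> real) \<Rightarrow> ('e \<Rightarrow> 'e \<Rightarrow> 'e) \<Rightarrow> ('e \<Rightarrow> 'e \<Rightarrow> 'e \<Rightarrow> real) \<Rightarrow>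
    ('a \<Rightarrow> 'e) \<Rightarrow> bool" where
  "hamiltonian_minimal A L h J \<omega> f \<longleftrightarrow>
     immersion A f \<and> (\<forall>x\<in>carrier A. f x \<in> L) \<and> lagrangian A \<omega> f \<and>
     nondegenerate_metric A h f \<and>
     (\<forall>\<delta> K F. hamiltonian_variation A L h J f \<delta> K F \<longrightarrow>
        ((\<lambda>t. measure (volume_measure A h (F t)) K) has_real_derivative 0) (at 0))"

section \<open>The space form and its hypersurfaces\<close>

text \<open>The coordinates of \<open>\<real>\<^sup>n\<^sup>+\<^sup>2\<close> are indexed by a linearly ordered type with \<open>n + 2\<close> elements;
  \<open>idx\<close> numbers them from 0, so that the first \<open>p\<close> coordinates are those with \<open>idx i < p\<close>.\<close>

type_synonym 'm rvec = "(real, 'm) vec"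
type_synonym 'm bivec = "((real, 'm) vec, 'm) vec"

definition idx :: "'m::{finite,linorder} \<Rightarrow> nat" where
  "idx i = card {j. j < i}"

definition sgn_coord :: "nat \<Rightarrow> 'm::{finite,linorder} \<Rightarrow> real" where
  "sgn_coord p i = (if idx i < p then -1 else 1)"

definition ip :: "nat \<Rightarrow> 'm::{finite,linorder} rvec \<Rightarrow> 'm rvec \<Rightarrow> real" where
  "ip p x y = (\<Sum>i\<in>UNIV. sgn_coord p i * x $ i * y $ i)"

definition pseudo_sphere :: "nat \<Rightarrow> ('m::{finite,linorder} rvec) set" where
  "pseudo_sphere p = {x. ip p x x = 1}"

definition unit_normal ::
  "('a, 'n::finite) chart set \<Rightarrow> nat \<Rightarrow> real \<Rightarrow> ('a \<Rightarrow> 'm::{finite,linorder} rvec) \<Rightarrow>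
    ('a \<Rightarrow> 'm rvec) \<Rightarrow> bool" where
  "unit_normal A p \<epsilon> \<phi> N \<longleftrightarrow>
     smooth_map A N \<and>
     (\<forall>c\<in>A. \<forall>x\<in>fst c. ip p (N x) (N x) = \<epsilon> \<and> ip p (N x) (\<phi> x) = 0 \<and>
        (\<forall>v. ip p (N x) (differential c \<phi> x v) = 0))"

text \<open>\<open>A = -dN\<close>, where tangent vectors \<open>v\<close> are identified with \<open>d\<phi> v\<close>.\<close>

definition shape_operator ::
  "('a, 'n::finite) chart \<Rightarrow> ('a \<Rightarrow> 'm::finite rvec) \<Rightarrow> ('a \<Rightarrow> 'm rvec) \<Rightarrow> 'a \<Rightarrow>
    real ^ 'n \<Rightarrow> real ^ 'n" where
  "shape_operator c \<phi> N x v = (THE w. differential c \<phi> x w = - differential c N x v)"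

definition orthonormal ::
  "(real ^ 'n \<Rightarrow> real ^ 'n \<Rightarrow> real) \<Rightarrow> ('n::finite \<Rightarrow> real ^ 'n) \<Rightarrow> bool" where
  "orthonormal g e \<longleftrightarrow>
     (\<forall>i. g (e i) (e i) \<in> {-1, 1}) \<and> (\<forall>i j. i \<noteq> j \<longrightarrow> g (e i) (e j) = 0)"

definition principal_curvatures ::
  "('a, 'n::finite) chart \<Rightarrow> nat \<Rightarrow> ('a \<Rightarrow> 'm::{finite,linorder} rvec) \<Rightarrow>
    ('a \<Rightarrow> 'm rvec) \<Rightarrow> 'a \<Rightarrow> ('n \<Rightarrow> real) \<Rightarrow> bool" where
  "principal_curvatures c p \<phi> N x k \<longleftrightarrow>
     (\<exists>e. orthonormal (induced_metric (\<lambda>_. ip p) c \<phi> x) e \<and>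
          (\<forall>i. shape_operator c \<phi> N x (e i) = k i *\<^sub>R e i))"

text \<open>The frame \<open>e\<close> is smooth; the smoothness of the functions \<open>k\<close> is then automatic.\<close>

definition real_diagonalizable ::
  "('a::topological_space, 'n::finite) chart set \<Rightarrow> nat \<Rightarrow>
    ('a \<Rightarrow> 'm::{finite,linorder} rvec) \<Rightarrow> ('a \<Rightarrow> 'm rvec) \<Rightarrow> bool" where
  "real_diagonalizable A p \<phi> N \<longleftrightarrow>
     (\<forall>x\<in>carrier A. \<exists>c\<in>A. \<exists>V. open V \<and> x \<in> V \<and> V \<subseteq> fst c \<and>
        (\<exists>(e :: 'n \<Rightarrow> 'a \<Rightarrow> real ^ 'n) (k :: 'n \<Rightarrow> 'a \<Rightarrow> real).
           (\<forall>i. smooth_on (snd c ` V) (e i \<circ> chart_inv c)) \<and>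
           (\<forall>y\<in>V. orthonormal (induced_metric (\<lambda>_. ip p) c \<phi> y) (\<lambda>i. e i y) \<and>
              (\<forall>i. shape_operator c \<phi> N y (e i y) = k i y *\<^sub>R e i y))))"

definition non_umbilic ::
  "('a, 'n::finite) chart set \<Rightarrow> nat \<Rightarrow> ('a \<Rightarrow> 'm::{finite,linorder} rvec) \<Rightarrow>
    ('a \<Rightarrow> 'm rvec) \<Rightarrow> 'a set" where
  "non_umbilic A p \<phi> N = {x \<in> carrier A.
     \<forall>c\<in>A. x \<in> fst c \<longrightarrow>
       (\<forall>k. principal_curvatures c p \<phi> N x k \<longrightarrow> (\<exists>i j. k i \<noteq> k j))}"

section \<open>The two functionals\<close>

definition chart_at :: "('a, 'n) chart set \<Rightarrow> 'a \<Rightarrow> ('a, 'n) chart" where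
  "chart_at A x = (SOME c. c \<in> A \<and> x \<in> fst c)"

text \<open>Neither integrand below depends on the chart, nor on the choice of the unit normal (replacing
  \<open>N\<close> by \<open>-N\<close> on a component replaces \<open>A\<close> by \<open>-A\<close>). A map close to an immersion with unit normal,
  and equal to it off a compact set, again has a unit normal.\<close>

definition W_functional ::
  "('a::topological_space, 'n::finite) chart set \<Rightarrow> nat \<Rightarrow> real \<Rightarrow> 'a set \<Rightarrow>
    ('a \<Rightarrow> 'm::{finite,linorder} rvec) \<Rightarrow> real" where
  "W_functional A p \<epsilon> K \<phi> =
     (let N = (SOME N. unit_normal A p \<epsilon> \<phi> N) in
      LINT x:K|volume_measure A (\<lambda>_. ip p) \<phi>.
        (let S = matrix (shape_operator (chart_at A x) \<phi> N x)
         in sqrt \<bar>det (\<epsilon> *\<^sub>R mat 1 + S ** S)\<bar>))"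

text \<open>Hence, where the principal curvatures \<open>k\<close> exist, the integrand of \<open>W_functional\<close> is the square
  root of \<open>\<Prod>\<bar>\<epsilon> + k\<^sub>i\<^sup>2\<bar>\<close>.\<close>

lemma det_eps_square_shape:
  fixes e :: "'n::finite \<Rightarrow> real ^ 'n"
  assumes e: "orthonormal g e" and g: "bilinear g" and S: "linear S" "\<And>i. S (e i) = k i *\<^sub>R e i"
  shows "\<bar>det (\<epsilon> *\<^sub>R mat 1 + matrix S ** matrix S)\<bar> = (\<Prod>i\<in>UNIV. \<bar>\<epsilon> + (k i)\<^sup>2\<bar>)"
proof -
  define P :: "real ^ 'n ^ 'n" where "P = (\<chi> i j. e j $ i)"
  define D :: "real ^ 'n ^ 'n" where "D = (\<chi> i j. if i = j then \<epsilon> + (k i)\<^sup>2 else 0)"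
  have Pax: "P *v axis i 1 = e i" for i
    by (simp add: P_def matrix_vector_mult_basis column_def vec_eq_iff)
  have Pv: "P *v v = (\<Sum>i\<in>UNIV. v $ i *\<^sub>R e i)" for v
    by (simp add: P_def matrix_vector_mult_def vec_eq_iff mult.commute)
  have "v = 0" if "P *v v = 0" for v
  proof -
    have "v $ j = 0" for j
    proof -
      have "g (P *v v) (e j) = 0"
        using that bilinear_lzero[OF g] by simp
      moreover have "g (P *v v) (e j) = (\<Sum>i\<in>UNIV. v $ i * g (e i) (e j))"
        using g unfolding Pv bilinear_def
        by (simp add: linear_sum[of "\<lambda>x. g x (e j)"] linear_cmul[of "\<lambda>x. g x (e j)"])
      moreover have "(\<Sum>i\<in>UNIV. v $ i * g (e i) (e j)) = (\<Sum>i\<in>UNIV. if i = j then v $ i * g (e i) (e j) else 0)"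
        using e by (intro sum.cong) (auto simp: orthonormal_def)
      ultimately have "v $ j * g (e j) (e j) = 0" by simp
      moreover have "g (e j) (e j) \<in> {-1, 1}" using e by (auto simp: orthonormal_def)
      ultimately show ?thesis by auto
    qed
    then show ?thesis by (simp add: vec_eq_iff)
  qed
  then have inv: "det P \<noteq> 0"
    using invertible_det_nz[of P] invertible_left_inverse[of P] matrix_left_invertible_ker[of P] by blast
  have S': "matrix S *v v = S v" for v using S(1) by (simp add: matrix_works)
  have "(\<epsilon> *\<^sub>R mat 1 + matrix S ** matrix S) ** P = P ** D"
  proof -
    have "((\<epsilon> *\<^sub>R mat 1 + matrix S ** matrix S) ** P) *v axis i 1 = (P ** D) *v axis i 1" for i
    proof -
      have "D *v axis i 1 = (\<epsilon> + (k i)\<^sup>2) *\<^sub>R axis i 1"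
        by (simp only: D_def matrix_vector_mult_basis column_def) (simp add: vec_eq_iff axis_def)
      then have r: "(P ** D) *v axis i 1 = (\<epsilon> + (k i)\<^sup>2) *\<^sub>R e i"
        by (simp add: matrix_vector_mul_assoc[symmetric] matrix_vector_mult_scaleR Pax)
      have "((\<epsilon> *\<^sub>R mat 1 + matrix S ** matrix S) ** P) *v axis i 1
          = \<epsilon> *\<^sub>R e i + S (S (e i))"
        by (simp add: matrix_vector_mul_assoc[symmetric] Pax matrix_vector_mult_add_rdistrib S'
            scaleR_matrix_vector_assoc[symmetric])
      also have "\<dots> = (\<epsilon> + (k i)\<^sup>2) *\<^sub>R e i"
        using S by (simp add: linear_cmul algebra_simps power2_eq_square)
      finally show ?thesis using r by simp
    qed
    then show ?thesis
      by (simp only: matrix_vector_mult_basis) (simp add: column_def vec_eq_iff)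
  qed
  then have "det (\<epsilon> *\<^sub>R mat 1 + matrix S ** matrix S) * det P = det P * det D"
    by (metis det_mul)
  then have "det (\<epsilon> *\<^sub>R mat 1 + matrix S ** matrix S) = det D" using inv by simp
  also have "det D = (\<Prod>i\<in>UNIV. \<epsilon> + (k i)\<^sup>2)"
    by (subst det_diagonal) (auto simp: D_def)
  finally show ?thesis by (simp add: abs_prod)
qed

definition curvature_gap ::
  "('a, 'n::finite) chart \<Rightarrow> nat \<Rightarrow> ('a \<Rightarrow> 'm::{finite,linorder} rvec) \<Rightarrow>
    ('a \<Rightarrow> 'm rvec) \<Rightarrow> 'a \<Rightarrow> real" where
  "curvature_gap c p \<phi> N x =
     (THE d. \<exists>k i j. principal_curvatures c p \<phi> N x k \<and> i \<noteq> j \<and> d = \<bar>k i - k j\<bar>)"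

text \<open>Meant for \<open>CARD('n) = 2\<close>. Near a surface without umbilics that is real diagonalizable, all
  surfaces are pointwise real diagonalizable, so that the integrand is defined.\<close>

definition W'_functional ::
  "('a::topological_space, 'n::finite) chart set \<Rightarrow> nat \<Rightarrow> real \<Rightarrow> 'a set \<Rightarrow>
    ('a \<Rightarrow> 'm::{finite,linorder} rvec) \<Rightarrow> real" where
  "W'_functional A p \<epsilon> K \<phi> =
     (let N = (SOME N. unit_normal A p \<epsilon> \<phi> N) in
      LINT x:K|volume_measure A (\<lambda>_. ip p) \<phi>. curvature_gap (chart_at A x) p \<phi> N x)"

section \<open>The space of oriented geodesics\<close>

text \<open>\<open>\<Lambda>\<^sup>2\<close> is realised as the skew-symmetric matrices inside \<open>'m bivec\<close>.\<close>

definition wedge :: "'m::finite rvec \<Rightarrow> 'm rvec \<Rightarrow> 'm bivec" where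
  "wedge x y = (\<chi> i j. x $ i * y $ j - x $ j * y $ i)"

definition biv_ip ::
  "nat \<Rightarrow> 'm bivec \<Rightarrow> 'm::{finite,linorder} bivec \<Rightarrow> real" where
  "biv_ip p V W = (\<Sum>i\<in>UNIV. \<Sum>j\<in>UNIV. sgn_coord p i * sgn_coord p j * V $ i $ j * W $ i $ j) / 2"

lemma biv_ip_wedge:
  "biv_ip p (wedge x1 y1) (wedge x2 y2) = ip p x1 x2 * ip p y1 y2 - ip p x1 y2 * ip p x2 y1"
proof -
  let ?s = "sgn_coord p"
  have "ip p x1 x2 * ip p y1 y2 - ip p x1 y2 * ip p x2 y1 =
      (\<Sum>i\<in>UNIV. \<Sum>j\<in>UNIV. ?s i * ?s j * (x1$i * x2$i * y1$j * y2$j - x1$i * y2$i * x2$j * y1$j))"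
    (is "?r = ?a")
    by (simp add: ip_def sum_product sum_subtractf algebra_simps)
  moreover have "?a =
      (\<Sum>i\<in>UNIV. \<Sum>j\<in>UNIV. ?s i * ?s j * (x1$j * x2$j * y1$i * y2$i - x1$j * y2$j * x2$i * y1$i))"
    (is "_ = ?b")
    by (subst sum.swap) (simp add: mult.commute)
  moreover have "2 * biv_ip p (wedge x1 y1) (wedge x2 y2) = ?a + ?b"
    by (simp add: biv_ip_def wedge_def sum.distrib[symmetric] algebra_simps)
  ultimately show ?thesis by linarith
qed

text \<open>\<open>P\<close> is the geodesic \<open>x \<and> y\<close> through \<open>x\<close> with unit tangent \<open>y\<close>.\<close>

definition geodesic ::
  "nat \<Rightarrow> real \<Rightarrow> 'm::{finite,linorder} bivec \<Rightarrow> 'm rvec \<Rightarrow> 'm rvec \<Rightarrow> bool" where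
  "geodesic p \<epsilon> P x y \<longleftrightarrow>
     x \<in> pseudo_sphere p \<and> ip p x y = 0 \<and> ip p y y = \<epsilon> \<and> P = wedge x y"

definition L_geo :: "nat \<Rightarrow> real \<Rightarrow> ('m::{finite,linorder} bivec) set" where
  "L_geo p \<epsilon> = {P. \<exists>x y. geodesic p \<epsilon> P x y}"

definition perp ::
  "nat \<Rightarrow> 'm rvec \<Rightarrow> 'm rvec \<Rightarrow> ('m::{finite,linorder} rvec) set" where
  "perp p x y = {X. ip p X x = 0 \<and> ip p X y = 0}"

definition G_metric ::
  "nat \<Rightarrow> 'm bivec \<Rightarrow> 'm bivec \<Rightarrow> 'm::{finite,linorder} bivec \<Rightarrow> real" where
  "G_metric p P V W = biv_ip p V W"

text \<open>The structures \<open>J_geo\<close> and \<open>J'_geo\<close> act on the vectors \<open>V\<close> tangent to \<open>L_geo\<close> at \<open>P\<close>; the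
  result does not depend on the vectors \<open>x\<close>, \<open>y\<close> chosen to represent \<open>P\<close>.\<close>

definition J_geo ::
  "nat \<Rightarrow> real \<Rightarrow> 'm bivec \<Rightarrow> 'm bivec \<Rightarrow> 'm::{finite,linorder} bivec" where
  "J_geo p \<epsilon> P V = (THE W. \<exists>x y X Y. geodesic p \<epsilon> P x y \<and> X \<in> perp p x y \<and> Y \<in> perp p x y \<and>
     V = wedge x X + wedge y Y \<and> W = wedge y X - \<epsilon> *\<^sub>R wedge x Y)"

lemma wedge_mul:
  assumes "x \<in> pseudo_sphere p" "ip p x y = 0" "ip p y y = \<epsilon>" "X \<in> perp p x y" "Y \<in> perp p x y"
  shows "(\<Sum>l\<in>UNIV. sgn_coord p l * (wedge x X + wedge y Y) $ i $ l * wedge x y $ l $ j)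
     = \<epsilon> * Y $ i * x $ j - X $ i * y $ j"
proof -
  have "(\<Sum>l\<in>UNIV. sgn_coord p l * (wedge x X + wedge y Y) $ i $ l * wedge x y $ l $ j)
     = x$i * y$j * ip p X x - x$i*x$j * ip p X y - X$i*y$j * ip p x x + X$i * x$j * ip p x y
     + y$i * y$j * ip p Y x - y$i*x$j * ip p Y y - Y$i*y$j * ip p x y + Y$i * x$j * ip p y y"
    by (simp add: wedge_def ip_def sum_distrib_left sum.distrib[symmetric] sum_subtractf[symmetric] algebra_simps)
  then show ?thesis using assms by (simp add: pseudo_sphere_def perp_def)
qed

lemma J_geo_wedge:
  assumes g: "geodesic p \<epsilon> P x y" and X: "X \<in> perp p x y" and Y: "Y \<in> perp p x y"
  shows "J_geo p \<epsilon> P (wedge x X + wedge y Y) = wedge y X - \<epsilon> *\<^sub>R wedge x Y"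
  unfolding J_geo_def
proof (rule the_equality)
  let ?f = "\<lambda>V. \<chi> i j. (\<Sum>l\<in>UNIV. sgn_coord p l * V $ i $ l * P $ l $ j)
        - (\<Sum>l\<in>UNIV. sgn_coord p l * V $ j $ l * P $ l $ i)"
  have *: "wedge y X - \<epsilon> *\<^sub>R wedge x Y = ?f (wedge x X + wedge y Y)"
    if "geodesic p \<epsilon> P x y" "X \<in> perp p x y" "Y \<in> perp p x y" for x y X Y
    using that wedge_mul[of x p y \<epsilon> X Y]
    by (simp add: geodesic_def vec_eq_iff) (simp add: wedge_def algebra_simps)
  show "\<exists>x' y' X' Y'. geodesic p \<epsilon> P x' y' \<and> X' \<in> perp p x' y' \<and> Y' \<in> perp p x' y' \<and>
     wedge x X + wedge y Y = wedge x' X' + wedge y' Y' \<and>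
     wedge y X - \<epsilon> *\<^sub>R wedge x Y = wedge y' X' - \<epsilon> *\<^sub>R wedge x' Y'"
    using assms by blast
  fix W assume "\<exists>x' y' X' Y'. geodesic p \<epsilon> P x' y' \<and> X' \<in> perp p x' y' \<and> Y' \<in> perp p x' y' \<and>
     wedge x X + wedge y Y = wedge x' X' + wedge y' Y' \<and> W = wedge y' X' - \<epsilon> *\<^sub>R wedge x' Y'"
  then obtain x' y' X' Y' where "geodesic p \<epsilon> P x' y'" "X' \<in> perp p x' y'" "Y' \<in> perp p x' y'"
      and V: "wedge x X + wedge y Y = wedge x' X' + wedge y' Y'"
      and W: "W = wedge y' X' - \<epsilon> *\<^sub>R wedge x' Y'"
    by blast
  then have "W = ?f (wedge x' X' + wedge y' Y')" by (simp only: *)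
  then show "W = wedge y X - \<epsilon> *\<^sub>R wedge x Y"
    by (simp only: V[symmetric] *[OF assms])
qed

definition Omega ::
  "nat \<Rightarrow> real \<Rightarrow> 'm bivec \<Rightarrow> 'm bivec \<Rightarrow> 'm::{finite,linorder} bivec \<Rightarrow> real" where
  "Omega p \<epsilon> P V W = \<epsilon> * G_metric p P (J_geo p \<epsilon> P V) W"

text \<open>The remaining definitions are meant for \<open>CARD('m) = 4\<close>.\<close>

definition positively_oriented ::
  "'m rvec \<Rightarrow> 'm rvec \<Rightarrow> 'm rvec \<Rightarrow> 'm::{finite,linorder} rvec \<Rightarrow> bool" where
  "positively_oriented x y e1 e2 \<longleftrightarrow> det ((\<chi> i. [x, y, e1, e2] ! idx i) :: 'm bivec) > 0"

text \<open>A positively oriented orthonormal basis of the plane orthogonal to \<open>x\<close> and \<open>y\<close>, whose first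
  vector is spacelike if the plane is indefinite.\<close>

definition adapted_basis ::
  "nat \<Rightarrow> 'm rvec \<Rightarrow> 'm rvec \<Rightarrow> 'm rvec \<Rightarrow> 'm::{finite,linorder} rvec \<Rightarrow> bool" where
  "adapted_basis p x y e1 e2 \<longleftrightarrow>
     e1 \<in> perp p x y \<and> e2 \<in> perp p x y \<and> ip p e1 e2 = 0 \<and>
     ip p e1 e1 \<in> {-1, 1} \<and> ip p e2 e2 \<in> {-1, 1} \<and>
     (ip p e1 e1 \<noteq> ip p e2 e2 \<longrightarrow> ip p e1 e1 = 1) \<and>
     positively_oriented x y e1 e2"

definition J'_plane ::
  "nat \<Rightarrow> 'm rvec \<Rightarrow> 'm rvec \<Rightarrow> 'm rvec \<Rightarrow> 'm::{finite,linorder} rvec" where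
  "J'_plane p x y X = (THE Z. \<exists>e1 e2 a b. adapted_basis p x y e1 e2 \<and>
     X = a *\<^sub>R e1 + b *\<^sub>R e2 \<and> Z = a *\<^sub>R e2 - (b * ip p e1 e1 * ip p e2 e2) *\<^sub>R e1)"

definition J'_geo ::
  "nat \<Rightarrow> real \<Rightarrow> 'm bivec \<Rightarrow> 'm bivec \<Rightarrow> 'm::{finite,linorder} bivec" where
  "J'_geo p \<epsilon> P V = (THE W. \<exists>x y X Y. geodesic p \<epsilon> P x y \<and> X \<in> perp p x y \<and> Y \<in> perp p x y \<and>
     V = wedge x X + wedge y Y \<and> W = wedge x (J'_plane p x y X) + wedge y (J'_plane p x y Y))"

definition G'_metric ::
  "nat \<Rightarrow> real \<Rightarrow> 'm bivec \<Rightarrow> 'm bivec \<Rightarrow> 'm::{finite,linorder} bivec \<Rightarrow> real" where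
  "G'_metric p \<epsilon> P V W = Omega p \<epsilon> P V (J'_geo p \<epsilon> P W)"

end

theory Submission
  imports Defs
begin

text \<open>The functionals \<open>W\<close> and \<open>W'\<close> are the volumes of the Gauss map \<open>\<Phi>\<close> for \<open>G\<close> and \<open>G'\<close>: with
  respect to \<open>\<phi>\<^sup>*g\<close>, the form \<open>\<Phi>\<^sup>*G\<close> corresponds to \<open>\<epsilon> + A\<^sup>2\<close>, and \<open>\<Phi>\<^sup>*G'\<close> has determinant
  \<open>(k\<^sub>1 - k\<^sub>2)\<^sup>2\<close> up to sign. Along a variation of \<open>\<phi>\<close> the unit normal extends smoothly (and for
  \<open>W'\<close> the discriminant of \<open>A\<close> stays positive), so that \<open>W\<close> and \<open>W'\<close> remain the volumes of the Gauss
  maps. A variation of \<open>\<Phi>\<close> with initial velocity \<open>V\<close> is Hamiltonian with function \<open>u\<close> if and only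
  if \<open>\<Omega>(V, d\<Phi> w) = - du(w)\<close> for all \<open>w\<close>, whichever of the two structures is used. The Gauss maps of
  a variation of \<open>\<phi>\<close> satisfy this with \<open>u\<close> minus the normal component of the variation.
  Conversely, every Hamiltonian variation of \<open>\<Phi>\<close> has the same initial velocity as the Gauss maps of
  a suitable variation of \<open>\<phi>\<close>, and the derivative of the volume depends on the initial velocity
  only.\<close>

section \<open>Calculus of smooth maps\<close>

text \<open>At later times the members of a Hamiltonian variation need not be Lagrangian, so they
  are in general not Gauss maps and cannot be lifted to hypersurfaces. Only the velocity at time
  zero can be matched, and it is matched completely: agreement of the normal parts alone would leave
  the divergence of a vector field to be integrated away. Mean curvature and
  \<open>div (J H)\<close> are never formed. Two variations with equal velocity have volume
  densities that differ by \<open>o(t)\<close>, uniformly on a compact set, because the Gram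
  determinants agree to first order and do not vanish at time zero; this also provides the existence
  of the derivative, which Hamiltonian minimality includes.

  The two structures share \<Omega> and differ in the form whose volume is measured. Since
  \<open>G'_metric\<close> is defined through chosen representatives and bases, it is replaced by
  the wedge pairing into the fourth exterior power, which is free of choices.

  The functionals select a unit normal afresh for every map, possibly with signs that differ from
  those of the smooth family of normals; the integrands are therefore compared point by point up to
  sign.\<close>

named_theorems smooth_intros

text \<open>\<open>Ck_on\<close> refers to the chosen term \<open>frechet_derivative\<close>;
  uniqueness of the derivative lets any explicit formula \<open>f'\<close> take its place. The
  inductions on the order below go through this rule.\<close>

lemma Ck_on_SucI:
  assumes "\<And>x. x \<in> S \<Longrightarrow> (f has_derivative f' x) (at x)"
    and "\<And>v. Ck_on k S (\<lambda>x. f' x v)" and "open S"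
  shows "Ck_on (Suc k) S f"
proof -
  have eq: "f' x v = frechet_derivative f (at x) v" if "x \<in> S" for x v
    using frechet_derivative_at[OF assms(1)[OF that]] by simp
  \<comment> \<open>The two candidates for the derivative agree on \<open>S\<close> only; since
    \<open>S\<close> is open, derivatives of all orders ignore the values outside.\<close>
  have cong: "Ck_on k S g'" if "Ck_on k S g" "\<And>x. x \<in> S \<Longrightarrow> g x = g' x" for g g' :: "'a \<Rightarrow> 'b"
    using that
  proof (induction k arbitrary: g g')
    case 0
    then show ?case by (auto cong: continuous_on_cong)
  next
    case (Suc k)
    have ev: "(g has_derivative D) (at x) \<longleftrightarrow> (g' has_derivative D) (at x)" if "x \<in> S" for x D
      using has_derivative_transform_within_open[OF _ assms(3) that] Suc.prems(2) by metis
    have "frechet_derivative g (at x) = frechet_derivative g' (at x)" if "x \<in> S" for x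
      unfolding frechet_derivative_def using ev[OF that] by simp
    moreover have "g' differentiable (at x)" if "x \<in> S" for x
      using Suc.prems(1) ev[OF that] that unfolding differentiable_def Ck_on.simps by metis
    ultimately show ?case
      using Suc.prems(1) by (auto intro: Suc.IH)
  qed
  show ?thesis
    using assms(1) cong[OF assms(2) eq] by (auto simp: differentiable_def)
qed

lemma Ck_on_SucD:
  assumes "Ck_on (Suc k) S f" "x \<in> S"
  shows "(f has_derivative frechet_derivative f (at x)) (at x)"
  using assms by (simp add: frechet_derivative_works)

lemma Ck_on_cong:
  assumes "open S" "Ck_on k S f" "\<And>x. x \<in> S \<Longrightarrow> f x = g x"
  shows "Ck_on k S g"
proof (cases k)
  case 0
  then show ?thesis using assms by (auto cong: continuous_on_cong)
next
  case (Suc l)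
  show ?thesis
    unfolding Suc
  proof (rule Ck_on_SucI)
    show "(g has_derivative frechet_derivative f (at x)) (at x)" if "x \<in> S" for x
      using has_derivative_transform_within_open[OF Ck_on_SucD[of l S f x] assms(1) that assms(3)]
        assms(2) that Suc by auto
    show "Ck_on l S (\<lambda>x. frechet_derivative f (at x) v)" for v
      using assms(2) Suc by auto
  qed (fact assms(1))
qed

lemma Ck_on_mono: "Ck_on (Suc k) S f \<Longrightarrow> Ck_on k S f"
proof (induction k arbitrary: f)
  case 0
  then show ?case
    by (auto intro!: continuous_at_imp_continuous_on differentiable_imp_continuous_within)
next
  case (Suc k)
  then show ?case by (metis Ck_on.simps(2))
qed

lemma Ck_on_const: "open S \<Longrightarrow> Ck_on k S (\<lambda>x. c)"
proof (induction k arbitrary: c)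
  case (Suc k)
  show ?case by (rule Ck_on_SucI[where f'="\<lambda>x v. 0"]) (auto simp: Suc)
qed auto

lemma Ck_on_linear: "open S \<Longrightarrow> bounded_linear l \<Longrightarrow> Ck_on k S f \<Longrightarrow> Ck_on k S (\<lambda>x. l (f x))"
proof (induction k arbitrary: f)
  case 0
  then show ?case by (auto intro: bounded_linear.continuous_on)
next
  case (Suc k)
  show ?case
    by (rule Ck_on_SucI[where f'="\<lambda>x v. l (frechet_derivative f (at x) v)"])
      (use Suc Ck_on_SucD[OF Suc.prems(3)] in \<open>auto intro: bounded_linear.has_derivative\<close>)
qed

lemma Ck_on_add: "open S \<Longrightarrow> Ck_on k S f \<Longrightarrow> Ck_on k S g \<Longrightarrow> Ck_on k S (\<lambda>x. f x + g x)"
proof (induction k arbitrary: f g)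
  case (Suc k)
  show ?case
    by (rule Ck_on_SucI[where f'="\<lambda>x v. frechet_derivative f (at x) v + frechet_derivative g (at x) v"])
      (use Suc Ck_on_SucD[OF Suc.prems(2)] Ck_on_SucD[OF Suc.prems(3)] in \<open>auto intro: has_derivative_add\<close>)
qed (auto intro: continuous_on_add)

lemma Ck_on_bilinear:
  assumes "open S" "bounded_bilinear b"
  shows "Ck_on k S f \<Longrightarrow> Ck_on k S g \<Longrightarrow> Ck_on k S (\<lambda>x. b (f x) (g x))"
proof (induction k arbitrary: f g)
  case 0
  then show ?case using assms(2) by (auto intro: bounded_bilinear.continuous_on)
next
  case (Suc k)
  note f = Ck_on_mono[OF Suc.prems(1)] and g = Ck_on_mono[OF Suc.prems(2)]
  show ?case
  proof (rule Ck_on_SucI[where f'="\<lambda>x v. b (f x) (frechet_derivative g (at x) v) + b (frechet_derivative f (at x) v) (g x)"])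
    show "((\<lambda>x. b (f x) (g x)) has_derivative (\<lambda>v. b (f x) (frechet_derivative g (at x) v)
        + b (frechet_derivative f (at x) v) (g x))) (at x)" if "x \<in> S" for x
      by (rule bounded_bilinear.FDERIV[OF assms(2) Ck_on_SucD[OF Suc.prems(1) that] Ck_on_SucD[OF Suc.prems(2) that]])
    show "Ck_on k S (\<lambda>x. b (f x) (frechet_derivative g (at x) v) + b (frechet_derivative f (at x) v) (g x))" for v
      using Suc.prems by (intro Ck_on_add Suc.IH f g assms(1)) auto
  qed (fact assms(1))
qed

lemma Ck_on_sum:
  "open S \<Longrightarrow> (\<And>i. i \<in> I \<Longrightarrow> Ck_on k S (f i)) \<Longrightarrow> Ck_on k S (\<lambda>x. \<Sum>i\<in>I. f i x)"
  by (induction I rule: infinite_finite_induct) (auto intro: Ck_on_const Ck_on_add)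

text \<open>In the chain rule the base point and the direction of the derivative of \<open>f\<close>
  both move with \<open>x\<close>. Expanding the direction in \<open>Basis\<close> leaves
  directional derivatives along fixed vectors, to which the induction hypothesis applies; this is
  why \<open>g\<close> takes values in a Euclidean space.\<close>

lemma Ck_on_compose:
  fixes g :: "'a::real_normed_vector \<Rightarrow> 'b::euclidean_space"
  assumes "open S" "open T" "\<And>x. x \<in> S \<Longrightarrow> g x \<in> T"
  shows "Ck_on k T f \<Longrightarrow> Ck_on k S g \<Longrightarrow> Ck_on k S (\<lambda>x. f (g x))"
proof (induction k arbitrary: f)
  case 0
  then show ?case using assms(3) by (auto intro: continuous_on_compose2)
next
  case (Suc k)
  let ?D = "\<lambda>x. frechet_derivative f (at (g x))" and ?D' = "\<lambda>x. frechet_derivative g (at x)"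
  have D: "(f has_derivative ?D x) (at (g x))" if "x \<in> S" for x
    using Ck_on_SucD[OF Suc.prems(1) assms(3)[OF that]] .
  show ?case
  proof (rule Ck_on_SucI[where f'="\<lambda>x v. \<Sum>b\<in>Basis. (?D' x v \<bullet> b) *\<^sub>R ?D x b"])
    fix x assume x: "x \<in> S"
    have "((\<lambda>x. f (g x)) has_derivative (\<lambda>v. ?D x (?D' x v))) (at x)"
      by (rule has_derivative_compose[OF Ck_on_SucD[OF Suc.prems(2) x] D[OF x]])
    moreover have "?D x (?D' x v) = (\<Sum>b\<in>Basis. (?D' x v \<bullet> b) *\<^sub>R ?D x b)" for v
    proof -
      interpret linear "?D x" using D[OF x] by (rule has_derivative_linear)
      show ?thesis by (subst euclidean_representation[of "?D' x v", symmetric]) (simp only: sum scaleR)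
    qed
    ultimately show "((\<lambda>x. f (g x)) has_derivative (\<lambda>v. \<Sum>b\<in>Basis. (?D' x v \<bullet> b) *\<^sub>R ?D x b)) (at x)"
      by simp
  next
    fix v
    show "Ck_on k S (\<lambda>x. \<Sum>b\<in>Basis. (?D' x v \<bullet> b) *\<^sub>R ?D x b)"
      using Suc.prems Ck_on_mono[OF Suc.prems(2)]
      by (intro Ck_on_sum Ck_on_bilinear[OF _ bounded_bilinear_scaleR] assms(1)
          Ck_on_linear[OF _ bounded_linear_inner_left] Suc.IH[of "\<lambda>x. frechet_derivative f (at x) b" for b]) auto
  qed (fact assms(1))
qed

text \<open>The derivative is a product of the derivative of \<open>f\<close> and of the reciprocal
  itself, and the latter has the lower order of regularity by induction. The square root is treated
  in the same way.\<close>

lemma Ck_on_inverse: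
  fixes f :: "'a::real_normed_vector \<Rightarrow> real"
  assumes "open S" "\<And>x. x \<in> S \<Longrightarrow> f x \<noteq> 0"
  shows "Ck_on k S f \<Longrightarrow> Ck_on k S (\<lambda>x. inverse (f x))"
proof (induction k)
  case 0
  then show ?case using assms(2) by (auto intro: continuous_on_inverse)
next
  case (Suc k)
  note IH = Suc.IH[OF Ck_on_mono[OF Suc.prems]]
  show ?case
  proof (rule Ck_on_SucI[where f'="\<lambda>x v. - (inverse (f x) * frechet_derivative f (at x) v * inverse (f x))"])
    show "((\<lambda>x. inverse (f x)) has_derivative (\<lambda>v. - (inverse (f x) * frechet_derivative f (at x) v * inverse (f x)))) (at x)"
      if "x \<in> S" for x
      by (rule Deriv.has_derivative_inverse[OF assms(2)[OF that] Ck_on_SucD[OF Suc.prems that]])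
    show "Ck_on k S (\<lambda>x. - (inverse (f x) * frechet_derivative f (at x) v * inverse (f x)))" for v
      using Suc.prems IH
      by (intro Ck_on_linear[OF _ bounded_linear_minus[OF bounded_linear_ident]]
          Ck_on_bilinear[OF _ bounded_bilinear_mult] assms(1)) auto
  qed (fact assms(1))
qed

lemma Ck_on_sqrt:
  fixes f :: "'a::real_normed_vector \<Rightarrow> real"
  assumes "open S" "\<And>x. x \<in> S \<Longrightarrow> f x > 0"
  shows "Ck_on k S f \<Longrightarrow> Ck_on k S (\<lambda>x. sqrt (f x))"
proof (induction k)
  case 0
  then show ?case by (auto intro: continuous_on_real_sqrt)
next
  case (Suc k)
  note IH = Suc.IH[OF Ck_on_mono[OF Suc.prems]]
  have i: "Ck_on k S (\<lambda>x. inverse (sqrt (f x)))"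
    by (intro Ck_on_inverse assms(1) IH) (use assms(2) in force)
  show ?case
  proof (rule Ck_on_SucI[where f'="\<lambda>x v. frechet_derivative f (at x) v * (inverse (sqrt (f x)) / 2)"])
    fix x assume x: "x \<in> S"
    have s: "(sqrt has_derivative (\<lambda>v. v * (inverse (sqrt (f x)) / 2))) (at (f x))"
      using DERIV_real_sqrt[OF assms(2)[OF x]] unfolding has_field_derivative_def
      by (rule has_derivative_eq_rhs) (auto simp: mult_ac)
    show "((\<lambda>x. sqrt (f x)) has_derivative (\<lambda>v. frechet_derivative f (at x) v * (inverse (sqrt (f x)) / 2))) (at x)"
      by (rule has_derivative_compose[OF Ck_on_SucD[OF Suc.prems x] s])
  next
    show "Ck_on k S (\<lambda>x. frechet_derivative f (at x) v * (inverse (sqrt (f x)) / 2))" for v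
      using Suc.prems i
      by (intro Ck_on_bilinear[OF _ bounded_bilinear_mult] assms(1)
          Ck_on_linear[OF _ bounded_linear_divide[of 2]]) auto
  qed (fact assms(1))
qed

section \<open>Closure properties of smooth maps\<close>

lemma smooth_on_cong:
  "open S \<Longrightarrow> smooth_on S f \<Longrightarrow> (\<And>x. x \<in> S \<Longrightarrow> f x = g x) \<Longrightarrow> smooth_on S g"
  unfolding smooth_on_def using Ck_on_cong by blast

lemma smooth_on_imp_continuous_on: "smooth_on S f \<Longrightarrow> continuous_on S f"
  unfolding smooth_on_def by (metis Ck_on.simps(1))

lemma smooth_on_has_derivative:
  "smooth_on S f \<Longrightarrow> x \<in> S \<Longrightarrow> (f has_derivative frechet_derivative f (at x)) (at x)"
  unfolding smooth_on_def using Ck_on_SucD by blast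

lemma smooth_on_subset: "smooth_on S f \<Longrightarrow> T \<subseteq> S \<Longrightarrow> smooth_on T f"
proof -
  have "Ck_on k S f \<Longrightarrow> T \<subseteq> S \<Longrightarrow> Ck_on k T f" for k
    by (induction k arbitrary: f) (auto intro: continuous_on_subset)
  then show "smooth_on S f \<Longrightarrow> T \<subseteq> S \<Longrightarrow> smooth_on T f" by (auto simp: smooth_on_def)
qed

lemma smooth_on_const [smooth_intros]: "open S \<Longrightarrow> smooth_on S (\<lambda>x. c)"
  by (simp add: smooth_on_def Ck_on_const)

lemma smooth_on_linear:
  "bounded_linear l \<Longrightarrow> open S \<Longrightarrow> smooth_on S f \<Longrightarrow> smooth_on S (\<lambda>x. l (f x))"
  by (simp add: smooth_on_def Ck_on_linear)

lemma smooth_on_id [smooth_intros]: "open S \<Longrightarrow> smooth_on S (\<lambda>x. x)"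
proof -
  assume S: "open S"
  have "Ck_on k S (\<lambda>x. x)" for k
  proof (cases k)
    case (Suc l)
    show ?thesis unfolding Suc
      by (rule Ck_on_SucI[where f'="\<lambda>x v. v"]) (auto intro: Ck_on_const S)
  qed auto
  then show ?thesis by (simp add: smooth_on_def)
qed

lemma smooth_on_fst [smooth_intros]: "open S \<Longrightarrow> smooth_on S fst"
  using smooth_on_linear[OF bounded_linear_fst _ smooth_on_id] by auto

lemma smooth_on_snd [smooth_intros]: "open S \<Longrightarrow> smooth_on S snd"
  using smooth_on_linear[OF bounded_linear_snd _ smooth_on_id] by auto

lemma smooth_on_add [smooth_intros]:
  "open S \<Longrightarrow> smooth_on S f \<Longrightarrow> smooth_on S g \<Longrightarrow> smooth_on S (\<lambda>x. f x + g x)"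
  by (simp add: smooth_on_def Ck_on_add)

lemma smooth_on_minus [smooth_intros]:
  "open S \<Longrightarrow> smooth_on S f \<Longrightarrow> smooth_on S (\<lambda>x. - f x)"
  using smooth_on_linear[OF bounded_linear_minus[OF bounded_linear_ident]] by auto

lemma smooth_on_diff [smooth_intros]:
  "open S \<Longrightarrow> smooth_on S f \<Longrightarrow> smooth_on S g \<Longrightarrow> smooth_on S (\<lambda>x. f x - g x)"
  using smooth_on_add[OF _ _ smooth_on_minus, of S f g] by simp

lemma smooth_on_bounded_bilinear:
  "bounded_bilinear b \<Longrightarrow> open S \<Longrightarrow> smooth_on S f \<Longrightarrow> smooth_on S g \<Longrightarrow>
    smooth_on S (\<lambda>x. b (f x) (g x))"
  by (simp add: smooth_on_def Ck_on_bilinear)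

lemma smooth_on_mult [smooth_intros]:
  fixes f g :: "'a::real_normed_vector \<Rightarrow> real"
  shows "open S \<Longrightarrow> smooth_on S f \<Longrightarrow> smooth_on S g \<Longrightarrow> smooth_on S (\<lambda>x. f x * g x)"
  by (rule smooth_on_bounded_bilinear[OF bounded_bilinear_mult])

lemma smooth_on_scaleR [smooth_intros]:
  "open S \<Longrightarrow> smooth_on S f \<Longrightarrow> smooth_on S g \<Longrightarrow> smooth_on S (\<lambda>x. f x *\<^sub>R g x)"
  by (rule smooth_on_bounded_bilinear[OF bounded_bilinear_scaleR])

lemma smooth_on_bilinear:
  fixes b :: "'e::euclidean_space \<Rightarrow> 'f::euclidean_space \<Rightarrow> 'g::real_normed_vector"
  shows "bilinear b \<Longrightarrow> open S \<Longrightarrow> smooth_on S f \<Longrightarrow> smooth_on S g \<Longrightarrow> smooth_on S (\<lambda>x. b (f x) (g x))"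
  by (rule smooth_on_bounded_bilinear) (auto simp: bilinear_conv_bounded_bilinear)

lemma smooth_on_sum [smooth_intros]:
  "open S \<Longrightarrow> (\<And>i. i \<in> I \<Longrightarrow> smooth_on S (f i)) \<Longrightarrow> smooth_on S (\<lambda>x. \<Sum>i\<in>I. f i x)"
  by (auto simp: smooth_on_def intro: Ck_on_sum)

lemma smooth_on_prod [smooth_intros]:
  fixes f :: "'i \<Rightarrow> 'a::real_normed_vector \<Rightarrow> real"
  assumes "open S" "\<And>i. i \<in> I \<Longrightarrow> smooth_on S (f i)"
  shows "smooth_on S (\<lambda>x. \<Prod>i\<in>I. f i x)"
  using assms(2)
  by (induction I rule: infinite_finite_induct) (auto intro: smooth_on_const smooth_on_mult assms(1))

lemma smooth_on_compose:
  fixes g :: "'a::real_normed_vector \<Rightarrow> 'b::euclidean_space"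
  shows "smooth_on T f \<Longrightarrow> open S \<Longrightarrow> open T \<Longrightarrow> (\<And>x. x \<in> S \<Longrightarrow> g x \<in> T) \<Longrightarrow> smooth_on S g \<Longrightarrow>
    smooth_on S (\<lambda>x. f (g x))"
  by (simp add: smooth_on_def Ck_on_compose)

lemma smooth_on_inverse [smooth_intros]:
  fixes f :: "'a::real_normed_vector \<Rightarrow> real"
  shows "open S \<Longrightarrow> (\<And>x. x \<in> S \<Longrightarrow> f x \<noteq> 0) \<Longrightarrow> smooth_on S f \<Longrightarrow> smooth_on S (\<lambda>x. inverse (f x))"
  by (simp add: smooth_on_def Ck_on_inverse)

lemma smooth_on_divide [smooth_intros]:
  fixes f :: "'a::real_normed_vector \<Rightarrow> real"
  shows "open S \<Longrightarrow> (\<And>x. x \<in> S \<Longrightarrow> g x \<noteq> 0) \<Longrightarrow> smooth_on S f \<Longrightarrow> smooth_on S g \<Longrightarrow>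
    smooth_on S (\<lambda>x. f x / g x)"
  unfolding divide_inverse by (intro smooth_intros)

lemma smooth_on_sqrt [smooth_intros]:
  fixes f :: "'a::real_normed_vector \<Rightarrow> real"
  shows "open S \<Longrightarrow> (\<And>x. x \<in> S \<Longrightarrow> f x > 0) \<Longrightarrow> smooth_on S f \<Longrightarrow> smooth_on S (\<lambda>x. sqrt (f x))"
  by (simp add: smooth_on_def Ck_on_sqrt)

lemma smooth_on_power [smooth_intros]:
  fixes f :: "'a::real_normed_vector \<Rightarrow> real"
  shows "open S \<Longrightarrow> smooth_on S f \<Longrightarrow> smooth_on S (\<lambda>x. f x ^ n)"
  by (induction n) (auto intro: smooth_intros)

lemma smooth_on_vec_nth [smooth_intros]:
  "open S \<Longrightarrow> smooth_on S f \<Longrightarrow> smooth_on S (\<lambda>x. f x $ i)"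
  by (rule smooth_on_linear[OF bounded_linear_vec_nth])

lemma smooth_on_Pair [smooth_intros]:
  fixes f :: "'a::real_normed_vector \<Rightarrow> 'b::real_normed_vector" and g :: "'a \<Rightarrow> 'c::real_normed_vector"
  assumes "open S" "smooth_on S f" "smooth_on S g"
  shows "smooth_on S (\<lambda>x. (f x, g x))"
proof -
  have l: "bounded_linear (\<lambda>y::'b. (y, 0::'c))" "bounded_linear (\<lambda>y::'c. (0::'b, y))"
    by (intro bounded_linear_Pair bounded_linear_ident bounded_linear_zero)+
  have "smooth_on S (\<lambda>x. (f x, 0) + (0, g x))"
    by (intro smooth_on_add smooth_on_linear[OF l(1)] smooth_on_linear[OF l(2)] assms)
  then show ?thesis by simp
qed

lemma smooth_on_det [smooth_intros]:
  fixes A :: "'a::real_normed_vector \<Rightarrow> real ^ 'n ^ 'n"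
  assumes "open S" "\<And>i j. smooth_on S (\<lambda>x. A x $ i $ j)"
  shows "smooth_on S (\<lambda>x. det (A x))"
  unfolding det_def by (intro smooth_intros assms)

lemma smooth_on_frechet_const:
  assumes "smooth_on S f"
  shows "smooth_on S (\<lambda>x. frechet_derivative f (at x) v)"
  unfolding smooth_on_def
proof
  fix k show "Ck_on k S (\<lambda>x. frechet_derivative f (at x) v)"
    using assms unfolding smooth_on_def by (auto dest!: spec[of _ "Suc k"])
qed

text \<open>Linearity in the direction reduces the case of a moving direction to the finitely many
  directions in \<open>Basis\<close>, where only the base point moves.\<close>

lemma smooth_on_frechet:
  fixes f :: "'a::euclidean_space \<Rightarrow> 'b::real_normed_vector"
    and g :: "'c::real_normed_vector \<Rightarrow> 'a"
  assumes "smooth_on T f" "open T" "open S" "\<And>x. x \<in> S \<Longrightarrow> g x \<in> T" "smooth_on S g" "smooth_on S v"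
  shows "smooth_on S (\<lambda>x. frechet_derivative f (at (g x)) (v x))"
proof -
  have "smooth_on S (\<lambda>x. \<Sum>b\<in>Basis. (v x \<bullet> b) *\<^sub>R frechet_derivative f (at (g x)) b)"
    by (intro smooth_intros smooth_on_linear[OF bounded_linear_inner_left] assms(3,6)
        smooth_on_compose[OF smooth_on_frechet_const[OF assms(1)] assms(3,2,4,5)])
  moreover have "(\<Sum>b\<in>Basis. (v x \<bullet> b) *\<^sub>R frechet_derivative f (at (g x)) b) =
      frechet_derivative f (at (g x)) (v x)" if "x \<in> S" for x
  proof -
    interpret linear "frechet_derivative f (at (g x))"
      by (rule has_derivative_linear[OF smooth_on_has_derivative[OF assms(1) assms(4)[OF that]]])
    show ?thesis
      by (simp only: sum[symmetric] scaleR[symmetric] euclidean_representation)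
  qed
  ultimately show ?thesis by (rule smooth_on_cong[OF assms(3)])
qed

lemma frechet_eqI: "(f has_derivative f') (at x) \<Longrightarrow> frechet_derivative f (at x) = f'"
  using frechet_derivative_at by metis

text \<open>Both mixed derivatives are values of the second difference quotient at nearby points.\<close>

lemma mixed_derivatives_real:
  fixes f :: "'a::euclidean_space \<Rightarrow> real"
  assumes f: "smooth_on S f" and S: "open S" and x: "x \<in> S"
  shows "frechet_derivative (\<lambda>y. frechet_derivative f (at y) v) (at x) w =
    frechet_derivative (\<lambda>y. frechet_derivative f (at y) w) (at x) v"
proof (rule ccontr)
  define D2 where "D2 v w y = frechet_derivative (\<lambda>y. frechet_derivative f (at y) v) (at y) w" for v w y
  assume "\<not> ?thesis"
  then have ne: "dist (D2 v w x) (D2 w v x) > 0" (is "?e > 0") by (simp add: D2_def)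
  have cont: "isCont (D2 v w) x" for v w
    unfolding D2_def using smooth_on_imp_continuous_on[OF smooth_on_frechet_const[OF smooth_on_frechet_const[OF f]]]
      continuous_on_eq_continuous_at[OF S] x by blast
  obtain d1 where d1: "d1 > 0" "\<And>y. dist y x < d1 \<Longrightarrow> dist (D2 v w y) (D2 v w x) < ?e / 2"
    using cont[of v w] ne unfolding continuous_at_eps_delta by (metis half_gt_zero)
  obtain d2 where d2: "d2 > 0" "\<And>y. dist y x < d2 \<Longrightarrow> dist (D2 w v y) (D2 w v x) < ?e / 2"
    using cont[of w v] ne unfolding continuous_at_eps_delta by (metis half_gt_zero)
  obtain d3 where d3: "d3 > 0" "ball x d3 \<subseteq> S" using S x openE by blast
  define d where "d = min d1 (min d2 d3)"
  \<comment> \<open>Points reached with coefficients of size at most \<open>h\<close> along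
    \<open>v\<close> and \<open>w\<close> stay within distance \<open>d\<close> of \<open>x\<close>;
    the summand 1 keeps the denominator positive when both vectors vanish.\<close>
  define h where "h = d / (2 * (norm v + norm w + 1))"
  have d: "d > 0" using d1 d2 d3 by (simp add: d_def)
  then have h: "h > 0" by (simp add: h_def add_nonneg_pos)
  have near: "dist (x + a *\<^sub>R v + b *\<^sub>R w) x < d" if "\<bar>a\<bar> \<le> h" "\<bar>b\<bar> \<le> h" for a b
  proof -
    have "dist (x + a *\<^sub>R v + b *\<^sub>R w) x \<le> norm (a *\<^sub>R v) + norm (b *\<^sub>R w)"
      by (metis add.assoc add_diff_cancel_left' dist_norm norm_triangle_ineq)
    also have "\<dots> \<le> h * (norm v + norm w)"
      using that by (auto simp: distrib_left intro!: add_mono mult_right_mono)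
    also have "\<dots> < d"
    proof -
      have "norm v + norm w < 2 * (norm v + norm w + 1)"
        by (smt (verit) norm_ge_zero)
      then have "d * (norm v + norm w) < d * (2 * (norm v + norm w + 1))"
        using d by (rule mult_strict_left_mono)
      then show ?thesis
        by (simp add: h_def divide_less_eq add_nonneg_pos)
    qed
    finally show ?thesis .
  qed
  \<comment> \<open>The mean value theorem is used twice: along \<open>v\<close> for the increment
    \<open>q\<close> of \<open>f\<close> in direction \<open>w\<close>, then along \<open>w\<close>
    for the derivative in direction \<open>v\<close>.\<close>
  have key: "\<exists>a b. 0 \<le> a \<and> a \<le> h \<and> 0 \<le> b \<and> b \<le> h \<and>
      f (x + h *\<^sub>R v + h *\<^sub>R w) - f (x + h *\<^sub>R v) - f (x + h *\<^sub>R w) + f x = h * h * D2 v w (x + a *\<^sub>R v + b *\<^sub>R w)"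
    if near: "\<And>a b. \<bar>a\<bar> \<le> h \<Longrightarrow> \<bar>b\<bar> \<le> h \<Longrightarrow> x + a *\<^sub>R v + b *\<^sub>R w \<in> S" for v w
  proof -
    have der: "((\<lambda>a. f (x + a *\<^sub>R v + b *\<^sub>R w)) has_real_derivative frechet_derivative f (at (x + a *\<^sub>R v + b *\<^sub>R w)) v) (at a)"
      if "\<bar>a\<bar> \<le> h" "\<bar>b\<bar> \<le> h" for a b
    proof -
      have F: "(f has_derivative frechet_derivative f (at (x + a *\<^sub>R v + b *\<^sub>R w))) (at (x + a *\<^sub>R v + b *\<^sub>R w))"
        using smooth_on_has_derivative[OF f near[OF that]] .
      have "((\<lambda>a. x + a *\<^sub>R v + b *\<^sub>R w) has_derivative (\<lambda>t. t *\<^sub>R v)) (at a)"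
        by (auto intro!: derivative_eq_intros)
      from has_derivative_compose[OF this F]
      show ?thesis
        using linear_cmul[OF has_derivative_linear[OF F]]
        by (simp add: has_field_derivative_def mult_commute_abs)
    qed
    define q where "q a = f (x + a *\<^sub>R v + h *\<^sub>R w) - f (x + a *\<^sub>R v + 0 *\<^sub>R w)" for a
    have q: "(q has_real_derivative frechet_derivative f (at (x + a *\<^sub>R v + h *\<^sub>R w)) v
        - frechet_derivative f (at (x + a *\<^sub>R v + 0 *\<^sub>R w)) v) (at a)"
      if "0 \<le> a" "a \<le> h" for a
      unfolding q_def using h that by (intro DERIV_diff der) auto
    obtain a where a: "0 < a" "a < h" "q h - q 0 = (h - 0) * (frechet_derivative f (at (x + a *\<^sub>R v + h *\<^sub>R w)) v
        - frechet_derivative f (at (x + a *\<^sub>R v + 0 *\<^sub>R w)) v)"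
      using MVT2[OF h q] by auto
    have r: "((\<lambda>b. frechet_derivative f (at (x + a *\<^sub>R v + b *\<^sub>R w)) v) has_real_derivative
        D2 v w (x + a *\<^sub>R v + b *\<^sub>R w)) (at b)"
      if "0 \<le> b" "b \<le> h" for b
    proof -
      have F: "((\<lambda>y. frechet_derivative f (at y) v) has_derivative
          frechet_derivative (\<lambda>y. frechet_derivative f (at y) v) (at (x + a *\<^sub>R v + b *\<^sub>R w))) (at (x + a *\<^sub>R v + b *\<^sub>R w))"
        using a that by (intro smooth_on_has_derivative[OF smooth_on_frechet_const[OF f]] near) auto
      have "((\<lambda>b. x + a *\<^sub>R v + b *\<^sub>R w) has_derivative (\<lambda>t. t *\<^sub>R w)) (at b)"
        by (auto intro!: derivative_eq_intros)
      from has_derivative_compose[OF this F]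
      show ?thesis
        using linear_cmul[OF has_derivative_linear[OF F]]
        by (simp add: has_field_derivative_def D2_def mult_commute_abs)
    qed
    obtain b where b: "0 < b" "b < h" "frechet_derivative f (at (x + a *\<^sub>R v + h *\<^sub>R w)) v
        - frechet_derivative f (at (x + a *\<^sub>R v + 0 *\<^sub>R w)) v = (h - 0) * D2 v w (x + a *\<^sub>R v + b *\<^sub>R w)"
      using MVT2[OF h r] by auto
    show ?thesis
      using a b by (intro exI[of _ a] exI[of _ b]) (auto simp: q_def)
  qed
  have S': "x + a *\<^sub>R v + b *\<^sub>R w \<in> S" if "\<bar>a\<bar> \<le> h" "\<bar>b\<bar> \<le> h" for a b
    using near[OF that] d3 by (auto simp: d_def dist_commute)
  obtain a b where ab: "0 \<le> a" "a \<le> h" "0 \<le> b" "b \<le> h"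
      "f (x + h *\<^sub>R v + h *\<^sub>R w) - f (x + h *\<^sub>R v) - f (x + h *\<^sub>R w) + f x = h * h * D2 v w (x + a *\<^sub>R v + b *\<^sub>R w)"
    using key[of v w] S' by blast
  have "x + a *\<^sub>R w + b *\<^sub>R v \<in> S" if "\<bar>a\<bar> \<le> h" "\<bar>b\<bar> \<le> h" for a b
    using S'[OF that(2,1)] by (simp add: add_ac)
  then obtain a' b' where ab': "0 \<le> a'" "a' \<le> h" "0 \<le> b'" "b' \<le> h"
      "f (x + h *\<^sub>R w + h *\<^sub>R v) - f (x + h *\<^sub>R w) - f (x + h *\<^sub>R v) + f x = h * h * D2 w v (x + a' *\<^sub>R w + b' *\<^sub>R v)"
    using key[of w v] by blast
  have "f (x + h *\<^sub>R w + h *\<^sub>R v) = f (x + h *\<^sub>R v + h *\<^sub>R w)" by (simp add: add_ac)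
  then have "h * h * D2 v w (x + a *\<^sub>R v + b *\<^sub>R w) = h * h * D2 w v (x + a' *\<^sub>R w + b' *\<^sub>R v)"
    using ab(5) ab'(5) by linarith
  then have eq: "D2 v w (x + a *\<^sub>R v + b *\<^sub>R w) = D2 w v (x + a' *\<^sub>R w + b' *\<^sub>R v)"
    using h by simp
  have "dist (D2 v w (x + a *\<^sub>R v + b *\<^sub>R w)) (D2 v w x) < ?e / 2"
    using near[of a b] ab by (intro d1(2)) (auto simp: d_def)
  moreover have "dist (D2 w v (x + a' *\<^sub>R w + b' *\<^sub>R v)) (D2 w v x) < ?e / 2"
    using near[of b' a'] ab' by (intro d2(2)) (auto simp: d_def add_ac)
  ultimately show False
    unfolding eq dist_real_def by argo
qed

lemma mixed_derivatives:
  fixes f :: "'a::euclidean_space \<Rightarrow> 'b::euclidean_space"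
  assumes f: "smooth_on S f" and S: "open S" and x: "x \<in> S"
  shows "frechet_derivative (\<lambda>y. frechet_derivative f (at y) v) (at x) w =
    frechet_derivative (\<lambda>y. frechet_derivative f (at y) w) (at x) v"
proof (rule euclidean_eqI)
  fix b :: 'b assume "b \<in> Basis"
  define fb where "fb = (\<lambda>y. f y \<bullet> b)"
  have fb: "smooth_on S fb"
    unfolding fb_def by (rule smooth_on_linear[OF bounded_linear_inner_left S f])
  have 1: "frechet_derivative fb (at y) = (\<lambda>v. frechet_derivative f (at y) v \<bullet> b)" if "y \<in> S" for y
    unfolding fb_def
    by (intro frechet_eqI bounded_linear.has_derivative[OF bounded_linear_inner_left]
        smooth_on_has_derivative[OF f that])
  have 2: "frechet_derivative (\<lambda>y. frechet_derivative fb (at y) v) (at x) w =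
      frechet_derivative (\<lambda>y. frechet_derivative f (at y) v) (at x) w \<bullet> b" for v w
  proof -
    have "((\<lambda>y. frechet_derivative f (at y) v \<bullet> b) has_derivative
        (\<lambda>w. frechet_derivative (\<lambda>y. frechet_derivative f (at y) v) (at x) w \<bullet> b)) (at x)"
      by (intro bounded_linear.has_derivative[OF bounded_linear_inner_left]
          smooth_on_has_derivative[OF smooth_on_frechet_const[OF f] x])
    then have "((\<lambda>y. frechet_derivative fb (at y) v) has_derivative
        (\<lambda>w. frechet_derivative (\<lambda>y. frechet_derivative f (at y) v) (at x) w \<bullet> b)) (at x)"
      by (rule has_derivative_transform_within_open[OF _ S x]) (simp add: 1)
    then show ?thesis by (simp add: frechet_eqI)
  qed
  show "frechet_derivative (\<lambda>y. frechet_derivative f (at y) v) (at x) w \<bullet> b =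
      frechet_derivative (\<lambda>y. frechet_derivative f (at y) w) (at x) v \<bullet> b"
    using mixed_derivatives_real[OF fb S x, of v w] by (simp add: 2)
qed

section \<open>Change of variables\<close>

text \<open>The library states the change of variables theorem for well-ordered index types only; the
  type \<open>'n wo\<close> is a well-ordered copy of \<open>'n\<close>.\<close>

typedef 'n wo = "UNIV :: 'n set" morphisms un_wo mk_wo by simp

lemma bij_mk_wo: "bij mk_wo" and bij_un_wo: "bij un_wo"
  by (auto intro!: bijI' simp: mk_wo_inject un_wo_inject mk_wo_inverse un_wo_inverse)
    (metis UNIV_I mk_wo_inverse un_wo_inverse)+

instance wo :: (finite) finite
proof
  show "finite (UNIV :: 'a wo set)"
    using bij_betw_finite[OF bij_mk_wo[where 'a='a]] by simp
qed

definition wo_index :: "'n::finite \<Rightarrow> nat" where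
  "wo_index = (SOME f. inj f)"

lemma inj_wo_index: "inj wo_index"
proof -
  have "\<exists>f :: 'a \<Rightarrow> nat. inj f"
    using finite_imp_inj_to_nat_seg[OF finite_class.finite_UNIV] by blast
  then show ?thesis unfolding wo_index_def by (rule someI_ex)
qed

instantiation wo :: (finite) wellorder
begin

definition "x \<le> y \<longleftrightarrow> wo_index (un_wo x) \<le> wo_index (un_wo y)"
definition "x < y \<longleftrightarrow> wo_index (un_wo x) < wo_index (un_wo y)"

instance
proof
  fix P :: "'a wo \<Rightarrow> bool" and a :: "'a wo"
  assume H: "\<And>x. (\<And>y. y < x \<Longrightarrow> P y) \<Longrightarrow> P x"
  show "P a"
    by (induction a rule: measure_induct_rule[of "\<lambda>x. wo_index (un_wo x)"])
      (rule H, simp only: less_wo_def)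
qed (auto simp: less_eq_wo_def less_wo_def un_wo_inject dest: injD[OF inj_wo_index])

end

definition to_wo :: "real ^ 'n \<Rightarrow> real ^ ('n::finite wo)" where
  "to_wo v = (\<chi> i. v $ un_wo i)"

definition of_wo :: "real ^ ('n::finite wo) \<Rightarrow> real ^ 'n" where
  "of_wo v = (\<chi> i. v $ mk_wo i)"

lemma of_to_wo [simp]: "of_wo (to_wo v) = v" and to_of_wo [simp]: "to_wo (of_wo w) = w"
  by (simp_all add: of_wo_def to_wo_def un_wo_inverse mk_wo_inverse)

lemma linear_to_wo: "linear to_wo" and linear_of_wo: "linear of_wo"
  by (auto intro!: linearI simp: to_wo_def of_wo_def vec_eq_iff)

lemma bounded_linear_to_wo: "bounded_linear to_wo" and bounded_linear_of_wo: "bounded_linear of_wo"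
  using linear_to_wo linear_of_wo by (auto simp: linear_conv_bounded_linear)

lemma measurable_to_wo [measurable]: "to_wo \<in> borel_measurable borel"
  and measurable_of_wo [measurable]: "of_wo \<in> borel_measurable borel"
  by (auto intro!: borel_measurable_continuous_onI linear_continuous_on bounded_linear_to_wo bounded_linear_of_wo)

lemma prod_Basis_cart: "(\<Prod>b\<in>Basis. (v :: real ^ 'n) \<bullet> b) = (\<Prod>i\<in>UNIV. v $ i)"
proof -
  have B: "(Basis :: (real ^ 'n) set) = range (\<lambda>i. axis i 1)" by (auto simp: Basis_vec_def)
  have i: "inj (\<lambda>i :: 'n. axis i (1 :: real))" by (auto simp: inj_def axis_eq_axis)
  show ?thesis unfolding B prod.reindex[OF i] by (simp add: inner_axis)
qed

lemma lborel_to_wo: "distr lborel borel to_wo = (lborel :: (real ^ ('n::finite wo)) measure)"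
proof (rule lborel_eqI[symmetric])
  fix l u :: "real ^ 'n wo"
  assume lu: "\<And>b. b \<in> Basis \<Longrightarrow> l \<bullet> b \<le> u \<bullet> b"
  have lu': "of_wo l \<bullet> b \<le> of_wo u \<bullet> b" if "b \<in> Basis" for b
    using lu[of "axis (mk_wo i) 1" for i] that by (force simp: of_wo_def Basis_vec_def inner_axis)
  have "to_wo -` box l u = box (of_wo l) (of_wo u)"
    by (auto simp: mem_box_cart to_wo_def of_wo_def) (metis mk_wo_inverse un_wo_inverse UNIV_I)+
  then have "emeasure (distr lborel borel to_wo) (box l u) = ennreal (\<Prod>b\<in>Basis. (of_wo u - of_wo l) \<bullet> b)"
    using lu' by (simp add: emeasure_distr)
  also have "(\<Prod>b\<in>Basis. (of_wo u - of_wo l) \<bullet> b) = (\<Prod>i\<in>UNIV. u $ mk_wo i - l $ mk_wo i)"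
    by (simp add: prod_Basis_cart of_wo_def)
  also have "\<dots> = (\<Prod>i\<in>UNIV. u $ i - l $ i)"
    using bij_mk_wo by (intro prod.reindex_bij_betw[of mk_wo UNIV UNIV "\<lambda>i. u $ i - l $ i"]) simp
  also have "\<dots> = (\<Prod>b\<in>Basis. (u - l) \<bullet> b)"
    by (simp add: prod_Basis_cart)
  finally show "emeasure (distr lborel borel to_wo) (box l u) = ennreal (\<Prod>b\<in>Basis. (u - l) \<bullet> b)" .
qed simp

text \<open>Conjugation turns the transposition of \<open>a\<close> and \<open>b\<close> into that
  of \<open>r a\<close> and \<open>r b\<close>. The length of a product of transpositions, and with
  it the sign, thus survives the transfer to another index type.\<close>

lemma swapidseq_conjugate:
  assumes "swapidseq n p" "bij r"
  shows "swapidseq n (r \<circ> p \<circ> inv r)"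
  using assms
proof (induction rule: swapidseq.induct)
  case id
  then have "r \<circ> id \<circ> inv r = id" by (simp add: surj_iff[symmetric] bij_is_surj)
  then show ?case by (metis swapidseq.id)
next
  case (comp_Suc n p a b)
  have "r \<circ> (Transposition.transpose a b \<circ> p) \<circ> inv r
      = Transposition.transpose (r a) (r b) \<circ> (r \<circ> p \<circ> inv r)"
    using bij_is_inj[OF comp_Suc.prems]
    by (auto simp: fun_eq_iff Transposition.transpose_def inj_eq)
  moreover have "r a \<noteq> r b" using comp_Suc bij_is_inj[OF comp_Suc.prems] by (simp add: inj_eq)
  ultimately show ?case
    using swapidseq.comp_Suc comp_Suc by metis
qed

text \<open>The Leibniz sum is reindexed by conjugating the permutations with \<open>un_wo\<close>,
  which preserves their signs.\<close>

lemma det_to_wo: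
  fixes A :: "real ^ 'n ^ 'n"
  shows "det (\<chi> i j. A $ un_wo i $ un_wo j :: real ^ ('n wo) ^ ('n::finite wo)) = det A"
proof -
  let ?c = "\<lambda>p. un_wo \<circ> p \<circ> inv un_wo :: 'n \<Rightarrow> 'n"
  have inv: "inv un_wo = mk_wo"
    by (metis UNIV_I inv_unique_comp comp_def fun_eq_iff id_apply mk_wo_inverse un_wo_inverse)
  have perm: "p permutes UNIV \<longleftrightarrow> bij p" for p :: "'x \<Rightarrow> 'x"
    by (auto dest: permutes_bij intro: bij_imp_permutes)
  have bij: "bij_betw ?c {p. p permutes UNIV} {p. p permutes UNIV}"
  proof (rule bij_betwI[where g="\<lambda>q. mk_wo \<circ> q \<circ> un_wo"])
    show "?c \<in> {p. p permutes UNIV} \<rightarrow> {p. p permutes UNIV}"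
      using bij_mk_wo bij_un_wo by (auto simp: perm inv intro!: bij_comp)
    show "(\<lambda>q. mk_wo \<circ> q \<circ> un_wo) \<in> {p. p permutes UNIV} \<rightarrow> {p. p permutes UNIV}"
      using bij_mk_wo bij_un_wo by (auto simp: perm intro!: bij_comp)
  qed (simp_all add: inv fun_eq_iff mk_wo_inverse un_wo_inverse)
  have sgn: "sign (?c p) = sign p" if "p permutes UNIV" for p
  proof -
    have "permutation p"
      unfolding permutation_permutes using that by (intro exI[of _ UNIV]) simp
    then obtain n where n: "swapidseq n p"
      unfolding permutation_def by (elim exE)
    have "evenperm (?c p) = evenperm p"
      by (simp only: evenperm_unique[OF n refl] evenperm_unique[OF swapidseq_conjugate[OF n bij_un_wo] refl])
    then show ?thesis by (simp only: sign_def)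
  qed
  have "det A = (\<Sum>q | q permutes UNIV. of_int (sign q) * (\<Prod>i\<in>UNIV. A $ i $ q i))"
    by (simp add: det_def)
  also have "\<dots> = (\<Sum>p | p permutes UNIV. of_int (sign (?c p)) * (\<Prod>i\<in>UNIV. A $ i $ ?c p i))"
    by (rule sum.reindex_bij_betw[OF bij, symmetric])
  also have "\<dots> = (\<Sum>p | p permutes UNIV. of_int (sign p) * (\<Prod>i\<in>UNIV. A $ un_wo i $ un_wo (p i)))"
  proof (rule sum.cong[OF refl])
    fix p :: "'n wo \<Rightarrow> 'n wo" assume p: "p \<in> {p. p permutes UNIV}"
    have "(\<Prod>i\<in>UNIV. A $ i $ ?c p i) = (\<Prod>i\<in>UNIV. A $ un_wo i $ ?c p (un_wo i))"
      by (rule prod.reindex_bij_betw[symmetric]) (use bij_un_wo in simp)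
    then show "of_int (sign (?c p)) * (\<Prod>i\<in>UNIV. A $ i $ ?c p i)
        = of_int (sign p) * (\<Prod>i\<in>UNIV. A $ un_wo i $ un_wo (p i))"
      using sgn p by (simp add: inv un_wo_inverse)
  qed
  finally show ?thesis by (simp add: det_def)
qed

text \<open>The known theorem is about \<open>has_integral\<close>, that is, about finite values.
  Two elements of \<open>ennreal\<close> coincide as soon as they are equal to the same real
  numbers, so the infinite case takes care of itself.\<close>

lemma nn_integral_change_of_variables_wo:
  fixes f :: "real ^ 'n::{finite,wellorder} \<Rightarrow> real" and g h :: "real ^ 'n::_ \<Rightarrow> real ^ 'n::_"
  assumes der_g: "\<And>x. x \<in> S \<Longrightarrow> (g has_derivative g' x) (at x within S)"
    and der_h: "\<And>y. y \<in> T \<Longrightarrow> (h has_derivative h' y) (at y within T)"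
    and f0: "\<And>y. y \<in> T \<Longrightarrow> 0 \<le> f y"
    and hg: "\<And>x. x \<in> S \<Longrightarrow> g x \<in> T \<and> h (g x) = x"
    and gh: "\<And>y. y \<in> T \<Longrightarrow> h y \<in> S \<and> g (h y) = y"
    and id: "\<And>y. y \<in> T \<Longrightarrow> h' y \<circ> g' (h y) = id"
    and meas: "(\<lambda>y. indicator T y * f y) \<in> borel_measurable borel"
      "(\<lambda>x. indicator S x * (\<bar>det (matrix (g' x))\<bar> * f (g x))) \<in> borel_measurable borel"
  shows "(\<integral>\<^sup>+y\<in>T. ennreal (f y) \<partial>lborel) = (\<integral>\<^sup>+x\<in>S. ennreal (\<bar>det (matrix (g' x))\<bar> * f (g x)) \<partial>lborel)"
proof -
  let ?D = "\<lambda>x. \<bar>det (matrix (g' x))\<bar> * f (g x)"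
  have *: "(\<integral>\<^sup>+y\<in>T. ennreal (f y) \<partial>lborel) = ennreal r \<longleftrightarrow> (f has_integral r) T"
    if nn: "\<And>y. y \<in> T \<Longrightarrow> 0 \<le> f y" and meas: "(\<lambda>y. indicator T y * f y) \<in> borel_measurable borel"
      and r: "r \<ge> 0"
    for r T and f :: "real ^ 'n::{finite,wellorder} \<Rightarrow> real"
  proof -
    define F where "F y = indicator T y * f y" for y
    have "(\<integral>\<^sup>+y\<in>T. ennreal (f y) \<partial>lborel) = integral\<^sup>N lborel (\<lambda>y. ennreal (F y))"
      by (intro nn_integral_cong) (simp add: F_def indicator_def)
    then have 1: "(\<integral>\<^sup>+y\<in>T. ennreal (f y) \<partial>lborel) = integral\<^sup>N lebesgue (\<lambda>y. ennreal (F y))"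
      by (simp only: nn_integral_completion)
    have "F = (\<lambda>y. if y \<in> T then f y else 0)" by (auto simp: F_def indicator_def)
    then have 2: "(f has_integral r) T \<longleftrightarrow> (F has_integral r) UNIV"
      by (simp only: has_integral_restrict_UNIV)
    have F0: "0 \<le> F y" for y using nn by (auto simp: F_def indicator_def)
    have "F \<in> borel_measurable lborel" using meas unfolding F_def by simp
    then have "F \<in> borel_measurable lebesgue" by (rule measurable_completion)
    then show ?thesis
      unfolding 1 2 has_integral_iff_nn_integral_lebesgue[OF F0] using r by simp
  qed
  have cov: "(?D has_integral b) S \<longleftrightarrow> (f has_integral b) T" for b
    by (rule cov_invertible_nonneg_eq[OF der_g der_h f0 hg gh id])
  have D0: "0 \<le> ?D x" if "x \<in> S" for x using f0 hg[OF that] by simp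
  have ext: "a = b" if "\<And>r. r \<ge> 0 \<Longrightarrow> a = ennreal r \<longleftrightarrow> b = ennreal r" for a b :: ennreal
    using that by (metis ennreal_cases)
  show ?thesis
    by (rule ext) (simp only: *[OF f0 meas(1)] *[OF D0 meas(2)] cov)
qed

text \<open>Transport along \<open>to_wo\<close> and \<open>of_wo\<close>: they preserve Lebesgue
  measure, and conjugation with them preserves determinants.\<close>

theorem nn_integral_change_of_variables:
  fixes f :: "real ^ 'n::finite \<Rightarrow> real" and g h :: "real ^ 'n \<Rightarrow> real ^ 'n"
  assumes der_g: "\<And>x. x \<in> S \<Longrightarrow> (g has_derivative g' x) (at x within S)"
    and der_h: "\<And>y. y \<in> T \<Longrightarrow> (h has_derivative h' y) (at y within T)"
    and f0: "\<And>y. y \<in> T \<Longrightarrow> 0 \<le> f y"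
    and hg: "\<And>x. x \<in> S \<Longrightarrow> g x \<in> T \<and> h (g x) = x"
    and gh: "\<And>y. y \<in> T \<Longrightarrow> h y \<in> S \<and> g (h y) = y"
    and id: "\<And>y. y \<in> T \<Longrightarrow> h' y \<circ> g' (h y) = id"
    and meas [measurable]: "(\<lambda>y. indicator T y * f y) \<in> borel_measurable borel"
      "(\<lambda>x. indicator S x * (\<bar>det (matrix (g' x))\<bar> * f (g x))) \<in> borel_measurable borel"
  shows "(\<integral>\<^sup>+y\<in>T. ennreal (f y) \<partial>lborel) = (\<integral>\<^sup>+x\<in>S. ennreal (\<bar>det (matrix (g' x))\<bar> * f (g x)) \<partial>lborel)"
proof -
  let ?c = "\<lambda>k. to_wo \<circ> k \<circ> of_wo :: real ^ 'n wo \<Rightarrow> real ^ 'n wo"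
  let ?S = "of_wo -` S" and ?T = "of_wo -` T"
  have ind: "indicator (of_wo -` U) y = indicator U (of_wo y)" for U y by (auto simp: indicator_def)
 have hi: "ennreal a * indicator U y = ennreal (indicator U y * a)" for a y and U :: "'x set"
    by (simp add: indicator_def)
  have det: "det (matrix (?c l)) = det (matrix l)" for l
  proof -
    have "to_wo (l (of_wo (axis j 1))) = to_wo (l (axis (un_wo j) 1))" for j
    proof -
      have "of_wo (axis j 1) = axis (un_wo j) 1"
        by (auto simp: of_wo_def axis_def vec_eq_iff) (metis UNIV_I mk_wo_inverse un_wo_inverse)+
      then show ?thesis by simp
    qed
    then have "matrix (?c l) = (\<chi> i j. matrix l $ un_wo i $ un_wo j)"
      by (simp add: matrix_def to_wo_def vec_eq_iff)
    then show ?thesis by (simp add: det_to_wo)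
  qed
  have der: "(?c k has_derivative ?c k') (at x within of_wo -` U)"
    if "(k has_derivative k') (at (of_wo x) within U)" for k k' x U
  proof -
    have "(of_wo has_derivative of_wo) (at x within of_wo -` U)"
      by (rule bounded_linear_imp_has_derivative[OF bounded_linear_of_wo])
    from has_derivative_in_compose[OF this has_derivative_subset[OF that]]
    have "((\<lambda>x. k (of_wo x)) has_derivative (\<lambda>x. k' (of_wo x))) (at x within of_wo -` U)" by auto
    from bounded_linear.has_derivative[OF bounded_linear_to_wo this]
    show ?thesis by (simp add: comp_def)
  qed
  have lb: "(\<integral>\<^sup>+y. q (of_wo y) \<partial>lborel) = (\<integral>\<^sup>+y. q y \<partial>lborel)" if [measurable]: "q \<in> borel_measurable borel" for q
    by (subst lborel_to_wo[symmetric]) (simp add: nn_integral_distr)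
  have "(\<integral>\<^sup>+y\<in>?T. ennreal (f (of_wo y)) \<partial>lborel)
      = (\<integral>\<^sup>+x\<in>?S. ennreal (\<bar>det (matrix (?c (g' (of_wo x))))\<bar> * f (of_wo (?c g x))) \<partial>lborel)"
  proof (rule nn_integral_change_of_variables_wo[where h = "?c h" and h' = "\<lambda>y. ?c (h' (of_wo y))"])
    show "(?c g has_derivative ?c (g' (of_wo x))) (at x within ?S)" if "x \<in> ?S" for x
      using that by (intro der der_g) auto
    show "(?c h has_derivative ?c (h' (of_wo y))) (at y within ?T)" if "y \<in> ?T" for y
      using that by (intro der der_h) auto
    show "?c (h' (of_wo y)) \<circ> ?c (g' (of_wo (?c h y))) = id" if "y \<in> ?T" for y
      using id[of "of_wo y"] that by (auto simp: fun_eq_iff)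
    show "(\<lambda>y. indicator ?T y * f (of_wo y)) \<in> borel_measurable borel"
      unfolding ind using measurable_compose[OF measurable_of_wo meas(1)] by simp
    show "(\<lambda>x. indicator ?S x * (\<bar>det (matrix (?c (g' (of_wo x))))\<bar> * f (of_wo (?c g x)))) \<in> borel_measurable borel"
      unfolding ind det using measurable_compose[OF measurable_of_wo meas(2)] by simp
  qed (use f0 hg gh in auto)
  then have "(\<integral>\<^sup>+y. ennreal (indicator T (of_wo y) * f (of_wo y)) \<partial>lborel)
      = (\<integral>\<^sup>+x. ennreal (indicator S (of_wo x) * (\<bar>det (matrix (g' (of_wo x)))\<bar> * f (g (of_wo x)))) \<partial>(lborel :: (real ^ 'n wo) measure))"
    unfolding ind det hi by simp
  then have "(\<integral>\<^sup>+y. ennreal (indicator T y * f y) \<partial>lborel)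
      = (\<integral>\<^sup>+x. ennreal (indicator S x * (\<bar>det (matrix (g' x))\<bar> * f (g x))) \<partial>lborel)"
    using lb[of "\<lambda>y. ennreal (indicator T y * f y)"]
      lb[of "\<lambda>x. ennreal (indicator S x * (\<bar>det (matrix (g' x))\<bar> * f (g x)))"] by simp
  then show ?thesis by (simp only: hi)
qed

section \<open>Charts\<close>

lemma bilinear_expand:
  fixes \<beta> :: "real ^ 'n \<Rightarrow> real ^ 'm \<Rightarrow> real"
  assumes "bilinear \<beta>"
  shows "\<beta> v w = (\<Sum>k\<in>UNIV. \<Sum>l\<in>UNIV. v $ k * w $ l * \<beta> (axis k 1) (axis l 1))"
proof -
  have l: "linear (\<lambda>v. \<beta> v w)" "linear (\<beta> v)" for v w using assms by (auto simp: bilinear_def)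
  have 1: "\<beta> v w = (\<Sum>k\<in>UNIV. v $ k * \<beta> (axis k 1) w)" for v w
    by (subst basis_expansion[of v, symmetric], unfold scalar_mult_eq_scaleR)
      (simp add: linear_sum[OF l(1)] linear_cmul[OF l(1)])
  have 2: "\<beta> v w = (\<Sum>k\<in>UNIV. w $ k * \<beta> v (axis k 1))" for v w
    by (subst basis_expansion[of w, symmetric], unfold scalar_mult_eq_scaleR)
      (simp add: linear_sum[OF l(2)] linear_cmul[OF l(2)])
  have "\<beta> v w = (\<Sum>k\<in>UNIV. v $ k * (\<Sum>l\<in>UNIV. w $ l * \<beta> (axis k 1) (axis l 1)))"
    using 1[of v w] 2[of _ w] by simp
  then show ?thesis by (simp add: sum_distrib_left mult.assoc)
qed

lemma bilinear_compose:
  assumes "bilinear \<beta>" "linear T"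
  shows "bilinear (\<lambda>v w. \<beta> (T v) (T w))"
  using assms(1) linear_compose[OF assms(2), of "\<beta> (T x)" for x]
    linear_compose[OF assms(2), of "\<lambda>z. \<beta> z (T y)" for y]
  by (simp add: bilinear_def comp_def)

lemma matrix_real: "linear f \<Longrightarrow> matrix f *v x = f (x :: real ^ 'n)"
  by (simp add: matrix_works)

definition gram :: "(real ^ 'n \<Rightarrow> real ^ 'n \<Rightarrow> real) \<Rightarrow> real ^ 'n ^ 'n" where
  "gram \<beta> = (\<chi> i j. \<beta> (axis i 1) (axis j 1))"

lemma gram_vec: "bilinear \<beta> \<Longrightarrow> \<beta> v w = v \<bullet> (gram \<beta> *v w)"
  by (subst bilinear_expand) (auto simp: gram_def inner_vec_def matrix_vector_mult_def sum_distrib_left mult_ac)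

lemma gram_eqI:
  assumes "\<And>v w. \<beta> v w = v \<bullet> (M *v w)"
  shows "gram \<beta> = M"
  by (auto simp: gram_def vec_eq_iff assms matrix_vector_mult_basis inner_axis' column_def)

lemma gram_compose:
  assumes "bilinear \<beta>" "linear S" "linear T"
  shows "gram (\<lambda>v w. \<beta> (S v) (T w)) = transpose (matrix S) ** gram \<beta> ** matrix T"
proof (rule gram_eqI)
  fix v w
  show "\<beta> (S v) (T w) = v \<bullet> ((transpose (matrix S) ** gram \<beta> ** matrix T) *v w)"
  proof -
    have "\<beta> (S v) (T w) = (matrix S *v v) \<bullet> (gram \<beta> *v (matrix T *v w))"
      using gram_vec[OF assms(1), of "S v" "T w"]
      by (simp only: matrix_real[OF assms(2)] matrix_real[OF assms(3)])
    also have "\<dots> = v \<bullet> (transpose (matrix S) *v (gram \<beta> *v (matrix T *v w)))"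
      by (metis dot_lmul_matrix inner_commute transpose_matrix_vector)
    finally show ?thesis by (simp only: matrix_vector_mul_assoc matrix_mul_assoc)
  qed
qed

lemma det_gram_compose:
  assumes "bilinear \<beta>" "linear S" "linear T"
  shows "det (gram (\<lambda>v w. \<beta> (S v) (T w))) = det (matrix S) * det (gram \<beta>) * det (matrix T)"
  by (simp add: gram_compose[OF assms] det_mul det_transpose)

lemma det_gram_nonzero_iff:
  fixes \<beta> :: "real ^ 'n \<Rightarrow> real ^ 'n \<Rightarrow> real"
  assumes "bilinear \<beta>" "\<And>v w. \<beta> v w = \<beta> w v"
  shows "det (gram \<beta>) \<noteq> 0 \<longleftrightarrow> (\<forall>v. (\<forall>w. \<beta> v w = 0) \<longrightarrow> v = 0)"
proof -
  have e: "\<beta> v w = w \<bullet> (gram \<beta> *v v)" for v w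
    using gram_vec[OF assms(1), of w v] assms(2)[of v w] by simp
  have "gram \<beta> *v v = 0 \<longleftrightarrow> (\<forall>w. \<beta> v w = 0)" for v
  proof
    assume "\<forall>w. \<beta> v w = 0"
    then have "(gram \<beta> *v v) \<bullet> (gram \<beta> *v v) = 0" using e by metis
    then show "gram \<beta> *v v = 0" by simp
  qed (simp add: e)
  then show ?thesis
    using invertible_det_nz[of "gram \<beta>"] invertible_left_inverse[of "gram \<beta>"]
      matrix_left_invertible_ker[of "gram \<beta>"] by auto
qed

text \<open>In contrast to \<open>induced_metric\<close>, the form \<open>b\<close> is the same at
  all points; for bilinear \<open>b\<close> the Gram matrix is then smooth in coordinates as soon as
  \<open>f\<close> is smooth.\<close>

definition pullback :: "('e \<Rightarrow> 'e \<Rightarrow> real) \<Rightarrow> ('a, 'n::finite) chart \<Rightarrow> ('a \<Rightarrow> 'e::real_normed_vector) \<Rightarrow>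
    'a \<Rightarrow> real ^ 'n \<Rightarrow> real ^ 'n \<Rightarrow> real" where
  "pullback b c f x v w = b (differential c f x v) (differential c f x w)"

lemma volume_density_eq: "volume_density (\<lambda>_. b) c f x = sqrt \<bar>det (gram (pullback b c f x))\<bar>"
  by (simp add: volume_density_def induced_metric_def gram_def pullback_def)

locale omfd =
  fixes A :: "('a::{t2_space,second_countable_topology}, 'n::finite) chart set"
  assumes om: "oriented_manifold A"
begin

lemma homeo: "c \<in> A \<Longrightarrow> homeomorphism (fst c) (chart_range c) (snd c) (chart_inv c)"
  and open_fst: "c \<in> A \<Longrightarrow> open (fst c)" and open_range: "c \<in> A \<Longrightarrow> open (chart_range c)"
  using om unfolding oriented_manifold_def by auto

lemma inv_snd [simp]: "c \<in> A \<Longrightarrow> x \<in> fst c \<Longrightarrow> chart_inv c (snd c x) = x"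
  and snd_inv [simp]: "c \<in> A \<Longrightarrow> u \<in> chart_range c \<Longrightarrow> snd c (chart_inv c u) = u"
  and inv_in [simp]: "c \<in> A \<Longrightarrow> u \<in> chart_range c \<Longrightarrow> chart_inv c u \<in> fst c"
  and cont_snd: "c \<in> A \<Longrightarrow> continuous_on (fst c) (snd c)"
  and cont_inv: "c \<in> A \<Longrightarrow> continuous_on (chart_range c) (chart_inv c)"
  using homeo[of c] unfolding homeomorphism_def by auto

lemma snd_in [simp]: "x \<in> fst c \<Longrightarrow> snd c x \<in> chart_range c"
  by (simp add: chart_range_def)

lemma image_eq: "c \<in> A \<Longrightarrow> V \<subseteq> fst c \<Longrightarrow> snd c ` V = {u \<in> chart_range c. chart_inv c u \<in> V}"
  by (intro equalityI subsetI; clarsimp simp: subset_iff) (metis imageI snd_inv)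

lemma open_image:
  assumes "c \<in> A" "open V" "V \<subseteq> fst c"
  shows "open (snd c ` V)"
proof -
  have "{u \<in> chart_range c. chart_inv c u \<in> V} = chart_range c \<inter> chart_inv c -` V" by auto
  then show ?thesis
    using continuous_open_preimage[OF cont_inv[OF assms(1)] open_range[OF assms(1)] assms(2)]
    unfolding image_eq[OF assms(1,3)] by simp
qed

lemma open_carrier: "open (carrier A)"
  unfolding carrier_def by (intro open_UN ballI open_fst)

lemma carrierI: "c \<in> A \<Longrightarrow> x \<in> fst c \<Longrightarrow> x \<in> carrier A"
  by (auto simp: carrier_def)

lemma carrierE: assumes "x \<in> carrier A" obtains c where "c \<in> A" "x \<in> fst c"
  using assms by (auto simp: carrier_def)

definition trans :: "('a, 'n) chart \<Rightarrow> ('a, 'n) chart \<Rightarrow> 'a \<Rightarrow> real ^ 'n \<Rightarrow> real ^ 'n" where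
  "trans c d x = frechet_derivative (snd d \<circ> chart_inv c) (at (snd c x))"

lemma trans_has_derivative:
  assumes "c \<in> A" "d \<in> A" "x \<in> fst c" "x \<in> fst d"
  shows "((snd d \<circ> chart_inv c) has_derivative trans c d x) (at (snd c x))"
  using om assms smooth_on_has_derivative unfolding oriented_manifold_def trans_def by blast

lemma linear_trans:
  "c \<in> A \<Longrightarrow> d \<in> A \<Longrightarrow> x \<in> fst c \<Longrightarrow> x \<in> fst d \<Longrightarrow> linear (trans c d x)"
  by (rule has_derivative_linear[OF trans_has_derivative])

lemma trans_pos: "c \<in> A \<Longrightarrow> d \<in> A \<Longrightarrow> x \<in> fst c \<Longrightarrow> x \<in> fst d \<Longrightarrow> det (matrix (trans c d x)) > 0"
  using om unfolding oriented_manifold_def trans_def by auto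

lemma change_chart:
  assumes "c \<in> A" "d \<in> A" "x \<in> fst c" "x \<in> fst d"
    and f: "((f \<circ> chart_inv d) has_derivative f') (at (snd d x))"
  shows "((f \<circ> chart_inv c) has_derivative f' \<circ> trans c d x) (at (snd c x))"
proof (rule has_derivative_transform_within_open)
  have "(snd d \<circ> chart_inv c) (snd c x) = snd d x" using assms by simp
  then show "((f \<circ> chart_inv d) \<circ> (snd d \<circ> chart_inv c) has_derivative f' \<circ> trans c d x) (at (snd c x))"
    using diff_chain_at[OF trans_has_derivative[OF assms(1-4)]] f by metis
  show "open (snd c ` (fst c \<inter> fst d))"
    by (rule open_image) (use assms in \<open>auto intro: open_fst\<close>)
qed (use assms in auto)

lemma differential_trans:
  assumes "c \<in> A" "d \<in> A" "x \<in> fst c" "x \<in> fst d"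
    and f: "((f \<circ> chart_inv d) has_derivative f') (at (snd d x))"
  shows "differential c f x v = differential d f x (trans c d x v)"
  unfolding differential_def
  using frechet_eqI[OF change_chart[OF assms]] frechet_eqI[OF f] by simp

lemma trans_trans:
  assumes "c \<in> A" "d \<in> A" "x \<in> fst c" "x \<in> fst d"
  shows "trans d c x \<circ> trans c d x = id"
proof -
  have 1: "((snd c \<circ> chart_inv c) has_derivative trans d c x \<circ> trans c d x) (at (snd c x))"
    by (rule change_chart[OF assms trans_has_derivative]) (use assms in auto)
  have "((snd c \<circ> chart_inv c) has_derivative id) (at (snd c x))"
    by (rule has_derivative_transform_within_open[OF has_derivative_id open_range[OF assms(1)]])
      (use assms in auto)
  then show ?thesis using frechet_eqI 1 by metis
qed

lemma trans_onto:
  assumes "c \<in> A" "d \<in> A" "x \<in> fst c" "x \<in> fst d"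
  obtains v' where "trans c d x v' = v"
  using trans_trans[OF assms(2,1,4,3)] by (metis comp_apply id_apply)

lemma smooth_map_has_derivative:
  assumes "smooth_map A f" "c \<in> A" "x \<in> fst c"
  shows "((f \<circ> chart_inv c) has_derivative differential c f x) (at (snd c x))"
  using assms smooth_on_has_derivative[of "chart_range c" "f \<circ> chart_inv c" "snd c x"]
  unfolding smooth_map_def differential_def by auto

lemma differential_change:
  assumes "smooth_map A f" "c \<in> A" "d \<in> A" "x \<in> fst c" "x \<in> fst d"
  shows "differential c f x v = differential d f x (trans c d x v)"
  by (rule differential_trans[OF assms(2-5) smooth_map_has_derivative[OF assms(1,3,5)]])

lemma linear_differential: "smooth_map A f \<Longrightarrow> c \<in> A \<Longrightarrow> x \<in> fst c \<Longrightarrow> linear (differential c f x)"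
  by (rule has_derivative_linear[OF smooth_map_has_derivative])

lemma smooth_map_differential:
  assumes "smooth_map A f" "c \<in> A"
  shows "smooth_on (chart_range c) (\<lambda>u. differential c f (chart_inv c u) v)"
proof (rule smooth_on_cong[OF open_range[OF assms(2)]])
  show "smooth_on (chart_range c) (\<lambda>u. frechet_derivative (f \<circ> chart_inv c) (at u) v)"
    using assms by (intro smooth_on_frechet_const) (auto simp: smooth_map_def)
qed (use assms in \<open>auto simp: differential_def\<close>)

lemma differential_cong_open:
  assumes "c \<in> A" "x \<in> fst c" "open V" "x \<in> V" "\<And>y. y \<in> V \<Longrightarrow> y \<in> fst c \<Longrightarrow> f y = g y"
    and "smooth_map A f"
  shows "differential c g x = differential c f x"
  unfolding differential_def
proof (rule frechet_eqI, rule has_derivative_transform_within_open)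
  show "((f \<circ> chart_inv c) has_derivative frechet_derivative (f \<circ> chart_inv c) (at (snd c x))) (at (snd c x))"
    using smooth_map_has_derivative[OF assms(6,1,2)] by (simp add: differential_def)
  show "open (snd c ` (fst c \<inter> V))" by (rule open_image) (use assms in \<open>auto intro: open_fst\<close>)
qed (use assms in auto)

lemma continuous_in_chart:
  assumes "c \<in> A" "continuous_on (chart_range c) f"
  shows "continuous_on (fst c) (\<lambda>x. f (snd c x))"
  by (rule continuous_on_compose2[OF assms(2) cont_snd[OF assms(1)]]) auto

lemma bilinear_pullback:
  assumes "smooth_map A f" "bilinear b" "c \<in> A" "x \<in> fst c"
  shows "bilinear (pullback b c f x)"
  unfolding pullback_def by (rule bilinear_compose[OF assms(2) linear_differential[OF assms(1,3,4)]])

lemma det_gram_pullback_change: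
  assumes "smooth_map A f" "bilinear b" "c \<in> A" "d \<in> A" "x \<in> fst c" "x \<in> fst d"
  shows "det (gram (pullback b c f x)) = (det (matrix (trans c d x)))\<^sup>2 * det (gram (pullback b d f x))"
proof -
  have "pullback b c f x = (\<lambda>v w. pullback b d f x (trans c d x v) (trans c d x w))"
    by (simp add: pullback_def fun_eq_iff differential_change[OF assms(1,3-6)])
  then show ?thesis
    using det_gram_compose[OF bilinear_pullback[OF assms(1,2,4,6)] linear_trans[OF assms(3-6)] linear_trans[OF assms(3-6)]]
    by (simp add: power2_eq_square mult_ac)
qed

lemma volume_density_change:
  assumes "smooth_map A f" "bilinear b" "c \<in> A" "d \<in> A" "x \<in> fst c" "x \<in> fst d"
  shows "volume_density (\<lambda>_. b) c f x = \<bar>det (matrix (trans c d x))\<bar> * volume_density (\<lambda>_. b) d f x"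
  by (simp add: volume_density_eq det_gram_pullback_change[OF assms] abs_mult real_sqrt_mult)

lemma volume_density_nonneg [simp]: "volume_density h c f x \<ge> 0"
  by (simp add: volume_density_def)

lemma continuous_volume_density:
  fixes f :: "'a \<Rightarrow> 'e::euclidean_space"
  assumes "smooth_map A f" "bilinear b" "c \<in> A"
  shows "continuous_on (chart_range c) (\<lambda>u. volume_density (\<lambda>_. b) c f (chart_inv c u))"
proof -
  have "smooth_on (chart_range c) (\<lambda>u. det (gram (pullback b c f (chart_inv c u))))"
    unfolding gram_def pullback_def
    by (auto intro!: smooth_on_det smooth_on_bilinear[OF assms(2)] open_range smooth_map_differential assms)
  then show ?thesis
    unfolding volume_density_eq by (intro continuous_intros smooth_on_imp_continuous_on)
qed

end

section \<open>Restriction of an atlas to an open subset\<close>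

lemma chart_inv_restrict:
  assumes "inj_on (snd c) (fst c)" "x \<in> fst c \<inter> W"
  shows "chart_inv (fst c \<inter> W, snd c) (snd c x) = chart_inv c (snd c x)"
  unfolding chart_inv_def using assms
  by (metis IntD1 fst_conv inf_le1 inj_on_subset inv_into_f_f snd_conv)

lemma restrict_atlas_iff: "c \<in> restrict_atlas A W \<longleftrightarrow> (\<exists>d\<in>A. c = (fst d \<inter> W, snd d))"
  by (auto simp: restrict_atlas_def image_iff split_beta)

lemma carrier_restrict: "carrier (restrict_atlas A W) = carrier A \<inter> W"
  by (auto simp: carrier_def restrict_atlas_def split_beta)

context omfd begin

lemma inj_chart: "c \<in> A \<Longrightarrow> inj_on (snd c) (fst c)"
  by (metis inv_snd inj_onI)

lemma chart_inv_restrict': "c \<in> A \<Longrightarrow> u \<in> snd c ` (fst c \<inter> W) \<Longrightarrow>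
    chart_inv (fst c \<inter> W, snd c) u = chart_inv c u"
  using chart_inv_restrict[OF inj_chart] by blast

text \<open>\<open>chart_inv\<close> is an \<open>inv_into\<close> and changes with the domain of
  the chart, so the two local expressions agree only on the image of the smaller domain. That image
  is open, and a derivative sees no more.\<close>

lemma frechet_restrict:
  assumes "c \<in> A" "open W" "x \<in> fst c \<inter> W"
  shows "frechet_derivative (f \<circ> chart_inv (fst c \<inter> W, snd c)) (at (snd c x)) =
    frechet_derivative (f \<circ> chart_inv c) (at (snd c x))"
proof -
  have o: "open (snd c ` (fst c \<inter> W))" by (rule open_image) (use assms in \<open>auto intro: open_fst\<close>)
  have "((f \<circ> chart_inv (fst c \<inter> W, snd c)) has_derivative D) (at (snd c x)) \<longleftrightarrow>
      ((f \<circ> chart_inv c) has_derivative D) (at (snd c x))" for D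
    using chart_inv_restrict'[OF assms(1)] assms(3)
    by (intro iffI; elim has_derivative_transform_within_open[OF _ o]) auto
  then show ?thesis unfolding frechet_derivative_def by simp
qed

lemma differential_restrict:
  assumes "c \<in> A" "open W" "x \<in> fst c \<inter> W"
  shows "differential (fst c \<inter> W, snd c) f x = differential c f x"
  using frechet_restrict[OF assms] by (simp add: differential_def)

lemma smooth_map_restrict:
  assumes "open W" "smooth_map A f"
  shows "smooth_map (restrict_atlas A W) f"
  unfolding smooth_map_def
proof
  fix c assume "c \<in> restrict_atlas A W"
  then obtain d where d: "d \<in> A" "c = (fst d \<inter> W, snd d)" by (auto simp: restrict_atlas_iff)
  have o: "open (snd d ` (fst d \<inter> W))" by (rule open_image) (use d assms in \<open>auto intro: open_fst\<close>)
  have "smooth_on (snd d ` (fst d \<inter> W)) (f \<circ> chart_inv d)"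
    using assms(2) d by (auto simp: smooth_map_def chart_range_def intro: smooth_on_subset)
  from smooth_on_cong[OF o this, of "f \<circ> chart_inv c"]
  show "smooth_on (chart_range c) (f \<circ> chart_inv c)"
    unfolding d(2) chart_range_def by (simp add: chart_inv_restrict'[OF d(1)])
qed

lemma omfd_restrict:
  assumes W: "open W"
  shows "omfd (restrict_atlas A W)"
proof
  show "oriented_manifold (restrict_atlas A W)"
    unfolding oriented_manifold_def
  proof (intro conjI ballI)
    fix c assume "c \<in> restrict_atlas A W"
    then obtain d where d: "d \<in> A" "c = (fst d \<inter> W, snd d)" by (auto simp: restrict_atlas_iff)
    show "open (fst c)" using d W by (auto intro: open_fst)
    have r: "chart_range c = snd d ` (fst d \<inter> W)" using d by (simp add: chart_range_def)
    show "open (chart_range c)"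
      unfolding r by (rule open_image) (use d W in \<open>auto intro: open_fst\<close>)
    have inv: "chart_inv c (snd d x) = x" if "x \<in> fst c" for x
      using that d chart_inv_restrict'[OF d(1), of "snd d x" W] by simp
    have im: "chart_inv c ` chart_range c = fst c"
      unfolding r using inv d(2) by (simp add: image_image)
    have "continuous_on (fst c) (snd d)"
      using continuous_on_subset[OF cont_snd[OF d(1)], of "fst c"] d(2) by simp
    moreover have "continuous_on (chart_range c) (chart_inv d)"
      by (rule continuous_on_subset[OF cont_inv[OF d(1)]], unfold r, unfold chart_range_def) auto
    then have "continuous_on (chart_range c) (chart_inv c)"
      by (rule continuous_on_eq) (unfold r, unfold d(2), simp add: chart_inv_restrict'[OF d(1)])
    moreover have "snd d ` fst c = chart_range c" using d(2) r by simp
    moreover have "snd d (chart_inv c u) = u" if u: "u \<in> chart_range c" for u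
    proof -
      obtain x where "x \<in> fst c" "u = snd d x" using u unfolding r by (auto simp: d(2))
      then show ?thesis using inv by simp
    qed
    moreover have "snd c = snd d" using d(2) by simp
    ultimately show "homeomorphism (fst c) (chart_range c) (snd c) (chart_inv c)"
      unfolding homeomorphism_def using inv im by simp
  next
    fix c c' assume "c \<in> restrict_atlas A W" "c' \<in> restrict_atlas A W"
    then obtain d d' where d: "d \<in> A" "c = (fst d \<inter> W, snd d)" and d': "d' \<in> A" "c' = (fst d' \<inter> W, snd d')"
      by (auto simp: restrict_atlas_iff)
    have o: "open (snd c ` (fst c \<inter> fst c'))"
      unfolding d(2) d'(2) fst_conv snd_conv
      by (rule open_image) (use d d' W in \<open>auto intro: open_fst\<close>)
    have "smooth_on (snd d ` (fst d \<inter> fst d')) (snd d' \<circ> chart_inv d)"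
      using om d(1) d'(1) unfolding oriented_manifold_def by blast
    then have "smooth_on (snd c ` (fst c \<inter> fst c')) (snd d' \<circ> chart_inv d)"
      by (rule smooth_on_subset) (use d d' in auto)
    then show "smooth_on (snd c ` (fst c \<inter> fst c')) (snd c' \<circ> chart_inv c)"
      by (rule smooth_on_cong[OF o]) (use d d' in \<open>auto simp: chart_inv_restrict'\<close>)
    fix x assume x: "x \<in> fst c \<inter> fst c'"
    then show "0 < det (matrix (frechet_derivative (snd c' \<circ> chart_inv c) (at (snd c x))))"
      using trans_pos[of d d' x] frechet_restrict[OF d(1) W, of x "snd d'"] d d' by (simp add: trans_def)
  qed
qed

end

section \<open>The volume measure\<close>

context omfd begin

definition chart_volume :: "(('a, 'n) chart \<Rightarrow> 'a \<Rightarrow> real) \<Rightarrow> ('a, 'n) chart \<Rightarrow> 'a set \<Rightarrow> ennreal" where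
  "chart_volume d c B = (\<integral>\<^sup>+u\<in>snd c ` B. ennreal (d c (chart_inv c u)) \<partial>lborel)"

text \<open>A continuous nonnegative density in the sense of differential geometry: local functions
  that change by the absolute value of the Jacobian determinant of the transition map.\<close>

definition is_density :: "(('a, 'n) chart \<Rightarrow> 'a \<Rightarrow> real) \<Rightarrow> bool" where
  "is_density d \<longleftrightarrow> (\<forall>c\<in>A. continuous_on (chart_range c) (\<lambda>u. d c (chart_inv c u)) \<and> (\<forall>x\<in>fst c. d c x \<ge> 0)) \<and>
     (\<forall>c\<in>A. \<forall>c'\<in>A. \<forall>x\<in>fst c \<inter> fst c'. d c x = \<bar>det (matrix (trans c c' x))\<bar> * d c' x)"

lemma is_density_cont: "is_density d \<Longrightarrow> c \<in> A \<Longrightarrow> continuous_on (chart_range c) (\<lambda>u. d c (chart_inv c u))"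
  and is_density_nonneg: "is_density d \<Longrightarrow> c \<in> A \<Longrightarrow> x \<in> fst c \<Longrightarrow> d c x \<ge> 0"
  and is_density_change: "is_density d \<Longrightarrow> c \<in> A \<Longrightarrow> c' \<in> A \<Longrightarrow> x \<in> fst c \<Longrightarrow> x \<in> fst c' \<Longrightarrow>
    d c x = \<bar>det (matrix (trans c c' x))\<bar> * d c' x"
  unfolding is_density_def by blast+

definition density_measure :: "(('a, 'n) chart \<Rightarrow> 'a \<Rightarrow> real) \<Rightarrow> 'a measure \<Rightarrow> bool" where
  "density_measure d \<mu> \<longleftrightarrow> sets \<mu> = sets (restrict_space borel (carrier A)) \<and>
     (\<forall>c\<in>A. \<forall>B\<in>sets borel. B \<subseteq> fst c \<longrightarrow> emeasure \<mu> B = chart_volume d c B)"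

lemma borel_image:
  assumes "c \<in> A" "B \<in> sets borel" "B \<subseteq> fst c"
  shows "snd c ` B \<in> sets borel"
proof -
  have "chart_inv c \<in> borel_measurable (restrict_space borel (chart_range c))"
    by (rule borel_measurable_continuous_on_restrict[OF cont_inv[OF assms(1)]])
  from measurable_sets[OF this assms(2)]
  have "chart_inv c -` B \<inter> chart_range c \<in> sets (restrict_space borel (chart_range c))"
    by (simp add: space_restrict_space)
  moreover have "chart_range c \<in> sets borel" using open_range[OF assms(1)] by simp
  ultimately have "chart_inv c -` B \<inter> chart_range c \<in> sets borel"
    by (simp add: sets_restrict_space_iff)
  moreover have "snd c ` B = chart_inv c -` B \<inter> chart_range c"
    unfolding image_eq[OF assms(1,3)] by auto
  ultimately show ?thesis by simp
qed

lemma density_measurable: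
  assumes "is_density d" "c \<in> A" "B \<in> sets borel" "B \<subseteq> fst c"
  shows "(\<lambda>u. indicator (snd c ` B) u * d c (chart_inv c u)) \<in> borel_measurable borel"
proof -
  have "continuous_on (snd c ` B) (\<lambda>u. d c (chart_inv c u))"
    using continuous_on_subset[OF is_density_cont[OF assms(1,2)]] assms(4) unfolding chart_range_def by blast
  from borel_measurable_continuous_on_indicator[OF borel_image[OF assms(2-4)] this]
  show ?thesis by simp
qed

lemma chart_volume_eq:
  "chart_volume d c B = (\<integral>\<^sup>+u. ennreal (indicator (snd c ` B) u * d c (chart_inv c u)) \<partial>lborel)"
  unfolding chart_volume_def by (intro nn_integral_cong) (simp add: indicator_def)

text \<open>The change of variables theorem for the transition map from \<open>c'\<close> to
  \<open>c\<close>; the transformation rule of a density absorbs the Jacobian determinant.\<close>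

lemma chart_volume_indep:
  assumes d: "is_density d" and c: "c \<in> A" "c' \<in> A" and B: "B \<in> sets borel" "B \<subseteq> fst c" "B \<subseteq> fst c'"
  shows "chart_volume d c B = chart_volume d c' B"
proof -
  define g where "g = snd c \<circ> chart_inv c'"
  define h where "h = snd c' \<circ> chart_inv c"
  define g' where "g' u = trans c' c (chart_inv c' u)" for u
  define h' where "h' u = trans c c' (chart_inv c u)" for u
  have 1: "\<bar>det (matrix (g' u))\<bar> * d c (chart_inv c (g u)) = d c' (chart_inv c' u)" if u: "u \<in> snd c' ` B" for u
  proof -
    obtain x where x: "x \<in> B" "u = snd c' x" using u by blast
    then have "g u = snd c x" "chart_inv c' u = x" using c B by (auto simp: g_def subset_iff)
    moreover have "x \<in> fst c" "x \<in> fst c'" using x B by auto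
    ultimately show ?thesis using is_density_change[OF d c(2,1), of x] c by (simp add: g'_def)
  qed
  have eq: "indicator (snd c' ` B) u * (\<bar>det (matrix (g' u))\<bar> * d c (chart_inv c (g u)))
      = indicator (snd c' ` B) u * d c' (chart_inv c' u)" for u
    using 1[of u] by (cases "u \<in> snd c' ` B") auto
  have "chart_volume d c B = (\<integral>\<^sup>+u\<in>snd c' ` B. ennreal (\<bar>det (matrix (g' u))\<bar> * d c (chart_inv c (g u))) \<partial>lborel)"
    unfolding chart_volume_def
  proof (rule nn_integral_change_of_variables[where h = h and h' = h'])
    show "(g has_derivative g' u) (at u within snd c' ` B)" if H: "u \<in> snd c' ` B" for u
    proof -
      obtain x where x: "x \<in> B" "u = snd c' x" using H by blast
      then have B': "x \<in> fst c" "x \<in> fst c'" using B by auto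
      have "(g has_derivative trans c' c x) (at u)"
        unfolding x(2) g_def by (rule trans_has_derivative[OF c(2,1)]) (fact B')+
      moreover have "g' u = trans c' c x" using x(2) c B' by (simp add: g'_def)
      ultimately show ?thesis by (simp add: has_derivative_at_withinI)
    qed
    show "(h has_derivative h' u) (at u within snd c ` B)" if H: "u \<in> snd c ` B" for u
    proof -
      obtain x where x: "x \<in> B" "u = snd c x" using H by blast
      then have B': "x \<in> fst c" "x \<in> fst c'" using B by auto
      have "(h has_derivative trans c c' x) (at u)"
        unfolding x(2) h_def by (rule trans_has_derivative[OF c(1,2)]) (fact B')+
      moreover have "h' u = trans c c' x" using x(2) c B' by (simp add: h'_def)
      ultimately show ?thesis by (simp add: has_derivative_at_withinI)
    qed
    show "0 \<le> d c (chart_inv c y)" if "y \<in> snd c ` B" for y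
      using that c B by (auto simp: subset_iff intro!: is_density_nonneg[OF d c(1)])
    show "g u \<in> snd c ` B \<and> h (g u) = u" if H: "u \<in> snd c' ` B" for u
    proof -
      obtain x where "x \<in> B" "u = snd c' x" using H by blast
      then show ?thesis using c B by (auto simp: g_def h_def subset_iff)
    qed
    show "h y \<in> snd c' ` B \<and> g (h y) = y" if H: "y \<in> snd c ` B" for y
    proof -
      obtain x where "x \<in> B" "y = snd c x" using H by blast
      then show ?thesis using c B by (auto simp: g_def h_def subset_iff)
    qed
    show "h' y \<circ> g' (h y) = id" if H: "y \<in> snd c ` B" for y
    proof -
      obtain x where "x \<in> B" "y = snd c x" using H by blast
      then have "chart_inv c y = x" "chart_inv c' (h y) = x" "x \<in> fst c" "x \<in> fst c'"
        using c B by (auto simp: h_def subset_iff)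
      then show ?thesis using trans_trans[OF c(2,1)] by (simp add: h'_def g'_def)
    qed
    show "(\<lambda>y. indicator (snd c ` B) y * d c (chart_inv c y)) \<in> borel_measurable borel"
      by (rule density_measurable[OF d c(1) B(1,2)])
    show "(\<lambda>u. indicator (snd c' ` B) u * (\<bar>det (matrix (g' u))\<bar> * d c (chart_inv c (g u)))) \<in> borel_measurable borel"
      unfolding eq by (rule density_measurable[OF d c(2) B(1,3)])
  qed
  also have "\<dots> = chart_volume d c' B"
    unfolding chart_volume_def
    by (intro nn_integral_cong) (use 1 in \<open>auto simp: indicator_def\<close>)
  finally show ?thesis .
qed

text \<open>A chart is injective, so disjoint sets have disjoint images and at each coordinate point
  at most one term of the series is nonzero.\<close>

lemma chart_volume_suminf:
  assumes d: "is_density d" and c: "c \<in> A"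
    and B: "\<And>j :: nat. B j \<in> sets borel" "\<And>j. B j \<subseteq> fst c" "disjoint_family B"
  shows "chart_volume d c (\<Union>j. B j) = (\<Sum>j. chart_volume d c (B j))"
proof -
  have ind: "(\<Sum>j. ennreal (indicator (snd c ` B j) u * d c (chart_inv c u)))
      = ennreal (indicator (snd c ` (\<Union>j. B j)) u * d c (chart_inv c u))" for u
  proof (cases "u \<in> snd c ` (\<Union>j. B j)")
    case True
    then obtain j x where j: "x \<in> B j" "u = snd c x" by blast
    have "u \<notin> snd c ` B i" if "i \<noteq> j" for i
    proof
      assume "u \<in> snd c ` B i"
      then obtain y where "y \<in> B i" "u = snd c y" by blast
      then have "x = y" using inj_chart[OF c] B(2) j by (auto simp: inj_on_def subset_iff)
      then show False using B(3) \<open>y \<in> B i\<close> j that by (auto simp: disjoint_family_on_def)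
    qed
    then have "(\<Sum>i. ennreal (indicator (snd c ` B i) u * d c (chart_inv c u)))
        = (\<Sum>i\<in>{j}. ennreal (indicator (snd c ` B i) u * d c (chart_inv c u)))"
      by (intro suminf_finite) (auto simp: indicator_def)
    then show ?thesis using j True by (simp add: indicator_def)
  next
    case False
    then have "u \<notin> snd c ` B j" for j by blast
    then show ?thesis using False by (simp add: indicator_def)
  qed
  show ?thesis
    unfolding chart_volume_eq ind[symmetric]
    by (rule nn_integral_suminf) (use density_measurable[OF d c B(1,2)] in simp)
qed

definition cover :: "(nat \<Rightarrow> ('a, 'n) chart) \<Rightarrow> bool" where
  "cover cs \<longleftrightarrow> (\<forall>i. cs i \<in> A) \<and> (\<Union>i. fst (cs i)) = carrier A"

text \<open>The cells form a Borel partition of the manifold, each inside one chart domain. Cutting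
  a set along them reduces a measure on the manifold to countably many chart integrals.\<close>

definition cell :: "(nat \<Rightarrow> ('a, 'n) chart) \<Rightarrow> nat \<Rightarrow> 'a set" where
  "cell cs = disjointed (\<lambda>i. fst (cs i))"

text \<open>Second countability yields a countable subcover. It is listed as a sequence, with
  repetitions if it is finite, which takes at least one chart.\<close>

lemma ex_cover:
  assumes "A \<noteq> {}"
  obtains cs where "cover cs"
proof -
  obtain F' where F': "F' \<subseteq> fst ` A" "countable F'" "\<Union>F' = \<Union>(fst ` A)"
    by (rule Lindelof[of "fst ` A"]) (use open_fst in auto)
  then obtain C where C: "C \<subseteq> A" "countable C" "F' = fst ` C"
    using countable_subset_image by metis
  show thesis
  proof (cases "C = {}")
    case True
    obtain c where "c \<in> A" using assms by blast
    then have "cover (\<lambda>_. c)" using F' C True by (auto simp: cover_def carrier_def)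
    then show thesis by (rule that)
  next
    case False
    have r: "range (from_nat_into C) = C" using range_from_nat_into[OF False C(2)] .
    have "(\<Union>i. fst (from_nat_into C i)) = \<Union>(fst ` range (from_nat_into C))" by auto
    also have "\<dots> = carrier A" unfolding r using F' C by (simp add: carrier_def)
    finally have "cover (from_nat_into C)"
      unfolding cover_def using from_nat_into[OF False] C by blast
    then show thesis by (rule that)
  qed
qed

lemma cell_props:
  assumes "cover cs"
  shows "cell cs i \<in> sets borel" "cell cs i \<subseteq> fst (cs i)" "disjoint_family (cell cs)" "(\<Union>i. cell cs i) = carrier A"
proof -
  have "range (\<lambda>i. fst (cs i)) \<subseteq> sets borel"
    using assms open_fst[of "cs i" for i] by (auto simp: cover_def)
  from sets.range_disjointed_sets[OF this]
  show "cell cs i \<in> sets borel" by (auto simp: cell_def)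
  show "cell cs i \<subseteq> fst (cs i)" unfolding cell_def by (rule disjointed_subset)
  show "disjoint_family (cell cs)" unfolding cell_def by (rule disjoint_family_disjointed)
  show "(\<Union>i. cell cs i) = carrier A"
    using assms UN_disjointed_eq[of "\<lambda>i. fst (cs i)"] by (simp add: cell_def cover_def)
qed

lemma sets_carrier_iff: "B \<in> sets (restrict_space borel (carrier A)) \<longleftrightarrow> B \<in> sets borel \<and> B \<subseteq> carrier A"
  using open_carrier by (subst sets_restrict_space_iff) auto

lemma density_measure_cells:
  assumes d: "density_measure d \<mu>" and cs: "cover cs" and B: "B \<in> sets borel" "B \<subseteq> carrier A"
  shows "emeasure \<mu> B = (\<Sum>i. chart_volume d (cs i) (B \<inter> cell cs i))"
proof -
  note cell = cell_props[OF cs]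
  have A: "cs i \<in> A" for i using cs by (simp add: cover_def)
  have "emeasure \<mu> B = emeasure \<mu> (\<Union>i. B \<inter> cell cs i)"
    using B(2) cell(4) by (metis Int_UN_distrib inf.absorb1)
  also have "\<dots> = (\<Sum>i. emeasure \<mu> (B \<inter> cell cs i))"
  proof (rule suminf_emeasure[symmetric])
    show "range (\<lambda>i. B \<inter> cell cs i) \<subseteq> sets \<mu>"
      using d B cell(1) by (auto simp: density_measure_def sets_carrier_iff)
    show "disjoint_family (\<lambda>i. B \<inter> cell cs i)"
      using cell(3) by (auto simp: disjoint_family_on_def)
  qed
  also have "\<dots> = (\<Sum>i. chart_volume d (cs i) (B \<inter> cell cs i))"
  proof (rule suminf_cong)
    fix i
    have "B \<inter> cell cs i \<in> sets borel" "B \<inter> cell cs i \<subseteq> fst (cs i)" using B cell(1,2) by auto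
    then show "emeasure \<mu> (B \<inter> cell cs i) = chart_volume d (cs i) (B \<inter> cell cs i)"
      using d A[of i] by (simp add: density_measure_def)
  qed
  finally show ?thesis .
qed

lemma density_measure_unique:
  assumes "density_measure d \<mu>" "density_measure d \<nu>"
  shows "\<mu> = \<nu>"
proof (cases "A = {}")
  case True
  then have c: "carrier A = {}" by (simp add: carrier_def)
  show ?thesis
  proof (rule measure_eqI)
    show "sets \<mu> = sets \<nu>" using assms by (simp add: density_measure_def)
    fix X assume "X \<in> sets \<mu>"
    then have "X = {}" using assms c sets_carrier_iff[of X] by (simp add: density_measure_def)
    then show "emeasure \<mu> X = emeasure \<nu> X" by simp
  qed
next
  case False
  then obtain cs where cs: "cover cs" by (rule ex_cover)
  show ?thesis
  proof (rule measure_eqI)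
    show "sets \<mu> = sets \<nu>" using assms by (simp add: density_measure_def)
    fix X assume "X \<in> sets \<mu>"
    then have "X \<in> sets borel" "X \<subseteq> carrier A" using assms sets_carrier_iff by (auto simp: density_measure_def)
    then show "emeasure \<mu> X = emeasure \<nu> X"
      using density_measure_cells[OF assms(1) cs] density_measure_cells[OF assms(2) cs] by simp
  qed
qed

text \<open>The measure is built as the sum of the chart integrals over the cells. A set inside
  another chart \<open>c\<close> gets the right value by \<open>chart_volume_indep\<close>, because
  each of its pieces lies in \<open>c\<close> and in the chart of its cell.\<close>

lemma ex_density_measure:
  assumes d: "is_density d"
  obtains \<mu> where "density_measure d \<mu>"
proof (cases "A = {}")
  case True
  have "density_measure d (restrict_space borel (carrier A))" unfolding density_measure_def
    by (intro conjI ballI refl) (use True in simp)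
  then show thesis by (rule that)
next
  case False
  then obtain cs where cs: "cover cs" by (rule ex_cover)
  note cell = cell_props[OF cs]
  have A: "cs i \<in> A" for i using cs by (simp add: cover_def)
  define S where "S = sets (restrict_space borel (carrier A))"
  define m where "m B = (\<Sum>i. chart_volume d (cs i) (B \<inter> cell cs i))" for B
  define \<mu> where "\<mu> = measure_of (carrier A) S m"
  have sp: "space (restrict_space borel (carrier A)) = carrier A" by (simp add: space_restrict_space)
  have S: "sigma_algebra (carrier A) S"
    unfolding S_def using sets.sigma_algebra_axioms[of "restrict_space borel (carrier A)"] sp by simp
  have pos: "positive S m"
    by (simp add: positive_def m_def chart_volume_def)
  have ca: "countably_additive S m"
  proof (rule countably_additiveI)
    fix B :: "nat \<Rightarrow> 'a set" assume B: "range B \<subseteq> S" "disjoint_family B"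
    have B': "B j \<in> sets borel" for j using B(1) sets_carrier_iff[of "B j"] unfolding S_def by auto
    \<comment> \<open>One of the two series is read as an integral over counting measure, so that
      the sums can be exchanged.\<close>
    have "(\<Sum>j. m (B j)) = (\<integral>\<^sup>+j. (\<Sum>i. chart_volume d (cs i) (B j \<inter> cell cs i)) \<partial>count_space UNIV)"
      by (simp add: m_def nn_integral_count_space_nat)
    also have "\<dots> = (\<Sum>i. \<integral>\<^sup>+j. chart_volume d (cs i) (B j \<inter> cell cs i) \<partial>count_space UNIV)"
      by (rule nn_integral_suminf) simp
    also have "\<dots> = (\<Sum>i. \<Sum>j. chart_volume d (cs i) (B j \<inter> cell cs i))"
      by (simp add: nn_integral_count_space_nat)
    also have "\<dots> = (\<Sum>i. chart_volume d (cs i) (\<Union>j. B j \<inter> cell cs i))"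
    proof (intro suminf_cong chart_volume_suminf[symmetric] d A)
      fix i j show "B j \<inter> cell cs i \<in> sets borel" "B j \<inter> cell cs i \<subseteq> fst (cs i)" using B' cell(1,2) by auto
      show "disjoint_family (\<lambda>j. B j \<inter> cell cs i)" using B(2) by (auto simp: disjoint_family_on_def)
    qed
    also have "\<dots> = m (\<Union>j. B j)" by (simp add: m_def)
    finally show "(\<Sum>j. m (B j)) = m (\<Union>j. B j)" .
  qed
  have em: "emeasure \<mu> B = m B" if "B \<in> S" for B
    unfolding \<mu>_def by (rule emeasure_measure_of_sigma[OF S pos ca that])
  have "density_measure d \<mu>"
    unfolding density_measure_def
  proof (intro conjI ballI impI)
    show "sets \<mu> = sets (restrict_space borel (carrier A))"
      unfolding \<mu>_def using sigma_algebra.sets_measure_of_eq[OF S] by (simp add: S_def)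
    fix c B assume c: "c \<in> A" and B: "B \<in> sets borel" "B \<subseteq> fst c"
    have sub: "B \<subseteq> carrier A" using B(2) c by (auto simp: carrier_def)
    then have "B \<in> S" using B unfolding S_def sets_carrier_iff by simp
    then have "emeasure \<mu> B = m B" by (rule em)
    also have "m B = (\<Sum>i. chart_volume d c (B \<inter> cell cs i))"
      unfolding m_def
    proof (intro suminf_cong chart_volume_indep d A c)
      fix i show "B \<inter> cell cs i \<in> sets borel" "B \<inter> cell cs i \<subseteq> fst (cs i)" "B \<inter> cell cs i \<subseteq> fst c"
        using B cell(1,2) by auto
    qed
    also have "\<dots> = chart_volume d c (\<Union>i. B \<inter> cell cs i)"
    proof (intro chart_volume_suminf[symmetric] d c)
      fix i show "B \<inter> cell cs i \<in> sets borel" "B \<inter> cell cs i \<subseteq> fst c"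
        using B cell(1) by auto
      show "disjoint_family (\<lambda>i. B \<inter> cell cs i)" using cell(3) by (auto simp: disjoint_family_on_def)
    qed
    also have "(\<Union>i. B \<inter> cell cs i) = B" using sub cell(4) by (metis Int_UN_distrib inf.absorb1)
    finally show "emeasure \<mu> B = chart_volume d c B" .
  qed
  then show thesis by (rule that)
qed

lemma is_density_volume_density:
  fixes f :: "'a \<Rightarrow> 'e::euclidean_space"
  assumes "smooth_map A f" "bilinear b"
  shows "is_density (\<lambda>c. volume_density (\<lambda>_. b) c f)"
  unfolding is_density_def
proof (intro conjI ballI)
  fix c c' x assume "c \<in> A" "c' \<in> A" "x \<in> fst c \<inter> fst c'"
  then show "volume_density (\<lambda>_. b) c f x = \<bar>det (matrix (trans c c' x))\<bar> * volume_density (\<lambda>_. b) c' f x"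
    by (intro volume_density_change[OF assms]) auto
qed (use continuous_volume_density[OF assms] in auto)

lemma volume_measure_eq: "volume_measure A h f = (THE \<mu>. density_measure (\<lambda>c. volume_density h c f) \<mu>)"
  unfolding volume_measure_def density_measure_def chart_volume_def by (rule refl)

lemma volume_measure_eqI:
  fixes f :: "'a \<Rightarrow> 'e::euclidean_space"
  assumes "density_measure (\<lambda>c. volume_density h c f) \<mu>"
  shows "volume_measure A h f = \<mu>"
  unfolding volume_measure_eq by (rule the_equality) (use assms density_measure_unique in blast)+

lemma density_measure_volume:
  fixes f :: "'a \<Rightarrow> 'e::euclidean_space"
  assumes "smooth_map A f" "bilinear b"
  shows "density_measure (\<lambda>c. volume_density (\<lambda>_. b) c f) (volume_measure A (\<lambda>_. b) f)"
  using volume_measure_eqI ex_density_measure[OF is_density_volume_density[OF assms]] by metis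

lemma density_measure_cong:
  assumes "\<And>c x. c \<in> A \<Longrightarrow> x \<in> fst c \<Longrightarrow> d c x = d' c x"
  shows "density_measure d \<mu> = density_measure d' \<mu>"
proof -
  have "chart_volume d c B = chart_volume d' c B" if "c \<in> A" "B \<subseteq> fst c" for c B
    unfolding chart_volume_def
  proof (rule nn_integral_cong)
    fix u
    have "d c (chart_inv c u) = d' c (chart_inv c u)" if "u \<in> snd c ` B"
      by (rule assms[OF \<open>c \<in> A\<close>]) (use that \<open>c \<in> A\<close> \<open>B \<subseteq> fst c\<close> in auto)
    then show "ennreal (d c (chart_inv c u)) * indicator (snd c ` B) u =
        ennreal (d' c (chart_inv c u)) * indicator (snd c ` B) u"
      by (simp add: indicator_def)
  qed
  then show ?thesis unfolding density_measure_def by (metis (no_types, lifting))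
qed

lemma volume_measure_cong:
  assumes "\<And>c x. c \<in> A \<Longrightarrow> x \<in> fst c \<Longrightarrow> volume_density h c f x = volume_density h' c f' x"
  shows "volume_measure A h f = volume_measure A h' f'"
  unfolding volume_measure_eq
  by (intro arg_cong[where f = The] ext density_measure_cong assms)

lemma chart_volume_le:
  assumes d: "is_density d1" "is_density d2" "is_density d3" and c: "c \<in> A" and B: "B \<in> sets borel" "B \<subseteq> fst c"
    and s: "s \<ge> 0" and le: "\<And>x. x \<in> B \<Longrightarrow> d1 c x \<le> d2 c x + s * d3 c x"
  shows "chart_volume d1 c B \<le> chart_volume d2 c B + ennreal s * chart_volume d3 c B"
proof -
  have nn: "d' c x \<ge> 0" if "is_density d'" "x \<in> B" for d' x
    using that is_density_nonneg[OF _ c] B by blast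
  have "chart_volume d1 c B \<le> (\<integral>\<^sup>+u. ennreal (indicator (snd c ` B) u * d2 c (chart_inv c u))
      + ennreal s * ennreal (indicator (snd c ` B) u * d3 c (chart_inv c u)) \<partial>lborel)"
    unfolding chart_volume_eq
  proof (rule nn_integral_mono)
    fix u
    show "ennreal (indicator (snd c ` B) u * d1 c (chart_inv c u)) \<le>
      ennreal (indicator (snd c ` B) u * d2 c (chart_inv c u)) + ennreal s * ennreal (indicator (snd c ` B) u * d3 c (chart_inv c u))"
    proof (cases "u \<in> snd c ` B")
      case True
      then have x: "chart_inv c u \<in> B" using c B by (auto simp: subset_iff)
      then have "ennreal (d1 c (chart_inv c u)) \<le> ennreal (d2 c (chart_inv c u) + s * d3 c (chart_inv c u))"
        by (intro ennreal_leI le)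
      also have "\<dots> = ennreal (d2 c (chart_inv c u)) + ennreal s * ennreal (d3 c (chart_inv c u))"
        using s nn[OF d(2) x] nn[OF d(3) x] by (simp add: ennreal_mult)
      finally show ?thesis using True by simp
    qed simp
  qed
  also have "\<dots> = chart_volume d2 c B + ennreal s * chart_volume d3 c B"
    unfolding chart_volume_eq
    using density_measurable[OF d(2) c B] density_measurable[OF d(3) c B]
    by (subst nn_integral_add) (auto simp: nn_integral_cmult)
  finally show ?thesis .
qed

text \<open>All three densities scale by the same factor under a change of chart, so the inequality
  is asked for in one chart at each point. The shape of the bound is dictated by the comparison of
  two families at time \<open>t\<close>, where \<open>s\<close> is a small multiple of the absolute
  value of \<open>t\<close>.\<close>

lemma density_measure_le:
  assumes d: "is_density d1" "is_density d2" "is_density d3"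
    and m: "density_measure d1 \<mu>1" "density_measure d2 \<mu>2" "density_measure d3 \<mu>3"
    and B: "B \<in> sets borel" "B \<subseteq> carrier A" and s: "s \<ge> 0"
    and le: "\<And>x. x \<in> B \<Longrightarrow> \<exists>c\<in>A. x \<in> fst c \<and> d1 c x \<le> d2 c x + s * d3 c x"
  shows "emeasure \<mu>1 B \<le> emeasure \<mu>2 B + ennreal s * emeasure \<mu>3 B"
proof (cases "A = {}")
  case True
  then have "B = {}" using B by (simp add: carrier_def)
  then show ?thesis by simp
next
  case False
  then obtain cs where cs: "cover cs" by (rule ex_cover)
  note cell = cell_props[OF cs]
  have A: "cs i \<in> A" for i using cs by (simp add: cover_def)
  have all: "d1 c x \<le> d2 c x + s * d3 c x" if x: "x \<in> B" "c \<in> A" "x \<in> fst c" for c x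
  proof -
    obtain c' where c': "c' \<in> A" "x \<in> fst c'" "d1 c' x \<le> d2 c' x + s * d3 c' x" using le[OF x(1)] by blast
    define k where "k = \<bar>det (matrix (trans c c' x))\<bar>"
    have k: "k \<ge> 0" by (simp add: k_def)
    have e: "d' c x = k * d' c' x" if "is_density d'" for d'
      unfolding k_def by (rule is_density_change[OF that x(2) c'(1) x(3) c'(2)])
    then show ?thesis
      unfolding e[OF d(1)] e[OF d(2)] e[OF d(3)] using mult_left_mono[OF c'(3) k] by (simp add: algebra_simps)
  qed
  have "emeasure \<mu>1 B = (\<Sum>i. chart_volume d1 (cs i) (B \<inter> cell cs i))"
    by (rule density_measure_cells[OF m(1) cs B])
  also have "\<dots> \<le> (\<Sum>i. chart_volume d2 (cs i) (B \<inter> cell cs i) + ennreal s * chart_volume d3 (cs i) (B \<inter> cell cs i))"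
  proof (intro suminf_le summableI chart_volume_le d A s)
    fix i show "B \<inter> cell cs i \<in> sets borel" "B \<inter> cell cs i \<subseteq> fst (cs i)" using B cell(1,2) by auto
    fix x assume "x \<in> B \<inter> cell cs i"
    then show "d1 (cs i) x \<le> d2 (cs i) x + s * d3 (cs i) x" using cell(2) by (intro all A) auto
  qed
  also have "\<dots> = emeasure \<mu>2 B + ennreal s * emeasure \<mu>3 B"
    unfolding density_measure_cells[OF m(2) cs B] density_measure_cells[OF m(3) cs B]
    by (subst suminf_add[symmetric]) (auto intro: summableI)
  finally show ?thesis .
qed

text \<open>Every point has a neighborhood inside a closed coordinate ball, where the density is
  bounded by compactness; finitely many such balls cover \<open>K\<close>.\<close>

lemma density_measure_finite:
  assumes d: "is_density d" and m: "density_measure d \<mu>" and K: "compact K" "K \<subseteq> carrier A"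
  shows "emeasure \<mu> K < \<infinity>"
proof -
  have "\<exists>V C. open V \<and> x \<in> V \<and> V \<subseteq> C \<and> C \<in> sets \<mu> \<and> emeasure \<mu> C < \<infinity>" if x: "x \<in> K" for x
  proof -
    obtain c where c: "c \<in> A" "x \<in> fst c" using K x carrierE by blast
    obtain r where r: "r > 0" "cball (snd c x) r \<subseteq> chart_range c"
      using open_range[OF c(1)] snd_in[OF c(2)] open_contains_cball by metis
    define C where "C = chart_inv c ` cball (snd c x) r"
    define V where "V = {y \<in> fst c. snd c y \<in> ball (snd c x) r}"
    have imC: "snd c ` C = cball (snd c x) r"
      using r c by (force simp: C_def image_image subset_iff)
    have "compact C" unfolding C_def
      by (intro compact_continuous_image continuous_on_subset[OF cont_inv[OF c(1)]] r) simp
    then have bC: "C \<in> sets borel" by (rule borel_compact)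
    have sub: "C \<subseteq> fst c" using r c by (auto simp: C_def subset_iff)
    have oV: "open V"
    proof -
      have "V = fst c \<inter> snd c -` ball (snd c x) r" by (auto simp: V_def)
      then show ?thesis using continuous_open_preimage[OF cont_snd[OF c(1)] open_fst[OF c(1)]] by simp
    qed
    have xV: "x \<in> V" using c r by (simp add: V_def)
    have VC: "V \<subseteq> C"
    proof
      fix y assume "y \<in> V"
      then have "y = chart_inv c (snd c y)" "snd c y \<in> cball (snd c x) r" using c by (auto simp: V_def)
      then show "y \<in> C" unfolding C_def by (rule image_eqI)
    qed
    have "C \<subseteq> carrier A" using sub carrierI[OF c(1)] by blast
    then have CS: "C \<in> sets \<mu>" using m bC sets_carrier_iff[of C] by (simp add: density_measure_def)
    have ct: "continuous_on (cball (snd c x) r) (\<lambda>u. d c (chart_inv c u))"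
      by (rule continuous_on_subset[OF is_density_cont[OF d c(1)] r(2)])
    have "compact ((\<lambda>u. d c (chart_inv c u)) ` cball (snd c x) r)"
      by (rule compact_continuous_image[OF ct compact_cball])
    then obtain M where M: "\<And>u. u \<in> cball (snd c x) r \<Longrightarrow> d c (chart_inv c u) \<le> M"
      using compact_imp_bounded bounded_iff by (metis abs_le_D1 image_eqI real_norm_def)
    have "emeasure \<mu> C = chart_volume d c C"
      using m c bC sub by (simp add: density_measure_def)
    also have "\<dots> \<le> (\<integral>\<^sup>+u\<in>cball (snd c x) r. ennreal M \<partial>lborel)"
      unfolding chart_volume_def imC
    proof (rule nn_integral_mono)
      fix u show "ennreal (d c (chart_inv c u)) * indicator (cball (snd c x) r) u \<le> ennreal M * indicator (cball (snd c x) r) u"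
        using M[of u] by (cases "u \<in> cball (snd c x) r") (auto intro: ennreal_leI)
    qed
    also have "\<dots> = ennreal M * emeasure lborel (cball (snd c x) r)"
      by (subst nn_integral_cmult_indicator) auto
    also have "\<dots> < \<infinity>"
      using emeasure_lborel_cball_finite[of "snd c x" r] by (simp add: ennreal_mult_less_top)
    finally show ?thesis using oV xV VC CS by blast
  qed
  then obtain V C where VC: "\<And>x. x \<in> K \<Longrightarrow> open (V x) \<and> x \<in> V x \<and> V x \<subseteq> C x \<and> C x \<in> sets \<mu> \<and> emeasure \<mu> (C x) < \<infinity>"
    by metis
  obtain D where D: "D \<subseteq> K" "finite D" "K \<subseteq> (\<Union>x\<in>D. V x)"
    using compactE_image[OF K(1), of K V] VC by (metis (no_types, lifting) UN_iff subsetI)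
  have "emeasure \<mu> K \<le> emeasure \<mu> (\<Union>x\<in>D. C x)"
  proof (rule emeasure_mono)
    show "K \<subseteq> (\<Union>x\<in>D. C x)" using D VC by blast
    show "(\<Union>x\<in>D. C x) \<in> sets \<mu>" using D VC by (intro sets.finite_UN) auto
  qed
  also have "\<dots> \<le> (\<Sum>x\<in>D. emeasure \<mu> (C x))"
    using D VC by (intro emeasure_subadditive_finite) auto
  also have "\<dots> < \<infinity>" using D VC by (auto simp: subset_iff)
  finally show ?thesis .
qed

text \<open>On \<open>B\<close> the measure is the image of a weighted Lebesgue measure under the
  inverse chart. Equality of the two measures on sets gives equality of all integrals.\<close>

lemma nn_integral_chart:
  assumes d: "is_density d" and m: "density_measure d \<mu>" and c: "c \<in> A" and B: "B \<in> sets borel" "B \<subseteq> fst c"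
    and w: "w \<in> borel_measurable \<mu>"
  shows "(\<integral>\<^sup>+x\<in>B. w x \<partial>\<mu>) = (\<integral>\<^sup>+u\<in>snd c ` B. w (chart_inv c u) * ennreal (d c (chart_inv c u)) \<partial>lborel)"
proof (cases "B = {}")
  case False
  then obtain x0 where x0: "x0 \<in> B" by blast
  \<comment> \<open>The inverse chart, extended by a constant value in the carrier, is measurable on
    the whole coordinate space.\<close>
  define k where "k u = (if u \<in> chart_range c then chart_inv c u else x0)" for u
  define \<nu> where "\<nu> = density lborel (\<lambda>u. ennreal (indicator (snd c ` B) u * d c (chart_inv c u)))"
  note meas = density_measurable[OF d c B]
  have sets: "sets \<mu> = sets (restrict_space borel (carrier A))" using m by (simp add: density_measure_def)
  have Bs: "B \<in> sets \<mu>" using B c unfolding sets sets_carrier_iff by (auto simp: carrier_def)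
  have "(\<lambda>u. if u \<in> chart_range c then chart_inv c u else x0) \<in> borel_measurable borel"
  proof (subst measurable_If_restrict_space_iff)
    show "{u \<in> space borel. u \<in> chart_range c} \<in> sets borel" using open_range[OF c] by simp
    show "chart_inv c \<in> borel_measurable (restrict_space borel {u. u \<in> chart_range c}) \<and>
       (\<lambda>u. x0) \<in> borel_measurable (restrict_space borel {u. u \<notin> chart_range c})"
      using borel_measurable_continuous_on_restrict[OF cont_inv[OF c]] by simp
  qed
  then have "k \<in> borel_measurable borel" by (simp add: k_def[abs_def])
  moreover have "k u \<in> carrier A" for u
    using x0 B c by (auto simp: k_def carrier_def intro: inv_in)
  ultimately have "k \<in> measurable borel (restrict_space borel (carrier A))"
    by (intro measurable_restrict_space2) auto
  then have k: "k \<in> measurable \<nu> \<mu>"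
    using measurable_cong_sets[of \<nu> borel \<mu> "restrict_space borel (carrier A)"] sets by (simp add: \<nu>_def)
  have "density \<mu> (indicator B) = distr \<nu> \<mu> k"
  proof (rule measure_eqI)
    fix X assume "X \<in> sets (density \<mu> (indicator B))"
    then have X: "X \<in> sets \<mu>" by simp
    then have X': "X \<in> sets borel" unfolding sets sets_carrier_iff by simp
    have kX: "k -` X \<in> sets borel" using measurable_sets[OF k X] by (simp add: \<nu>_def)
    have "emeasure (density \<mu> (indicator B)) X = (\<integral>\<^sup>+x. indicator B x * indicator X x \<partial>\<mu>)"
      by (rule emeasure_density) (use Bs X in auto)
    also have "\<dots> = (\<integral>\<^sup>+x. indicator (B \<inter> X) x \<partial>\<mu>)" by (simp only: indicator_inter_arith)
    also have "\<dots> = emeasure \<mu> (B \<inter> X)"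
      by (rule nn_integral_indicator) (use X Bs in auto)
    also have "\<dots> = chart_volume d c (B \<inter> X)"
    proof -
      have "B \<inter> X \<in> sets borel" "B \<inter> X \<subseteq> fst c" using B X' by auto
      then show ?thesis using m c by (simp add: density_measure_def)
    qed
    also have "\<dots> = (\<integral>\<^sup>+u. ennreal (indicator (snd c ` B) u * d c (chart_inv c u)) * indicator (k -` X) u \<partial>lborel)"
      unfolding chart_volume_eq
    proof (rule nn_integral_cong)
      fix u
      have "u \<in> snd c ` (B \<inter> X) \<longleftrightarrow> u \<in> snd c ` B \<and> k u \<in> X"
        using image_eq[OF c, of B] image_eq[OF c, of "B \<inter> X"] B by (auto simp: k_def)
      then show "ennreal (indicator (snd c ` (B \<inter> X)) u * d c (chart_inv c u)) =
          ennreal (indicator (snd c ` B) u * d c (chart_inv c u)) * indicator (k -` X) u"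
        by (simp add: indicator_def)
    qed
    also have "\<dots> = emeasure \<nu> (k -` X)"
      unfolding \<nu>_def using meas kX by (subst emeasure_density) auto
    also have "\<dots> = emeasure (distr \<nu> \<mu> k) X"
      using emeasure_distr[OF k X] by (simp add: \<nu>_def)
    finally show "emeasure (density \<mu> (indicator B)) X = emeasure (distr \<nu> \<mu> k) X" .
  qed simp
  then have "(\<integral>\<^sup>+x. w x \<partial>density \<mu> (indicator B)) = (\<integral>\<^sup>+x. w x \<partial>distr \<nu> \<mu> k)" by simp
  moreover have "(\<integral>\<^sup>+x. w x \<partial>density \<mu> (indicator B)) = (\<integral>\<^sup>+x\<in>B. w x \<partial>\<mu>)"
    using Bs w by (subst nn_integral_density) (auto simp: mult.commute)
  moreover have "(\<integral>\<^sup>+x. w x \<partial>distr \<nu> \<mu> k) = (\<integral>\<^sup>+u. w (k u) \<partial>\<nu>)"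
    by (rule nn_integral_distr[OF k]) (use w in simp)
  moreover have "(\<lambda>u. w (k u)) \<in> borel_measurable lborel"
    using measurable_compose[OF k w] by (simp add: \<nu>_def)
  then have "(\<integral>\<^sup>+u. w (k u) \<partial>\<nu>) = (\<integral>\<^sup>+u. ennreal (indicator (snd c ` B) u * d c (chart_inv c u)) * w (k u) \<partial>lborel)"
    unfolding \<nu>_def using meas by (subst nn_integral_density) auto
  moreover have "\<dots> = (\<integral>\<^sup>+u\<in>snd c ` B. w (chart_inv c u) * ennreal (d c (chart_inv c u)) \<partial>lborel)"
  proof (rule nn_integral_cong)
    fix u
    have "k u = chart_inv c u" if "u \<in> snd c ` B" using that B by (auto simp: k_def chart_range_def)
    then show "ennreal (indicator (snd c ` B) u * d c (chart_inv c u)) * w (k u) =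
        w (chart_inv c u) * ennreal (d c (chart_inv c u)) * indicator (snd c ` B) u"
      by (cases "u \<in> snd c ` B") (auto simp: mult.commute)
  qed
  ultimately show ?thesis by simp
qed simp

lemma density_measure_density:
  assumes d: "is_density d" and m: "density_measure d \<mu>"
    and w: "w \<in> borel_measurable \<mu>" "\<And>x. x \<in> carrier A \<Longrightarrow> w x \<ge> 0"
    and eq: "\<And>c x. c \<in> A \<Longrightarrow> x \<in> fst c \<Longrightarrow> d' c x = w x * d c x"
  shows "density_measure d' (density \<mu> (\<lambda>x. ennreal (w x)))"
  unfolding density_measure_def
proof (intro conjI ballI impI)
  show "sets (density \<mu> (\<lambda>x. ennreal (w x))) = sets (restrict_space borel (carrier A))"
    using m by (simp add: density_measure_def)
  fix c B assume c: "c \<in> A" and B: "B \<in> sets borel" "B \<subseteq> fst c"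
  have "B \<in> sets \<mu>" using m B c sets_carrier_iff[of B] by (auto simp: density_measure_def carrier_def)
  then have "emeasure (density \<mu> (\<lambda>x. ennreal (w x))) B = (\<integral>\<^sup>+x\<in>B. ennreal (w x) \<partial>\<mu>)"
    using w by (intro emeasure_density) auto
  also have "\<dots> = (\<integral>\<^sup>+u\<in>snd c ` B. ennreal (w (chart_inv c u)) * ennreal (d c (chart_inv c u)) \<partial>lborel)"
    by (rule nn_integral_chart[OF d m c B]) (use w in simp)
  also have "\<dots> = chart_volume d' c B"
    unfolding chart_volume_def
  proof (rule nn_integral_cong)
    fix u
    show "ennreal (w (chart_inv c u)) * ennreal (d c (chart_inv c u)) * indicator (snd c ` B) u =
        ennreal (d' c (chart_inv c u)) * indicator (snd c ` B) u"
    proof (cases "u \<in> snd c ` B")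
      case True
      then have x: "chart_inv c u \<in> fst c" using c B by (auto simp: subset_iff)
      then have "d c (chart_inv c u) \<ge> 0" by (rule is_density_nonneg[OF d c])
      then show ?thesis using eq[OF c x] w(2)[OF carrierI[OF c x]] by (simp add: ennreal_mult)
    qed simp
  qed
  finally show "emeasure (density \<mu> (\<lambda>x. ennreal (w x))) B = chart_volume d' c B" .
qed

lemma measurable_on_carrier:
  assumes sets: "sets \<mu> = sets (restrict_space borel (carrier A))"
    and w: "\<And>c. c \<in> A \<Longrightarrow> continuous_on (fst c) w"
  shows "w \<in> borel_measurable \<mu>"
proof -
  have "continuous_on (carrier A) w"
    unfolding carrier_def by (rule continuous_on_open_UN) (use w open_fst in auto)
  then show ?thesis
    using borel_measurable_continuous_on_restrict measurable_cong_sets[OF sets refl] by blast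
qed

text \<open>The function \<open>w\<close> is the density of one volume measure with respect to the
  other. In this way an integral over the hypersurface becomes the volume of its Gauss map.\<close>

lemma set_integral_volume_measure:
  fixes f :: "'a \<Rightarrow> 'e::euclidean_space" and g :: "'a \<Rightarrow> 'f::euclidean_space"
  assumes "smooth_map A f" "bilinear b" "smooth_map A g" "bilinear b'"
    and cont: "\<And>c. c \<in> A \<Longrightarrow> continuous_on (fst c) w" and nn: "\<And>x. x \<in> carrier A \<Longrightarrow> w x \<ge> 0"
    and eq: "\<And>c x. c \<in> A \<Longrightarrow> x \<in> fst c \<Longrightarrow>
      volume_density (\<lambda>_. b') c g x = w x * volume_density (\<lambda>_. b) c f x"
    and K: "compact K" "K \<subseteq> carrier A"
  shows "(LINT x:K|volume_measure A (\<lambda>_. b) f. w x) = measure (volume_measure A (\<lambda>_. b') g) K"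
proof -
  let ?\<mu> = "volume_measure A (\<lambda>_. b) f"
  note m = density_measure_volume[OF assms(1,2)] and d = is_density_volume_density[OF assms(1,2)]
  have sets: "sets ?\<mu> = sets (restrict_space borel (carrier A))" using m by (simp add: density_measure_def)
  have w: "w \<in> borel_measurable ?\<mu>" by (rule measurable_on_carrier[OF sets cont])
  have K': "K \<in> sets ?\<mu>" unfolding sets sets_carrier_iff using K by (simp add: borel_compact)
  have g: "volume_measure A (\<lambda>_. b') g = density ?\<mu> (\<lambda>x. ennreal (w x))"
    by (rule volume_measure_eqI[OF density_measure_density[OF d m w nn eq]])
  have "(LINT x:K|?\<mu>. w x) = enn2real (\<integral>\<^sup>+x. ennreal (indicator K x *\<^sub>R w x) \<partial>?\<mu>)"
    unfolding set_lebesgue_integral_def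
  proof (rule integral_eq_nn_integral)
    show "(\<lambda>x. indicator K x *\<^sub>R w x) \<in> borel_measurable ?\<mu>" using w K' by simp
    show "AE x in ?\<mu>. 0 \<le> indicator K x *\<^sub>R w x" using nn K by (auto simp: indicator_def subset_iff)
  qed
  also have "(\<integral>\<^sup>+x. ennreal (indicator K x *\<^sub>R w x) \<partial>?\<mu>) = emeasure (density ?\<mu> (\<lambda>x. ennreal (w x))) K"
    using w K' by (subst emeasure_density) (auto intro!: nn_integral_cong simp: indicator_def)
  finally show ?thesis unfolding g by (simp add: measure_def)
qed

end

section \<open>The space of geodesics\<close>

lemma ip_add_left [simp]: "ip p (x + y) z = ip p x z + ip p y z"
  and ip_add_right [simp]: "ip p z (x + y) = ip p z x + ip p z y"
  and ip_scaleR_left [simp]: "ip p (c *\<^sub>R x) z = c * ip p x z"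
  and ip_scaleR_right [simp]: "ip p z (c *\<^sub>R x) = c * ip p z x"
  by (simp_all add: ip_def algebra_simps sum.distrib sum_distrib_left)

lemma ip_minus_left [simp]: "ip p (- x) z = - ip p x z"
  and ip_minus_right [simp]: "ip p z (- x) = - ip p z x"
  and ip_zero_left [simp]: "ip p 0 z = 0" and ip_zero_right [simp]: "ip p z 0 = 0"
  by (simp_all add: ip_def sum_negf)

lemma ip_diff_left [simp]: "ip p (x - y) z = ip p x z - ip p y z"
  and ip_diff_right [simp]: "ip p z (x - y) = ip p z x - ip p z y"
  using ip_add_left[of p x "- y" z] ip_add_right[of p z x "- y"] by simp_all

lemma ip_commute: "ip p x y = ip p y x"
  by (simp add: ip_def mult_ac)

lemma bilinear_ip: "bilinear (ip p)"
  by (auto simp: bilinear_def intro!: linearI)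

lemma ip_sum_left: "ip p (\<Sum>i\<in>I. f i) z = (\<Sum>i\<in>I. ip p (f i) z)"
  using bilinear_ip[of p] by (auto simp: bilinear_def intro: linear_sum[of "\<lambda>x. ip p x z"])

lemma ip_axis: "ip p v (axis i 1) = sgn_coord p i * v $ i"
proof -
  have "ip p v (axis i 1) = (\<Sum>j\<in>UNIV. if j = i then sgn_coord p i * v $ i else 0)"
    unfolding ip_def by (intro sum.cong) (auto simp: axis_def)
  then show ?thesis by simp
qed

lemma sgn_coord_square [simp]: "sgn_coord p i * sgn_coord p i = 1"
  by (simp add: sgn_coord_def)

lemma ip_nondegenerate: "(\<And>w. ip p v w = 0) \<Longrightarrow> v = 0"
  using ip_axis[of p v] by (force simp: vec_eq_iff sgn_coord_def split: if_splits)

lemma wedge_simps: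
  "wedge (x + x') y = wedge x y + wedge x' y" "wedge x (y + y') = wedge x y + wedge x y'"
  "wedge (c *\<^sub>R x) y = c *\<^sub>R wedge x y" "wedge x (c *\<^sub>R y) = c *\<^sub>R wedge x y"
  "wedge (- x) y = - wedge x y" "wedge x (- y) = - wedge x y"
  "wedge (x - x') y = wedge x y - wedge x' y" "wedge x (y - y') = wedge x y - wedge x y'"
  "wedge 0 y = 0" "wedge x 0 = 0" "wedge x x = 0"
  by (simp_all add: wedge_def vec_eq_iff algebra_simps)

lemma wedge_commute: "wedge x y = - wedge y x"
  by (simp add: wedge_def vec_eq_iff)

lemma bilinear_wedge: "bilinear wedge"
  by (auto simp: bilinear_def wedge_simps intro!: linearI)

lemma bilinear_biv_ip: "bilinear (biv_ip p)"
  by (auto simp: bilinear_def biv_ip_def algebra_simps sum.distrib sum_distrib_left add_divide_distrib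
      sum_divide_distrib intro!: linearI)

text \<open>The endomorphism that \<open>ip\<close> associates with a bivector; it sends
  \<open>v\<close> to \<open>ip p y v *\<^sub>R x - ip p x v *\<^sub>R y\<close> when the bivector
  is \<open>wedge x y\<close>.\<close>

definition contract :: "nat \<Rightarrow> 'm bivec \<Rightarrow> 'm::{finite,linorder} rvec \<Rightarrow> 'm rvec" where
  "contract p V v = (\<chi> i. \<Sum>l\<in>UNIV. sgn_coord p l * V $ i $ l * v $ l)"

lemma bilinear_contract: "bilinear (contract p)"
  by (auto simp: bilinear_def contract_def vec_eq_iff algebra_simps sum.distrib sum_distrib_left intro!: linearI)

lemma contract_wedge: "contract p (wedge x y) v = ip p y v *\<^sub>R x - ip p x v *\<^sub>R y"
  by (simp add: contract_def wedge_def vec_eq_iff ip_def sum_distrib_left sum_distrib_right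
      sum_subtractf[symmetric] algebra_simps)

lemma contract_simps:
  "contract p (V + W) v = contract p V v + contract p W v"
  "contract p (c *\<^sub>R V) v = c *\<^sub>R contract p V v"
  "contract p (- V) v = - contract p V v"
  "contract p (V - W) v = contract p V v - contract p W v"
  by (simp_all add: contract_def vec_eq_iff algebra_simps sum.distrib sum_distrib_left sum_subtractf sum_negf)

lemma geodesicD:
  assumes "geodesic p \<epsilon> P x y"
  shows "ip p x x = 1" "ip p x y = 0" "ip p y x = 0" "ip p y y = \<epsilon>" "P = wedge x y"
  using assms ip_commute[of p y x] by (auto simp: geodesic_def pseudo_sphere_def)

lemma perpD: "X \<in> perp p x y \<Longrightarrow> ip p X x = 0" "X \<in> perp p x y \<Longrightarrow> ip p X y = 0"
  "X \<in> perp p x y \<Longrightarrow> ip p x X = 0" "X \<in> perp p x y \<Longrightarrow> ip p y X = 0"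
  by (auto simp: perp_def ip_commute[of p _ X])

lemma perp_simps:
  "X \<in> perp p x y \<Longrightarrow> Y \<in> perp p x y \<Longrightarrow> X + Y \<in> perp p x y"
  "X \<in> perp p x y \<Longrightarrow> Y \<in> perp p x y \<Longrightarrow> X - Y \<in> perp p x y"
  "X \<in> perp p x y \<Longrightarrow> c *\<^sub>R X \<in> perp p x y" "X \<in> perp p x y \<Longrightarrow> - X \<in> perp p x y"
  by (auto simp: perp_def)

text \<open>Contraction recovers the two components of a tangent vector without a choice. This gives
  uniqueness of the decomposition and, since \<open>contract\<close> is bilinear, smooth dependence
  of the components along a family.\<close>

lemma contract_tangent:
  assumes g: "geodesic p \<epsilon> P x y" and "X \<in> perp p x y" "Y \<in> perp p x y"
  shows "contract p (wedge x X + wedge y Y) x = - X" "contract p (wedge x X + wedge y Y) y = - \<epsilon> *\<^sub>R Y"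
  by (simp_all add: contract_simps contract_wedge geodesicD[OF g] perpD[OF assms(2)] perpD[OF assms(3)])

lemma eps_square: "\<epsilon> \<in> {-1, 1 :: real} \<Longrightarrow> \<epsilon> * \<epsilon> = 1"
  by auto

lemma tangent_unique:
  assumes g: "geodesic p \<epsilon> P x y" and eps: "\<epsilon> \<in> {-1, 1}"
    and "X \<in> perp p x y" "Y \<in> perp p x y" "X' \<in> perp p x y" "Y' \<in> perp p x y"
    and eq: "wedge x X + wedge y Y = wedge x X' + wedge y Y'"
  shows "X = X'" "Y = Y'"
proof -
  show "X = X'"
    using contract_tangent(1)[OF g assms(3,4)] contract_tangent(1)[OF g assms(5,6)] eq by simp
  have "- \<epsilon> *\<^sub>R Y = - \<epsilon> *\<^sub>R Y'"
    using contract_tangent(2)[OF g assms(3,4)] contract_tangent(2)[OF g assms(5,6)] eq by metis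
  then show "Y = Y'" using eps by auto
qed

text \<open>This description mentions \<open>P\<close> alone, so the orthogonal space is the same
  for all pairs of vectors that represent one geodesic.\<close>

lemma perp_eq_kernel:
  assumes g: "geodesic p \<epsilon> P x y" and eps: "\<epsilon> \<in> {-1, 1}"
  shows "perp p x y = {z. contract p P z = 0}"
proof (intro equalityI subsetI CollectI)
  fix z assume "z \<in> perp p x y"
  then show "contract p P z = 0" by (simp add: geodesicD(5)[OF g] contract_wedge perpD)
next
  fix z assume "z \<in> {z. contract p P z = 0}"
  then have "ip p y z *\<^sub>R x - ip p x z *\<^sub>R y = 0" (is "?v = 0")
    by (simp add: geodesicD(5)[OF g] contract_wedge)
  then have "ip p ?v x = 0" "ip p ?v y = 0" by simp_all
  then show "z \<in> perp p x y"
    using eps by (auto simp: geodesicD[OF g] perp_def ip_commute[of p z])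
qed

text \<open>A decomposable bivector satisfies the quadratic identity
  \<open>P(v) \<and> P(w) = \<langle>\<langle>P, v \<and> w\<rangle>\<rangle> P\<close>; differentiating it along a curve in \<open>L_geo\<close> gives the form of
  the tangent vectors.\<close>

lemma tangent_L_geo:
  fixes F :: "'b::real_normed_vector \<Rightarrow> 'm::{finite,linorder} bivec"
  assumes F: "(F has_derivative F') (at a)" and S: "open S" "a \<in> S"
    and L: "\<And>u. u \<in> S \<Longrightarrow> F u \<in> L_geo p \<epsilon>"
    and g: "geodesic p \<epsilon> (F a) x y" and eps: "\<epsilon> \<in> {-1, 1}"
  obtains X Y where "X \<in> perp p x y" "Y \<in> perp p x y" "F' h = wedge x X + wedge y Y"
proof -
  note bb = bilinear_wedge bilinear_biv_ip bilinear_contract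
  have "bounded_bilinear (wedge :: 'm rvec \<Rightarrow> _)" "bounded_bilinear (biv_ip p :: 'm bivec \<Rightarrow> _)"
    using bilinear_wedge bilinear_biv_ip by (auto simp: bilinear_conv_bounded_bilinear[symmetric])
  note wd = bounded_bilinear.FDERIV[OF this(1)] and bd = bounded_bilinear.FDERIV[OF this(2)]
  have cl: "bounded_linear (\<lambda>V. contract p V v)" for v :: "'m rvec"
    using bilinear_contract by (auto simp: bilinear_def linear_conv_bounded_linear)
  have bl: "bounded_linear (\<lambda>V. biv_ip p V W)" for W :: "'m bivec"
    using bilinear_biv_ip by (auto simp: bilinear_def linear_conv_bounded_linear)
  define P where "P = wedge x y"
  have Fa: "F a = P" using geodesicD(5)[OF g] by (simp add: P_def)
  have quad: "wedge (contract p (F u) x) (contract p (F u) y) = biv_ip p (F u) P *\<^sub>R F u"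
    and norm: "biv_ip p (F u) (F u) = \<epsilon>" if u: "u \<in> S" for u
  proof -
    obtain v w where vw: "geodesic p \<epsilon> (F u) v w" using L[OF u] by (auto simp: L_geo_def)
    show "biv_ip p (F u) (F u) = \<epsilon>"
      by (simp add: geodesicD(5)[OF vw] biv_ip_wedge geodesicD(1-4)[OF vw])
    show "wedge (contract p (F u) x) (contract p (F u) y) = biv_ip p (F u) P *\<^sub>R F u"
      unfolding P_def geodesicD(5)[OF vw] biv_ip_wedge contract_wedge
      by (simp add: wedge_def vec_eq_iff algebra_simps ip_commute[of p x w])
  qed
  define V where "V = F' h"
  have c: "((\<lambda>u. contract p (F u) v) has_derivative (\<lambda>h. contract p (F' h) v)) (at a)" for v
    by (rule bounded_linear.has_derivative[OF cl F])
  have d1: "((\<lambda>u. wedge (contract p (F u) x) (contract p (F u) y)) has_derivative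
      (\<lambda>h. wedge (contract p P x) (contract p (F' h) y) + wedge (contract p (F' h) x) (contract p P y))) (at a)"
    using wd[OF c c, of x y] by (simp add: Fa)
  have d2: "((\<lambda>u. biv_ip p (F u) P *\<^sub>R F u) has_derivative
      (\<lambda>h. biv_ip p P P *\<^sub>R F' h + biv_ip p (F' h) P *\<^sub>R P)) (at a)"
    using bounded_bilinear.FDERIV[OF bounded_bilinear_scaleR bounded_linear.has_derivative[OF bl F] F] by (simp add: Fa)
  have "((\<lambda>u. biv_ip p (F u) P *\<^sub>R F u) has_derivative
      (\<lambda>h. wedge (contract p P x) (contract p (F' h) y) + wedge (contract p (F' h) x) (contract p P y))) (at a)"
    by (rule has_derivative_transform_within_open[OF d1 S]) (rule quad)
  from fun_cong[OF has_derivative_unique[OF this d2], of h]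
  have e1: "wedge (contract p P x) (contract p V y) + wedge (contract p V x) (contract p P y)
      = biv_ip p P P *\<^sub>R V + biv_ip p V P *\<^sub>R P" by (simp add: V_def)
  \<comment> \<open>The square of a point of \<open>L_geo\<close> is constantly \<epsilon>, so the
    tangent vector \<open>V\<close> is orthogonal to \<open>P\<close> and the last term of
    \<open>e1\<close> drops out.\<close>
  have d3: "((\<lambda>u. biv_ip p (F u) (F u)) has_derivative (\<lambda>h. biv_ip p P (F' h) + biv_ip p (F' h) P)) (at a)"
    using bd[OF F F] by (simp add: Fa)
  have "((\<lambda>u. \<epsilon>) has_derivative (\<lambda>h. biv_ip p P (F' h) + biv_ip p (F' h) P)) (at a)"
    by (rule has_derivative_transform_within_open[OF d3 S]) (rule norm)
  from fun_cong[OF has_derivative_unique[OF this has_derivative_const], of h]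
  have "biv_ip p P V + biv_ip p V P = 0" by (simp add: V_def)
  moreover have "biv_ip p P V = biv_ip p V P" by (simp add: biv_ip_def mult_ac)
  ultimately have z: "biv_ip p V P = 0" by simp
  have PP: "biv_ip p P P = \<epsilon>" using norm[OF S(2)] by (simp add: Fa)
  \<comment> \<open>Since \<open>P\<close> sends \<open>x\<close> to \<open>- y\<close> and
    \<open>y\<close> to a multiple of \<open>x\<close>, equation \<open>e1\<close> expresses
    \<open>V\<close> through its contractions \<open>A\<close> and \<open>B\<close>. It remains to
    see that these are orthogonal to \<open>x\<close> and \<open>y\<close>.\<close>
  define A where "A = contract p V x"
  define B where "B = contract p V y"
  have "contract p P x = - y" "contract p P y = \<epsilon> *\<^sub>R x"
    by (simp_all add: P_def contract_wedge geodesicD(1-4)[OF g])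
  then have "\<epsilon> *\<^sub>R V = \<epsilon> *\<^sub>R wedge A x - wedge y B"
    using e1 unfolding PP z A_def[symmetric] B_def[symmetric] by (simp add: wedge_simps)
  then have "\<epsilon> *\<^sub>R (\<epsilon> *\<^sub>R V) = \<epsilon> *\<^sub>R (\<epsilon> *\<^sub>R wedge A x - wedge y B)" by simp
  then have V: "V = - wedge x A - \<epsilon> *\<^sub>R wedge y B"
    using eps_square[OF eps] wedge_commute[of A x] by (simp add: scaleR_diff_right)
  \<comment> \<open>Contracting the formula for \<open>V\<close> with \<open>x\<close> gives
    \<open>A\<close> back, plus a combination of \<open>x\<close> and \<open>y\<close> that must
    therefore vanish. The same is done with \<open>y\<close> below.\<close>
  have "ip p A x *\<^sub>R x + (\<epsilon> * ip p B x) *\<^sub>R y = 0" (is "?v = 0")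
    using arg_cong[OF V, of "\<lambda>V. contract p V x"]
    by (simp add: A_def[symmetric] contract_simps contract_wedge geodesicD(1-4)[OF g] neg_eq_iff_add_eq_0)
  then have "ip p ?v x = 0" "ip p ?v y = 0" by simp_all
  then have 1: "ip p A x = 0" "ip p B x = 0" using eps by (auto simp: geodesicD(1-4)[OF g])
  have "ip p A y *\<^sub>R x + (\<epsilon> * ip p B y) *\<^sub>R y = 0" (is "?w = 0")
    using arg_cong[OF V, of "\<lambda>V. contract p V y"] eps_square[OF eps]
    by (simp add: B_def[symmetric] contract_simps contract_wedge geodesicD(1-4)[OF g] algebra_simps)
  then have "ip p ?w x = 0" "ip p ?w y = 0" by simp_all
  then have 2: "ip p A y = 0" "ip p B y = 0" using eps by (auto simp: geodesicD(1-4)[OF g])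
  show thesis
  proof (rule that)
    show "- A \<in> perp p x y" "(- \<epsilon>) *\<^sub>R B \<in> perp p x y" using 1 2 by (auto simp: perp_def)
    show "F' h = wedge x (- A) + wedge y ((- \<epsilon>) *\<^sub>R B)"
      using V by (simp add: V_def wedge_simps)
  qed
qed

lemma Omega_tangent:
  assumes g: "geodesic p \<epsilon> P x y" and eps: "\<epsilon> \<in> {-1, 1}"
    and X: "X \<in> perp p x y" "Y \<in> perp p x y" "X' \<in> perp p x y" "Y' \<in> perp p x y"
  shows "Omega p \<epsilon> P (wedge x X + wedge y Y) (wedge x X' + wedge y Y') = ip p X Y' - ip p Y X'"
proof -
  have l: "biv_ip p (V - c *\<^sub>R W) U = biv_ip p V U - c * biv_ip p W U"
      "biv_ip p U (V + W) = biv_ip p U V + biv_ip p U W" for V W U :: "'a bivec" and c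
    using bilinear_lsub[OF bilinear_biv_ip, of p V "c *\<^sub>R W" U] bilinear_lmul[OF bilinear_biv_ip, of p c W U]
      bilinear_radd[OF bilinear_biv_ip, of p U V W] by simp_all
  show ?thesis
    unfolding Omega_def G_metric_def J_geo_wedge[OF g X(1,2)] l biv_ip_wedge
    using eps by (auto simp: geodesicD(1-4)[OF g] perpD[OF X(1)] perpD[OF X(2)] perpD[OF X(3)] perpD[OF X(4)])
qed

text \<open>Both metrics are, up to a sign that may depend on the geodesic, restrictions of a form \<open>b\<close>
  that is bilinear on all bivectors and does not depend on the geodesic. Hence \<open>h\<close> and \<open>b\<close> induce
  the same volume.\<close>

definition kahler_structure :: "nat \<Rightarrow> real \<Rightarrow> ('m bivec \<Rightarrow> 'm bivec \<Rightarrow> 'm bivec \<Rightarrow> real) \<Rightarrow>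
    ('m bivec \<Rightarrow> 'm bivec \<Rightarrow> 'm::{finite,linorder} bivec) \<Rightarrow> ('m bivec \<Rightarrow> 'm bivec \<Rightarrow> real) \<Rightarrow> bool" where
  "kahler_structure p \<epsilon> h J b \<longleftrightarrow> bilinear b \<and>
     (\<forall>P x y. geodesic p \<epsilon> P x y \<longrightarrow>
       (\<exists>s\<in>{-1, 1}. \<exists>\<kappa>. \<forall>X\<in>perp p x y. \<forall>Y\<in>perp p x y. \<forall>X'\<in>perp p x y. \<forall>Y'\<in>perp p x y.
         let V = wedge x X + wedge y Y; W = wedge x X' + wedge y Y' in
           h P V W = s * b V W \<and>
           (\<exists>Z\<in>perp p x y. \<exists>Z'\<in>perp p x y. J P V = wedge x Z + wedge y Z') \<and>
           Omega p \<epsilon> P (J P V) W = - h P V W \<and>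
           h P (J P V) W = \<kappa> * Omega p \<epsilon> P V W))"

text \<open>Here the sign is 1 and \<open>\<kappa>\<close> is \<epsilon>. The clause with
  \<open>\<kappa>\<close> says that the complex structure maps a Lagrangian subspace into its normal
  space.\<close>

lemma kahler_structure_G:
  assumes eps: "\<epsilon> \<in> {-1, 1}"
  shows "kahler_structure p \<epsilon> (G_metric p) (J_geo p \<epsilon>) (biv_ip p)"
  unfolding kahler_structure_def Let_def
proof (intro conjI allI impI bilinear_biv_ip)
  fix P x y assume g: "geodesic p \<epsilon> P x (y :: 'a rvec)"
  have G: "G_metric p P (wedge x X + wedge y Y) (wedge x X' + wedge y Y') = ip p X X' + \<epsilon> * ip p Y Y'"
    if X: "X \<in> perp p x y" "Y \<in> perp p x y" "X' \<in> perp p x y" "Y' \<in> perp p x y" for X Y X' Y'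
    unfolding G_metric_def
    by (simp add: bilinear_ladd[OF bilinear_biv_ip] bilinear_radd[OF bilinear_biv_ip] biv_ip_wedge
        geodesicD(1-4)[OF g] perpD[OF X(1)] perpD[OF X(2)] perpD[OF X(3)] perpD[OF X(4)])
  have J: "J_geo p \<epsilon> P (wedge x X + wedge y Y) = wedge x ((- \<epsilon>) *\<^sub>R Y) + wedge y X"
    if X: "X \<in> perp p x y" "Y \<in> perp p x y" for X Y
    using J_geo_wedge[OF g X] by (simp add: wedge_simps)
  note m = perp_simps(3)[of _ p x y "- \<epsilon>"]
  have "G_metric p P (wedge x X + wedge y Y) (wedge x X' + wedge y Y')
        = 1 * biv_ip p (wedge x X + wedge y Y) (wedge x X' + wedge y Y')
      \<and> (\<exists>Z\<in>perp p x y. \<exists>Z'\<in>perp p x y. J_geo p \<epsilon> P (wedge x X + wedge y Y) = wedge x Z + wedge y Z')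
      \<and> Omega p \<epsilon> P (J_geo p \<epsilon> P (wedge x X + wedge y Y)) (wedge x X' + wedge y Y')
        = - G_metric p P (wedge x X + wedge y Y) (wedge x X' + wedge y Y')
      \<and> G_metric p P (J_geo p \<epsilon> P (wedge x X + wedge y Y)) (wedge x X' + wedge y Y')
        = \<epsilon> * Omega p \<epsilon> P (wedge x X + wedge y Y) (wedge x X' + wedge y Y')"
    if X: "X \<in> perp p x y" "Y \<in> perp p x y" "X' \<in> perp p x y" "Y' \<in> perp p x y" for X Y X' Y'
    unfolding J[OF X(1,2)] G[OF X] Omega_tangent[OF g eps X] Omega_tangent[OF g eps m[OF X(2)] X(1) X(3,4)]
      G[OF m[OF X(2)] X(1) X(3,4)]
    using G[OF X] m[OF X(2)] X(1) eps by (auto simp: G_metric_def)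
  then show "\<exists>s\<in>{-1, 1}. \<exists>\<kappa>. \<forall>X\<in>perp p x y. \<forall>Y\<in>perp p x y. \<forall>X'\<in>perp p x y. \<forall>Y'\<in>perp p x y.
           G_metric p P (wedge x X + wedge y Y) (wedge x X' + wedge y Y') =
           s * biv_ip p (wedge x X + wedge y Y) (wedge x X' + wedge y Y') \<and>
           (\<exists>Z\<in>perp p x y. \<exists>Z'\<in>perp p x y. J_geo p \<epsilon> P (wedge x X + wedge y Y) = wedge x Z + wedge y Z') \<and>
           Omega p \<epsilon> P (J_geo p \<epsilon> P (wedge x X + wedge y Y)) (wedge x X' + wedge y Y') =
           - G_metric p P (wedge x X + wedge y Y) (wedge x X' + wedge y Y') \<and>
           G_metric p P (J_geo p \<epsilon> P (wedge x X + wedge y Y)) (wedge x X' + wedge y Y') =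
           \<kappa> * Omega p \<epsilon> P (wedge x X + wedge y Y) (wedge x X' + wedge y Y')"
    by (intro bexI[of _ 1] exI[of _ \<epsilon>] ballI) simp_all
qed

subsection \<open>The second structure in dimension four\<close>

lemma idx_strict_mono: "i < j \<Longrightarrow> idx i < idx j"
  unfolding idx_def by (intro psubset_card_mono) auto

lemma idx_eq_iff: "idx i = idx j \<longleftrightarrow> i = j"
  using idx_strict_mono[of i j] idx_strict_mono[of j i] by (cases i j rule: linorder_cases) auto

lemma idx_less: "idx (i :: 'm::{finite,linorder}) < CARD('m)"
  unfolding idx_def by (intro psubset_card_mono) auto

lemma idx_onto:
  assumes "n < CARD('m)"
  obtains i :: "'m::{finite,linorder}" where "idx i = n"
proof -
  have "card (range (idx :: 'm \<Rightarrow> nat)) = card {..<CARD('m)}"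
    by (subst card_image) (auto simp: inj_def idx_eq_iff)
  then have "range (idx :: 'm \<Rightarrow> nat) = {..<CARD('m)}"
    using idx_less by (intro card_subset_eq) auto
  then have "n \<in> range (idx :: 'm \<Rightarrow> nat)" using assms by simp
  then show thesis using that by blast
qed

text \<open>Rows are placed in the order of \<open>idx\<close>, as in
  \<open>positively_oriented\<close>; a list makes the determinant a function of numbered arguments
  for an arbitrary index type.\<close>

definition rows :: "'m rvec list \<Rightarrow> 'm::{finite,linorder} bivec" where
  "rows L = (\<chi> i. L ! idx i)"

lemma det_rows_add:
  fixes L :: "'m::{finite,linorder} rvec list"
  assumes "length L = CARD('m)" "n < CARD('m)"
  shows "det (rows (L[n := a + b])) = det (rows (L[n := a])) + det (rows (L[n := b]))"
proof -
  obtain k :: 'm where k: "idx k = n" by (rule idx_onto[OF assms(2)])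
  have "rows (L[n := v]) = (\<chi> i. if i = k then v else L ! idx i)" for v
    unfolding rows_def vec_eq_iff using assms idx_less[where 'm='m]
    by (auto simp: nth_list_update k[symmetric] idx_eq_iff)
  then show ?thesis using det_row_add[of k "\<lambda>_. a" "\<lambda>_. b" "\<lambda>i. L ! idx i"] by simp
qed

lemma det_rows_scale:
  fixes L :: "'m::{finite,linorder} rvec list"
  assumes "length L = CARD('m)" "n < CARD('m)"
  shows "det (rows (L[n := c *\<^sub>R a])) = c * det (rows (L[n := a]))"
proof -
  obtain k :: 'm where k: "idx k = n" by (rule idx_onto[OF assms(2)])
  have "rows (L[n := v]) = (\<chi> i. if i = k then v else L ! idx i)" for v
    unfolding rows_def vec_eq_iff using assms idx_less[where 'm='m]
    by (auto simp: nth_list_update k[symmetric] idx_eq_iff)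
  then show ?thesis using det_row_mul[of k c "\<lambda>_. a" "\<lambda>i. L ! idx i", unfolded scalar_mult_eq_scaleR] by simp
qed

lemma det_rows_eq:
  fixes L :: "'m::{finite,linorder} rvec list"
  assumes "m < CARD('m)" "n < CARD('m)" "m \<noteq> n" "L ! m = L ! n"
  shows "det (rows L) = 0"
proof -
  obtain k :: 'm where k: "idx k = m" by (rule idx_onto[OF assms(1)])
  obtain l :: 'm where l: "idx l = n" by (rule idx_onto[OF assms(2)])
  show ?thesis
    by (rule det_identical_rows[of k l]) (use k l assms in \<open>auto simp: rows_def row_def\<close>)
qed

definition det4 :: "'m rvec \<Rightarrow> 'm rvec \<Rightarrow> 'm rvec \<Rightarrow> 'm::{finite,linorder} rvec \<Rightarrow> real" where
  "det4 a b c d = det (rows [a, b, c, d])"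

context
  assumes four: "CARD('m::{finite,linorder}) = 4"
begin

lemma det4_add:
  "det4 (a + a') b c d = det4 a b c d + det4 a' b c (d :: 'm rvec)"
  "det4 a (b + b') c d = det4 a b c d + det4 a b' c (d :: 'm rvec)"
  "det4 a b (c + c') d = det4 a b c d + det4 a b c' (d :: 'm rvec)"
  "det4 a b c (d + d') = det4 a b c d + det4 a b c (d' :: 'm rvec)"
  unfolding det4_def
  using det_rows_add[of "[a, b, c, d]" 0 a a'] det_rows_add[of "[a, b, c, d]" 1 b b']
    det_rows_add[of "[a, b, c, d]" 2 c c'] det_rows_add[of "[a, b, c, d]" 3 d d'] four
  by (simp_all add: numeral_eq_Suc)

lemma det4_scale:
  "det4 (r *\<^sub>R a) b c d = r * det4 a b c (d :: 'm rvec)"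
  "det4 a (r *\<^sub>R b) c d = r * det4 a b c (d :: 'm rvec)"
  "det4 a b (r *\<^sub>R c) d = r * det4 a b c (d :: 'm rvec)"
  "det4 a b c (r *\<^sub>R d) = r * det4 a b c (d :: 'm rvec)"
  unfolding det4_def
  using det_rows_scale[of "[a, b, c, d]" 0 r a] det_rows_scale[of "[a, b, c, d]" 1 r b]
    det_rows_scale[of "[a, b, c, d]" 2 r c] det_rows_scale[of "[a, b, c, d]" 3 r d] four
  by (simp_all add: numeral_eq_Suc)

lemma det4_same:
  "det4 a a c d = 0" "det4 a b a d = 0" "det4 a b c a = 0" "det4 a b b d = 0" "det4 a b c b = 0"
  "det4 a b c (c :: 'm rvec) = 0"
  unfolding det4_def
  using det_rows_eq[of 0 1 "[a, a, c, d]"] det_rows_eq[of 0 2 "[a, b, a, d]"] det_rows_eq[of 0 3 "[a, b, c, a]"]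
    det_rows_eq[of 1 2 "[a, b, b, d]"] det_rows_eq[of 1 3 "[a, b, c, b]"] det_rows_eq[of 2 3 "[a, b, c, c]"] four
  by (simp_all add: numeral_eq_Suc)

text \<open>Polarization: a determinant with the repeated argument \<open>a + b\<close> vanishes and
  is expanded by multilinearity.\<close>

lemma det4_swap:
  "det4 b a c d = - det4 a b c (d :: 'm rvec)" "det4 a c b d = - det4 a b c (d :: 'm rvec)"
  "det4 a b d c = - det4 a b c (d :: 'm rvec)"
  using det4_same(1)[of "a + b" c d] det4_same(4)[of a "b + c" d] det4_same(6)[of a b "c + d"]
  unfolding det4_add by (simp_all add: det4_same)

lemma det4_linear:
  "linear (\<lambda>a. det4 a b c (d :: 'm rvec))" "linear (\<lambda>b. det4 a b c (d :: 'm rvec))"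
  "linear (\<lambda>c. det4 a b c (d :: 'm rvec))" "linear (\<lambda>d. det4 a b c (d :: 'm rvec))"
  by (auto intro!: linearI simp: det4_add det4_scale)

end

lemma linear_expand:
  fixes f :: "real ^ 'n \<Rightarrow> real"
  assumes "linear f"
  shows "f v = (\<Sum>i\<in>UNIV. v $ i * f (axis i 1))"
  by (subst basis_expansion[of v, symmetric], unfold scalar_mult_eq_scaleR)
    (simp add: linear_sum[OF assms] linear_cmul[OF assms])

text \<open>The coefficient of \<open>V \<and> W\<close> in the one-dimensional space \<open>\<Lambda>\<^sup>4\<close>.\<close>

definition klein :: "'m bivec \<Rightarrow> 'm::{finite,linorder} bivec \<Rightarrow> real" where
  "klein V W = (\<Sum>i\<in>UNIV. \<Sum>j\<in>UNIV. \<Sum>k\<in>UNIV. \<Sum>l\<in>UNIV.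
     V $ i $ j * W $ k $ l * det4 (axis i 1) (axis j 1) (axis k 1) (axis l 1)) / 4"

lemma bilinear_klein: "bilinear klein"
  by (auto simp: bilinear_def klein_def algebra_simps sum.distrib sum_distrib_left add_divide_distrib
      sum_divide_distrib intro!: linearI)

lemma klein_wedge:
  assumes "CARD('m) = 4"
  shows "klein (wedge a b) (wedge c d) = det4 a b c (d :: 'm::{finite,linorder} rvec)"
proof -
  let ?D = "\<lambda>i j k l :: 'm. det4 (axis i 1) (axis j 1) (axis k 1) (axis l 1)"
  note l = det4_linear[OF assms]
  have ex: "det4 a b c d = (\<Sum>i\<in>UNIV. \<Sum>j\<in>UNIV. \<Sum>k\<in>UNIV. \<Sum>l\<in>UNIV. a $ i * b $ j * c $ k * d $ l * ?D i j k l)"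
    for a b c d :: "'m rvec"
  proof -
    have "det4 a b c d = (\<Sum>i\<in>UNIV. a $ i * det4 (axis i 1) b c d)"
      by (rule linear_expand[OF l(1)])
    also have "\<dots> = (\<Sum>i\<in>UNIV. a $ i * (\<Sum>j\<in>UNIV. b $ j * det4 (axis i 1) (axis j 1) c d))"
      by (intro sum.cong refl arg_cong2[where f = "(*)"] linear_expand[OF l(2)])
    also have "\<dots> = (\<Sum>i\<in>UNIV. a $ i * (\<Sum>j\<in>UNIV. b $ j * (\<Sum>k\<in>UNIV. c $ k * det4 (axis i 1) (axis j 1) (axis k 1) d)))"
      by (intro sum.cong refl arg_cong2[where f = "(*)"] linear_expand[OF l(3)])
    also have "\<dots> = (\<Sum>i\<in>UNIV. a $ i * (\<Sum>j\<in>UNIV. b $ j * (\<Sum>k\<in>UNIV. c $ k * (\<Sum>l\<in>UNIV. d $ l * ?D i j k l))))"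
      by (intro sum.cong refl arg_cong2[where f = "(*)"] linear_expand[OF l(4)])
    finally show ?thesis by (simp add: sum_distrib_left mult.assoc)
  qed
  have "4 * klein (wedge a b) (wedge c d) = (\<Sum>i\<in>UNIV. \<Sum>j\<in>UNIV. \<Sum>k\<in>UNIV. \<Sum>l\<in>UNIV.
      a $ i * b $ j * c $ k * d $ l * ?D i j k l - b $ i * a $ j * c $ k * d $ l * ?D i j k l
      - a $ i * b $ j * d $ k * c $ l * ?D i j k l + b $ i * a $ j * d $ k * c $ l * ?D i j k l)"
    unfolding klein_def
    by (simp, intro sum.cong refl) (simp add: wedge_def algebra_simps)
  also have "\<dots> = det4 a b c d - det4 b a c d - det4 a b d c + det4 b a d c"
    by (simp only: sum.distrib sum_subtractf ex[of a b c d] ex[of b a c d] ex[of a b d c] ex[of b a d c])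
  \<comment> \<open>Each of the two wedges contributes two terms, and antisymmetry makes all four
    products equal; this is the origin of the 4 in \<open>klein\<close>.\<close>
  also have "\<dots> = 4 * det4 a b c d"
    using det4_swap(1)[OF assms, of b a c d] det4_swap(1)[OF assms, of b a d c] det4_swap(3)[OF assms, of a b d c]
    by simp
  finally show ?thesis by simp
qed

section \<open>Orthonormal systems for an indefinite inner product\<close>

definition pseudo_orthonormal :: "nat \<Rightarrow> ('m::{finite,linorder} rvec) set \<Rightarrow> bool" where
  "pseudo_orthonormal p B \<longleftrightarrow> finite B \<and> (\<forall>b\<in>B. ip p b b \<in> {-1, 1}) \<and>
     (\<forall>b\<in>B. \<forall>c\<in>B. b \<noteq> c \<longrightarrow> ip p b c = 0)"

lemma ip_sum_orthonormal:
  assumes B: "pseudo_orthonormal p B" and c: "c \<in> B"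
  shows "ip p (\<Sum>b\<in>B. f b *\<^sub>R b) c = f c * ip p c c"
proof -
  have "ip p (\<Sum>b\<in>B. f b *\<^sub>R b) c = (\<Sum>b\<in>B. f b * ip p b c)"
    by (simp add: ip_sum_left)
  also have "\<dots> = (\<Sum>b\<in>B. if b = c then f c * ip p c c else 0)"
    using B c by (intro sum.cong) (auto simp: pseudo_orthonormal_def)
  finally show ?thesis using B c by (simp add: pseudo_orthonormal_def)
qed

lemma independent_orthonormal:
  assumes B: "pseudo_orthonormal p B"
  shows "independent B"
proof (rule independent_if_scalars_zero)
  show "finite B" using B by (simp add: pseudo_orthonormal_def)
  fix f x assume "(\<Sum>b\<in>B. f b *\<^sub>R b) = 0" "x \<in> B"
  then have "f x * ip p x x = 0" using ip_sum_orthonormal[OF B, of x f] by simp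
  moreover have "ip p x x \<noteq> 0" using B \<open>x \<in> B\<close> by (auto simp: pseudo_orthonormal_def)
  ultimately show "f x = 0" by simp
qed

lemma orthogonal_span:
  assumes "\<And>b. b \<in> B \<Longrightarrow> ip p v b = 0" "w \<in> span B"
  shows "ip p v w = 0"
  using assms(2)
proof (induction rule: span_induct)
  case base
  show ?case unfolding subspace_def by auto
qed (use assms in auto)

lemma orthogonal_full:
  fixes B :: "('m::{finite,linorder} rvec) set"
  assumes B: "pseudo_orthonormal p B" "card B = CARD('m)" and v: "\<And>b. b \<in> B \<Longrightarrow> ip p v b = 0"
  shows "v = 0"
proof (rule ip_nondegenerate)
  have "UNIV \<subseteq> span B"
    by (rule card_ge_dim_independent) (use independent_orthonormal[OF B(1)] B(2) in auto)
  then show "ip p v w = 0" for w using orthogonal_span[OF v] by blast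
qed

text \<open>If every vector orthogonal to \<open>B\<close> were null, polarization would make the
  form vanish on that whole complement. The remainder \<open>\<pi> v\<close> after projection to the
  span of \<open>B\<close> would then be orthogonal to everything, hence zero, and \<open>B\<close>
  would span, against its cardinality.\<close>

lemma orthonormal_extend:
  fixes B :: "('m::{finite,linorder} rvec) set"
  assumes B: "pseudo_orthonormal p B" "card B < CARD('m)"
  obtains v where "ip p v v \<in> {-1, 1}" "\<And>b. b \<in> B \<Longrightarrow> ip p v b = 0"
proof -
  have "\<exists>v. (\<forall>b\<in>B. ip p v b = 0) \<and> ip p v v \<noteq> 0"
  proof (rule ccontr)
    assume H: "\<not> ?thesis"
    have zero: "ip p u v = 0" if "\<forall>b\<in>B. ip p u b = 0" "\<forall>b\<in>B. ip p v b = 0" for u v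
    proof -
      have "\<forall>b\<in>B. ip p (u + v) b = 0" using that by simp
      then have "ip p (u + v) (u + v) = 0" "ip p u u = 0" "ip p v v = 0" using H that by blast+
      then show ?thesis using ip_commute[of p u v] by simp
    qed
    define \<pi> where "\<pi> v = v - (\<Sum>b\<in>B. (ip p b b * ip p v b) *\<^sub>R b)" for v
    have \<pi>: "\<forall>b\<in>B. ip p (\<pi> v) b = 0" for v
    proof
      fix b assume b: "b \<in> B"
      then have "ip p b b \<in> {-1, 1}" using B by (simp only: pseudo_orthonormal_def)
      then have "ip p b b * ip p v b * ip p b b = ip p v b" by auto
      then show "ip p (\<pi> v) b = 0"
        unfolding \<pi>_def ip_diff_left ip_sum_orthonormal[OF B(1) b] by simp
    qed
    have sp: "v - \<pi> v \<in> span B" for v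
      unfolding \<pi>_def diff_diff_eq2 add_diff_cancel_left' by (intro span_sum span_scale span_base)
    have "\<pi> v = 0" for v
    proof (rule ip_nondegenerate)
      fix w
      have "ip p (\<pi> v) (\<pi> w) = 0" by (rule zero[OF \<pi> \<pi>])
      moreover have "ip p (\<pi> v) (w - \<pi> w) = 0" using \<pi> by (intro orthogonal_span[OF _ sp]) auto
      ultimately show "ip p (\<pi> v) w = 0" by simp
    qed
    then have "UNIV \<subseteq> span B" using sp by auto
    then have "dim (UNIV :: 'm rvec set) \<le> card B"
      using B by (intro dim_le_card) (auto simp: pseudo_orthonormal_def)
    then show False using B(2) by simp
  qed
  then obtain v where v: "\<And>b. b \<in> B \<Longrightarrow> ip p v b = 0" "ip p v v \<noteq> 0" by blast
  define c where "c = 1 / sqrt \<bar>ip p v v\<bar>"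
  have "c * (c * ip p v v) \<in> {-1, 1}"
    using v(2) by (cases "ip p v v > 0") (auto simp: c_def)
  then show thesis using v by (intro that[of "c *\<^sub>R v"]) auto
qed

lemma orthonormal_insert:
  assumes "pseudo_orthonormal p B" "ip p v v \<in> {-1, 1}" "\<And>b. b \<in> B \<Longrightarrow> ip p v b = 0"
  shows "pseudo_orthonormal p (insert v B)" "v \<notin> B"
proof -
  have "ip p b v = 0" if "b \<in> B" for b using assms(3)[OF that] ip_commute[of p b v] by simp
  then show "pseudo_orthonormal p (insert v B)" using assms by (auto simp: pseudo_orthonormal_def)
  show "v \<notin> B" using assms(2,3) by auto
qed

text \<open>The matrix with these rows transforms the diagonal sign matrix \<open>D\<close> of the
  inner product into the diagonal sign matrix \<open>E\<close> of the system. Both have determinant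
  1 or -1, and absolute values give the claim.\<close>

lemma det_rows_orthonormal:
  fixes L :: "'m::{finite,linorder} rvec list"
  assumes len: "length L = CARD('m)" and dist: "distinct L" and B: "pseudo_orthonormal p (set L)"
  shows "(det (rows L))\<^sup>2 = 1"
proof -
  define D :: "'m bivec" where "D = (\<chi> i j. if i = j then sgn_coord p i else 0)"
  define E :: "'m bivec" where "E = (\<chi> i j. if i = j then ip p (L ! idx i) (L ! idx i) else 0)"
  have "(rows L ** D ** transpose (rows L)) $ i $ j = E $ i $ j" for i j
  proof -
    have "(rows L ** D) $ i $ k = L ! idx i $ k * sgn_coord p k" for k
    proof -
      have "(rows L ** D) $ i $ k = (\<Sum>l\<in>UNIV. if l = k then L ! idx i $ k * sgn_coord p k else 0)"
        unfolding matrix_matrix_mult_def D_def rows_def vec_lambda_beta by (intro sum.cong) auto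
      then show ?thesis by simp
    qed
    then have "(rows L ** D ** transpose (rows L)) $ i $ j = ip p (L ! idx i) (L ! idx j)"
    proof -
      assume H: "\<And>k. (rows L ** D) $ i $ k = L ! idx i $ k * sgn_coord p k"
      have "(rows L ** D ** transpose (rows L)) $ i $ j = (\<Sum>k\<in>UNIV. (rows L ** D) $ i $ k * transpose (rows L) $ k $ j)"
        unfolding matrix_matrix_mult_def[of "rows L ** D"] by simp
      then show ?thesis unfolding H by (simp add: transpose_def rows_def ip_def mult_ac)
    qed
    also have "\<dots> = E $ i $ j"
    proof (cases "i = j")
      case False
      then have "L ! idx i \<noteq> L ! idx j"
        using nth_eq_iff_index_eq[OF dist] idx_less[of i] idx_less[of j] len by (simp add: idx_eq_iff)
      moreover have "L ! idx i \<in> set L" "L ! idx j \<in> set L" using idx_less[of i] idx_less[of j] len by simp_all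
      ultimately show ?thesis using B False by (simp add: pseudo_orthonormal_def E_def)
    qed (simp add: E_def)
    finally show ?thesis .
  qed
  then have "rows L ** D ** transpose (rows L) = E" by (simp add: vec_eq_iff)
  then have "det (rows L) * det D * det (rows L) = det E" by (metis det_mul det_transpose)
  then have "det E = (det (rows L))\<^sup>2 * det D" by (simp add: power2_eq_square mult_ac)
  then have "(det (rows L))\<^sup>2 * \<bar>det D\<bar> = \<bar>det E\<bar>" by (simp add: abs_mult)
  moreover have "\<bar>det D\<bar> = 1"
  proof -
    have "det D = (\<Prod>i\<in>(UNIV :: 'm set). sgn_coord p i)" by (subst det_diagonal) (auto simp: D_def)
    moreover have "\<bar>sgn_coord p i\<bar> = 1" for i :: 'm by (simp add: sgn_coord_def)
    ultimately show ?thesis by (simp add: abs_prod)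
  qed
  moreover have "\<bar>det E\<bar> = 1"
  proof -
    have "det E = (\<Prod>i\<in>(UNIV :: 'm set). ip p (L ! idx i) (L ! idx i))" by (subst det_diagonal) (auto simp: E_def)
    moreover have "\<bar>ip p (L ! idx i) (L ! idx i)\<bar> = 1" for i :: 'm
    proof -
      have "L ! idx i \<in> set L" using idx_less[of i] len by simp
      then have "ip p (L ! idx i) (L ! idx i) \<in> {-1, 1}" using B by (simp only: pseudo_orthonormal_def)
      then show ?thesis by auto
    qed
    ultimately show ?thesis by (simp add: abs_prod)
  qed
  ultimately show ?thesis by simp
qed

lemma geodesic_orthonormal:
  assumes g: "geodesic p \<epsilon> P x y" and eps: "\<epsilon> \<in> {-1, 1}"
  shows "pseudo_orthonormal p {x, y}" "x \<noteq> y"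
  using geodesicD[OF g] eps by (auto simp: pseudo_orthonormal_def)

context
  fixes p :: nat and \<epsilon> :: real and P :: "'m::{finite,linorder} bivec" and x y :: "'m rvec"
  assumes four: "CARD('m) = 4" and eps: "\<epsilon> \<in> {-1, 1}" and g: "geodesic p \<epsilon> P x y"
begin

text \<open>Shows that the orientation of the orthogonal plane is determined by the bivector
  \<open>P\<close>, not by the vectors that represent it.\<close>

lemma positively_oriented_iff: "positively_oriented x y e1 e2 \<longleftrightarrow> klein P (wedge e1 e2) > 0"
  unfolding geodesicD(5)[OF g] klein_wedge[OF four] by (simp add: positively_oriented_def det4_def rows_def)

lemma basis_orthonormal:
  assumes "e1 \<in> perp p x y" "e2 \<in> perp p x y" "ip p e1 e2 = 0" "ip p e1 e1 \<in> {-1, 1}" "ip p e2 e2 \<in> {-1, 1}"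
  shows "pseudo_orthonormal p {x, y, e1, e2}" "card {x, y, e1, e2} = 4" "(det4 x y e1 e2)\<^sup>2 = 1"
proof -
  note g2 = geodesic_orthonormal[OF g eps]
  have 1: "pseudo_orthonormal p (insert e1 {x, y})" "e1 \<notin> {x, y}"
    using orthonormal_insert[OF g2(1) assms(4)] perpD[OF assms(1)] by auto
  have 2: "pseudo_orthonormal p (insert e2 (insert e1 {x, y}))" "e2 \<notin> insert e1 {x, y}"
    using orthonormal_insert[OF 1(1) assms(5)] perpD[OF assms(2)] assms(3) ip_commute[of p e1 e2] by auto
  show 3: "pseudo_orthonormal p {x, y, e1, e2}"
    using 2(1) by (simp add: insert_commute)
  have d: "distinct [x, y, e1, e2]" using 1(2) 2(2) g2(2) by auto
  show "card {x, y, e1, e2} = 4" using distinct_card[OF d] by simp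
  show "(det4 x y e1 e2)\<^sup>2 = 1"
    unfolding det4_def by (rule det_rows_orthonormal[where p = p]) (use four d 3 in auto)
qed

lemma adapted_props:
  assumes "adapted_basis p x y e1 e2"
  shows "e1 \<in> perp p x y" "e2 \<in> perp p x y" "ip p e1 e2 = 0" "ip p e1 e1 \<in> {-1, 1}" "ip p e2 e2 \<in> {-1, 1}"
    "det4 x y e1 e2 = 1"
    "\<And>v. ip p v x = 0 \<Longrightarrow> ip p v y = 0 \<Longrightarrow> ip p v e1 = 0 \<Longrightarrow> ip p v e2 = 0 \<Longrightarrow> v = 0"
proof -
  show a: "e1 \<in> perp p x y" "e2 \<in> perp p x y" "ip p e1 e2 = 0" "ip p e1 e1 \<in> {-1, 1}" "ip p e2 e2 \<in> {-1, 1}"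
    using assms by (simp_all add: adapted_basis_def)
  note b = basis_orthonormal[OF a]
  have "det4 x y e1 e2 > 0"
    using assms by (simp add: adapted_basis_def positively_oriented_def det4_def rows_def)
  then show "det4 x y e1 e2 = 1" using b(3) by (simp add: power2_eq_1_iff)
  show "v = 0" if "ip p v x = 0" "ip p v y = 0" "ip p v e1 = 0" "ip p v e2 = 0" for v
    by (rule orthogonal_full[OF b(1)]) (use b(2) four that in auto)
qed

lemma ex_adapted:
  obtains e1 e2 where "adapted_basis p x y e1 e2"
proof -
  note g2 = geodesic_orthonormal[OF g eps]
  have c2: "card {x, y} < CARD('m)" using g2(2) four by simp
  obtain f1 where f1: "ip p f1 f1 \<in> {-1, 1}" "\<And>b. b \<in> {x, y} \<Longrightarrow> ip p f1 b = 0"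
    using orthonormal_extend[OF g2(1) c2] by metis
  have 1: "pseudo_orthonormal p (insert f1 {x, y})" "f1 \<notin> {x, y}"
    using orthonormal_insert[OF g2(1) f1] by auto
  have "card (insert f1 {x, y}) < CARD('m)" using 1(2) g2(2) four by simp
  then obtain f2 where f2: "ip p f2 f2 \<in> {-1, 1}" "\<And>b. b \<in> insert f1 {x, y} \<Longrightarrow> ip p f2 b = 0"
    using orthonormal_extend[OF 1(1)] by metis
  \<comment> \<open>If the plane is indefinite, the two vectors are exchanged when necessary, so
    that the spacelike one comes first.\<close>
  have "\<exists>e1 e2. e1 \<in> perp p x y \<and> e2 \<in> perp p x y \<and> ip p e1 e2 = 0 \<and> ip p e1 e1 \<in> {-1, 1} \<and> ip p e2 e2 \<in> {-1, 1} \<and>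
      (ip p e1 e1 \<noteq> ip p e2 e2 \<longrightarrow> ip p e1 e1 = 1)"
  proof (cases "ip p f1 f1 \<noteq> ip p f2 f2 \<and> ip p f1 f1 = -1")
    case True
    then show ?thesis using f1 f2 ip_commute[of p f1 f2]
      by (intro exI[of _ f2] exI[of _ f1]) (auto simp: perp_def)
  next
    case False
    then show ?thesis using f1 f2 ip_commute[of p f1 f2]
      by (intro exI[of _ f1] exI[of _ f2]) (auto simp: perp_def)
  qed
  then obtain e1 e2 where e: "e1 \<in> perp p x y" "e2 \<in> perp p x y" "ip p e1 e2 = 0" "ip p e1 e1 \<in> {-1, 1}" "ip p e2 e2 \<in> {-1, 1}"
      "ip p e1 e1 \<noteq> ip p e2 e2 \<longrightarrow> ip p e1 e1 = 1" by blast
  have po: "positively_oriented x y a b \<longleftrightarrow> det4 x y a b > 0" for a b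
    by (simp add: positively_oriented_def det4_def rows_def)
  have "det4 x y e1 e2 \<noteq> 0" using basis_orthonormal(3)[OF e(1-5)] by auto
  moreover have "det4 x y e1 (- e2) = - det4 x y e1 e2"
    using det4_scale(4)[OF four, of x y e1 "-1" e2] by simp
  ultimately consider "det4 x y e1 e2 > 0" | "det4 x y e1 (- e2) > 0"
    by (cases "det4 x y e1 e2 > 0") auto
  then show thesis
  proof cases
    case 1
    then show thesis using e by (intro that[of e1 e2]) (simp add: adapted_basis_def po)
  next
    case 2
    then show thesis using e by (intro that[of e1 "- e2"]) (simp add: adapted_basis_def po perp_simps)
  qed
qed

lemma adapted_expand:
  assumes e: "adapted_basis p x y e1 e2" and X: "X \<in> perp p x y"
  obtains a b where "X = a *\<^sub>R e1 + b *\<^sub>R e2"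
proof -
  note ad = adapted_props[OF e]
  let ?a = "ip p e1 e1 * ip p X e1" and ?b = "ip p e2 e2 * ip p X e2"
  have s: "?a * ip p e1 e1 = ip p X e1" "?b * ip p e2 e2 = ip p X e2" using ad(4,5) by auto
  have "X - (?a *\<^sub>R e1 + ?b *\<^sub>R e2) = 0"
    by (rule ad(7)) (use s ad(3) ip_commute[of p e2 e1] in
      \<open>simp_all add: perpD[OF X] perpD[OF ad(1)] perpD[OF ad(2)]\<close>)
  then show thesis by (intro that[of ?a ?b]) simp
qed

text \<open>In a definite plane all unit vectors have the same sign. In an indefinite one the
  convention on adapted bases makes the second vector timelike.\<close>

lemma adapted_sign:
  assumes e: "adapted_basis p x y e1 e2" and f: "adapted_basis p x y f1 f2"
  shows "ip p e2 e2 = ip p f2 f2"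
proof -
  have def: "ip p z z = ip p e2 e2"
    if e: "adapted_basis p x y e1 e2" and eq: "ip p e1 e1 = ip p e2 e2" and z: "z \<in> perp p x y" "ip p z z \<in> {-1, 1}"
    for e1 e2 z
  proof -
    note ad = adapted_props[OF e]
    obtain a b where z': "z = a *\<^sub>R e1 + b *\<^sub>R e2" using adapted_expand[OF e z(1)] .
    define q where "q = a\<^sup>2 + b\<^sup>2"
    have "ip p z z = ip p e2 e2 * q"
      unfolding z' q_def using ad(3) eq ip_commute[of p e2 e1] by (simp add: power2_eq_square algebra_simps)
    moreover have "0 \<le> q" by (simp add: q_def)
    ultimately show ?thesis using z(2) ad(5) by auto
  qed
  note ae = adapted_props[OF e] and af = adapted_props[OF f]
  show ?thesis
  proof (cases "ip p e1 e1 = ip p e2 e2")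
    case True
    then show ?thesis using def[OF e True af(2,5)] by simp
  next
    case False
    then have "ip p f1 f1 \<noteq> ip p f2 f2"
      using def[OF f _ ae(1,4)] def[OF f _ ae(2,5)] by auto
    then show ?thesis using False e f ae af by (auto simp: adapted_basis_def)
  qed
qed

text \<open>The structure \<open>J'\<close> of the plane orthogonal to \<open>x\<close> and \<open>y\<close>, extended by zero.\<close>

definition rotation :: "real \<Rightarrow> 'm rvec \<Rightarrow> 'm rvec" where
  "rotation s X = (\<chi> i. - s * sgn_coord p i * det4 x y (axis i 1) X)"

text \<open>The entries of \<open>rotation s X\<close> are chosen so that this vector represents the
  linear form \<open>- s * det4 x y U X\<close> in \<open>U\<close>. The description uses no basis,
  is linear in \<open>X\<close>, and vanishes on \<open>x\<close> and \<open>y\<close>.\<close>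

lemma ip_rotation: "ip p U (rotation s X) = - s * det4 x y U X"
proof -
  have "ip p U (rotation s X) = (\<Sum>i\<in>UNIV. - s * (U $ i * det4 x y (axis i 1) X) * (sgn_coord p i * sgn_coord p i))"
    unfolding ip_def rotation_def by (intro sum.cong) (auto simp: mult_ac)
  also have "\<dots> = - s * (\<Sum>i\<in>UNIV. U $ i * det4 x y (axis i 1) X)"
    by (simp add: sum_distrib_left sum_negf)
  also have "\<dots> = - s * det4 x y U X"
    using linear_expand[OF det4_linear(3)[OF four, where a = x and b = y and d = X], of U] by simp
  finally show ?thesis .
qed

lemma rotation_linear: "rotation s (X + Y) = rotation s X + rotation s Y" "rotation s (c *\<^sub>R X) = c *\<^sub>R rotation s X"
  by (simp_all add: rotation_def vec_eq_iff det4_add[OF four] det4_scale[OF four] algebra_simps)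

lemma rotation_perp: "rotation s X \<in> perp p x y"
  using ip_rotation[of x s X] ip_rotation[of y s X]
  by (simp add: perp_def det4_same[OF four] ip_commute[of p "rotation s X" x] ip_commute[of p "rotation s X" y])

lemma rotation_basis:
  assumes e: "adapted_basis p x y e1 e2"
  shows "rotation (ip p e2 e2) (a *\<^sub>R e1 + b *\<^sub>R e2) = a *\<^sub>R e2 - (b * ip p e1 e1 * ip p e2 e2) *\<^sub>R e1" (is "?r = ?z")
proof -
  note ad = adapted_props[OF e]
  have d: "det4 x y e2 e1 = -1" using det4_swap(3)[OF four, of x y e2 e1] ad(6) by simp
  have i: "ip p U ?r = - ip p e2 e2 * (a * det4 x y U e1 + b * det4 x y U e2)" for U
    unfolding ip_rotation by (simp add: det4_add[OF four] det4_scale[OF four])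
  have i': "ip p ?r U = - ip p e2 e2 * (a * det4 x y U e1 + b * det4 x y U e2)" for U
    using i[of U] ip_commute[of p U ?r] by simp
  have "?r - ?z = 0"
    by (rule ad(7)) (use d ad(3,4,5,6) ip_commute[of p e2 e1] in
      \<open>auto simp: i' det4_same[OF four] perpD[OF ad(1)] perpD[OF ad(2)]\<close>)
  then show ?thesis by simp
qed

text \<open>The formula in an adapted basis equals a rotation that depends on the basis only through
  the sign of its second vector, and that sign is common to all adapted bases. Hence the definite
  description has a unique value.\<close>

lemma J'_plane_eq:
  assumes e: "adapted_basis p x y e1 e2" and X: "X \<in> perp p x y"
  shows "J'_plane p x y X = rotation (ip p e2 e2) X"
  unfolding J'_plane_def
proof (rule the_equality)
  obtain a b where X': "X = a *\<^sub>R e1 + b *\<^sub>R e2" using adapted_expand[OF e X] .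
  then show "\<exists>e1' e2' a b. adapted_basis p x y e1' e2' \<and> X = a *\<^sub>R e1' + b *\<^sub>R e2' \<and>
      rotation (ip p e2 e2) X = a *\<^sub>R e2' - (b * ip p e1' e1' * ip p e2' e2') *\<^sub>R e1'"
    using e rotation_basis[OF e, of a b] by blast
  fix Z assume "\<exists>e1' e2' a b. adapted_basis p x y e1' e2' \<and> X = a *\<^sub>R e1' + b *\<^sub>R e2' \<and>
      Z = a *\<^sub>R e2' - (b * ip p e1' e1' * ip p e2' e2') *\<^sub>R e1'"
  then obtain e1' e2' a b where e': "adapted_basis p x y e1' e2'" and "X = a *\<^sub>R e1' + b *\<^sub>R e2'"
      "Z = a *\<^sub>R e2' - (b * ip p e1' e1' * ip p e2' e2') *\<^sub>R e1'" by blast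
  then show "Z = rotation (ip p e2 e2) X"
    using rotation_basis[OF e', of a b] adapted_sign[OF e e'] by simp
qed

lemma rotation_isometry:
  assumes e: "adapted_basis p x y e1 e2" and X: "X \<in> perp p x y" "Y \<in> perp p x y"
  shows "ip p (rotation (ip p e2 e2) X) (rotation (ip p e2 e2) Y) = ip p e1 e1 * ip p e2 e2 * ip p X Y"
proof -
  note ad = adapted_props[OF e]
  obtain a b where X': "X = a *\<^sub>R e1 + b *\<^sub>R e2" using adapted_expand[OF e X(1)] .
  obtain c d where Y': "Y = c *\<^sub>R e1 + d *\<^sub>R e2" using adapted_expand[OF e X(2)] .
  show ?thesis
    unfolding X' Y' rotation_basis[OF e] using ad(3,4,5) ip_commute[of p e2 e1]
    by (auto simp: algebra_simps)
qed

end

text \<open>Contracting \<open>P\<close>, written in terms of \<open>x\<close> and \<open>y\<close>,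
  with the vectors \<open>y'\<close> and \<open>x'\<close> expresses \<open>x'\<close> and
  \<open>y'\<close> through \<open>x\<close> and \<open>y\<close>.\<close>

lemma geodesic_change:
  assumes g: "geodesic p \<epsilon> P x y" and g': "geodesic p \<epsilon> P x' y'" and eps: "\<epsilon> \<in> {-1, 1}"
  obtains a b c d where "x' = a *\<^sub>R x + b *\<^sub>R y" "y' = c *\<^sub>R x + d *\<^sub>R y"
proof -
  have P: "contract p P v = ip p y v *\<^sub>R x - ip p x v *\<^sub>R y" "contract p P v = ip p y' v *\<^sub>R x' - ip p x' v *\<^sub>R y'" for v
    using geodesicD(5)[OF g] geodesicD(5)[OF g'] contract_wedge by metis+
  have "\<epsilon> *\<^sub>R x' = ip p y y' *\<^sub>R x - ip p x y' *\<^sub>R y"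
    using P[of y'] by (simp add: geodesicD(1-4)[OF g'])
  then have "\<epsilon> *\<^sub>R (\<epsilon> *\<^sub>R x') = \<epsilon> *\<^sub>R (ip p y y' *\<^sub>R x - ip p x y' *\<^sub>R y)" by simp
  then have 1: "x' = (\<epsilon> * ip p y y') *\<^sub>R x + (- \<epsilon> * ip p x y') *\<^sub>R y"
    using eps_square[OF eps] by (simp add: scaleR_diff_right)
  have "- y' = ip p y x' *\<^sub>R x - ip p x x' *\<^sub>R y"
    using P[of x'] by (simp add: geodesicD(1-4)[OF g'])
  then have "y' = (- ip p y x') *\<^sub>R x + ip p x x' *\<^sub>R y" by (simp add: minus_equation_iff[of y'])
  with 1 show thesis by (rule that)
qed

text \<open>The map \<open>J'_plane\<close> is linear on the orthogonal plane and depends on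
  \<open>P\<close> only, so it commutes with the linear change of the pair that represents
  \<open>P\<close>.\<close>

lemma J'_geo_wedge:
  fixes x y :: "'m::{finite,linorder} rvec"
  assumes four: "CARD('m) = 4" and eps: "\<epsilon> \<in> {-1, 1}" and g: "geodesic p \<epsilon> P x y"
    and X: "X \<in> perp p x y" and Y: "Y \<in> perp p x y"
  shows "J'_geo p \<epsilon> P (wedge x X + wedge y Y) = wedge x (J'_plane p x y X) + wedge y (J'_plane p x y Y)"
  unfolding J'_geo_def
proof (rule the_equality)
  show "\<exists>x' y' X' Y'. geodesic p \<epsilon> P x' y' \<and> X' \<in> perp p x' y' \<and> Y' \<in> perp p x' y' \<and>
     wedge x X + wedge y Y = wedge x' X' + wedge y' Y' \<and>
     wedge x (J'_plane p x y X) + wedge y (J'_plane p x y Y) =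
     wedge x' (J'_plane p x' y' X') + wedge y' (J'_plane p x' y' Y')"
    using g X Y by blast
  fix W assume "\<exists>x' y' X' Y'. geodesic p \<epsilon> P x' y' \<and> X' \<in> perp p x' y' \<and> Y' \<in> perp p x' y' \<and>
     wedge x X + wedge y Y = wedge x' X' + wedge y' Y' \<and>
     W = wedge x' (J'_plane p x' y' X') + wedge y' (J'_plane p x' y' Y')"
  then obtain x' y' X' Y' where g': "geodesic p \<epsilon> P x' y'" and X': "X' \<in> perp p x' y'" and Y': "Y' \<in> perp p x' y'"
    and V: "wedge x X + wedge y Y = wedge x' X' + wedge y' Y'"
    and W: "W = wedge x' (J'_plane p x' y' X') + wedge y' (J'_plane p x' y' Y')" by blast
  have perp: "perp p x' y' = perp p x y"
    using perp_eq_kernel[OF g eps] perp_eq_kernel[OF g' eps] by simp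
  have "adapted_basis p x' y' = adapted_basis p x y"
    unfolding adapted_basis_def fun_eq_iff perp positively_oriented_iff[OF four eps g]
      positively_oriented_iff[OF four eps g'] by simp
  then have J': "J'_plane p x' y' = J'_plane p x y" by (simp add: J'_plane_def fun_eq_iff)
  obtain e1 e2 where e: "adapted_basis p x y e1 e2" using ex_adapted[OF four eps g] .
  note J = J'_plane_eq[OF four eps g e] and lin = rotation_linear[OF four eps g, of "ip p e2 e2"]
  obtain a b c d where x': "x' = a *\<^sub>R x + b *\<^sub>R y" and y': "y' = c *\<^sub>R x + d *\<^sub>R y"
    using geodesic_change[OF g g' eps] .
  have "wedge x X + wedge y Y = wedge x (a *\<^sub>R X' + c *\<^sub>R Y') + wedge y (b *\<^sub>R X' + d *\<^sub>R Y')"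
    unfolding V x' y' by (simp add: wedge_simps)
  from tangent_unique[OF g eps X Y _ _ this] X' Y'
  have XY: "X = a *\<^sub>R X' + c *\<^sub>R Y'" "Y = b *\<^sub>R X' + d *\<^sub>R Y'"
    unfolding perp by (simp_all add: perp_simps)
  show "W = wedge x (J'_plane p x y X) + wedge y (J'_plane p x y Y)"
    unfolding W J' J[OF X] J[OF Y] J[OF X'[unfolded perp]] J[OF Y'[unfolded perp]]
    unfolding XY lin x' y' by (simp add: wedge_simps)
qed

text \<open>Pairing with a rotated vector is, up to the sign \<open>s\<close>, a determinant
  containing \<open>x\<close> and \<open>y\<close>. The two determinants that appear in \<Omega> are
  exactly those in the expansion of \<open>klein\<close>, which no longer refers to
  \<open>P\<close>.\<close>

lemma kahler_structure_G':
  assumes four: "CARD('m) = 4" and eps: "\<epsilon> \<in> {-1, 1}"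
  shows "kahler_structure p \<epsilon> (G'_metric p \<epsilon>) (J'_geo p \<epsilon>) (klein :: 'm::{finite,linorder} bivec \<Rightarrow> _)"
  unfolding kahler_structure_def Let_def
proof (intro conjI allI impI bilinear_klein)
  fix P x y assume g: "geodesic p \<epsilon> P x (y :: 'm rvec)"
  obtain e1 e2 where e: "adapted_basis p x y e1 e2" using ex_adapted[OF four eps g] .
  define s where "s = ip p e2 e2"
  define \<kappa> where "\<kappa> = ip p e1 e1 * ip p e2 e2"
  have s: "s \<in> {-1, 1}" using adapted_props(5)[OF four eps g e] by (simp add: s_def)
  define r where "r = rotation p x y s"
  note rp = rotation_perp[OF four eps g, of s, folded r_def]
  have ipr: "ip p U (r X) = - s * det4 x y U X" for U X
    unfolding r_def by (rule ip_rotation[OF four eps g])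
  have iso: "ip p (r X) (r Y) = \<kappa> * ip p X Y" if "X \<in> perp p x y" "Y \<in> perp p x y" for X Y
    using rotation_isometry[OF four eps g e that] by (simp add: r_def s_def \<kappa>_def)
  have J: "J'_geo p \<epsilon> P (wedge x X + wedge y Y) = wedge x (r X) + wedge y (r Y)"
    if "X \<in> perp p x y" "Y \<in> perp p x y" for X Y
    unfolding J'_geo_wedge[OF four eps g that] J'_plane_eq[OF four eps g e that(1)] J'_plane_eq[OF four eps g e that(2)]
    by (simp add: r_def s_def)
  have G': "G'_metric p \<epsilon> P (wedge x X + wedge y Y) (wedge x X' + wedge y Y') = ip p X (r Y') - ip p Y (r X')"
    if X: "X \<in> perp p x y" "Y \<in> perp p x y" "X' \<in> perp p x y" "Y' \<in> perp p x y" for X Y X' Y'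
    unfolding G'_metric_def J[OF X(3,4)] by (rule Omega_tangent[OF g eps X(1,2) rp rp])
  have sw: "det4 x y X Y = - det4 x y Y X" for X Y using det4_swap(3)[OF four, of x y Y X] by simp
  have K: "klein (wedge x X + wedge y Y) (wedge x X' + wedge y Y') = - det4 x y X Y' + det4 x y Y X'" for X Y X' Y'
  proof -
    have "det4 x X y Y' = - det4 x y X Y'" "det4 y Y x X' = det4 x y Y X'"
      using det4_swap(2)[OF four, of x y X Y'] det4_swap(1)[OF four, of y x Y X'] det4_swap(2)[OF four, of y x Y X']
      by simp_all
    then show ?thesis
      by (simp add: bilinear_ladd[OF bilinear_klein] bilinear_radd[OF bilinear_klein] klein_wedge[OF four] det4_same[OF four])
  qed
  have "G'_metric p \<epsilon> P (wedge x X + wedge y Y) (wedge x X' + wedge y Y')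
        = s * klein (wedge x X + wedge y Y) (wedge x X' + wedge y Y')
      \<and> (\<exists>Z\<in>perp p x y. \<exists>Z'\<in>perp p x y. J'_geo p \<epsilon> P (wedge x X + wedge y Y) = wedge x Z + wedge y Z')
      \<and> Omega p \<epsilon> P (J'_geo p \<epsilon> P (wedge x X + wedge y Y)) (wedge x X' + wedge y Y')
        = - G'_metric p \<epsilon> P (wedge x X + wedge y Y) (wedge x X' + wedge y Y')
      \<and> G'_metric p \<epsilon> P (J'_geo p \<epsilon> P (wedge x X + wedge y Y)) (wedge x X' + wedge y Y')
        = \<kappa> * Omega p \<epsilon> P (wedge x X + wedge y Y) (wedge x X' + wedge y Y')"
    if X: "X \<in> perp p x y" "Y \<in> perp p x y" "X' \<in> perp p x y" "Y' \<in> perp p x y" for X Y X' Y'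
  proof (intro conjI)
    show "G'_metric p \<epsilon> P (wedge x X + wedge y Y) (wedge x X' + wedge y Y')
        = s * klein (wedge x X + wedge y Y) (wedge x X' + wedge y Y')"
      unfolding G'[OF X] K ipr by (simp add: algebra_simps)
    show "\<exists>Z\<in>perp p x y. \<exists>Z'\<in>perp p x y. J'_geo p \<epsilon> P (wedge x X + wedge y Y) = wedge x Z + wedge y Z'"
      unfolding J[OF X(1,2)] using rp by blast
    show "Omega p \<epsilon> P (J'_geo p \<epsilon> P (wedge x X + wedge y Y)) (wedge x X' + wedge y Y')
        = - G'_metric p \<epsilon> P (wedge x X + wedge y Y) (wedge x X' + wedge y Y')"
      unfolding G'[OF X] J[OF X(1,2)] Omega_tangent[OF g eps rp rp X(3,4)]
        ip_commute[of p "r _"] ipr using sw[of X Y'] sw[of Y X'] by simp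
    show "G'_metric p \<epsilon> P (J'_geo p \<epsilon> P (wedge x X + wedge y Y)) (wedge x X' + wedge y Y')
        = \<kappa> * Omega p \<epsilon> P (wedge x X + wedge y Y) (wedge x X' + wedge y Y')"
      unfolding J[OF X(1,2)] G'[OF rp rp X(3,4)] Omega_tangent[OF g eps X] iso[OF X(1,4)] iso[OF X(2,3)]
      by (simp add: right_diff_distrib)
  qed
  then show "\<exists>s\<in>{-1, 1}. \<exists>\<kappa>. \<forall>X\<in>perp p x y. \<forall>Y\<in>perp p x y. \<forall>X'\<in>perp p x y. \<forall>Y'\<in>perp p x y.
           G'_metric p \<epsilon> P (wedge x X + wedge y Y) (wedge x X' + wedge y Y') =
           s * klein (wedge x X + wedge y Y) (wedge x X' + wedge y Y') \<and>
           (\<exists>Z\<in>perp p x y. \<exists>Z'\<in>perp p x y. J'_geo p \<epsilon> P (wedge x X + wedge y Y) = wedge x Z + wedge y Z') \<and>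
           Omega p \<epsilon> P (J'_geo p \<epsilon> P (wedge x X + wedge y Y)) (wedge x X' + wedge y Y') =
           - G'_metric p \<epsilon> P (wedge x X + wedge y Y) (wedge x X' + wedge y Y') \<and>
           G'_metric p \<epsilon> P (J'_geo p \<epsilon> P (wedge x X + wedge y Y)) (wedge x X' + wedge y Y') =
           \<kappa> * Omega p \<epsilon> P (wedge x X + wedge y Y) (wedge x X' + wedge y Y')"
    using s by blast
qed

section \<open>Hypersurfaces at a point\<close>

lemma det_card_2:
  fixes M :: "real ^ 'n ^ 'n"
  assumes "UNIV = {i, j :: 'n::finite}" "i \<noteq> j"
  shows "det M = M $ i $ i * M $ j $ j - M $ i $ j * M $ j $ i"
proof -
  have f: "finite {j}" "i \<notin> {j}" using assms by auto
  show ?thesis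
    unfolding det_def assms(1) unfolding sum_over_permutations_insert[OF f] unfolding permutes_sing
    using assms(2) by (simp add: sign_swap_id sign_id swap_id_eq)
qed

text \<open>For two by two matrices this is the discriminant of the characteristic polynomial; with
  eigenvalues \<open>k1\<close> and \<open>k2\<close> it is the square of
  \<open>k1 - k2\<close>.\<close>

definition disc :: "real ^ 'n ^ 'n \<Rightarrow> real" where
  "disc M = (trace M)\<^sup>2 - 4 * det M"

lemma disc_card_2:
  fixes M :: "real ^ 'n ^ 'n"
  assumes U: "UNIV = {i, j :: 'n::finite}" "i \<noteq> j"
  shows "disc M = (M $ i $ i - M $ j $ j)\<^sup>2 + 4 * M $ i $ j * M $ j $ i"
proof -
  have "trace M = M $ i $ i + M $ j $ j" unfolding trace_def U(1) using U(2) by simp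
  then show ?thesis by (simp add: disc_def det_card_2[OF U] power2_eq_square algebra_simps)
qed

text \<open>The point of the hypersurface is \<open>x\<close>, its normal is \<open>N\<close>, and \<open>L\<close>, \<open>B\<close> are the differentials
  of the immersion and of the unit normal field.\<close>

locale hframe =
  fixes p :: nat and \<epsilon> :: real and x N :: "'m::{finite,linorder} rvec"
    and L B :: "real ^ 'n::finite \<Rightarrow> 'm rvec"
  assumes card: "CARD('m) = CARD('n) + 2" and eps: "\<epsilon> \<in> {-1, 1}"
    and xx: "ip p x x = 1" and NN: "ip p N N = \<epsilon>" and Nx: "ip p N x = 0"
    and linear_L: "linear L" and linear_B: "linear B"
    and Lx: "\<And>v. ip p (L v) x = 0" and LN: "\<And>v. ip p (L v) N = 0"
    and nondegenerate: "\<And>v. (\<And>w. ip p (L v) (L w) = 0) \<Longrightarrow> v = 0"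
    and Bx: "\<And>v. ip p (B v) x = 0" and BN: "\<And>v. ip p (B v) N = 0"
    and BL: "\<And>v w. ip p (B v) (L w) = ip p (L v) (B w)"
begin

lemma sym_facts: "ip p x N = 0" "ip p x (L v) = 0" "ip p N (L v) = 0" "ip p x (B v) = 0" "ip p N (B v) = 0"
  using Nx Lx[of v] LN[of v] Bx[of v] BN[of v] ip_commute[of p x N] ip_commute[of p x "L v"] ip_commute[of p N "L v"]
    ip_commute[of p x "B v"] ip_commute[of p N "B v"] by simp_all

lemma geo: "geodesic p \<epsilon> (wedge x N) x N"
  by (simp add: geodesic_def pseudo_sphere_def xx NN sym_facts)

lemma L_perp [simp]: "L v \<in> perp p x N" and B_perp [simp]: "B v \<in> perp p x N"
  by (simp_all add: perp_def Lx LN Bx BN)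

lemma L_inj: "L v = L w \<Longrightarrow> v = w"
proof -
  assume "L v = L w"
  then have "L (v - w) = 0" by (simp add: linear_diff[OF linear_L])
  then have "v - w = 0" by (intro nondegenerate) simp
  then show "v = w" by simp
qed

text \<open>Dimension count: the triples \<open>(a, b, z)\<close> are mapped injectively into a
  space of the same dimension.\<close>

lemma decompose: obtains a b z where "w = a *\<^sub>R x + b *\<^sub>R N + L z"
proof -
  define T where "T = (\<lambda>(a, b, z). a *\<^sub>R x + b *\<^sub>R N + L z)"
  have lin: "linear T"
    by (auto intro!: linearI simp: T_def linear_add[OF linear_L] linear_cmul[OF linear_L] algebra_simps)
  have "q = 0" if q: "T q = 0" for q
  proof -
    obtain a b z where abz: "q = (a, b, z)" by (cases q)
    have 0: "a *\<^sub>R x + b *\<^sub>R N + L z = 0" using q by (simp add: abz T_def)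
    have "a = 0" using arg_cong[OF 0, of "\<lambda>v. ip p v x"] by (simp add: xx Nx Lx)
    moreover have "b = 0" using arg_cong[OF 0, of "\<lambda>v. ip p v N"] eps by (auto simp: sym_facts NN LN)
    moreover have "z = 0" using 0 calculation L_inj[of z 0] by (simp add: linear_0[OF linear_L])
    ultimately show ?thesis by (simp add: abz zero_prod_def)
  qed
  then have "inj T" using linear_injective_0[OF lin] by blast
  then have "dim (range T) = DIM('m rvec)"
    using dim_image_eq[OF lin, of UNIV] by (simp add: card)
  then have "span (range T) = UNIV" by (simp only: dim_eq_full)
  then have "surj T"
    using linear_subspace_image[OF lin subspace_UNIV] by (simp add: span_eq_iff[symmetric])
  then obtain q where "w = T q" by blast
  then show thesis using that by (cases q) (auto simp: T_def)
qed

lemma perp_range: assumes "X \<in> perp p x N" obtains z where "X = L z"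
proof -
  obtain a b z where X: "X = a *\<^sub>R x + b *\<^sub>R N + L z" by (rule decompose)
  have "a = 0" using perpD(1)[OF assms] by (simp add: X xx Nx Lx)
  moreover have "b = 0" using perpD(2)[OF assms] eps by (auto simp: X sym_facts NN LN)
  ultimately show thesis using that X by simp
qed

lemma orthogonal_zero:
  assumes "ip p v x = 0" "ip p v N = 0" "\<And>w. ip p v (L w) = 0"
  shows "v = 0"
proof (rule ip_nondegenerate)
  fix w
  obtain a b z where "w = a *\<^sub>R x + b *\<^sub>R N + L z" by (rule decompose)
  then show "ip p v w = 0" using assms by simp
qed

text \<open>Compares the given normal with any other admissible one, in particular with the normal
  that the functionals select.\<close>

lemma normal_unique:
  assumes "ip p M x = 0" "\<And>w. ip p M (L w) = 0" "ip p M M = \<epsilon>"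
  obtains \<sigma> where "\<sigma> \<in> {-1, 1}" "M = \<sigma> *\<^sub>R N"
proof -
  define \<sigma> where "\<sigma> = \<epsilon> * ip p M N"
  have "M - \<sigma> *\<^sub>R N = 0"
    by (rule orthogonal_zero) (use assms eps in \<open>auto simp: \<sigma>_def Nx NN sym_facts\<close>)
  then have M: "M = \<sigma> *\<^sub>R N" by simp
  then have "\<sigma> * (\<sigma> * \<epsilon>) = \<epsilon>" using assms(3) by (simp add: NN)
  then have "\<sigma> * \<sigma> = 1" using eps by auto
  then have "\<sigma> \<in> {-1, 1}" using power2_eq_1_iff[of \<sigma>] by (auto simp: power2_eq_square)
  then show thesis using M that by blast
qed

text \<open>The differential of the Gauss map, by the product rule.\<close>

definition dG :: "real ^ 'n \<Rightarrow> 'm bivec" where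
  "dG v = wedge (L v) N + wedge x (B v)"

lemma dG_tangent: "dG v = wedge x (B v) + wedge N (- L v)"
  using wedge_commute[of "L v" N] by (simp add: dG_def wedge_simps)

lemma Omega_dG:
  assumes "X \<in> perp p x N" "Y \<in> perp p x N"
  shows "Omega p \<epsilon> (wedge x N) (wedge x X + wedge N Y) (dG w) = - ip p X (L w) - ip p Y (B w)"
  unfolding dG_tangent
  using Omega_tangent[OF geo eps assms B_perp perp_simps(4)[OF L_perp], of w w] by simp

text \<open>The Lagrangian condition for the Gauss map amounts to the symmetry \<open>BL\<close> of
  the second fundamental form.\<close>

lemma lagrangian_dG: "Omega p \<epsilon> (wedge x N) (dG v) (dG w) = 0"
proof -
  have "Omega p \<epsilon> (wedge x N) (dG v) (dG w) = - ip p (B v) (L w) + ip p (L v) (B w)"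
    unfolding dG_tangent[of v] Omega_dG[OF B_perp perp_simps(4)[OF L_perp]] by simp
  then show ?thesis using BL by simp
qed

text \<open>A Lagrangian subspace is its own \<Omega>-orthogonal complement. Here \<open>Y\<close>
  determines \<open>v\<close> because \<open>L\<close> maps onto \<open>perp p x N\<close>, and the
  pairings with all \<open>dG w\<close> then force \<open>X = B v\<close>.\<close>

lemma lagrangian_maximal:
  assumes X: "X \<in> perp p x N" and Y: "Y \<in> perp p x N"
    and 0: "\<And>w. Omega p \<epsilon> (wedge x N) (wedge x X + wedge N Y) (dG w) = 0"
  shows "wedge x X + wedge N Y \<in> range dG"
proof -
  obtain v where v: "- Y = L v" using perp_range[OF perp_simps(4)[OF Y]] .
  have "X - B v = 0"
  proof (rule orthogonal_zero)
    show "ip p (X - B v) (L w) = 0" for w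
      using 0[of w] BL[of v w] unfolding Omega_dG[OF X Y] v[symmetric] by simp
  qed (simp_all add: perpD[OF X] Bx BN)
  then have "wedge x X + wedge N Y = dG v" by (simp add: dG_tangent v[symmetric])
  then show ?thesis by blast
qed

text \<open>For fixed \<open>Y\<close> the pairings determine the products of \<open>X\<close> with
  all tangent vectors of the hypersurface, and these fill \<open>perp p x N\<close>.\<close>

lemma tangent_eqI:
  assumes X: "X \<in> perp p x N" "X' \<in> perp p x N" and Y: "Y \<in> perp p x N"
    and eq: "\<And>w. Omega p \<epsilon> (wedge x N) (wedge x X + wedge N Y) (dG w)
      = Omega p \<epsilon> (wedge x N) (wedge x X' + wedge N Y) (dG w)"
  shows "X = X'"
proof -
  have "X - X' = 0"
  proof (rule orthogonal_zero)
    show "ip p (X - X') (L w) = 0" for w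
      using eq[of w] unfolding Omega_dG[OF X(1) Y] Omega_dG[OF X(2) Y] by simp
  qed (simp_all add: perpD[OF X(1)] perpD[OF X(2)])
  then show ?thesis by simp
qed

definition S :: "real ^ 'n \<Rightarrow> real ^ 'n" where
  "S v = (THE w. L w = - B v)"

lemma S_eq: "L (S v) = - B v"
proof -
  obtain z where "- B v = L z" using perp_range[OF perp_simps(4)[OF B_perp]] .
  then have "\<exists>!w. L w = - B v" using L_inj by metis
  then show ?thesis unfolding S_def by (rule theI')
qed

lemma B_eq: "B v = - L (S v)"
  using S_eq[of v] by simp

lemma linear_S: "linear S"
  by (intro linearI; rule L_inj)
    (simp_all add: S_eq linear_add[OF linear_L] linear_cmul[OF linear_L] linear_add[OF linear_B] linear_cmul[OF linear_B])

definition g :: "real ^ 'n \<Rightarrow> real ^ 'n \<Rightarrow> real" where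
  "g v w = ip p (L v) (L w)"

lemma bilinear_g: "bilinear g"
  unfolding g_def by (rule bilinear_compose[OF bilinear_ip linear_L])

lemma g_commute: "g v w = g w v"
  by (simp add: g_def ip_commute)

lemma S_symmetric: "g (S v) w = g v (S w)"
  using BL[of v w] by (simp add: g_def S_eq)

lemma det_gram_g: "det (gram g) \<noteq> 0"
proof
  assume "det (gram g) = 0"
  then have "\<not> (\<exists>M. M ** gram g = mat 1)"
    using invertible_det_nz[of "gram g"] invertible_left_inverse[of "gram g"] by simp
  then obtain v where v: "gram g *v v = 0" "v \<noteq> 0"
    using matrix_left_invertible_ker[of "gram g"] by blast
  have "g w v = 0" for w using gram_vec[OF bilinear_g, of w v] v(1) by simp
  then have "g v w = 0" for w using g_commute[of v w] by (simp only:)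
  then show False using nondegenerate[of v] v(2) by (simp add: g_def)
qed

text \<open>Self-adjointness moves the second \<open>S\<close> across, so the form is
  \<open>g (T v) w\<close> with \<open>T\<close> the sum of \<epsilon> and the square of
  \<open>S\<close>.\<close>

lemma det_gram_G:
  "\<bar>det (gram (\<lambda>v w. biv_ip p (dG v) (dG w)))\<bar> =
    \<bar>det (\<epsilon> *\<^sub>R mat 1 + matrix S ** matrix S)\<bar> * \<bar>det (gram g)\<bar>"
proof -
  define T where "T v = \<epsilon> *\<^sub>R v + S (S v)" for v
  have lT: "linear T"
    by (auto intro!: linearI simp: T_def linear_add[OF linear_S] linear_cmul[OF linear_S] algebra_simps)
  have "biv_ip p (dG v) (dG w) = g (T v) w" for v w
  proof -
    have "biv_ip p (dG v) (dG w) = ip p (B v) (B w) + \<epsilon> * ip p (L v) (L w)"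
      by (simp add: dG_tangent bilinear_ladd[OF bilinear_biv_ip] bilinear_radd[OF bilinear_biv_ip] biv_ip_wedge
          xx NN Nx sym_facts Lx LN Bx BN)
    also have "\<dots> = g (S v) (S w) + \<epsilon> * g v w" by (simp add: g_def S_eq)
    also have "\<dots> = g (T v) w"
      by (simp add: T_def bilinear_ladd[OF bilinear_g] bilinear_lmul[OF bilinear_g] S_symmetric)
    finally show ?thesis .
  qed
  then have "gram (\<lambda>v w. biv_ip p (dG v) (dG w)) = gram (\<lambda>v w. g (T v) (id w))" by (simp add: gram_def)
  then have "det (gram (\<lambda>v w. biv_ip p (dG v) (dG w))) = det (matrix T) * det (gram g)"
    by (simp only: det_gram_compose[OF bilinear_g lT linear_id] matrix_id_mat_1 det_I mult_1_right)
  moreover have "matrix T = \<epsilon> *\<^sub>R mat 1 + matrix S ** matrix S"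
  proof -
    have "matrix T *v v = (\<epsilon> *\<^sub>R mat 1 + matrix S ** matrix S) *v v" for v
      by (simp add: matrix_real[OF lT] matrix_vector_mult_add_rdistrib matrix_vector_mul_assoc[symmetric]
          matrix_real[OF linear_S] scaleR_matrix_vector_assoc[symmetric] T_def)
    then show ?thesis by (simp add: matrix_eq)
  qed
  ultimately show ?thesis by (simp add: abs_mult)
qed

text \<open>The area form \<open>\<beta>\<close> of the tangent plane turns the pairing into
  \<open>\<beta> v (S w) - \<beta> (S v) w\<close>. As \<open>\<beta>\<close> is \<open>c\<close>
  times the coordinate determinant, the Gram determinant is minus the square of \<open>c\<close>
  times the discriminant of \<open>S\<close>.\<close>

lemma det_gram_klein:
  assumes two: "CARD('n) = 2"
  shows "\<bar>det (gram (\<lambda>v w. klein (dG v) (dG w)))\<bar> = \<bar>disc (matrix S)\<bar> * \<bar>det (gram g)\<bar>"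
proof -
  have four: "CARD('m) = 4" using card two by simp
  obtain i j :: 'n where U: "UNIV = {i, j}" "i \<noteq> j" using two card_2_iff[of "UNIV :: 'n set"] by auto
  define \<beta> where "\<beta> v w = det4 x N (L v) (L w)" for v w
  have \<beta>_lin: "\<beta> (u + v) w = \<beta> u w + \<beta> v w" "\<beta> u (v + w) = \<beta> u v + \<beta> u w"
      "\<beta> (r *\<^sub>R v) w = r * \<beta> v w" "\<beta> v (r *\<^sub>R w) = r * \<beta> v w" "\<beta> v v = 0" for u v w r
    by (simp_all add: \<beta>_def linear_add[OF linear_L] linear_cmul[OF linear_L] det4_add[OF four] det4_scale[OF four] det4_same[OF four])
  define ei where "ei = (axis i 1 :: real ^ 'n)"
  define ej where "ej = (axis j 1 :: real ^ 'n)"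
  have anti: "\<beta> ej ei = - \<beta> ei ej" using det4_swap(3)[OF four, of x N "L ej" "L ei"] by (simp add: \<beta>_def)
  have ex: "v = v $ i *\<^sub>R ei + v $ j *\<^sub>R ej" for v
    unfolding vec_eq_iff
  proof
    fix k
    have "k = i \<or> k = j" using U(1) by blast
    then show "v $ k = (v $ i *\<^sub>R ei + v $ j *\<^sub>R ej) $ k" using U(2) by (auto simp: ei_def ej_def axis_def)
  qed
  define c where "c = \<beta> ei ej"
  have \<beta>: "\<beta> v w = c * (v $ i * w $ j - v $ j * w $ i)" for v w
    by (subst ex[of v], subst ex[of w]) (simp add: \<beta>_lin anti c_def algebra_simps)
  have K: "klein (dG v) (dG w) = - \<beta> (S v) w + \<beta> v (S w)" for v w
  proof -
    have "det4 x (B v) N (- L w) = det4 x N (B v) (L w)" "det4 N (- L v) x (B w) = - det4 x N (L v) (B w)"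
      using det4_swap(2)[OF four, of x N "B v" "L w"] det4_swap(1)[OF four, of N x "L v" "B w"]
        det4_swap(2)[OF four, of N x "L v" "B w"] det4_scale(4)[OF four, of x "B v" N "-1" "L w"]
        det4_scale(2)[OF four, of N "-1" "L v" x "B w"] by simp_all
    then have "klein (dG v) (dG w) = det4 x N (B v) (L w) - det4 x N (L v) (B w)"
      by (simp add: dG_tangent bilinear_ladd[OF bilinear_klein] bilinear_radd[OF bilinear_klein] klein_wedge[OF four] det4_same[OF four])
    also have "\<dots> = - \<beta> (S v) w + \<beta> v (S w)"
      using det4_scale(3)[OF four, of x N "-1" "L (S v)" "L w"] det4_scale(4)[OF four, of x N "L v" "-1" "L (S w)"]
      by (simp add: \<beta>_def B_eq)
    finally show ?thesis .
  qed
  define M where "M = matrix S"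
  have M: "S ei $ k = M $ k $ i" "S ej $ k = M $ k $ j" for k by (simp_all add: M_def matrix_def ei_def ej_def)
  have e: "ei $ i = 1" "ei $ j = 0" "ej $ i = 0" "ej $ j = 1" using U(2) by (auto simp: ei_def ej_def axis_def)
  have "det (gram (\<lambda>v w. klein (dG v) (dG w)))
      = klein (dG ei) (dG ei) * klein (dG ej) (dG ej) - klein (dG ei) (dG ej) * klein (dG ej) (dG ei)"
    unfolding det_card_2[OF U] by (simp add: gram_def ei_def ej_def)
  also have "\<dots> = - (c\<^sup>2 * disc M)"
    unfolding K \<beta> M e disc_card_2[OF U] by (simp add: power2_eq_square algebra_simps)
  finally have 1: "\<bar>det (gram (\<lambda>v w. klein (dG v) (dG w)))\<bar> = \<bar>disc M\<bar> * c\<^sup>2" by (simp add: abs_mult)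
  \<comment> \<open>In an adapted basis \<open>c\<close> is the determinant of the matrix that
    expresses \<open>L ei\<close> and \<open>L ej\<close>, and the Gram determinant of
    \<open>g\<close> is, up to sign, the square of the same determinant.\<close>
  obtain e1 e2 where ad: "adapted_basis p x N e1 e2" using ex_adapted[OF four eps geo] .
  note ap = adapted_props[OF four eps geo ad]
  obtain a b where ab: "L ei = a *\<^sub>R e1 + b *\<^sub>R e2" using adapted_expand[OF four eps geo ad L_perp] .
  obtain r s where rs: "L ej = r *\<^sub>R e1 + s *\<^sub>R e2" using adapted_expand[OF four eps geo ad L_perp] .
  have "det4 x N e2 e1 = -1" using det4_swap(3)[OF four, of x N e2 e1] ap(6) by simp
  then have c: "c = a * s - b * r"
    unfolding c_def \<beta>_def ab rs using ap(6) by (simp add: det4_add[OF four] det4_scale[OF four] det4_same[OF four] algebra_simps)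
  have "det (gram g) = g ei ei * g ej ej - g ei ej * g ej ei"
    unfolding det_card_2[OF U] by (simp add: gram_def ei_def ej_def)
  also have "\<dots> = ip p e1 e1 * ip p e2 e2 * c\<^sup>2"
    unfolding g_def ab rs c using ap(3) ip_commute[of p e2 e1] by (simp add: power2_eq_square algebra_simps)
  finally have "\<bar>det (gram g)\<bar> = c\<^sup>2" using ap(4,5) by (auto simp: abs_mult)
  then show ?thesis using 1 by (simp add: M_def)
qed

text \<open>The component of \<open>x'\<close> along \<open>N\<close> and that of \<open>N'\<close>
  along \<open>x\<close> vanish in the wedge products. Subtracting them brings the velocity of the
  Gauss map into the standard form with both vectors in \<open>perp p x N\<close>.\<close>

lemma Omega_variation:
  assumes "ip p x' x = 0" "ip p N' N = 0"
  shows "wedge x' N + wedge x N' = wedge x (N' - ip p N' x *\<^sub>R x) + wedge N (- (x' - (\<epsilon> * ip p x' N) *\<^sub>R N))" (is "_ = ?V")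
    and "N' - ip p N' x *\<^sub>R x \<in> perp p x N" "- (x' - (\<epsilon> * ip p x' N) *\<^sub>R N) \<in> perp p x N"
    and "Omega p \<epsilon> (wedge x N) (wedge x' N + wedge x N') (dG w) = - ip p N' (L w) + ip p x' (B w)"
proof -
  show 1: "wedge x' N + wedge x N' = ?V"
    using wedge_commute[of x' N] by (simp add: wedge_simps)
  show 2: "N' - ip p N' x *\<^sub>R x \<in> perp p x N" "- (x' - (\<epsilon> * ip p x' N) *\<^sub>R N) \<in> perp p x N"
    using assms eps by (auto simp: perp_def xx NN Nx sym_facts)
  show "Omega p \<epsilon> (wedge x N) (wedge x' N + wedge x N') (dG w) = - ip p N' (L w) + ip p x' (B w)"
    unfolding 1 Omega_dG[OF 2] by (simp add: sym_facts)
qed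

end

section \<open>Smooth families of maps\<close>

lemma has_vector_derivative_fst:
  assumes "(f has_derivative D) (at (t, u))"
  shows "((\<lambda>s. f (s, u)) has_vector_derivative D (1, 0)) (at t)"
proof -
  have "((\<lambda>s. (s, u)) has_derivative (\<lambda>v. (v, 0))) (at t)"
    by (auto intro!: derivative_eq_intros)
  from has_derivative_compose[OF this assms]
  have "((\<lambda>s. f (s, u)) has_derivative (\<lambda>v. D (v, 0))) (at t)" .
  moreover have "D (v, 0) = v *\<^sub>R D (1, 0)" for v
    using linear_cmul[OF has_derivative_linear[OF assms], of v "(1, 0)"] by simp
  then have "(\<lambda>v. D (v, 0)) = (\<lambda>v. v *\<^sub>R D (1, 0))" by (rule ext)
  ultimately show ?thesis unfolding has_vector_derivative_def by (simp only:)
qed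

context omfd begin

lemma smooth_map_bilinear:
  fixes f :: "'a \<Rightarrow> 'e::euclidean_space" and g :: "'a \<Rightarrow> 'f::euclidean_space"
  assumes "bilinear b" "smooth_map A f" "smooth_map A g"
  shows "smooth_map A (\<lambda>x. b (f x) (g x))"
  unfolding smooth_map_def
proof
  fix c assume c: "c \<in> A"
  show "smooth_on (chart_range c) ((\<lambda>x. b (f x) (g x)) \<circ> chart_inv c)"
    using smooth_on_bilinear[OF assms(1) open_range[OF c], of "f \<circ> chart_inv c" "g \<circ> chart_inv c"] assms(2,3) c
    by (simp add: smooth_map_def comp_def)
qed

lemma differential_bilinear:
  fixes f :: "'a \<Rightarrow> 'e::euclidean_space" and g :: "'a \<Rightarrow> 'f::euclidean_space"
  assumes b: "bilinear b" and f: "smooth_map A f" and g: "smooth_map A g" and c: "c \<in> A" "x \<in> fst c"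
  shows "differential c (\<lambda>x. b (f x) (g x)) x v = b (f x) (differential c g x v) + b (differential c f x v) (g x)"
proof -
  have "((\<lambda>u. b ((f \<circ> chart_inv c) u) ((g \<circ> chart_inv c) u)) has_derivative
      (\<lambda>v. b (f x) (differential c g x v) + b (differential c f x v) (g x))) (at (snd c x))"
    using bounded_bilinear.FDERIV[OF _ smooth_map_has_derivative[OF f c] smooth_map_has_derivative[OF g c], of b]
      b c by (simp add: bilinear_conv_bounded_bilinear)
  then show ?thesis
    unfolding differential_def using frechet_eqI by (fastforce simp: comp_def)
qed

lemma differential_locally_const:
  assumes "c \<in> A" "x \<in> fst c" "open V" "x \<in> V" "\<And>y. y \<in> V \<Longrightarrow> y \<in> fst c \<Longrightarrow> f y = k"
  shows "differential c f x v = 0"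
proof -
  have a: "((\<lambda>_. k) has_derivative (\<lambda>_. 0)) (at (snd c x))" by simp
  have o: "open (snd c ` (fst c \<inter> V))"
    by (rule open_image) (use assms(1,3) open_fst[OF assms(1)] in auto)
  have e: "k = (f \<circ> chart_inv c) u" if u: "u \<in> snd c ` (fst c \<inter> V)" for u
  proof -
    obtain y where "y \<in> fst c" "y \<in> V" "u = snd c y" using u by blast
    then show ?thesis using assms(1) assms(5)[of y] by simp
  qed
  have "((f \<circ> chart_inv c) has_derivative (\<lambda>_. 0)) (at (snd c x))"
    by (rule has_derivative_transform_within_open[OF a o _ e]) (use assms(2,4) in auto)
  then show ?thesis by (simp add: differential_def frechet_eqI)
qed

text \<open>The local expression as a single function of time and coordinates, so that time and
  space derivatives are directional derivatives of one map.\<close>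

definition fam :: "(real \<Rightarrow> 'a \<Rightarrow> 'e) \<Rightarrow> ('a, 'n) chart \<Rightarrow> real \<times> (real ^ 'n) \<Rightarrow> 'e" where
  "fam F c q = F (fst q) (chart_inv c (snd q))"

definition smooth_family :: "real \<Rightarrow> (real \<Rightarrow> 'a \<Rightarrow> 'e::real_normed_vector) \<Rightarrow> bool" where
  "smooth_family \<delta> F \<longleftrightarrow> \<delta> > 0 \<and> (\<forall>c\<in>A. smooth_on ({-\<delta><..<\<delta>} \<times> chart_range c) (fam F c))"

definition velocity :: "(real \<Rightarrow> 'a \<Rightarrow> 'e::real_normed_vector) \<Rightarrow> 'a \<Rightarrow> 'e" where
  "velocity F x = vector_derivative (\<lambda>t. F t x) (at 0)"

lemma open_box: "c \<in> A \<Longrightarrow> open ({-\<delta><..<\<delta> :: real} \<times> chart_range c)"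
  by (intro open_Times open_range open_greaterThanLessThan)

lemma smooth_family_mono: "smooth_family \<delta> F \<Longrightarrow> 0 < \<delta>' \<Longrightarrow> \<delta>' \<le> \<delta> \<Longrightarrow> smooth_family \<delta>' F"
proof -
  assume F: "smooth_family \<delta> F" and d: "0 < \<delta>'" "\<delta>' \<le> \<delta>"
  have "smooth_on ({-\<delta>'<..<\<delta>'} \<times> chart_range c) (fam F c)" if c: "c \<in> A" for c
    by (rule smooth_on_subset[of "{-\<delta><..<\<delta>} \<times> chart_range c"])
      (use F d c in \<open>auto simp: smooth_family_def\<close>)
  then show ?thesis using d by (simp add: smooth_family_def)
qed

lemma smooth_family_const: "\<delta> > 0 \<Longrightarrow> smooth_map A f \<Longrightarrow> smooth_family \<delta> (\<lambda>_. f)"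
  unfolding smooth_family_def
proof (intro conjI ballI)
  fix c assume c: "c \<in> A" and f: "smooth_map A f"
  have "smooth_on ({-\<delta><..<\<delta>} \<times> chart_range c) (\<lambda>x. (f \<circ> chart_inv c) (snd x))"
    by (rule smooth_on_compose[where f = "f \<circ> chart_inv c" and g = snd and T = "chart_range c"])
      (use f[unfolded smooth_map_def, rule_format, OF c] in
        \<open>auto intro: smooth_on_snd open_range open_box c\<close>)
  then show "smooth_on ({-\<delta><..<\<delta>} \<times> chart_range c) (fam (\<lambda>_. f) c)"
    by (simp add: fam_def[abs_def] comp_def)
qed simp

lemma smooth_family_bilinear:
  fixes F :: "real \<Rightarrow> 'a \<Rightarrow> 'e::euclidean_space" and G :: "real \<Rightarrow> 'a \<Rightarrow> 'f::euclidean_space"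
  assumes "bilinear b" "smooth_family \<delta> F" "smooth_family \<delta> G"
  shows "smooth_family \<delta> (\<lambda>t x. b (F t x) (G t x))"
  unfolding smooth_family_def
proof (intro conjI ballI)
  fix c assume c: "c \<in> A"
  show "smooth_on ({-\<delta><..<\<delta>} \<times> chart_range c) (fam (\<lambda>t x. b (F t x) (G t x)) c)"
    using smooth_on_bilinear[OF assms(1) open_box[OF c], of \<delta> "fam F c" "fam G c"] assms(2,3) c
    by (simp add: smooth_family_def fam_def[abs_def])
qed (use assms in \<open>simp add: smooth_family_def\<close>)

context
  fixes \<delta> :: real and F :: "real \<Rightarrow> 'a \<Rightarrow> 'e::euclidean_space"
  assumes F: "smooth_family \<delta> F"
begin

lemma fam_has_derivative:
  assumes "c \<in> A" "x \<in> fst c" "\<bar>t\<bar> < \<delta>"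
  shows "(fam F c has_derivative frechet_derivative (fam F c) (at (t, snd c x))) (at (t, snd c x))"
  by (rule smooth_on_has_derivative[of "{-\<delta><..<\<delta>} \<times> chart_range c"])
    (use F assms in \<open>auto simp: smooth_family_def\<close>)

lemma family_has_derivative:
  assumes c: "c \<in> A" "x \<in> fst c" and t: "\<bar>t\<bar> < \<delta>"
  shows "((F t \<circ> chart_inv c) has_derivative (\<lambda>v. frechet_derivative (fam F c) (at (t, snd c x)) (0, v))) (at (snd c x))"
proof -
  have "((\<lambda>u. (t, u)) has_derivative (\<lambda>v. (0, v))) (at (snd c x))"
    by (auto intro!: derivative_eq_intros)
  from has_derivative_compose[OF this fam_has_derivative[OF c t]]
  show ?thesis by (simp add: fam_def[abs_def] comp_def)
qed

lemma family_differential: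
  assumes c: "c \<in> A" "x \<in> fst c" and t: "\<bar>t\<bar> < \<delta>"
  shows "differential c (F t) x v = frechet_derivative (fam F c) (at (t, snd c x)) (0, v)"
  unfolding differential_def using frechet_eqI[OF family_has_derivative[OF assms]] by simp

lemma smooth_family_map:
  assumes t: "\<bar>t\<bar> < \<delta>"
  shows "smooth_map A (F t)"
  unfolding smooth_map_def
proof
  fix c assume c: "c \<in> A"
  have "smooth_on (chart_range c) (\<lambda>u. fam F c (t, u))"
    by (rule smooth_on_compose[of "{-\<delta><..<\<delta>} \<times> chart_range c"])
      (use F c t in \<open>auto simp: smooth_family_def intro!: smooth_intros open_range open_box\<close>)
  then show "smooth_on (chart_range c) (F t \<circ> chart_inv c)" by (simp add: fam_def[abs_def] comp_def)
qed

lemma smooth_family_differential: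
  assumes c: "c \<in> A"
  shows "smooth_on ({-\<delta><..<\<delta>} \<times> chart_range c) (\<lambda>q. differential c (F (fst q)) (chart_inv c (snd q)) v)"
proof (rule smooth_on_cong[OF open_box[OF c]])
  show "smooth_on ({-\<delta><..<\<delta>} \<times> chart_range c) (\<lambda>q. frechet_derivative (fam F c) (at q) (0, v))"
    using F c by (intro smooth_on_frechet_const) (simp add: smooth_family_def)
  fix q assume "q \<in> {-\<delta><..<\<delta>} \<times> chart_range c"
  then show "frechet_derivative (fam F c) (at q) (0, v) = differential c (F (fst q)) (chart_inv c (snd q)) v"
    using family_differential[of c "chart_inv c (snd q)" "fst q" v] c by (auto simp: abs_less_iff)
qed

lemma zero_less: "\<bar>0 :: real\<bar> < \<delta>" "\<delta> > 0"
  using F by (simp_all add: smooth_family_def)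

lemma family_time_derivative:
  assumes c: "c \<in> A" "x \<in> fst c" and t: "\<bar>t\<bar> < \<delta>"
  shows "((\<lambda>s. F s x) has_vector_derivative frechet_derivative (fam F c) (at (t, snd c x)) (1, 0)) (at t)"
proof -
  show ?thesis
    using has_vector_derivative_fst[OF fam_has_derivative[OF c t]] c by (simp add: fam_def[of F])
qed

lemma velocity_eq:
  assumes c: "c \<in> A" "x \<in> fst c"
  shows "velocity F x = frechet_derivative (fam F c) (at (0, snd c x)) (1, 0)"
  unfolding velocity_def by (rule vector_derivative_at[OF family_time_derivative[OF c zero_less(1)]])

lemma family_velocity:
  assumes "x \<in> carrier A"
  shows "((\<lambda>s. F s x) has_vector_derivative velocity F x) (at 0)"
proof -
  obtain c where c: "c \<in> A" "x \<in> fst c" using carrierE[OF assms] .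
  show ?thesis unfolding velocity_eq[OF c] by (rule family_time_derivative[OF c zero_less(1)])
qed

lemma smooth_velocity_chart:
  assumes c: "c \<in> A"
  shows "smooth_on (chart_range c) (\<lambda>u. frechet_derivative (fam F c) (at (0, u)) (1, 0))"
  by (rule smooth_on_compose[of "{-\<delta><..<\<delta>} \<times> chart_range c" "\<lambda>q. frechet_derivative (fam F c) (at q) (1, 0)"])
    (use F c in \<open>auto simp: smooth_family_def intro!: smooth_intros open_range open_box smooth_on_frechet_const\<close>)

lemma smooth_velocity: "smooth_map A (velocity F)"
  unfolding smooth_map_def
proof
  fix c assume c: "c \<in> A"
  show "smooth_on (chart_range c) (velocity F \<circ> chart_inv c)"
    by (rule smooth_on_cong[OF open_range[OF c] smooth_velocity_chart[OF c]])
      (simp add: velocity_eq[OF c inv_in[OF c]] c)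
qed

text \<open>Time and space derivatives commute: symmetry of the second derivative of
  \<open>fam F c\<close> in the directions \<open>(1, 0)\<close> and \<open>(0, v)\<close>.\<close>

lemma differential_velocity:
  assumes c: "c \<in> A" "x \<in> fst c"
  shows "((\<lambda>t. differential c (F t) x v) has_vector_derivative differential c (velocity F) x v) (at 0)"
proof -
  let ?f = "fam F c" and ?q = "(0, snd c x)"
  let ?S = "{-\<delta><..<\<delta>} \<times> chart_range c"
  have S: "smooth_on ?S ?f" "open ?S" "?q \<in> ?S"
    using F c open_box[OF c(1)] by (auto simp: smooth_family_def)
  have d: "((\<lambda>q. frechet_derivative ?f (at q) w) has_derivative
      frechet_derivative (\<lambda>q. frechet_derivative ?f (at q) w) (at ?q)) (at ?q)" for w
    by (rule smooth_on_has_derivative[OF smooth_on_frechet_const[OF S(1)] S(3)])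
  have "((\<lambda>s. frechet_derivative ?f (at (s, snd c x)) (0, v)) has_vector_derivative
      frechet_derivative (\<lambda>q. frechet_derivative ?f (at q) (0, v)) (at ?q) (1, 0)) (at 0)"
    by (rule has_vector_derivative_fst[OF d])
  then have 1: "((\<lambda>t. differential c (F t) x v) has_vector_derivative
      frechet_derivative (\<lambda>q. frechet_derivative ?f (at q) (0, v)) (at ?q) (1, 0)) (at 0)"
    by (rule has_vector_derivative_transform_within_open[of _ _ _ "{-\<delta><..<\<delta>}"])
      (use zero_less family_differential[OF c] in \<open>auto simp: abs_less_iff\<close>)
  have "((\<lambda>u. (0, u)) has_derivative (\<lambda>v. (0, v))) (at (snd c x))"
    by (auto intro!: derivative_eq_intros)
  from has_derivative_compose[OF this d[of "(1, 0)"]]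
  have "((\<lambda>u. frechet_derivative ?f (at (0, u)) (1, 0)) has_derivative
      (\<lambda>v. frechet_derivative (\<lambda>q. frechet_derivative ?f (at q) (1, 0)) (at ?q) (0, v))) (at (snd c x))" .
  then have "((velocity F \<circ> chart_inv c) has_derivative
      (\<lambda>v. frechet_derivative (\<lambda>q. frechet_derivative ?f (at q) (1, 0)) (at ?q) (0, v))) (at (snd c x))"
    by (rule has_derivative_transform_within_open[OF _ open_range[OF c(1)]])
      (simp_all add: velocity_eq[OF c(1) inv_in[OF c(1)]] c)
  then have "differential c (velocity F) x v = frechet_derivative (\<lambda>q. frechet_derivative ?f (at q) (1, 0)) (at ?q) (0, v)"
    unfolding differential_def by (simp add: frechet_eqI)
  also have "\<dots> = frechet_derivative (\<lambda>q. frechet_derivative ?f (at q) (0, v)) (at ?q) (1, 0)"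
    by (rule mixed_derivatives[OF S])
  finally show ?thesis using 1 by simp
qed

end

text \<open>The positivity of the continuous function \<open>q\<close> stands for a condition that is open in time
  and space; compactness of \<open>K\<close> makes the time uniform.\<close>

lemma tube:
  assumes K: "compact K" "K \<subseteq> carrier A" and \<delta>: "\<delta> > 0"
    and q: "\<And>x. x \<in> K \<Longrightarrow> \<exists>c\<in>A. x \<in> fst c \<and> (\<exists>q :: real \<times> (real ^ 'n) \<Rightarrow> real.
      continuous_on ({-\<delta><..<\<delta>} \<times> chart_range c) q \<and> q (0, snd c x) > 0 \<and>
      (\<forall>t y. \<bar>t\<bar> < \<delta> \<longrightarrow> y \<in> fst c \<longrightarrow> q (t, snd c y) > 0 \<longrightarrow> P c t y))"
  obtains \<eta> where "0 < \<eta>" "\<eta> \<le> \<delta>" "\<And>y. y \<in> K \<Longrightarrow> \<exists>c\<in>A. y \<in> fst c \<and> (\<forall>t. \<bar>t\<bar> < \<eta> \<longrightarrow> P c t y)"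
proof -
  have "\<exists>V \<eta>. open V \<and> x \<in> V \<and> 0 < \<eta> \<and> \<eta> \<le> \<delta> \<and> (\<exists>c\<in>A. V \<subseteq> fst c \<and> (\<forall>y\<in>V. \<forall>t. \<bar>t\<bar> < \<eta> \<longrightarrow> P c t y))"
    if x: "x \<in> K" for x
  proof -
    obtain c q where c: "c \<in> A" "x \<in> fst c" and cont: "continuous_on ({-\<delta><..<\<delta>} \<times> chart_range c) q"
      and pos: "q (0, snd c x) > (0 :: real)"
      and P: "\<And>t y. \<bar>t\<bar> < \<delta> \<Longrightarrow> y \<in> fst c \<Longrightarrow> q (t, snd c y) > 0 \<Longrightarrow> P c t y"
      using q[OF x] by blast
    have "open (({-\<delta><..<\<delta>} \<times> chart_range c) \<inter> q -` {0<..})"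
      by (rule continuous_open_preimage[OF cont open_box[OF c(1)]]) simp
    moreover have "(0, snd c x) \<in> ({-\<delta><..<\<delta>} \<times> chart_range c) \<inter> q -` {0<..}"
      using pos c \<delta> by simp
    ultimately obtain T U where TU: "open T" "open U" "(0, snd c x) \<in> T \<times> U"
        "T \<times> U \<subseteq> ({-\<delta><..<\<delta>} \<times> chart_range c) \<inter> q -` {0<..}"
      by (rule open_prod_elim)
    obtain \<eta> where \<eta>: "\<eta> > 0" "ball 0 \<eta> \<subseteq> T" using TU(1,3) openE by blast
    define V where "V = fst c \<inter> snd c -` U"
    have V: "open V" "x \<in> V" "V \<subseteq> fst c"
      using continuous_open_preimage[OF cont_snd[OF c(1)] open_fst[OF c(1)] TU(2)] TU(3) c by (auto simp: V_def)
    have "P c t y" if y: "y \<in> V" "\<bar>t\<bar> < min \<eta> \<delta>" for y t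
    proof (rule P)
      have "t \<in> ball 0 \<eta>" using y(2) by simp
      then have "t \<in> T" using \<eta>(2) by blast
      moreover have "snd c y \<in> U" using y(1) by (simp add: V_def)
      ultimately have "(t, snd c y) \<in> T \<times> U" by simp
      then show "q (t, snd c y) > 0" using TU(4) by blast
    qed (use y V in auto)
    then show ?thesis
      using V c \<eta>(1) \<delta> by (intro exI[of _ V] exI[of _ "min \<eta> \<delta>"]) auto
  qed
  then obtain V \<eta> where V: "\<And>x. x \<in> K \<Longrightarrow> open (V x) \<and> x \<in> V x \<and> 0 < \<eta> x \<and> \<eta> x \<le> \<delta> \<and>
      (\<exists>c\<in>A. V x \<subseteq> fst c \<and> (\<forall>y\<in>V x. \<forall>t. \<bar>t\<bar> < \<eta> x \<longrightarrow> P c t y))"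
    by metis
  obtain D where D: "D \<subseteq> K" "finite D" "K \<subseteq> (\<Union>x\<in>D. V x)"
    using compactE_image[OF K(1), of K V] V by (metis (no_types, lifting) UN_iff subsetI)
  \<comment> \<open>Including \<open>\<delta>\<close> keeps the minimum meaningful when the subcover
    is empty.\<close>
  define e where "e = Min (insert \<delta> (\<eta> ` D))"
  have e: "0 < e" "e \<le> \<delta>" "\<And>x. x \<in> D \<Longrightarrow> e \<le> \<eta> x"
    using D V \<delta> by (auto simp: e_def)
  show thesis
  proof (rule that[OF e(1,2)])
    fix y assume "y \<in> K"
    then obtain x where x: "x \<in> D" "y \<in> V x" using D by blast
    then obtain c where "c \<in> A" "V x \<subseteq> fst c" "\<forall>y\<in>V x. \<forall>t. \<bar>t\<bar> < \<eta> x \<longrightarrow> P c t y" using V D by blast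
    then show "\<exists>c\<in>A. y \<in> fst c \<and> (\<forall>t. \<bar>t\<bar> < e \<longrightarrow> P c t y)"
      using x e(3)[OF x(1)] by (intro bexI[of _ c]) auto
  qed
qed

text \<open>In the application \<open>a\<close> and \<open>b\<close> are Gram determinants at time
  \<open>t\<close>, and \<open>d\<close> is the one at time zero. The second hypothesis keeps
  \<open>sqrt \<bar>b\<bar>\<close> above half of \<open>sqrt \<bar>d\<bar>\<close>, away from the
  point where the root fails to be Lipschitz; the double product in the square of the right side
  then exceeds \<open>s * \<bar>d\<bar> / 2\<close>, or equals it if \<open>s\<close> is
  zero.\<close>

lemma sqrt_difference_le:
  fixes a b d :: real
  assumes "\<bar>a - b\<bar> \<le> s * \<bar>d\<bar> / 2" "\<bar>b\<bar> \<ge> \<bar>d\<bar> / 4" "d \<noteq> 0"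
  shows "sqrt \<bar>a\<bar> \<le> sqrt \<bar>b\<bar> + s * sqrt \<bar>d\<bar>"
proof -
  define r where "r = sqrt \<bar>d\<bar>"
  have r: "r > 0" "r * r = \<bar>d\<bar>" using assms(3) by (simp_all add: r_def)
  have rb: "r / 2 \<le> sqrt \<bar>b\<bar>"
    using real_sqrt_le_mono[OF assms(2)] by (simp add: r_def real_sqrt_divide)
  have s0: "s \<ge> 0"
  proof -
    have "0 \<le> s * \<bar>d\<bar> / 2" using assms(1) abs_ge_zero order_trans by blast
    then show ?thesis using assms(3) by (simp add: zero_le_mult_iff)
  qed
  have "\<bar>a\<bar> \<le> \<bar>b\<bar> + s * \<bar>d\<bar> / 2" using assms(1) by linarith
  then have "\<bar>a\<bar> \<le> \<bar>b\<bar> + s * (r * r) / 2" by (simp only: r(2))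
  also have "\<dots> \<le> (sqrt \<bar>b\<bar> + s * r)\<^sup>2"
  proof -
    have "s * (r * r) / 2 \<le> s * r * sqrt \<bar>b\<bar>"
      using mult_left_mono[OF rb, of "s * r"] s0 r by (simp add: mult.assoc)
    moreover have "0 \<le> s * r * sqrt \<bar>b\<bar>" "0 \<le> (s * r)\<^sup>2" using s0 r by simp_all
    moreover have "(sqrt \<bar>b\<bar> + s * r)\<^sup>2 = \<bar>b\<bar> + (s * r)\<^sup>2 + 2 * (s * r * sqrt \<bar>b\<bar>)"
      by (simp add: power2_sum)
    ultimately show ?thesis by linarith
  qed
  finally have "sqrt \<bar>a\<bar> \<le> sqrt ((sqrt \<bar>b\<bar> + s * r)\<^sup>2)" by (rule real_sqrt_le_mono)
  then show ?thesis using s0 r by (simp add: r_def)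
qed

section \<open>Volumes of families with equal initial velocity\<close>

lemma has_derivative_det:
  fixes M :: "real ^ 'k ^ 'k"
  obtains D where "(det has_derivative D) (at M)"
proof -
  have "smooth_on UNIV (det :: real ^ 'k ^ 'k \<Rightarrow> real)"
    by (rule smooth_on_det[of UNIV "\<lambda>x. x"]) (auto intro!: smooth_intros)
  then show thesis using that smooth_on_has_derivative by blast
qed

lemma smooth_family_det:
  fixes F :: "real \<Rightarrow> 'a \<Rightarrow> 'e::euclidean_space"
  assumes F: "smooth_family \<delta> F" and b: "bilinear b" and c: "c \<in> A"
  shows "smooth_on ({-\<delta><..<\<delta>} \<times> chart_range c)
    (\<lambda>q. det (gram (pullback b c (F (fst q)) (chart_inv c (snd q)))))"
  unfolding gram_def pullback_def
  by (auto intro!: smooth_on_det smooth_on_bilinear[OF b] open_box[OF c] smooth_family_differential[OF F c])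

text \<open>Since time and space derivatives commute, the derivative of the Gram matrix at time zero
  is built from the map and the velocity at time zero only.\<close>

lemma det_gram_time_derivative:
  fixes F G :: "real \<Rightarrow> 'a \<Rightarrow> 'e::euclidean_space"
  assumes F: "smooth_family \<delta> F" and G: "smooth_family \<delta> G" and b: "bilinear b" and c: "c \<in> A" "x \<in> fst c"
    and eq0: "\<And>x. x \<in> carrier A \<Longrightarrow> F 0 x = G 0 x" and eq1: "\<And>x. x \<in> carrier A \<Longrightarrow> velocity F x = velocity G x"
  shows "((\<lambda>t. det (gram (pullback b c (F t) x)) - det (gram (pullback b c (G t) x))) has_real_derivative 0) (at 0)"
proof -
  have bb: "bounded_bilinear b" using b by (simp add: bilinear_conv_bounded_bilinear)
  have cong: "differential c f x v = differential c g x v"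
    if "\<And>x. x \<in> carrier A \<Longrightarrow> f x = g x" "smooth_map A g" for f g :: "'a \<Rightarrow> 'e" and v
    using differential_cong_open[OF c open_carrier _ _ that(2), of f] carrierI[OF c] that(1) by auto
  have e0: "differential c (F 0) x v = differential c (G 0) x v" for v
    by (rule cong[OF eq0 smooth_family_map[OF G zero_less(1)[OF G]]])
  have e1: "differential c (velocity F) x v = differential c (velocity G) x v" for v
    by (rule cong[OF eq1 smooth_velocity[OF G]])
  define M where "M H t = gram (pullback b c (H t) x)" for H :: "real \<Rightarrow> 'a \<Rightarrow> 'e" and t
  define M' where "M' H = (\<chi> i j. b (differential c (H 0) x (axis i 1)) (differential c (velocity H) x (axis j 1))
      + b (differential c (velocity H) x (axis i 1)) (differential c (H 0) x (axis j 1)))" for H :: "real \<Rightarrow> 'a \<Rightarrow> 'e"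
  have M: "(M H has_vector_derivative M' H) (at 0)" if H: "smooth_family \<delta> H" for H
  proof -
    have d: "((\<lambda>t. b (differential c (H t) x v) (differential c (H t) x w)) has_derivative
       (\<lambda>h. h *\<^sub>R (b (differential c (H 0) x v) (differential c (velocity H) x w)
      + b (differential c (velocity H) x v) (differential c (H 0) x w)))) (at 0)" for v w
      using bounded_bilinear.FDERIV[OF bb differential_velocity[OF H c, of v, unfolded has_vector_derivative_def]
          differential_velocity[OF H c, of w, unfolded has_vector_derivative_def]]
      by (simp add: bilinear_lmul[OF b] bilinear_rmul[OF b] distrib_left)
    have d': "((\<lambda>t. M H t $ i $ j) has_derivative (\<lambda>h. h *\<^sub>R (M' H $ i $ j))) (at 0)" for i j
      using d[of "axis i 1" "axis j 1"] by (simp add: M_def gram_def pullback_def M'_def)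
    have "(M H has_derivative (\<lambda>h. \<chi> i j. h *\<^sub>R (M' H $ i $ j))) (at 0)"
      unfolding has_derivative_componentwise_within[of "M H"]
    proof
      fix w :: "real ^ 'n ^ 'n" assume "w \<in> Basis"
      then obtain i j where w: "w = axis i (axis j 1)" by (auto simp: Basis_vec_def)
      show "((\<lambda>t. M H t \<bullet> w) has_derivative (\<lambda>h. (\<chi> i j. h *\<^sub>R (M' H $ i $ j)) \<bullet> w)) (at 0)"
        unfolding w using d'[of i j] by (simp add: inner_axis)
    qed
    moreover have "(\<lambda>h. \<chi> i j. h *\<^sub>R (M' H $ i $ j)) = (\<lambda>h. h *\<^sub>R M' H)" by (auto simp: vec_eq_iff)
    ultimately show ?thesis by (simp add: has_vector_derivative_def)
  qed
  have M0: "M F 0 = M G 0" by (simp add: M_def gram_def pullback_def e0)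
  have M'eq: "M' F = M' G" by (simp add: M'_def e0 e1)
  obtain D where D: "(det has_derivative D) (at (M F 0))" by (rule has_derivative_det)
  have dF: "((\<lambda>t. det (M F t)) has_derivative (\<lambda>h. D (h *\<^sub>R M' F))) (at 0)"
    by (rule has_derivative_compose[OF M[OF F, unfolded has_vector_derivative_def] D])
  have dG: "((\<lambda>t. det (M G t)) has_derivative (\<lambda>h. D (h *\<^sub>R M' F))) (at 0)"
    using has_derivative_compose[OF M[OF G, unfolded has_vector_derivative_def], of det D] D M0 M'eq by simp
  have "((\<lambda>t. det (M F t) - det (M G t)) has_derivative (\<lambda>h. 0)) (at 0)"
    using has_derivative_diff[OF dF dG] by simp
  then show ?thesis by (simp add: has_field_derivative_def M_def lambda_zero)
qed

text \<open>The difference \<open>r\<close> of the Gram determinants and its time derivative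
  \<open>\<rho>\<close> both vanish at time zero. By continuity and compactness
  \<open>\<rho>\<close> stays below a small multiple of the determinant at time zero for a short
  while, and the mean value inequality bounds \<open>r\<close> by that multiple of the elapsed
  time.\<close>

lemma density_comparison:
  fixes F G :: "real \<Rightarrow> 'a \<Rightarrow> 'e::euclidean_space"
  assumes F: "smooth_family \<delta> F" and G: "smooth_family \<delta> G" and b: "bilinear b"
    and eq0: "\<And>x. x \<in> carrier A \<Longrightarrow> F 0 x = G 0 x" and eq1: "\<And>x. x \<in> carrier A \<Longrightarrow> velocity F x = velocity G x"
    and nd: "\<And>c x. c \<in> A \<Longrightarrow> x \<in> fst c \<Longrightarrow> det (gram (pullback b c (G 0) x)) \<noteq> 0"
    and K: "compact K" "K \<subseteq> carrier A" and e: "e > 0"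
  obtains \<eta> where "0 < \<eta>" "\<eta> \<le> \<delta>" "\<And>t x. \<bar>t\<bar> < \<eta> \<Longrightarrow> x \<in> K \<Longrightarrow> \<exists>c\<in>A. x \<in> fst c \<and>
    volume_density (\<lambda>_. b) c (F t) x \<le> volume_density (\<lambda>_. b) c (G t) x + e * \<bar>t\<bar> * volume_density (\<lambda>_. b) c (G 0) x"
proof -
  define dt where "dt H c q = det (gram (pullback b c (H (fst q)) (chart_inv c (snd q))))"
    for H :: "real \<Rightarrow> 'a \<Rightarrow> 'e" and c :: "('a, 'n) chart" and q :: "real \<times> (real ^ 'n)"
  define r where "r c q = dt F c q - dt G c q" for c :: "('a, 'n) chart" and q :: "real \<times> (real ^ 'n)"
  define \<rho> where "\<rho> c q = frechet_derivative (r c) (at q) (1, 0)"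
    for c :: "('a, 'n) chart" and q :: "real \<times> (real ^ 'n)"
  note \<delta> = zero_less(2)[OF F]
  let ?P = "\<lambda>c t y. \<bar>\<rho> c (t, snd c y)\<bar> \<le> e / 2 * \<bar>dt G c (0, snd c y)\<bar> \<and>
      \<bar>dt G c (0, snd c y)\<bar> / 4 \<le> \<bar>dt G c (t, snd c y)\<bar>"
  have dts: "smooth_on ({-\<delta><..<\<delta>} \<times> chart_range c) (dt F c)" "smooth_on ({-\<delta><..<\<delta>} \<times> chart_range c) (dt G c)"
    if "c \<in> A" for c
    using smooth_family_det[OF F b that] smooth_family_det[OF G b that] by (simp_all add: dt_def[abs_def])
  have rs: "smooth_on ({-\<delta><..<\<delta>} \<times> chart_range c) (r c)" if "c \<in> A" for c
    unfolding r_def[abs_def] by (intro smooth_on_diff open_box dts that)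
  have der: "((\<lambda>t. r c (t, snd c x)) has_real_derivative \<rho> c (t, snd c x)) (at t)"
    if c: "c \<in> A" "x \<in> fst c" "\<bar>t\<bar> < \<delta>" for c x t
  proof -
    have d: "(r c has_derivative frechet_derivative (r c) (at (t, snd c x))) (at (t, snd c x))"
      by (rule smooth_on_has_derivative[OF rs[OF c(1)]]) (use c in auto)
    show ?thesis
      using has_vector_derivative_fst[OF d] by (simp add: \<rho>_def has_real_derivative_iff_has_vector_derivative)
  qed
  have r0: "r c (0, snd c x) = 0" and \<rho>0: "\<rho> c (0, snd c x) = 0" if c: "c \<in> A" "x \<in> fst c" for c x
  proof -
    have z: "((\<lambda>t. r c (t, snd c x)) has_real_derivative 0) (at 0)"
      using det_gram_time_derivative[OF F G b c eq0 eq1] c by (simp add: r_def dt_def)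
    show "\<rho> c (0, snd c x) = 0"
      using DERIV_unique[OF der[OF c] z] \<delta> by simp
    have "differential c (F 0) x v = differential c (G 0) x v" for v
      using differential_cong_open[OF c open_carrier carrierI[OF c] _ smooth_family_map[OF G zero_less(1)[OF G]], of "F 0"] eq0
      by auto
    then show "r c (0, snd c x) = 0" using c by (simp add: r_def dt_def gram_def pullback_def)
  qed
  obtain \<eta> where \<eta>: "0 < \<eta>" "\<eta> \<le> \<delta>" "\<And>y. y \<in> K \<Longrightarrow> \<exists>c\<in>A. y \<in> fst c \<and> (\<forall>t. \<bar>t\<bar> < \<eta> \<longrightarrow> ?P c t y)"
  proof (rule tube[OF K \<delta>, of ?P])
    fix x assume "x \<in> K"
    then obtain c where c: "c \<in> A" "x \<in> fst c" using K carrierE by blast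
    \<comment> \<open>Both required inequalities are strict at time zero, where
      \<open>\<rho>\<close> is zero and the determinant is not; the smaller of the two margins is
      the function for \<open>tube\<close>. The quarter is any fraction below 1 there, and it is the
      one in \<open>sqrt_difference_le\<close>.\<close>
    define q where "q = (\<lambda>z. min (e / 2 * \<bar>dt G c (0, snd z)\<bar> - \<bar>\<rho> c z\<bar>) (\<bar>dt G c z\<bar> - \<bar>dt G c (0, snd z)\<bar> / 4))"
    let ?S = "{-\<delta><..<\<delta>} \<times> chart_range c"
    have "continuous_on ?S (\<lambda>z. dt G c (0, snd z))"
      by (rule continuous_on_compose2[OF smooth_on_imp_continuous_on[OF dts(2)[OF c(1)]]])
        (use \<delta> in \<open>auto intro!: continuous_intros\<close>)
    moreover have "continuous_on ?S (\<rho> c)"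
      unfolding \<rho>_def[abs_def] by (rule smooth_on_imp_continuous_on[OF smooth_on_frechet_const[OF rs[OF c(1)]]])
    moreover have "continuous_on ?S (dt G c)" by (rule smooth_on_imp_continuous_on[OF dts(2)[OF c(1)]])
    ultimately have "continuous_on ?S q"
      unfolding q_def by (intro continuous_intros) auto
    moreover have "q (0, snd c x) > 0"
      using nd[OF c] \<rho>0[OF c] e c by (simp add: q_def dt_def)
    moreover have "\<forall>t y. \<bar>t\<bar> < \<delta> \<longrightarrow> y \<in> fst c \<longrightarrow> q (t, snd c y) > 0 \<longrightarrow> ?P c t y"
      by (simp add: q_def)
    ultimately show "\<exists>c\<in>A. x \<in> fst c \<and> (\<exists>q. continuous_on ({-\<delta><..<\<delta>} \<times> chart_range c) q \<and> q (0, snd c x) > (0 :: real) \<and>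
      (\<forall>t y. \<bar>t\<bar> < \<delta> \<longrightarrow> y \<in> fst c \<longrightarrow> q (t, snd c y) > 0 \<longrightarrow> ?P c t y))"
      using c by blast
  qed blast
  show thesis
  proof (rule that[OF \<eta>(1,2)])
    fix t x assume t: "\<bar>t\<bar> < \<eta>" and x: "x \<in> K"
    obtain c where c: "c \<in> A" "x \<in> fst c" and P: "\<And>t. \<bar>t\<bar> < \<eta> \<Longrightarrow> ?P c t x" using \<eta>(3)[OF x] by blast
    define d where "d = dt G c (0, snd c x)"
    have "norm (r c (t, snd c x) - r c (0, snd c x)) \<le> e / 2 * \<bar>d\<bar> * norm (t - 0)"
    proof (rule field_differentiable_bound[where S = "ball (0 :: real) \<eta>" and f' = "\<lambda>t. \<rho> c (t, snd c x)"])
      fix s :: real assume s: "s \<in> ball 0 \<eta>"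
      then show "((\<lambda>t. r c (t, snd c x)) has_field_derivative \<rho> c (s, snd c x)) (at s within ball 0 \<eta>)"
        using der[OF c, of s] \<eta>(2) by (auto intro: has_field_derivative_at_within)
      show "norm (\<rho> c (s, snd c x)) \<le> e / 2 * \<bar>d\<bar>" using P[of s] s by (simp add: d_def)
    qed (use t \<eta> in auto)
    then have "\<bar>dt F c (t, snd c x) - dt G c (t, snd c x)\<bar> \<le> (e * \<bar>t\<bar>) * \<bar>d\<bar> / 2"
      using r0[OF c] by (simp add: r_def mult_ac)
    moreover have "\<bar>d\<bar> / 4 \<le> \<bar>dt G c (t, snd c x)\<bar>" using P[OF t] by (simp add: d_def)
    moreover have "d \<noteq> 0" using nd[OF c] c by (simp add: d_def dt_def)
    ultimately have "sqrt \<bar>dt F c (t, snd c x)\<bar> \<le> sqrt \<bar>dt G c (t, snd c x)\<bar> + e * \<bar>t\<bar> * sqrt \<bar>d\<bar>"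
      by (rule sqrt_difference_le)
    then show "\<exists>c\<in>A. x \<in> fst c \<and> volume_density (\<lambda>_. b) c (F t) x \<le>
        volume_density (\<lambda>_. b) c (G t) x + e * \<bar>t\<bar> * volume_density (\<lambda>_. b) c (G 0) x"
      using c by (intro bexI[of _ c]) (simp_all add: volume_density_eq dt_def d_def)
  qed
qed

text \<open>Comparing the densities in both directions bounds the difference of the volumes by
  \<open>e * \<bar>t\<bar> * C\<close> for every positive \<open>e\<close>, where \<open>C\<close>
  is the common volume at time zero. Hence the difference has derivative zero.\<close>

theorem volume_derivative_velocity:
  fixes F G :: "real \<Rightarrow> 'a \<Rightarrow> 'e::euclidean_space"
  assumes F: "smooth_family \<delta> F" and G: "smooth_family \<delta> G" and b: "bilinear b"
    and eq0: "\<And>x. x \<in> carrier A \<Longrightarrow> F 0 x = G 0 x" and eq1: "\<And>x. x \<in> carrier A \<Longrightarrow> velocity F x = velocity G x"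
    and nd: "\<And>c x. c \<in> A \<Longrightarrow> x \<in> fst c \<Longrightarrow> det (gram (pullback b c (G 0) x)) \<noteq> 0"
    and K: "compact K" "K \<subseteq> carrier A"
    and G': "((\<lambda>t. measure (volume_measure A (\<lambda>_. b) (G t)) K) has_real_derivative D) (at 0)"
  shows "((\<lambda>t. measure (volume_measure A (\<lambda>_. b) (F t)) K) has_real_derivative D) (at 0)"
proof -
  let ?\<mu> = "\<lambda>f. volume_measure A (\<lambda>_. b) f"
  note F0 = zero_less(1)[OF F]
  have sm: "smooth_map A (F t)" "smooth_map A (G t)" if "\<bar>t\<bar> < \<delta>" for t
    using smooth_family_map[OF F that] smooth_family_map[OF G that] by simp_all
  have fin: "emeasure (?\<mu> f) K = ennreal (measure (?\<mu> f) K)" if "smooth_map A f" for f :: "'a \<Rightarrow> 'e"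
    using density_measure_finite[OF is_density_volume_density[OF that b] density_measure_volume[OF that b] K]
    by (simp add: emeasure_eq_ennreal_measure)
  define C where "C = measure (?\<mu> (G 0)) K"
  have comp: "measure (?\<mu> f) K \<le> measure (?\<mu> g) K + s * C"
    if sm': "smooth_map A f" "smooth_map A g" and s: "s \<ge> 0"
      and le: "\<And>x. x \<in> K \<Longrightarrow> \<exists>c\<in>A. x \<in> fst c \<and> volume_density (\<lambda>_. b) c f x \<le>
        volume_density (\<lambda>_. b) c g x + s * volume_density (\<lambda>_. b) c (G 0) x" for f g s
  proof -
    have "emeasure (?\<mu> f) K \<le> emeasure (?\<mu> g) K + ennreal s * emeasure (?\<mu> (G 0)) K"
    proof (rule density_measure_le[where ?d1.0 = "\<lambda>c. volume_density (\<lambda>_. b) c f"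
          and ?d2.0 = "\<lambda>c. volume_density (\<lambda>_. b) c g" and ?d3.0 = "\<lambda>c. volume_density (\<lambda>_. b) c (G 0)"])
      show "K \<in> sets borel" by (rule borel_compact[OF K(1)])
    qed (use sm' sm(2)[OF F0] s le K in \<open>auto intro: is_density_volume_density density_measure_volume b\<close>)
    then show ?thesis
      unfolding fin[OF sm'(1)] fin[OF sm'(2)] fin[OF sm(2)[OF F0]]
      using s by (simp add: C_def ennreal_mult[symmetric] ennreal_plus[symmetric] del: ennreal_plus)
  qed
  define \<Delta> where "\<Delta> t = measure (?\<mu> (F t)) K - measure (?\<mu> (G t)) K" for t
  have nd': "det (gram (pullback b c (F 0) x)) \<noteq> 0" if c: "c \<in> A" "x \<in> fst c" for c x
  proof -
    have "differential c (F 0) x v = differential c (G 0) x v" for v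
      using differential_cong_open[OF c open_carrier carrierI[OF c] _ sm(2)[OF F0], of "F 0"] eq0 by auto
    then show ?thesis using nd[OF c] by (simp add: gram_def pullback_def)
  qed
  have vd0: "volume_density (\<lambda>_. b) c (F 0) x = volume_density (\<lambda>_. b) c (G 0) x" if c: "c \<in> A" "x \<in> fst c" for c x
  proof -
    have "differential c (F 0) x v = differential c (G 0) x v" for v
      using differential_cong_open[OF c open_carrier carrierI[OF c] _ sm(2)[OF F0], of "F 0"] eq0 by auto
    then show ?thesis by (simp add: volume_density_eq gram_def pullback_def)
  qed
  have \<Delta>0: "\<Delta> 0 = 0"
    unfolding \<Delta>_def using volume_measure_cong[OF vd0] by simp
  have C0: "C \<ge> 0" by (simp add: C_def)
  have small: "\<exists>\<eta>>0. \<forall>t. \<bar>t\<bar> < \<eta> \<longrightarrow> \<bar>\<Delta> t\<bar> \<le> e * \<bar>t\<bar> * C" if e: "e > 0" for e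
  proof -
    obtain \<eta>1 where \<eta>1: "0 < \<eta>1" "\<eta>1 \<le> \<delta>" "\<And>t x. \<bar>t\<bar> < \<eta>1 \<Longrightarrow> x \<in> K \<Longrightarrow> \<exists>c\<in>A. x \<in> fst c \<and>
        volume_density (\<lambda>_. b) c (F t) x \<le> volume_density (\<lambda>_. b) c (G t) x + e * \<bar>t\<bar> * volume_density (\<lambda>_. b) c (G 0) x"
      using density_comparison[OF F G b eq0 eq1 nd K e] by blast
    \<comment> \<open>The same comparison with \<open>F\<close> and \<open>G\<close> exchanged
      bounds the difference from below; the reference density at time zero is common to both
      families.\<close>
    obtain \<eta>2 where \<eta>2: "0 < \<eta>2" "\<eta>2 \<le> \<delta>" "\<And>t x. \<bar>t\<bar> < \<eta>2 \<Longrightarrow> x \<in> K \<Longrightarrow> \<exists>c\<in>A. x \<in> fst c \<and>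
        volume_density (\<lambda>_. b) c (G t) x \<le> volume_density (\<lambda>_. b) c (F t) x + e * \<bar>t\<bar> * volume_density (\<lambda>_. b) c (F 0) x"
      using density_comparison[OF G F b eq0[symmetric] eq1[symmetric] nd' K e] by blast
    have "\<bar>\<Delta> t\<bar> \<le> e * \<bar>t\<bar> * C" if t: "\<bar>t\<bar> < min \<eta>1 \<eta>2" for t
    proof -
      have t': "\<bar>t\<bar> < \<delta>" "\<bar>t\<bar> < \<eta>1" "\<bar>t\<bar> < \<eta>2" using t \<eta>1(2) by auto
      have "measure (?\<mu> (F t)) K \<le> measure (?\<mu> (G t)) K + e * \<bar>t\<bar> * C"
        by (rule comp[OF sm(1,2)[OF t'(1)]]) (use e \<eta>1(3)[OF t'(2)] in auto)
      moreover have "measure (?\<mu> (G t)) K \<le> measure (?\<mu> (F t)) K + e * \<bar>t\<bar> * C"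
      proof (rule comp[OF sm(2,1)[OF t'(1)]])
        fix x assume "x \<in> K"
        then obtain c where c: "c \<in> A" "x \<in> fst c" "volume_density (\<lambda>_. b) c (G t) x \<le>
            volume_density (\<lambda>_. b) c (F t) x + e * \<bar>t\<bar> * volume_density (\<lambda>_. b) c (F 0) x"
          using \<eta>2(3)[OF t'(3)] by blast
        then show "\<exists>c\<in>A. x \<in> fst c \<and> volume_density (\<lambda>_. b) c (G t) x \<le>
            volume_density (\<lambda>_. b) c (F t) x + e * \<bar>t\<bar> * volume_density (\<lambda>_. b) c (G 0) x"
          using vd0[OF c(1,2)] by (intro bexI[of _ c]) auto
      qed (use e in auto)
      ultimately show ?thesis by (simp add: \<Delta>_def abs_le_iff)
    qed
    then show ?thesis using \<eta>1(1) \<eta>2(1) by (intro exI[of _ "min \<eta>1 \<eta>2"]) auto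
  qed
  have "(\<Delta> has_real_derivative 0) (at 0)"
    unfolding has_field_derivative_def
  proof (rule has_derivativeI_sandwich[where e = 1 and H = "\<lambda>y. \<bar>\<Delta> y\<bar> / \<bar>y\<bar>"])
    show "bounded_linear ((*) (0 :: real))" by (rule bounded_linear_mult_right)
    show "norm (\<Delta> y - \<Delta> 0 - 0 * (y - 0)) / norm (y - 0) \<le> \<bar>\<Delta> y\<bar> / \<bar>y\<bar>" for y
      by (simp add: \<Delta>0)
    show "((\<lambda>y. \<bar>\<Delta> y\<bar> / \<bar>y\<bar>) \<longlongrightarrow> 0) (at 0 within UNIV)"
    proof (rule tendstoI)
      fix e :: real assume e: "e > 0"
      \<comment> \<open>The summand 1 covers the case that \<open>C\<close> is zero, and the factor
        2 makes the final inequality strict.\<close>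
      define e' where "e' = e / (2 * (C + 1))"
      have e': "e' > 0" "e' * C < e"
        using e C0 mult_nonneg_nonneg[OF C0 less_imp_le[OF e]]
        by (auto simp: e'_def field_simps intro: add_nonneg_pos)
      obtain \<eta> where \<eta>: "\<eta> > 0" "\<And>t. \<bar>t\<bar> < \<eta> \<Longrightarrow> \<bar>\<Delta> t\<bar> \<le> e' * \<bar>t\<bar> * C" using small[OF e'(1)] by blast
      have "\<bar>\<Delta> t\<bar> / \<bar>t\<bar> < e" if "t \<noteq> 0" "\<bar>t\<bar> < \<eta>" for t
      proof -
        have "\<bar>\<Delta> t\<bar> / \<bar>t\<bar> \<le> e' * C" using \<eta>(2)[OF that(2)] that(1) by (simp add: divide_le_eq mult_ac)
        then show ?thesis using e'(2) by simp
      qed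
      then show "\<forall>\<^sub>F y in at 0. dist (\<bar>\<Delta> y\<bar> / \<bar>y\<bar>) 0 < e"
        unfolding eventually_at using \<eta>(1) by (intro exI[of _ \<eta>]) (auto simp: dist_real_def)
    qed
  qed simp
  from DERIV_add[OF this G'] show ?thesis by (simp add: \<Delta>_def)
qed

end

section \<open>Principal curvatures\<close>

lemma disc_similar:
  fixes T M M' :: "real ^ 'n ^ 'n"
  assumes "T ** M = M' ** T" "det T \<noteq> 0"
  shows "disc M = disc M'"
proof -
  obtain T' where T': "T ** T' = mat 1" "T' ** T = mat 1"
    using assms(2) invertible_det_nz[of T] by (auto simp: invertible_def)
  have M': "M' = T ** M ** T'"
    by (metis assms(1) T'(1) matrix_mul_assoc matrix_mul_rid)
  have "det T * det T' = 1" by (metis T'(1) det_mul det_I)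
  then have "det M' = det M" unfolding M' det_mul by (metis mult.assoc mult.commute mult.left_neutral)
  moreover have "trace M' = trace M"
    unfolding M' by (metis T'(2) matrix_mul_assoc matrix_mul_lid trace_mul_sym)
  ultimately show ?thesis by (simp add: disc_def)
qed

text \<open>In dimension two the discriminant is homogeneous of degree two in the matrix, so a sign
  cancels.\<close>

lemma disc_scale:
  fixes M :: "real ^ 'n ^ 'n"
  assumes "CARD('n) = 2" "\<sigma> \<in> {-1, 1}"
  shows "disc (\<sigma> *\<^sub>R M) = disc M"
proof -
  obtain i j :: 'n where "UNIV = {i, j}" "i \<noteq> j" using assms(1) card_2_iff[of "UNIV :: 'n set"] by auto
  then show ?thesis using assms(2) by (auto simp: disc_card_2[of i j] power2_eq_square algebra_simps)
qed

context hframe begin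

lemma orthonormal_frame:
  fixes e :: "'n \<Rightarrow> real ^ 'n"
  assumes e: "orthonormal g e"
  shows "det ((\<chi> i j. e j $ i) :: real ^ 'n ^ 'n) \<noteq> 0"
proof -
  let ?P = "(\<chi> i j. e j $ i) :: real ^ 'n ^ 'n"
  have Pv: "?P *v v = (\<Sum>i\<in>UNIV. v $ i *\<^sub>R e i)" for v
    by (simp add: matrix_vector_mult_def vec_eq_iff mult.commute)
  have "v = 0" if "?P *v v = 0" for v
  proof -
    have "v $ j = 0" for j
    proof -
      have "0 = g (\<Sum>i\<in>UNIV. v $ i *\<^sub>R e i) (e j)"
        using that bilinear_lzero[OF bilinear_g] unfolding Pv by simp
      also have "\<dots> = (\<Sum>i\<in>UNIV. v $ i * g (e i) (e j))"
        using bilinear_g unfolding bilinear_def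
        by (simp add: linear_sum[of "\<lambda>x. g x (e j)"] linear_cmul[of "\<lambda>x. g x (e j)"])
      also have "\<dots> = (\<Sum>i\<in>UNIV. if i = j then v $ j * g (e j) (e j) else 0)"
        using e by (intro sum.cong) (auto simp: orthonormal_def)
      also have "\<dots> = v $ j * g (e j) (e j)" by simp
      finally have "v $ j * g (e j) (e j) = 0" by simp
      moreover have "g (e j) (e j) \<in> {-1, 1}" using e by (simp only: orthonormal_def)
      ultimately show ?thesis by auto
    qed
    then show ?thesis by (simp add: vec_eq_iff)
  qed
  then show ?thesis
    using invertible_det_nz[of ?P] invertible_left_inverse[of ?P] matrix_left_invertible_ker[of ?P] by blast
qed

lemma frame_scalar:
  assumes e: "orthonormal g e" and k: "\<And>i. S (e i) = l *\<^sub>R e i"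
  shows "S v = l *\<^sub>R v"
proof -
  let ?P = "(\<chi> i j. e j $ i) :: real ^ 'n ^ 'n"
  have Pv: "?P *v v = (\<Sum>i\<in>UNIV. v $ i *\<^sub>R e i)" for v
    by (simp add: matrix_vector_mult_def vec_eq_iff mult.commute)
  obtain w where "v = ?P *v w"
    using orthonormal_frame[OF e] invertible_det_nz[of ?P]
    by (metis invertible_def matrix_vector_mul_assoc matrix_vector_mul_lid)
  then show ?thesis
    by (simp add: Pv linear_sum[OF linear_S] linear_cmul[OF linear_S] k scaleR_sum_right mult.commute)
qed

lemma disc_principal:
  assumes two: "CARD('n) = 2" and e: "orthonormal g e" and k: "\<And>i. S (e i) = k i *\<^sub>R e i" and ij: "i \<noteq> j"
  shows "disc (matrix S) = (k i - k j)\<^sup>2"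
proof -
  have "card {i, j} = CARD('n)" using two ij by simp
  then have U: "UNIV = {i, j}" by (metis card_subset_eq finite subset_UNIV)
  define P where "P = ((\<chi> i j. e j $ i) :: real ^ 'n ^ 'n)"
  define D where "D = ((\<chi> i j. if i = j then k i else 0) :: real ^ 'n ^ 'n)"
  have Pax: "P *v axis i 1 = e i" for i
    by (simp add: P_def matrix_vector_mult_basis column_def vec_eq_iff)
  have "(P ** D) *v axis i 1 = (matrix S ** P) *v axis i 1" for i
  proof -
    have "D *v axis i 1 = k i *\<^sub>R axis i 1"
      by (simp only: D_def matrix_vector_mult_basis column_def) (simp add: vec_eq_iff axis_def)
    then have "(P ** D) *v axis i 1 = k i *\<^sub>R e i"
      by (simp add: matrix_vector_mul_assoc[symmetric] matrix_vector_mult_scaleR Pax)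
    then show ?thesis by (simp add: matrix_vector_mul_assoc[symmetric] Pax matrix_real[OF linear_S] k)
  qed
  then have "P ** D = matrix S ** P"
    by (simp only: matrix_vector_mult_basis) (simp add: column_def vec_eq_iff)
  then have "disc D = disc (matrix S)"
    by (rule disc_similar) (use orthonormal_frame[OF e] in \<open>simp add: P_def\<close>)
  moreover have "disc D = (k i - k j)\<^sup>2"
    unfolding disc_card_2[OF U ij] using ij by (simp add: D_def)
  ultimately show ?thesis by simp
qed

text \<open>For an indefinite metric a self-adjoint operator can fail to be diagonalizable. A
  positive discriminant gives two distinct real eigenvalues, whose eigenvectors are then orthogonal
  and can be normalized.\<close>

lemma ex_principal:
  assumes two: "CARD('n) = 2" and d: "disc (matrix S) > 0"
  obtains e k where "orthonormal g e" "\<And>i. S (e i) = k i *\<^sub>R e i"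
proof -
  obtain i j :: 'n where U: "UNIV = {i, j}" "i \<noteq> j" using two card_2_iff[of "UNIV :: 'n set"] by auto
  define M where "M = matrix S"
  define r where "r = sqrt (disc M)"
  have r: "r > 0" "r * r = disc M" using d by (simp_all add: r_def M_def)
  have root: "\<exists>v. v \<noteq> 0 \<and> S v = l *\<^sub>R v" if l: "l * l - trace M * l + det M = 0" for l
  proof -
    have tr: "trace M = M $ i $ i + M $ j $ j" unfolding trace_def U(1) using U(2) by simp
    have "det (M - l *\<^sub>R mat 1) = l * l - trace M * l + det M"
      unfolding det_card_2[OF U] tr using U(2) by (simp add: mat_def algebra_simps)
    then have "\<not> (\<exists>B. B ** (M - l *\<^sub>R mat 1) = mat 1)"
      using l invertible_det_nz[of "M - l *\<^sub>R mat 1"] invertible_left_inverse[of "M - l *\<^sub>R mat 1"] by simp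
    then obtain v where "v \<noteq> 0" "(M - l *\<^sub>R mat 1) *v v = 0"
      unfolding matrix_left_invertible_ker[of "M - l *\<^sub>R mat 1"] by blast
    then show ?thesis
      using scaleR_matrix_vector_assoc[of l "mat 1 :: real ^ 'n ^ 'n" v, symmetric]
      by (intro exI[of _ v]) (simp add: matrix_vector_mult_diff_rdistrib M_def matrix_real[OF linear_S])
  qed
  define l1 where "l1 = (trace M + r) / 2"
  define l2 where "l2 = (trace M - r) / 2"
  have rr: "r * r = trace M * trace M - 4 * det M" using r(2) by (simp add: disc_def power2_eq_square)
  have "l1 * l1 - trace M * l1 + det M = 0" "l2 * l2 - trace M * l2 + det M = 0"
    using rr by (simp_all add: l1_def l2_def field_simps)
  then obtain v1 v2 where v: "v1 \<noteq> 0" "S v1 = l1 *\<^sub>R v1" "v2 \<noteq> 0" "S v2 = l2 *\<^sub>R v2" using root by blast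
  have ne: "l1 \<noteq> l2" using r(1) by (simp add: l1_def l2_def)
  have orth: "g v1 v2 = 0"
  proof -
    have "l1 * g v1 v2 = l2 * g v1 v2"
      using S_symmetric[of v1 v2] by (simp add: v bilinear_lmul[OF bilinear_g] bilinear_rmul[OF bilinear_g])
    then show ?thesis using ne by simp
  qed
  have zero: "a = 0 \<and> b = 0" if ab: "a *\<^sub>R v1 + b *\<^sub>R v2 = 0" for a b
  proof -
    have 1: "(a * l1) *\<^sub>R v1 + (b * l2) *\<^sub>R v2 = 0"
      using arg_cong[OF ab, of S] by (simp add: linear_add[OF linear_S] linear_cmul[OF linear_S] linear_0[OF linear_S] v)
    have "(b * (l1 - l2)) *\<^sub>R v2 = l1 *\<^sub>R (a *\<^sub>R v1 + b *\<^sub>R v2) - ((a * l1) *\<^sub>R v1 + (b * l2) *\<^sub>R v2)"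
      by (simp add: algebra_simps)
    then have "(b * (l1 - l2)) *\<^sub>R v2 = 0" unfolding 1 ab by simp
    then have "b = 0" using ne v by simp
    then show ?thesis using ab v by simp
  qed
  have v12: "v1 \<noteq> v2" using zero[of 1 "-1"] by auto
  have ind: "independent {v1, v2}"
  proof (rule independent_if_scalars_zero)
    fix f x assume "(\<Sum>x\<in>{v1, v2}. f x *\<^sub>R x) = 0" "x \<in> {v1, v2}"
    then show "f x = 0" using zero[of "f v1" "f v2"] v12 by auto
  qed simp
  have sp: "UNIV \<subseteq> span {v1, v2}"
    by (rule card_ge_dim_independent[OF _ ind]) (use two v12 in auto)
  \<comment> \<open>A null eigenvector would be orthogonal to both eigenvectors, hence to the whole
    plane, against nondegeneracy.\<close>
  have nz: "g v v \<noteq> 0" if H: "v \<in> {v1, v2}" for v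
  proof
    assume 0: "g v v = 0"
    have "g v v1 = 0" "g v v2 = 0" using H 0 orth g_commute[of v1 v2] by auto
    have "g v w = 0" for w
    proof -
      have "w \<in> span {v1, v2}" using sp by blast
      then show ?thesis
      proof (induction rule: span_induct)
        case base
        show ?case unfolding subspace_def
          using bilinear_rzero[OF bilinear_g] bilinear_radd[OF bilinear_g] bilinear_rmul[OF bilinear_g] by simp
      next
        case (step x)
        then show ?case using \<open>g v v1 = 0\<close> \<open>g v v2 = 0\<close> by auto
      qed
    qed
    then have "v = 0" using nondegenerate[of v] by (simp add: g_def)
    then show False using H v by auto
  qed
  define nm where "nm v = (1 / sqrt \<bar>g v v\<bar>) *\<^sub>R v" for v
  have nm: "g (nm v) (nm v) \<in> {-1, 1}" if H: "v \<in> {v1, v2}" for v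
    using nz[OF H] by (cases "g v v > 0") (auto simp: nm_def bilinear_lmul[OF bilinear_g] bilinear_rmul[OF bilinear_g])
  define e where "e q = (if q = i then nm v1 else nm v2)" for q
  define k where "k q = (if q = i then l1 else l2)" for q
  show thesis
  proof (rule that[of e k])
    have o: "g (nm v1) (nm v2) = 0" "g (nm v2) (nm v1) = 0"
      using orth g_commute[of v1 v2] by (simp_all add: nm_def bilinear_lmul[OF bilinear_g] bilinear_rmul[OF bilinear_g])
    have two_cases: "q = i \<or> q = j" for q using U(1) by blast
    show "orthonormal g e"
      unfolding orthonormal_def
    proof (intro conjI allI impI)
      fix a b :: 'n assume "a \<noteq> b"
      then show "g (e a) (e b) = 0" using two_cases[of a] two_cases[of b] U(2) o by (auto simp: e_def)
    qed (use nm in \<open>auto simp: e_def\<close>)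
    show "S (e q) = k q *\<^sub>R e q" for q
      by (simp add: e_def k_def nm_def linear_cmul[OF linear_S] v)
  qed
qed

end

section \<open>Immersions with a unit normal\<close>

locale hyp = omfd A for A :: "('a::{t2_space,second_countable_topology}, 'n::finite) chart set" +
  fixes p :: nat and \<epsilon> :: real and \<phi> N :: "'a \<Rightarrow> 'm::{finite,linorder} rvec"
  assumes card: "CARD('m) = CARD('n) + 2" and eps: "\<epsilon> \<in> {-1, 1}"
    and sphere: "\<And>x. x \<in> carrier A \<Longrightarrow> ip p (\<phi> x) (\<phi> x) = 1"
    and smooth_phi: "smooth_map A \<phi>"
    and nondeg: "nondegenerate_metric A (\<lambda>_. ip p) \<phi>"
    and normal: "unit_normal A p \<epsilon> \<phi> N"
begin

lemma smooth_N: "smooth_map A N"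
  using normal by (simp add: unit_normal_def)

lemma normalD:
  assumes "c \<in> A" "x \<in> fst c"
  shows "ip p (N x) (N x) = \<epsilon>" "ip p (N x) (\<phi> x) = 0" "ip p (N x) (differential c \<phi> x v) = 0"
  using normal assms unfolding unit_normal_def by blast+

lemma nondegD:
  assumes "c \<in> A" "x \<in> fst c" "\<And>w. ip p (differential c \<phi> x v) (differential c \<phi> x w) = 0"
  shows "v = 0"
  using nondeg assms unfolding nondegenerate_metric_def induced_metric_def by blast

definition hess :: "('a, 'n) chart \<Rightarrow> 'a \<Rightarrow> real ^ 'n \<Rightarrow> real ^ 'n \<Rightarrow> 'm rvec" where
  "hess c x w v = frechet_derivative (\<lambda>u. frechet_derivative (\<phi> \<circ> chart_inv c) (at u) w) (at (snd c x)) v"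

lemma hess_commute:
  assumes "c \<in> A" "x \<in> fst c"
  shows "hess c x w v = hess c x v w"
  unfolding hess_def
  by (rule mixed_derivatives[of "chart_range c"])
    (use smooth_phi[unfolded smooth_map_def, rule_format, OF assms(1)] open_range[OF assms(1)] assms(2) in auto)

text \<open>Derivative of the relation that \<open>N\<close> is orthogonal to the image of the
  differential of \<phi>. Together with \<open>hess_commute\<close> it makes the shape operator
  self-adjoint.\<close>

lemma weingarten:
  assumes c: "c \<in> A" "x \<in> fst c"
  shows "ip p (differential c N x v) (differential c \<phi> x w) = - ip p (N x) (hess c x w v)"
proof -
  let ?D = "\<lambda>u. frechet_derivative (\<phi> \<circ> chart_inv c) (at u) w"
  have sm: "smooth_on (chart_range c) ?D"
    using smooth_phi[unfolded smooth_map_def, rule_format, OF c(1)] by (rule smooth_on_frechet_const)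
  have d: "(?D has_derivative hess c x w) (at (snd c x))"
    using smooth_on_has_derivative[OF sm snd_in[OF c(2)]] unfolding hess_def[abs_def] .
  have bb: "bounded_bilinear (ip p :: 'm rvec \<Rightarrow> _)"
    using bilinear_ip by (simp add: bilinear_conv_bounded_bilinear)
  have "((\<lambda>u. ip p ((N \<circ> chart_inv c) u) (?D u)) has_derivative
      (\<lambda>v. ip p ((N \<circ> chart_inv c) (snd c x)) (hess c x w v) + ip p (differential c N x v) (?D (snd c x)))) (at (snd c x))"
    by (rule bounded_bilinear.FDERIV[OF bb smooth_map_has_derivative[OF smooth_N c] d])
  then have "((\<lambda>u. 0) has_derivative
      (\<lambda>v. ip p ((N \<circ> chart_inv c) (snd c x)) (hess c x w v) + ip p (differential c N x v) (?D (snd c x)))) (at (snd c x))"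
  proof (rule has_derivative_transform_within_open[OF _ open_range[OF c(1)] snd_in[OF c(2)]])
    fix u assume u: "u \<in> chart_range c"
    show "ip p ((N \<circ> chart_inv c) u) (?D u) = 0"
      using normalD(3)[OF c(1) inv_in[OF c(1) u], of w] c(1) u by (simp add: differential_def)
  qed
  from fun_cong[OF has_derivative_unique[OF this has_derivative_const], of v]
  show ?thesis using c by (simp add: differential_def)
qed

lemma frame:
  assumes c: "c \<in> A" "x \<in> fst c"
  shows "hframe p \<epsilon> (\<phi> x) (N x) (differential c \<phi> x) (differential c N x)"
proof (rule hframe.intro)
  show "CARD('m) = CARD('n) + 2" "\<epsilon> \<in> {-1, 1}" by (fact card eps)+
  have const: "ip p (f x) (differential c h x v) + ip p (differential c f x v) (h x) = 0"
    if "smooth_map A f" "smooth_map A h" "\<And>y. y \<in> fst c \<Longrightarrow> ip p (f y) (h y) = k" for f h :: "'a \<Rightarrow> 'm rvec" and k v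
    using differential_bilinear[OF bilinear_ip[of p] that(1,2) c, of v]
      differential_locally_const[OF c open_UNIV, of "\<lambda>x. ip p (f x) (h x)" k v] that(3) by simp
  show "ip p (\<phi> x) (\<phi> x) = 1" by (rule sphere[OF carrierI[OF c]])
  show "ip p (N x) (N x) = \<epsilon>" "ip p (N x) (\<phi> x) = 0" by (rule normalD[OF c])+
  show "linear (differential c \<phi> x)" "linear (differential c N x)"
    by (rule linear_differential[OF smooth_phi c] linear_differential[OF smooth_N c])+
  show "ip p (differential c \<phi> x v) (\<phi> x) = 0" for v
    using const[OF smooth_phi smooth_phi sphere[OF carrierI[OF c(1)]], of v] ip_commute[of p "\<phi> x" "differential c \<phi> x v"]
    by simp
  show LN: "ip p (differential c \<phi> x v) (N x) = 0" for v
    using normalD(3)[OF c, of v] ip_commute[of p "N x" "differential c \<phi> x v"] by simp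
  show "v = 0" if "\<And>w. ip p (differential c \<phi> x v) (differential c \<phi> x w) = 0" for v
    by (rule nondegD[OF c that])
  show "ip p (differential c N x v) (\<phi> x) = 0" for v
    using const[OF smooth_N smooth_phi normalD(2)[OF c(1)], of v] normalD(3)[OF c, of v] by simp
  show "ip p (differential c N x v) (N x) = 0" for v
    using const[OF smooth_N smooth_N normalD(1)[OF c(1)], of v] ip_commute[of p "N x" "differential c N x v"]
    by simp
  show "ip p (differential c N x v) (differential c \<phi> x w) = ip p (differential c \<phi> x v) (differential c N x w)" for v w
    using weingarten[OF c, of v w] weingarten[OF c, of w v] hess_commute[OF c, of v w]
      ip_commute[of p "differential c \<phi> x v" "differential c N x w"] by simp
qed

definition gauss :: "'a \<Rightarrow> 'm bivec" where
  "gauss x = wedge (\<phi> x) (N x)"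

lemma smooth_gauss: "smooth_map A gauss"
  unfolding gauss_def[abs_def] by (rule smooth_map_bilinear[OF bilinear_wedge smooth_phi smooth_N])

lemma differential_gauss:
  assumes c: "c \<in> A" "x \<in> fst c"
  shows "differential c gauss x = hframe.dG (\<phi> x) (N x) (differential c \<phi> x) (differential c N x)"
proof -
  interpret f: hframe p \<epsilon> "\<phi> x" "N x" "differential c \<phi> x" "differential c N x" by (rule frame[OF c])
  show ?thesis
    unfolding gauss_def[abs_def] using differential_bilinear[OF bilinear_wedge smooth_phi smooth_N c]
    by (simp add: fun_eq_iff f.dG_def)
qed

lemma geodesic_gauss: "c \<in> A \<Longrightarrow> x \<in> fst c \<Longrightarrow> geodesic p \<epsilon> (gauss x) (\<phi> x) (N x)"
  using hframe.geo[OF frame] by (simp add: gauss_def)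

lemma gauss_in: "x \<in> carrier A \<Longrightarrow> gauss x \<in> L_geo p \<epsilon>"
  unfolding L_geo_def by (elim carrierE) (blast intro: geodesic_gauss)

lemma lagrangian_gauss: "lagrangian A (Omega p \<epsilon>) gauss"
  unfolding lagrangian_def
proof (intro ballI allI)
  fix c x v w assume c: "c \<in> A" "x \<in> fst c"
  show "Omega p \<epsilon> (gauss x) (differential c gauss x v) (differential c gauss x w) = 0"
    unfolding differential_gauss[OF c] gauss_def by (rule hframe.lagrangian_dG[OF frame[OF c]])
qed

lemma shape_eq:
  assumes c: "c \<in> A" "x \<in> fst c"
  shows "shape_operator c \<phi> N x = hframe.S (differential c \<phi> x) (differential c N x)"
  using hframe.S_def[OF frame[OF c]] by (simp add: shape_operator_def fun_eq_iff)

lemma metric_eq: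
  assumes c: "c \<in> A" "x \<in> fst c"
  shows "pullback (ip p) c \<phi> x = hframe.g p (differential c \<phi> x)"
    and "induced_metric (\<lambda>_. ip p) c \<phi> x = hframe.g p (differential c \<phi> x)"
  using hframe.g_def[OF frame[OF c]] by (simp_all add: pullback_def induced_metric_def fun_eq_iff)

lemma density_phi_pos: "c \<in> A \<Longrightarrow> x \<in> fst c \<Longrightarrow> volume_density (\<lambda>_. ip p) c \<phi> x > 0"
  by (simp add: volume_density_eq metric_eq(1) hframe.det_gram_g[OF frame])

definition W_integrand :: "('a, 'n) chart \<Rightarrow> 'a \<Rightarrow> real" where
  "W_integrand c x = (let S = matrix (shape_operator c \<phi> N x) in sqrt \<bar>det (\<epsilon> *\<^sub>R mat 1 + S ** S)\<bar>)"

definition W'_integrand :: "('a, 'n) chart \<Rightarrow> 'a \<Rightarrow> real" where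
  "W'_integrand c x = sqrt \<bar>disc (matrix (shape_operator c \<phi> N x))\<bar>"

lemma pullback_gauss:
  assumes c: "c \<in> A" "x \<in> fst c"
  shows "pullback b c gauss x = (\<lambda>v w. b (hframe.dG (\<phi> x) (N x) (differential c \<phi> x) (differential c N x) v)
    (hframe.dG (\<phi> x) (N x) (differential c \<phi> x) (differential c N x) w))"
  by (simp add: pullback_def fun_eq_iff differential_gauss[OF c])

lemma W_density:
  assumes c: "c \<in> A" "x \<in> fst c"
  shows "volume_density (\<lambda>_. biv_ip p) c gauss x = W_integrand c x * volume_density (\<lambda>_. ip p) c \<phi> x"
proof -
  interpret f: hframe p \<epsilon> "\<phi> x" "N x" "differential c \<phi> x" "differential c N x" by (rule frame[OF c])
  show ?thesis
    unfolding volume_density_eq pullback_gauss[OF c] f.det_gram_G W_integrand_def shape_eq[OF c] metric_eq[OF c] Let_def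
    by (rule real_sqrt_mult)
qed

lemma W'_density:
  assumes "CARD('n) = 2" and c: "c \<in> A" "x \<in> fst c"
  shows "volume_density (\<lambda>_. klein) c gauss x = W'_integrand c x * volume_density (\<lambda>_. ip p) c \<phi> x"
proof -
  interpret f: hframe p \<epsilon> "\<phi> x" "N x" "differential c \<phi> x" "differential c N x" by (rule frame[OF c])
  show ?thesis
    unfolding volume_density_eq pullback_gauss[OF c] f.det_gram_klein[OF assms(1)] W'_integrand_def shape_eq[OF c] metric_eq[OF c]
    by (rule real_sqrt_mult)
qed

lemma chart_at: assumes "x \<in> carrier A" shows "chart_at A x \<in> A" "x \<in> fst (chart_at A x)"
proof -
  obtain c where "c \<in> A \<and> x \<in> fst c" using carrierE[OF assms] by blast
  then have "chart_at A x \<in> A \<and> x \<in> fst (chart_at A x)" unfolding chart_at_def by (rule someI)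
  then show "chart_at A x \<in> A" "x \<in> fst (chart_at A x)" by simp_all
qed

text \<open>The integrand is evaluated in the arbitrarily chosen \<open>chart_at A x\<close>. Being
  a quotient of two densities that scale alike, it does not depend on the chart, and as such a
  quotient it is continuous in every chart.\<close>

lemma functional_eq:
  assumes b: "bilinear b" and I0: "\<And>c x. c \<in> A \<Longrightarrow> x \<in> fst c \<Longrightarrow> I c x \<ge> 0"
    and I: "\<And>c x. c \<in> A \<Longrightarrow> x \<in> fst c \<Longrightarrow>
      volume_density (\<lambda>_. b) c gauss x = I c x * volume_density (\<lambda>_. ip p) c \<phi> x"
    and w: "\<And>x. x \<in> carrier A \<Longrightarrow> w x = I (chart_at A x) x"
    and K: "compact K" "K \<subseteq> carrier A"
  shows "(LINT x:K|volume_measure A (\<lambda>_. ip p) \<phi>. w x) = measure (volume_measure A (\<lambda>_. b) gauss) K"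
proof -
  have indep: "w x = I c x" if c: "c \<in> A" "x \<in> fst c" for c x
  proof -
    note d = chart_at[OF carrierI[OF c]]
    define k where "k = \<bar>det (matrix (trans c (chart_at A x) x))\<bar>"
    have "k > 0" using trans_pos[OF c(1) d(1) c(2) d(2)] by (simp add: k_def)
    have "I c x * (k * volume_density (\<lambda>_. ip p) (chart_at A x) \<phi> x) = volume_density (\<lambda>_. b) c gauss x"
      using I[OF c] volume_density_change[OF smooth_phi bilinear_ip[of p] c(1) d(1) c(2) d(2)] by (simp add: k_def)
    also have "\<dots> = k * (I (chart_at A x) x * volume_density (\<lambda>_. ip p) (chart_at A x) \<phi> x)"
      using I[OF d] volume_density_change[OF smooth_gauss b c(1) d(1) c(2) d(2)] by (simp add: k_def)
    finally have "I c x * (k * volume_density (\<lambda>_. ip p) (chart_at A x) \<phi> x)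
      = k * (I (chart_at A x) x * volume_density (\<lambda>_. ip p) (chart_at A x) \<phi> x)" .
    then have "I (chart_at A x) x = I c x" using \<open>k > 0\<close> density_phi_pos[OF d] by auto
    then show ?thesis using w[OF carrierI[OF c]] by simp
  qed
  show ?thesis
  proof (rule set_integral_volume_measure[OF smooth_phi bilinear_ip smooth_gauss b])
    fix c assume c: "c \<in> A"
    have "continuous_on (chart_range c) (\<lambda>u. volume_density (\<lambda>_. b) c gauss (chart_inv c u) /
        volume_density (\<lambda>_. ip p) c \<phi> (chart_inv c u))"
      by (intro continuous_on_divide continuous_volume_density smooth_gauss smooth_phi b bilinear_ip c)
        (use density_phi_pos[OF c inv_in[OF c]] in force)
    from continuous_in_chart[OF c this]
    show "continuous_on (fst c) w"
    proof (rule continuous_on_eq)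
      fix x assume x: "x \<in> fst c"
      show "volume_density (\<lambda>_. b) c gauss (chart_inv c (snd c x)) / volume_density (\<lambda>_. ip p) c \<phi> (chart_inv c (snd c x)) = w x"
        using I[OF c x] density_phi_pos[OF c x] indep[OF c x] c x by simp
    qed
    fix x assume x: "x \<in> fst c"
    show "volume_density (\<lambda>_. b) c gauss x = w x * volume_density (\<lambda>_. ip p) c \<phi> x"
      using I[OF c x] indep[OF c x] by simp
  next
    fix x assume "x \<in> carrier A"
    then show "w x \<ge> 0" using w I0 chart_at by simp
  qed (fact K)+
qed

text \<open>The sign is compared at the single point \<open>x\<close>, not on a neighborhood: by
  \<open>weingarten\<close> the tangential part of the derivative of a unit normal is determined by
  the value of the normal and by second derivatives of \<phi>.\<close>

lemma normal_sign:
  assumes N': "unit_normal A p \<epsilon> \<phi> N'" and c: "c \<in> A" "x \<in> fst c"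
  obtains \<sigma> where "\<sigma> \<in> {-1, 1}" "\<And>v. shape_operator c \<phi> N' x v = \<sigma> *\<^sub>R shape_operator c \<phi> N x v"
proof -
  interpret h': hyp A p \<epsilon> \<phi> N' by unfold_locales (use card eps sphere smooth_phi nondeg N' in auto)
  interpret f: hframe p \<epsilon> "\<phi> x" "N x" "differential c \<phi> x" "differential c N x" by (rule frame[OF c])
  interpret f': hframe p \<epsilon> "\<phi> x" "N' x" "differential c \<phi> x" "differential c N' x" by (rule h'.frame[OF c])
  obtain \<sigma> where \<sigma>: "\<sigma> \<in> {-1, 1}" "N' x = \<sigma> *\<^sub>R N x"
    using f.normal_unique[OF f'.Nx h'.normalD(3)[OF c] f'.NN] by blast
  have dN: "differential c N' x v = \<sigma> *\<^sub>R differential c N x v" for v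
  proof -
    have "differential c N' x v - \<sigma> *\<^sub>R differential c N x v = 0"
    proof (rule f.orthogonal_zero)
      show "ip p (differential c N' x v - \<sigma> *\<^sub>R differential c N x v) (\<phi> x) = 0" by (simp add: f.Bx f'.Bx)
      have "\<sigma> * ip p (differential c N' x v) (N x) = 0" using f'.BN[of v] by (simp add: \<sigma>(2))
      then show "ip p (differential c N' x v - \<sigma> *\<^sub>R differential c N x v) (N x) = 0" using \<sigma>(1) by (auto simp: f.BN)
      fix w
      show "ip p (differential c N' x v - \<sigma> *\<^sub>R differential c N x v) (differential c \<phi> x w) = 0"
        using weingarten[OF c, of v w] h'.weingarten[OF c, of v w] by (simp add: \<sigma>(2) h'.hess_def hess_def)
    qed
    then show ?thesis by simp
  qed
  have "f'.S v = \<sigma> *\<^sub>R f.S v" for v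
    by (rule f.L_inj) (simp add: f'.S_eq dN linear_cmul[OF f.linear_L] f.S_eq)
  then show thesis using that[OF \<sigma>(1)] shape_eq[OF c] h'.shape_eq[OF c] by simp
qed

lemma linear_shape: "c \<in> A \<Longrightarrow> x \<in> fst c \<Longrightarrow> linear (shape_operator c \<phi> N x)"
  by (simp add: shape_eq hframe.linear_S[OF frame])

lemma matrix_sign:
  assumes N': "unit_normal A p \<epsilon> \<phi> N'" and c: "c \<in> A" "x \<in> fst c"
  obtains \<sigma> where "\<sigma> \<in> {-1, 1}" "matrix (shape_operator c \<phi> N' x) = \<sigma> *\<^sub>R matrix (shape_operator c \<phi> N x)"
proof -
  obtain \<sigma> where \<sigma>: "\<sigma> \<in> {-1, 1}" "\<And>v. shape_operator c \<phi> N' x v = \<sigma> *\<^sub>R shape_operator c \<phi> N x v"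
    using normal_sign[OF assms] by blast
  show thesis by (rule that[OF \<sigma>(1)]) (simp add: matrix_def vec_eq_iff \<sigma>(2))
qed

theorem W_functional_eq:
  assumes K: "compact K" "K \<subseteq> carrier A"
  shows "W_functional A p \<epsilon> K \<phi> = measure (volume_measure A (\<lambda>_. biv_ip p) gauss) K"
proof -
  \<comment> \<open>The functional has its own unit normal, which agrees with \<open>N\<close> at
    each point only up to a sign; the square of the shape operator is insensitive to it.\<close>
  define N' where "N' = (SOME N. unit_normal A p \<epsilon> \<phi> N)"
  have N': "unit_normal A p \<epsilon> \<phi> N'" unfolding N'_def by (rule someI[of "unit_normal A p \<epsilon> \<phi>", OF normal])
  show ?thesis
    unfolding W_functional_def N'_def[symmetric] Let_def
  proof (rule functional_eq[OF bilinear_biv_ip _ W_density _ K])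
    show "W_integrand c x \<ge> 0" for c x by (simp add: W_integrand_def Let_def)
    fix x assume "x \<in> carrier A"
    note d = chart_at[OF this]
    obtain \<sigma> where \<sigma>: "\<sigma> \<in> {-1, 1}" "matrix (shape_operator (chart_at A x) \<phi> N' x)
        = \<sigma> *\<^sub>R matrix (shape_operator (chart_at A x) \<phi> N x)" using matrix_sign[OF N' d] .
    have "(\<sigma> *\<^sub>R M) ** (\<sigma> *\<^sub>R M) = M ** M" for M :: "real ^ 'n ^ 'n"
      using \<sigma>(1) by (auto simp: matrix_matrix_mult_def vec_eq_iff)
    then show "sqrt \<bar>det (\<epsilon> *\<^sub>R mat 1 + matrix (shape_operator (chart_at A x) \<phi> N' x) ** matrix (shape_operator (chart_at A x) \<phi> N' x))\<bar>
        = W_integrand (chart_at A x) x"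
      unfolding \<sigma>(2) W_integrand_def Let_def by simp
  qed
qed

text \<open>Positivity of the discriminant supplies principal curvatures, and every choice of them
  has the same gap, the root of the discriminant; so the definite description has a unique
  value.\<close>

lemma curvature_gap_eq:
  assumes two: "CARD('n) = 2" and c: "c \<in> A" "x \<in> fst c" and d: "disc (matrix (shape_operator c \<phi> N x)) > 0"
  shows "curvature_gap c p \<phi> N x = sqrt (disc (matrix (shape_operator c \<phi> N x)))"
proof -
  interpret f: hframe p \<epsilon> "\<phi> x" "N x" "differential c \<phi> x" "differential c N x" by (rule frame[OF c])
  have pc: "principal_curvatures c p \<phi> N x k \<longleftrightarrow> (\<exists>e. orthonormal f.g e \<and> (\<forall>i. f.S (e i) = k i *\<^sub>R e i))" for k
    by (simp add: principal_curvatures_def metric_eq(2)[OF c] shape_eq[OF c])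
  show ?thesis
    unfolding curvature_gap_def
  proof (rule the_equality)
    obtain e k where ek: "orthonormal f.g e" "\<And>i. f.S (e i) = k i *\<^sub>R e i"
      using f.ex_principal[OF two] d unfolding shape_eq[OF c] by metis
    obtain i j :: 'n where "i \<noteq> j" using two card_2_iff[of "UNIV :: 'n set"] by auto
    then have "sqrt (disc (matrix f.S)) = \<bar>k i - k j\<bar>" using f.disc_principal[OF two ek] by simp
    then show "\<exists>k i j. principal_curvatures c p \<phi> N x k \<and> i \<noteq> j \<and>
        sqrt (disc (matrix (shape_operator c \<phi> N x))) = \<bar>k i - k j\<bar>"
      unfolding pc shape_eq[OF c] using ek \<open>i \<noteq> j\<close> by blast
    fix d' assume "\<exists>k i j. principal_curvatures c p \<phi> N x k \<and> i \<noteq> j \<and> d' = \<bar>k i - k j\<bar>"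
    then obtain k i j where "principal_curvatures c p \<phi> N x k" "i \<noteq> j" "d' = \<bar>k i - k j\<bar>" by blast
    then obtain e where "orthonormal f.g e" "\<And>i. f.S (e i) = k i *\<^sub>R e i" unfolding pc by blast
    from f.disc_principal[OF two this \<open>i \<noteq> j\<close>]
    show "d' = sqrt (disc (matrix (shape_operator c \<phi> N x)))"
      unfolding shape_eq[OF c] \<open>d' = _\<close> by simp
  qed
qed

theorem W'_functional_eq:
  assumes two: "CARD('n) = 2" and K: "compact K" "K \<subseteq> carrier A"
    and d: "\<And>c x. c \<in> A \<Longrightarrow> x \<in> fst c \<Longrightarrow> disc (matrix (shape_operator c \<phi> N x)) > 0"
  shows "W'_functional A p \<epsilon> K \<phi> = measure (volume_measure A (\<lambda>_. klein) gauss) K"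
proof -
  define N' where "N' = (SOME N. unit_normal A p \<epsilon> \<phi> N)"
  have N': "unit_normal A p \<epsilon> \<phi> N'" unfolding N'_def by (rule someI[of "unit_normal A p \<epsilon> \<phi>", OF normal])
  interpret h': hyp A p \<epsilon> \<phi> N' by unfold_locales (use card eps sphere smooth_phi nondeg N' in auto)
  show ?thesis
    unfolding W'_functional_def N'_def[symmetric] Let_def
  proof (rule functional_eq[OF bilinear_klein _ W'_density[OF two] _ K])
    show "W'_integrand c x \<ge> 0" for c x by (simp add: W'_integrand_def)
    fix x assume "x \<in> carrier A"
    note ca = chart_at[OF this]
    obtain \<sigma> where \<sigma>: "\<sigma> \<in> {-1, 1}" "matrix (shape_operator (chart_at A x) \<phi> N' x)
        = \<sigma> *\<^sub>R matrix (shape_operator (chart_at A x) \<phi> N x)" using matrix_sign[OF N' ca] .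
    have e: "disc (matrix (shape_operator (chart_at A x) \<phi> N' x)) = disc (matrix (shape_operator (chart_at A x) \<phi> N x))"
      unfolding \<sigma>(2) by (rule disc_scale[OF two \<sigma>(1)])
    then show "curvature_gap (chart_at A x) p \<phi> N' x = W'_integrand (chart_at A x) x"
      using h'.curvature_gap_eq[OF two ca] d[OF ca] by (simp add: W'_integrand_def)
  qed
qed

lemma shape_change:
  assumes c: "c \<in> A" "c' \<in> A" "x \<in> fst c" "x \<in> fst c'"
  shows "trans c c' x (shape_operator c \<phi> N x v) = shape_operator c' \<phi> N x (trans c c' x v)"
proof -
  interpret f: hframe p \<epsilon> "\<phi> x" "N x" "differential c \<phi> x" "differential c N x" by (rule frame[OF c(1,3)])
  interpret f': hframe p \<epsilon> "\<phi> x" "N x" "differential c' \<phi> x" "differential c' N x" by (rule frame[OF c(2,4)])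
  show ?thesis
    unfolding shape_eq[OF c(1,3)] shape_eq[OF c(2,4)]
    by (rule f'.L_inj) (simp only: differential_change[OF smooth_phi c, symmetric] f.S_eq f'.S_eq
        differential_change[OF smooth_N c, symmetric])
qed

lemma disc_change:
  assumes c: "c \<in> A" "c' \<in> A" "x \<in> fst c" "x \<in> fst c'"
  shows "disc (matrix (shape_operator c \<phi> N x)) = disc (matrix (shape_operator c' \<phi> N x))"
proof (rule disc_similar)
  note l = linear_trans[OF c] linear_shape[OF c(1,3)] linear_shape[OF c(2,4)]
  show "matrix (trans c c' x) ** matrix (shape_operator c \<phi> N x) = matrix (shape_operator c' \<phi> N x) ** matrix (trans c c' x)"
    unfolding matrix_eq matrix_vector_mul_assoc[symmetric] matrix_real[OF l(1)] matrix_real[OF l(2)] matrix_real[OF l(3)]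
    using shape_change[OF c] by simp
  show "det (matrix (trans c c' x)) \<noteq> 0" using trans_pos[OF c] by simp
qed

end

section \<open>Unit normals along a variation\<close>

text \<open>Cramer's rule; the explicit quotient of determinants shows that the solution depends
  smoothly on the matrix and the right side.\<close>

definition solve :: "real ^ 'n ^ 'n \<Rightarrow> real ^ 'n \<Rightarrow> real ^ 'n" where
  "solve M r = (\<chi> k. det (\<chi> i j. if j = k then r $ i else M $ i $ j) / det M)"

lemma solve: "det M \<noteq> 0 \<Longrightarrow> M *v z = r \<longleftrightarrow> z = solve M r"
  unfolding solve_def using cramer[of M z r] by simp

lemma smooth_on_solve:
  fixes M :: "'b::real_normed_vector \<Rightarrow> real ^ 'n ^ 'n"
  assumes S: "open S" and M: "\<And>i j. smooth_on S (\<lambda>x. M x $ i $ j)" and r: "\<And>i. smooth_on S (\<lambda>x. r x $ i)"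
    and d: "\<And>x. x \<in> S \<Longrightarrow> det (M x) \<noteq> 0"
  shows "smooth_on S (\<lambda>x. solve (M x) (r x) $ k)"
proof -
  have "smooth_on S (\<lambda>x. if j = k then r x $ i else M x $ i $ j)" for i j
    using M r by (cases "j = k") auto
  then show ?thesis
    unfolding solve_def vec_lambda_beta
    by (intro smooth_on_divide smooth_on_det S M d) simp_all
qed

lemma linear_axis_expand:
  fixes L :: "real ^ 'n \<Rightarrow> 'b::real_vector"
  assumes "linear L"
  shows "L v = (\<Sum>i\<in>UNIV. v $ i *\<^sub>R L (axis i 1))"
  by (subst basis_expansion[of v, symmetric], unfold scalar_mult_eq_scaleR)
    (simp only: linear_sum[OF assms] linear_cmul[OF assms])

text \<open>From \<open>w\<close> its components along \<open>x\<close> and along the image of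
  \<open>L\<close> are removed. The frame of that image is not orthonormal, so the tangential
  coefficients solve a linear system with the Gram matrix.\<close>

lemma normal_projection:
  fixes L :: "real ^ 'n \<Rightarrow> 'm::{finite,linorder} rvec"
  assumes L: "linear L" and xx: "ip p x x = 1" and Lx: "\<And>v. ip p (L v) x = 0"
    and d: "det (gram (\<lambda>v w. ip p (L v) (L w))) \<noteq> 0"
    and M: "M = w - ip p w x *\<^sub>R x - L (solve (gram (\<lambda>v w. ip p (L v) (L w))) (\<chi> i. ip p w (L (axis i 1))))"
  shows "ip p M x = 0" "ip p M (L v) = 0"
proof -
  define z where "z = solve (gram (\<lambda>v w. ip p (L v) (L w))) (\<chi> i. ip p w (L (axis i 1)))"
  have M: "M = w - ip p w x *\<^sub>R x - L z" using M by (simp add: z_def)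
  show "ip p M x = 0" by (simp add: M xx Lx)
  have xL: "ip p x (L v) = 0" for v using Lx[of v] ip_commute[of p x "L v"] by simp
  have z: "gram (\<lambda>v w. ip p (L v) (L w)) *v z = (\<chi> i. ip p w (L (axis i 1)))"
    using solve[OF d] by (simp add: z_def)
  have b: "bilinear (\<lambda>v w. ip p (L v) (L w))" by (rule bilinear_compose[OF bilinear_ip L])
  have "ip p M (L (axis i 1)) = 0" for i
  proof -
    have "ip p (L (axis i 1)) (L z) = axis i 1 \<bullet> (gram (\<lambda>v w. ip p (L v) (L w)) *v z)"
      using gram_vec[OF b, of "axis i 1" z] .
    also have "\<dots> = ip p w (L (axis i 1))" unfolding z by (simp add: inner_axis')
    finally show ?thesis using ip_commute[of p "L z" "L (axis i 1)"] by (simp add: M xL)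
  qed
  moreover have "linear (\<lambda>v. ip p M (L v))"
    by (intro linearI) (simp_all add: linear_add[OF L] linear_cmul[OF L])
  ultimately show "ip p M (L v) = 0"
    using linear_axis_expand[of "\<lambda>v. ip p M (L v)" v] by simp
qed

text \<open>The coefficients may differ in the two representations, so projections computed in
  different charts can be identified.\<close>

lemma normal_projection_unique:
  fixes L :: "real ^ 'n \<Rightarrow> 'm::{finite,linorder} rvec"
  assumes L: "linear L" and xx: "ip p x x = 1" and Lx: "\<And>v. ip p (L v) x = 0"
    and nd: "\<And>v. (\<And>w. ip p (L v) (L w) = 0) \<Longrightarrow> v = 0"
    and M: "M = w - a *\<^sub>R x - L z" "ip p M x = 0" "\<And>v. ip p M (L v) = 0"
    and M': "M' = w - a' *\<^sub>R x - L z'" "ip p M' x = 0" "\<And>v. ip p M' (L v) = 0"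
  shows "M = M'"
proof -
  have D: "M - M' = (a' - a) *\<^sub>R x + L (z' - z)"
    by (simp add: M(1) M'(1) linear_diff[OF L] algebra_simps)
  have "ip p (M - M') x = 0" using M M' by simp
  then have "a' = a" unfolding D by (simp add: xx Lx)
  then have D': "M - M' = L (z' - z)" using D by simp
  have "z' - z = 0" by (rule nd) (simp only: D'[symmetric] ip_diff_left M(3) M'(3) diff_self)
  then show ?thesis using D' by (simp add: linear_0[OF L])
qed

lemma pullback_cong: "differential c f x = differential c f' x \<Longrightarrow> pullback b c f x = pullback b c f' x"
  by (simp add: pullback_def fun_eq_iff)

lemma (in omfd) variation_smooth_family:
  assumes "variation A T f \<delta> K F"
  shows "smooth_family \<delta> F"
  using assms unfolding variation_def smooth_family_def by (simp add: fam_def[abs_def] case_prod_beta')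

lemma (in omfd) variation_constant:
  assumes V: "variation A T f \<delta> K F" and t: "\<bar>t\<bar> < \<delta>" and c: "c \<in> A" "x \<in> fst c" "x \<notin> K"
    and f: "smooth_map A f"
  shows "F t x = f x" "differential c (F t) x = differential c f x"
proof -
  have K: "compact K" "\<And>y. y \<in> carrier A \<Longrightarrow> y \<notin> K \<Longrightarrow> F t y = f y"
    using V t by (auto simp: variation_def abs_less_iff)
  show "F t x = f x" using K(2)[OF carrierI[OF c(1,2)] c(3)] .
  have "open (- K)" using compact_imp_closed[OF K(1)] by (simp add: open_Compl)
  then show "differential c (F t) x = differential c f x"
    using differential_cong_open[OF c(1,2) _ _ _ f, of "- K" "F t"] K(2) carrierI[OF c(1)] c(3) by auto
qed

context hyp begin

lemma const_ip:
  assumes "smooth_map A f" "smooth_map A h" "\<And>y. y \<in> fst c \<Longrightarrow> ip p (f y) (h y) = k" "c \<in> A" "x \<in> fst c"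
  shows "ip p (f x) (differential c h x v) + ip p (differential c f x v) (h x) = 0"
  using differential_bilinear[OF bilinear_ip[of p] assms(1,2,4,5), of v]
    differential_locally_const[OF assms(4,5) open_UNIV, of "\<lambda>x. ip p (f x) (h x)" k v] assms(3) by simp

context
  fixes \<delta> K and F :: "real \<Rightarrow> 'a \<Rightarrow> 'm rvec"
  assumes V: "variation A (pseudo_sphere p) \<phi> \<delta> K F"
begin

lemma family: "smooth_family \<delta> F"
  by (rule variation_smooth_family[OF V])

lemma family_sphere: "\<bar>t\<bar> < \<delta> \<Longrightarrow> x \<in> carrier A \<Longrightarrow> ip p (F t x) (F t x) = 1"
  using V by (auto simp: variation_def pseudo_sphere_def abs_less_iff)

lemma family_compact: "compact K" "K \<subseteq> carrier A"
  using V by (auto simp: variation_def)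

lemma family_start: "x \<in> carrier A \<Longrightarrow> F 0 x = \<phi> x"
  using V by (auto simp: variation_def)

lemma family_start_differential: "c \<in> A \<Longrightarrow> x \<in> fst c \<Longrightarrow> differential c (F 0) x = differential c \<phi> x"
  using differential_cong_open[of c x "carrier A" \<phi> "F 0"] open_carrier carrierI family_start smooth_phi by auto

lemma family_constant:
  assumes "\<bar>t\<bar> < \<delta>" "c \<in> A" "x \<in> fst c" "x \<notin> K"
  shows "F t x = \<phi> x" "differential c (F t) x = differential c \<phi> x"
  by (rule variation_constant[OF V assms smooth_phi])+

lemma family_tangent:
  assumes t: "\<bar>t\<bar> < \<delta>" and c: "c \<in> A" "x \<in> fst c"
  shows "ip p (differential c (F t) x v) (F t x) = 0"
  using const_ip[OF smooth_family_map[OF family t] smooth_family_map[OF family t] family_sphere[OF t carrierI[OF c(1)]] c, of v]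
    ip_commute[of p "F t x" "differential c (F t) x v"] by simp

definition metric :: "('a, 'n) chart \<Rightarrow> real \<Rightarrow> 'a \<Rightarrow> real ^ 'n ^ 'n" where
  "metric c t x = gram (pullback (ip p) c (F t) x)"

lemma metric_nonzero_start: "c \<in> A \<Longrightarrow> x \<in> fst c \<Longrightarrow> det (gram (pullback (ip p) c \<phi> x)) \<noteq> 0"
  by (simp add: metric_eq(1) hframe.det_gram_g[OF frame])

text \<open>On \<open>K\<close> the nonzero determinant at time zero persists for a common short
  time by \<open>tube\<close>; off \<open>K\<close> the map has not moved. A change of chart
  multiplies the determinant by a positive square, so one chart for each point is enough.\<close>

lemma ex_metric_nonzero:
  obtains \<delta>1 where "0 < \<delta>1" "\<delta>1 \<le> \<delta>" "\<And>t c x. \<bar>t\<bar> < \<delta>1 \<Longrightarrow> c \<in> A \<Longrightarrow> x \<in> fst c \<Longrightarrow> det (metric c t x) \<noteq> 0"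
proof -
  note \<delta> = zero_less(2)[OF family]
  obtain \<delta>1 where \<delta>1: "0 < \<delta>1" "\<delta>1 \<le> \<delta>"
      "\<And>y. y \<in> K \<Longrightarrow> \<exists>c\<in>A. y \<in> fst c \<and> (\<forall>t. \<bar>t\<bar> < \<delta>1 \<longrightarrow> det (metric c t y) \<noteq> 0)"
  proof (rule tube[OF family_compact \<delta>, of "\<lambda>c t y. det (metric c t y) \<noteq> 0"])
    fix x assume "x \<in> K"
    then obtain c where c: "c \<in> A" "x \<in> fst c" using family_compact carrierE by blast
    define q where "q = (\<lambda>z. \<bar>det (metric c (fst z) (chart_inv c (snd z)))\<bar>)"
    have "continuous_on ({-\<delta><..<\<delta>} \<times> chart_range c) q"
      unfolding q_def metric_def
      by (intro continuous_intros smooth_on_imp_continuous_on smooth_family_det[OF family bilinear_ip c(1)])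
    moreover have "q (0, snd c x) > 0"
      using metric_nonzero_start[OF c] c pullback_cong[OF family_start_differential[OF c], where b = "ip p"] by (simp add: q_def metric_def)
    moreover have "\<forall>t y. \<bar>t\<bar> < \<delta> \<longrightarrow> y \<in> fst c \<longrightarrow> q (t, snd c y) > 0 \<longrightarrow> det (metric c t y) \<noteq> 0"
      using c by (auto simp: q_def)
    ultimately show "\<exists>c\<in>A. x \<in> fst c \<and> (\<exists>q. continuous_on ({-\<delta><..<\<delta>} \<times> chart_range c) q \<and> q (0, snd c x) > (0 :: real) \<and>
      (\<forall>t y. \<bar>t\<bar> < \<delta> \<longrightarrow> y \<in> fst c \<longrightarrow> q (t, snd c y) > 0 \<longrightarrow> det (metric c t y) \<noteq> 0))"
      using c by blast
  qed blast
  show thesis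
  proof (rule that[OF \<delta>1(1,2)])
    fix t c x assume t: "\<bar>t\<bar> < \<delta>1" and c: "c \<in> A" "x \<in> fst c"
    have t': "\<bar>t\<bar> < \<delta>" using t \<delta>1(2) by simp
    show "det (metric c t x) \<noteq> 0"
    proof (cases "x \<in> K")
      case True
      then obtain d where d: "d \<in> A" "x \<in> fst d" "det (metric d t x) \<noteq> 0" using \<delta>1(3) t by blast
      then show ?thesis
        using det_gram_pullback_change[OF smooth_family_map[OF family t'] bilinear_ip[of p] c(1) d(1) c(2) d(2)]
          trans_pos[OF c(1) d(1) c(2) d(2)] by (simp add: metric_def)
    next
      case False
      then show ?thesis
        using pullback_cong[OF family_constant(2)[OF t' c False], where b = "ip p"] metric_nonzero_start[OF c] by (simp add: metric_def)
    qed
  qed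
qed

text \<open>The original normal \<open>N x\<close>, held fixed in the ambient space and projected to
  the normal line of the moved hypersurface.\<close>

definition proj :: "('a, 'n) chart \<Rightarrow> real \<Rightarrow> 'a \<Rightarrow> 'm rvec" where
  "proj c t x = N x - ip p (N x) (F t x) *\<^sub>R F t x -
    differential c (F t) x (solve (metric c t x) (\<chi> i. ip p (N x) (differential c (F t) x (axis i 1))))"

lemma proj_normal:
  assumes t: "\<bar>t\<bar> < \<delta>" and c: "c \<in> A" "x \<in> fst c" and d: "det (metric c t x) \<noteq> 0"
  shows "ip p (proj c t x) (F t x) = 0" "ip p (proj c t x) (differential c (F t) x v) = 0"
proof -
  note l = linear_differential[OF smooth_family_map[OF family t] c]
  have e: "metric c t x = gram (\<lambda>v w. ip p (differential c (F t) x v) (differential c (F t) x w))"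
    by (simp add: metric_def pullback_def[abs_def])
  note np = normal_projection[OF l family_sphere[OF t carrierI[OF c]] family_tangent[OF t c] d[unfolded e], of "proj c t x" "N x"]
  show "ip p (proj c t x) (F t x) = 0" "ip p (proj c t x) (differential c (F t) x v) = 0"
    using np by (simp_all add: proj_def e)
qed

lemma metric_nondegenerate:
  assumes t: "\<bar>t\<bar> < \<delta>" and c: "c \<in> A" "x \<in> fst c" and d: "det (metric c t x) \<noteq> 0"
    and 0: "\<And>w. ip p (differential c (F t) x v) (differential c (F t) x w) = 0"
  shows "v = 0"
  using d det_gram_nonzero_iff[OF bilinear_pullback[OF smooth_family_map[OF family t] bilinear_ip[of p] c]]
    0 ip_commute unfolding metric_def pullback_def by blast

lemma proj_unique:
  assumes t: "\<bar>t\<bar> < \<delta>" and c: "c \<in> A" "x \<in> fst c" and d: "det (metric c t x) \<noteq> 0"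
    and M: "M = N x - a *\<^sub>R F t x - differential c (F t) x z" "ip p M (F t x) = 0"
      "\<And>v. ip p M (differential c (F t) x v) = 0"
  shows "proj c t x = M"
  by (rule normal_projection_unique[OF linear_differential[OF smooth_family_map[OF family t] c]
        family_sphere[OF t carrierI[OF c]] family_tangent[OF t c] metric_nondegenerate[OF t c d]
        proj_def proj_normal[OF t c d] M])

lemma proj_change:
  assumes t: "\<bar>t\<bar> < \<delta>" and c: "c \<in> A" "x \<in> fst c" and c': "c' \<in> A" "x \<in> fst c'"
    and d: "det (metric c t x) \<noteq> 0" "det (metric c' t x) \<noteq> 0"
  shows "proj c t x = proj c' t x"
proof -
  note ch = differential_change[OF smooth_family_map[OF family t]]
  show ?thesis
  proof (rule proj_unique[OF t c d(1)])
    show "proj c' t x = N x - ip p (N x) (F t x) *\<^sub>R F t x - differential c (F t) x (trans c' c x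
      (solve (metric c' t x) (\<chi> i. ip p (N x) (differential c' (F t) x (axis i 1)))))"
      unfolding ch[OF c'(1) c(1) c'(2) c(2), symmetric] by (rule proj_def)
    show "ip p (proj c' t x) (F t x) = 0" by (rule proj_normal[OF t c' d(2)])
    show "ip p (proj c' t x) (differential c (F t) x v) = 0" for v
      unfolding ch[OF c(1) c'(1) c(2) c'(2)] by (rule proj_normal[OF t c' d(2)])
  qed
qed

lemma proj_trivial:
  assumes t: "\<bar>t\<bar> < \<delta>" and c: "c \<in> A" "x \<in> fst c" and d: "det (metric c t x) \<noteq> 0"
    and eq: "F t x = \<phi> x" "differential c (F t) x = differential c \<phi> x"
  shows "proj c t x = N x"
proof (rule proj_unique[OF t c d, of _ 0 0])
  show "N x = N x - 0 *\<^sub>R F t x - differential c (F t) x 0"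
    using linear_0[OF linear_differential[OF smooth_family_map[OF family t] c]] by simp
qed (use normalD[OF c] eq in simp_all)

lemma smooth_proj:
  assumes \<delta>1: "0 < \<delta>1" "\<delta>1 \<le> \<delta>" and c: "c \<in> A"
    and d: "\<And>t x. \<bar>t\<bar> < \<delta>1 \<Longrightarrow> x \<in> fst c \<Longrightarrow> det (metric c t x) \<noteq> 0"
  shows "smooth_on ({-\<delta>1<..<\<delta>1} \<times> chart_range c) (\<lambda>q. proj c (fst q) (chart_inv c (snd q)))"
proof -
  let ?S = "{-\<delta>1<..<\<delta>1} \<times> chart_range c"
  note fam1 = smooth_family_mono[OF family \<delta>1]
  note o = open_box[OF c, of \<delta>1]
  have sF: "smooth_on ?S (\<lambda>q. F (fst q) (chart_inv c (snd q)))"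
    using fam1 c by (simp add: smooth_family_def fam_def[abs_def])
  have sN: "smooth_on ?S (\<lambda>q. N (chart_inv c (snd q)))"
    using smooth_family_const[OF \<delta>1(1) smooth_N] c by (simp add: smooth_family_def fam_def[abs_def])
  note sD = smooth_family_differential[OF fam1 c]
  have sm: "smooth_on ?S (\<lambda>q. metric c (fst q) (chart_inv c (snd q)) $ i $ j)" for i j
    unfolding metric_def gram_def pullback_def vec_lambda_beta
    by (intro smooth_on_bilinear[OF bilinear_ip] o sD)
  have sr: "smooth_on ?S (\<lambda>q. (\<chi> i. ip p (N (chart_inv c (snd q))) (differential c (F (fst q)) (chart_inv c (snd q)) (axis i 1))) $ i)" for i
    unfolding vec_lambda_beta by (intro smooth_on_bilinear[OF bilinear_ip] o sD sN)
  have ss: "smooth_on ?S (\<lambda>q. solve (metric c (fst q) (chart_inv c (snd q)))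
      (\<chi> i. ip p (N (chart_inv c (snd q))) (differential c (F (fst q)) (chart_inv c (snd q)) (axis i 1))) $ k)" for k
    by (rule smooth_on_solve[OF o sm sr]) (use d c in \<open>auto simp: abs_less_iff\<close>)
  have "smooth_on ?S (\<lambda>q. N (chart_inv c (snd q)) - ip p (N (chart_inv c (snd q))) (F (fst q) (chart_inv c (snd q))) *\<^sub>R
      F (fst q) (chart_inv c (snd q)) - (\<Sum>k\<in>UNIV. solve (metric c (fst q) (chart_inv c (snd q)))
      (\<chi> i. ip p (N (chart_inv c (snd q))) (differential c (F (fst q)) (chart_inv c (snd q)) (axis i 1))) $ k *\<^sub>R
      differential c (F (fst q)) (chart_inv c (snd q)) (axis k 1)))"
    by (intro smooth_on_diff smooth_on_scaleR smooth_on_sum smooth_on_bilinear[OF bilinear_ip] o ss sD sN sF)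
  then show ?thesis
  proof (rule smooth_on_cong[OF o])
    fix q assume q: "q \<in> ?S"
    have t: "\<bar>fst q\<bar> < \<delta>" "chart_inv c (snd q) \<in> fst c" using q \<delta>1 c by (auto simp: abs_less_iff)
    note l = linear_differential[OF smooth_family_map[OF family t(1)] c t(2)]
    show "N (chart_inv c (snd q)) - ip p (N (chart_inv c (snd q))) (F (fst q) (chart_inv c (snd q))) *\<^sub>R
      F (fst q) (chart_inv c (snd q)) - (\<Sum>k\<in>UNIV. solve (metric c (fst q) (chart_inv c (snd q)))
      (\<chi> i. ip p (N (chart_inv c (snd q))) (differential c (F (fst q)) (chart_inv c (snd q)) (axis i 1))) $ k *\<^sub>R
      differential c (F (fst q)) (chart_inv c (snd q)) (axis k 1)) = proj c (fst q) (chart_inv c (snd q))"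
      unfolding proj_def by (subst linear_axis_expand[OF l]) (rule refl)
  qed
qed

text \<open>The projection \<open>proj\<close> does not depend on the chart and is normal to the
  moved hypersurface. Its square is \<epsilon> at time zero and off \<open>K\<close>, and keeps the
  sign of \<epsilon> for short times by compactness of \<open>K\<close>, so it can be divided by its
  length.\<close>

theorem normal_variation:
  obtains \<delta>' N' where "0 < \<delta>'" "\<delta>' \<le> \<delta>" "smooth_family \<delta>' N'" "\<And>x. x \<in> carrier A \<Longrightarrow> N' 0 x = N x"
    "\<And>t x. \<bar>t\<bar> < \<delta>' \<Longrightarrow> x \<in> carrier A \<Longrightarrow> x \<notin> K \<Longrightarrow> N' t x = N x"
    "\<And>t. \<bar>t\<bar> < \<delta>' \<Longrightarrow> hyp A p \<epsilon> (F t) (N' t)"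
proof -
  obtain \<delta>1 where \<delta>1: "0 < \<delta>1" "\<delta>1 \<le> \<delta>" "\<And>t c x. \<bar>t\<bar> < \<delta>1 \<Longrightarrow> c \<in> A \<Longrightarrow> x \<in> fst c \<Longrightarrow> det (metric c t x) \<noteq> 0"
    using ex_metric_nonzero by blast
  note sp = smooth_proj[OF \<delta>1(1,2) _ \<delta>1(3)]
  have t1: "\<bar>t\<bar> < \<delta>" if "\<bar>t\<bar> < \<delta>1" for t using that \<delta>1(2) by simp
  \<comment> \<open>The factor \<epsilon> makes this quantity 1 at time zero, whether the normal is
    spacelike or timelike.\<close>
  define nq where "nq c t x = \<epsilon> * ip p (proj c t x) (proj c t x)" for c :: "('a, 'n) chart" and t x
  have snq: "smooth_on ({-\<delta>1<..<\<delta>1} \<times> chart_range c) (\<lambda>q. nq c (fst q) (chart_inv c (snd q)))" if c: "c \<in> A" for c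
    unfolding nq_def by (intro smooth_on_mult smooth_on_const smooth_on_bilinear[OF bilinear_ip] open_box sp c)
  have p0: "proj c 0 x = N x" if c: "c \<in> A" "x \<in> fst c" for c x
    by (rule proj_trivial[OF _ c]) (use zero_less[OF family] \<delta>1 c family_start[OF carrierI[OF c]] family_start_differential[OF c] in auto)
  have pK: "proj c t x = N x" if c: "c \<in> A" "x \<in> fst c" and t: "\<bar>t\<bar> < \<delta>1" and x: "x \<notin> K" for c x t
    by (rule proj_trivial[OF t1[OF t] c \<delta>1(3)[OF t c] family_constant[OF t1[OF t] c x]])
  have ee: "\<epsilon> * \<epsilon> = 1" by (rule eps_square[OF eps])
  obtain \<delta>2 where \<delta>2: "0 < \<delta>2" "\<delta>2 \<le> \<delta>1" "\<And>y. y \<in> K \<Longrightarrow> \<exists>c\<in>A. y \<in> fst c \<and> (\<forall>t. \<bar>t\<bar> < \<delta>2 \<longrightarrow> nq c t y > 0)"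
  proof (rule tube[OF family_compact \<delta>1(1), of "\<lambda>c t y. nq c t y > 0"])
    fix x assume "x \<in> K"
    then obtain c where c: "c \<in> A" "x \<in> fst c" using family_compact carrierE by blast
    have "continuous_on ({-\<delta>1<..<\<delta>1} \<times> chart_range c) (\<lambda>q. nq c (fst q) (chart_inv c (snd q)))"
      by (rule smooth_on_imp_continuous_on[OF snq[OF c(1)]])
    moreover have "nq c (fst (0, snd c x)) (chart_inv c (snd (0, snd c x))) > 0"
      using c p0[OF c] normalD(1)[OF c] ee by (simp add: nq_def)
    moreover have "\<forall>t y. \<bar>t\<bar> < \<delta>1 \<longrightarrow> y \<in> fst c \<longrightarrow> nq c (fst (t, snd c y)) (chart_inv c (snd (t, snd c y))) > 0 \<longrightarrow> nq c t y > 0"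
      using c by auto
    ultimately show "\<exists>c\<in>A. x \<in> fst c \<and> (\<exists>q. continuous_on ({-\<delta>1<..<\<delta>1} \<times> chart_range c) q \<and> q (0, snd c x) > (0 :: real) \<and>
      (\<forall>t y. \<bar>t\<bar> < \<delta>1 \<longrightarrow> y \<in> fst c \<longrightarrow> q (t, snd c y) > 0 \<longrightarrow> nq c t y > 0))"
      using c by (intro bexI[of _ c] conjI exI[of _ "\<lambda>q. nq c (fst q) (chart_inv c (snd q))"]) assumption+
  qed blast
  have indep: "proj c t x = proj d t x" if "c \<in> A" "x \<in> fst c" "d \<in> A" "x \<in> fst d" "\<bar>t\<bar> < \<delta>1" for c d t x
    by (rule proj_change[OF t1[OF that(5)] that(1-4) \<delta>1(3)[OF that(5,1,2)] \<delta>1(3)[OF that(5,3,4)]])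
  have pos: "nq c t x > 0" if t: "\<bar>t\<bar> < \<delta>2" and c: "c \<in> A" "x \<in> fst c" for c t x
  proof (cases "x \<in> K")
    case True
    then obtain d where "d \<in> A" "x \<in> fst d" "nq d t x > 0" using \<delta>2(3) t by blast
    then show ?thesis using indep[OF c, of d t] t \<delta>2(2) by (simp add: nq_def)
  next
    case False
    then show ?thesis using pK[OF c, of t] t \<delta>2(2) normalD(1)[OF c] ee by (simp add: nq_def)
  qed
  \<comment> \<open>Defined through an arbitrary chart at each point; \<open>indep\<close>
    identifies it with the smooth local formula of every chart.\<close>
  define N' where "N' t x = (1 / sqrt (nq (chart_at A x) t x)) *\<^sub>R proj (chart_at A x) t x" for t x
  have N'c: "N' t x = (1 / sqrt (nq c t x)) *\<^sub>R proj c t x" if t: "\<bar>t\<bar> < \<delta>2" and c: "c \<in> A" "x \<in> fst c" for c t x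
    using indep[OF c chart_at[OF carrierI[OF c]], of t] t \<delta>2(2) by (simp add: N'_def nq_def)
  have sN': "smooth_family \<delta>2 N'"
    unfolding smooth_family_def
  proof (intro conjI ballI)
    fix c assume c: "c \<in> A"
    let ?S = "{-\<delta>2<..<\<delta>2} \<times> chart_range c"
    have sub: "?S \<subseteq> {-\<delta>1<..<\<delta>1} \<times> chart_range c" using \<delta>2(2) by auto
    have "smooth_on ?S (\<lambda>q. (1 / sqrt (nq c (fst q) (chart_inv c (snd q)))) *\<^sub>R proj c (fst q) (chart_inv c (snd q)))"
    proof (intro smooth_on_scaleR smooth_on_divide smooth_on_const smooth_on_sqrt open_box c
        smooth_on_subset[OF sp[OF c] sub] smooth_on_subset[OF snq[OF c] sub])
      fix q assume "q \<in> ?S"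
      then show "nq c (fst q) (chart_inv c (snd q)) > 0"
        by (intro pos c) (auto simp: abs_less_iff c)
      then show "sqrt (nq c (fst q) (chart_inv c (snd q))) \<noteq> 0" by simp
    qed
    then show "smooth_on ?S (fam N' c)"
    proof (rule smooth_on_cong[OF open_box[OF c]])
      fix q assume "q \<in> ?S"
      then have "\<bar>fst q\<bar> < \<delta>2" "chart_inv c (snd q) \<in> fst c" using c by (auto simp: abs_less_iff)
      from N'c[OF this(1) c this(2)]
      show "(1 / sqrt (nq c (fst q) (chart_inv c (snd q)))) *\<^sub>R proj c (fst q) (chart_inv c (snd q)) = fam N' c q"
        by (simp add: fam_def)
    qed
  qed (rule \<delta>2(1))
  show thesis
  proof (rule that[OF \<delta>2(1) _ sN'])
    show "\<delta>2 \<le> \<delta>" using \<delta>1 \<delta>2 by simp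
    show "N' 0 x = N x" if x: "x \<in> carrier A" for x
    proof -
      obtain c where c: "c \<in> A" "x \<in> fst c" using carrierE[OF x] .
      show ?thesis using N'c[of 0, OF _ c] \<delta>2(1) p0[OF c] normalD(1)[OF c] ee by (simp add: nq_def)
    qed
    show "N' t x = N x" if t: "\<bar>t\<bar> < \<delta>2" and x: "x \<in> carrier A" "x \<notin> K" for t x
    proof -
      obtain c where c: "c \<in> A" "x \<in> fst c" using carrierE[OF x(1)] .
      show ?thesis using N'c[OF t c] t \<delta>2(2) pK[OF c _ x(2), of t] normalD(1)[OF c] ee by (simp add: nq_def)
    qed
    fix t :: real assume t: "\<bar>t\<bar> < \<delta>2"
    have t1': "\<bar>t\<bar> < \<delta>1" "\<bar>t\<bar> < \<delta>" using t \<delta>1(2) \<delta>2(2) by auto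
    show "hyp A p \<epsilon> (F t) (N' t)"
    proof (intro hyp.intro hyp_axioms.intro)
      show "omfd A" by (rule omfd_axioms)
      show "CARD('m) = CARD('n) + 2" "\<epsilon> \<in> {-1, 1}" by (fact card eps)+
      show "ip p (F t x) (F t x) = 1" if "x \<in> carrier A" for x by (rule family_sphere[OF t1'(2) that])
      show "smooth_map A (F t)" by (rule smooth_family_map[OF family t1'(2)])
      show "nondegenerate_metric A (\<lambda>_. ip p) (F t)"
        unfolding nondegenerate_metric_def induced_metric_def
        using metric_nondegenerate[OF t1'(2) _ _ \<delta>1(3)[OF t1'(1)]] by blast
      show "unit_normal A p \<epsilon> (F t) (N' t)"
        unfolding unit_normal_def
      proof (intro conjI ballI allI)
        show "smooth_map A (N' t)" by (rule smooth_family_map[OF sN' t])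
        fix c x assume c: "c \<in> A" "x \<in> fst c"
        note pn = proj_normal[OF t1'(2) c \<delta>1(3)[OF t1'(1) c]] and ps = pos[OF t c]
        have "ip p (N' t x) (N' t x) = ip p (proj c t x) (proj c t x) / nq c t x"
          using ps by (simp add: N'c[OF t c])
        also have "\<dots> = \<epsilon>" using ps eps by (auto simp: nq_def)
        finally show "ip p (N' t x) (N' t x) = \<epsilon>" .
        show "ip p (N' t x) (F t x) = 0" "ip p (N' t x) (differential c (F t) x v) = 0" for v
          by (simp_all add: N'c[OF t c] pn)
      qed
    qed
  qed
qed

text \<open>The discriminant is continuous in time and space and independent of the chart. On
  \<open>K\<close> compactness preserves its sign for short times; off \<open>K\<close> neither the
  map nor the normal has changed.\<close>

lemma disc_variation:
  assumes \<delta>': "0 < \<delta>'" "\<delta>' \<le> \<delta>" and N': "smooth_family \<delta>' N'" "\<And>x. x \<in> carrier A \<Longrightarrow> N' 0 x = N x"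
    "\<And>t x. \<bar>t\<bar> < \<delta>' \<Longrightarrow> x \<in> carrier A \<Longrightarrow> x \<notin> K \<Longrightarrow> N' t x = N x"
    "\<And>t. \<bar>t\<bar> < \<delta>' \<Longrightarrow> hyp A p \<epsilon> (F t) (N' t)"
    and d: "\<And>c x. c \<in> A \<Longrightarrow> x \<in> fst c \<Longrightarrow> disc (matrix (shape_operator c \<phi> N x)) > 0"
  obtains \<eta> where "0 < \<eta>" "\<eta> \<le> \<delta>'"
    "\<And>t c x. \<bar>t\<bar> < \<eta> \<Longrightarrow> c \<in> A \<Longrightarrow> x \<in> fst c \<Longrightarrow> disc (matrix (shape_operator c (F t) (N' t) x)) > 0"
proof -
  define M where "M c t x = matrix (shape_operator c (F t) (N' t) x)" for c :: "('a, 'n) chart" and t x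
  note fam1 = smooth_family_mono[OF family \<delta>']
  have H: "hyp A p \<epsilon> (F t) (N' t)" if "\<bar>t\<bar> < \<delta>'" for t using N'(4)[OF that] .
  \<comment> \<open>The relation between the second fundamental form and the shape operator, solved
    for the latter with Cramer's rule; this exhibits the entries of the shape operator as smooth
    functions of time and space.\<close>
  have Mc: "M c t x $ k $ i = solve (metric c t x) (\<chi> j. - ip p (differential c (N' t) x (axis i 1)) (differential c (F t) x (axis j 1))) $ k"
    and Mnz: "det (metric c t x) \<noteq> 0"
    if t: "\<bar>t\<bar> < \<delta>'" and c: "c \<in> A" "x \<in> fst c" for c t x k i
  proof -
    interpret h: hyp A p \<epsilon> "F t" "N' t" by (rule H[OF t])
    interpret f: hframe p \<epsilon> "F t x" "N' t x" "differential c (F t) x" "differential c (N' t) x" by (rule h.frame[OF c])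
    have m: "metric c t x = gram f.g" by (simp add: metric_def h.metric_eq(1)[OF c])
    show nz: "det (metric c t x) \<noteq> 0" unfolding m by (rule f.det_gram_g)
    have "gram f.g *v f.S (axis i 1) = (\<chi> j. - ip p (differential c (N' t) x (axis i 1)) (differential c (F t) x (axis j 1)))"
    proof (rule vec_eq_iff[THEN iffD2, rule_format])
      fix j
      have "(gram f.g *v f.S (axis i 1)) $ j = axis j 1 \<bullet> (gram f.g *v f.S (axis i 1))" by (simp add: inner_axis')
      also have "\<dots> = f.g (axis j 1) (f.S (axis i 1))" by (rule gram_vec[OF f.bilinear_g, symmetric])
      also have "\<dots> = f.g (f.S (axis i 1)) (axis j 1)" by (rule f.g_commute)
      finally show "(gram f.g *v f.S (axis i 1)) $ j =
          (\<chi> j. - ip p (differential c (N' t) x (axis i 1)) (differential c (F t) x (axis j 1))) $ j"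
        by (simp add: f.g_def f.S_eq)
    qed
    then have "f.S (axis i 1) = solve (metric c t x) (\<chi> j. - ip p (differential c (N' t) x (axis i 1)) (differential c (F t) x (axis j 1)))"
      unfolding m using solve[OF f.det_gram_g] by blast
    then show "M c t x $ k $ i = solve (metric c t x) (\<chi> j. - ip p (differential c (N' t) x (axis i 1)) (differential c (F t) x (axis j 1))) $ k"
      by (simp add: M_def matrix_def h.shape_eq[OF c])
  qed
  have sM: "smooth_on ({-\<delta>'<..<\<delta>'} \<times> chart_range c) (\<lambda>q. M c (fst q) (chart_inv c (snd q)) $ k $ i)" if c: "c \<in> A" for c k i
  proof -
    let ?S = "{-\<delta>'<..<\<delta>'} \<times> chart_range c"
    note o = open_box[OF c, of \<delta>']
    have "smooth_on ?S (\<lambda>q. solve (metric c (fst q) (chart_inv c (snd q))) (\<chi> j. - ip p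
        (differential c (N' (fst q)) (chart_inv c (snd q)) (axis i 1)) (differential c (F (fst q)) (chart_inv c (snd q)) (axis j 1))) $ k)"
    proof (rule smooth_on_solve[OF o])
      show "smooth_on ?S (\<lambda>q. metric c (fst q) (chart_inv c (snd q)) $ i $ j)" for i j
        unfolding metric_def gram_def pullback_def vec_lambda_beta
        by (intro smooth_on_bilinear[OF bilinear_ip] o smooth_family_differential[OF fam1 c])
      show "smooth_on ?S (\<lambda>q. (\<chi> j. - ip p (differential c (N' (fst q)) (chart_inv c (snd q)) (axis i 1))
          (differential c (F (fst q)) (chart_inv c (snd q)) (axis j 1))) $ j)" for j
        unfolding vec_lambda_beta
        by (intro smooth_on_minus smooth_on_bilinear[OF bilinear_ip] o smooth_family_differential[OF fam1 c]
            smooth_family_differential[OF N'(1) c])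
      show "det (metric c (fst q) (chart_inv c (snd q))) \<noteq> 0" if "q \<in> ?S" for q
        by (rule Mnz) (use that c in \<open>auto simp: abs_less_iff\<close>)
    qed
    then show ?thesis
      by (rule smooth_on_cong[OF o]) (use c in \<open>auto simp: abs_less_iff intro!: Mc[symmetric]\<close>)
  qed
  have sdisc: "smooth_on ({-\<delta>'<..<\<delta>'} \<times> chart_range c) (\<lambda>q. disc (M c (fst q) (chart_inv c (snd q))))" if c: "c \<in> A" for c
    unfolding disc_def trace_def
    by (intro smooth_on_diff smooth_on_power smooth_on_sum smooth_on_mult smooth_on_const smooth_on_det open_box c sM[OF c])
  have M0: "M c 0 x = matrix (shape_operator c \<phi> N x)" if c: "c \<in> A" "x \<in> fst c" for c x
  proof -
    have "differential c (N' 0) x = differential c N x"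
      using differential_cong_open[OF c open_carrier carrierI[OF c] _ smooth_N, of "N' 0"] N'(2) by auto
    then show ?thesis
      using family_start_differential[OF c] by (simp add: M_def shape_operator_def[abs_def])
  qed
  obtain \<eta> where \<eta>: "0 < \<eta>" "\<eta> \<le> \<delta>'" "\<And>y. y \<in> K \<Longrightarrow> \<exists>c\<in>A. y \<in> fst c \<and> (\<forall>t. \<bar>t\<bar> < \<eta> \<longrightarrow> disc (M c t y) > 0)"
  proof (rule tube[OF family_compact \<delta>'(1), of "\<lambda>c t y. disc (M c t y) > 0"])
    fix x assume "x \<in> K"
    then obtain c where c: "c \<in> A" "x \<in> fst c" using family_compact carrierE by blast
    have "continuous_on ({-\<delta>'<..<\<delta>'} \<times> chart_range c) (\<lambda>q. disc (M c (fst q) (chart_inv c (snd q))))"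
      by (rule smooth_on_imp_continuous_on[OF sdisc[OF c(1)]])
    moreover have "disc (M c (fst (0, snd c x)) (chart_inv c (snd (0, snd c x)))) > 0"
      using c M0[OF c] d[OF c] by simp
    moreover have "\<forall>t y. \<bar>t\<bar> < \<delta>' \<longrightarrow> y \<in> fst c \<longrightarrow> disc (M c (fst (t, snd c y)) (chart_inv c (snd (t, snd c y)))) > 0 \<longrightarrow> disc (M c t y) > 0"
      using c by auto
    ultimately show "\<exists>c\<in>A. x \<in> fst c \<and> (\<exists>q. continuous_on ({-\<delta>'<..<\<delta>'} \<times> chart_range c) q \<and> q (0, snd c x) > (0 :: real) \<and>
      (\<forall>t y. \<bar>t\<bar> < \<delta>' \<longrightarrow> y \<in> fst c \<longrightarrow> q (t, snd c y) > 0 \<longrightarrow> disc (M c t y) > 0))"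
      using c by (intro bexI[of _ c] conjI exI[of _ "\<lambda>q. disc (M c (fst q) (chart_inv c (snd q)))"]) assumption+
  qed blast
  show thesis
  proof (rule that[OF \<eta>(1,2)])
    fix t c x assume t: "\<bar>t\<bar> < \<eta>" and c: "c \<in> A" "x \<in> fst c"
    have t': "\<bar>t\<bar> < \<delta>'" "\<bar>t\<bar> < \<delta>" using t \<eta>(2) \<delta>'(2) by auto
    interpret h: hyp A p \<epsilon> "F t" "N' t" by (rule H[OF t'(1)])
    show "disc (matrix (shape_operator c (F t) (N' t) x)) > 0"
    proof (cases "x \<in> K")
      case True
      then obtain c' where c': "c' \<in> A" "x \<in> fst c'" "disc (M c' t x) > 0" using \<eta>(3) t by blast
      then show ?thesis using h.disc_change[OF c(1) c'(1) c(2) c'(2)] by (simp add: M_def)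
    next
      case False
      have "open (- K)" using compact_imp_closed[OF family_compact(1)] by (simp add: open_Compl)
      then have "differential c (N' t) x = differential c N x"
        using differential_cong_open[OF c _ _ _ smooth_N, of "- K" "N' t"] N'(3)[OF t'(1)] carrierI[OF c(1)] False by auto
      then show ?thesis
        using family_constant(2)[OF t'(2) c False] d[OF c] by (simp add: shape_operator_def[abs_def])
    qed
  qed
qed

end

end

section \<open>Hamiltonian variations of the Gauss map\<close>

text \<open>Stated for forms not known to be symmetric, which is all that
  \<open>kahler_structure\<close> says about \<open>b\<close>; the kernel condition on the left
  argument concerns the transposed matrix.\<close>

lemma det_gram_nonzero:
  fixes \<beta> :: "real ^ 'n \<Rightarrow> real ^ 'n \<Rightarrow> real"
  assumes b: "bilinear \<beta>" and nd: "\<And>v. (\<And>w. \<beta> v w = 0) \<Longrightarrow> v = 0"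
  shows "det (gram \<beta>) \<noteq> 0"
proof -
  let ?M = "transpose (gram \<beta>)"
  have e: "\<beta> v w = (?M *v v) \<bullet> w" for v w
    using gram_vec[OF b, of v w] by (simp add: dot_lmul_matrix transpose_matrix_vector)
  have "v = 0" if "?M *v v = 0" for v
  proof (rule nd)
    show "\<beta> v w = 0" for w using e[of v w] that by simp
  qed
  then have "det ?M \<noteq> 0"
    using invertible_det_nz[of ?M] invertible_left_inverse[of ?M] matrix_left_invertible_ker[of ?M] by blast
  then show ?thesis by (simp add: det_transpose)
qed

text \<open>Justifies the definite description in \<open>induced_gradient\<close>.\<close>

lemma ex1_representing_vector:
  fixes \<beta> :: "real ^ 'n \<Rightarrow> real ^ 'n \<Rightarrow> real" and l :: "real ^ 'n \<Rightarrow> real"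
  assumes b: "bilinear \<beta>" and nd: "\<And>v. (\<And>w. \<beta> v w = 0) \<Longrightarrow> v = 0" and l: "linear l"
  shows "\<exists>!w. \<forall>v. \<beta> w v = l v"
proof -
  let ?M = "transpose (gram \<beta>)"
  have e: "\<beta> v w = (?M *v v) \<bullet> w" for v w
    using gram_vec[OF b, of v w] by (simp add: dot_lmul_matrix transpose_matrix_vector)
  have d: "det ?M \<noteq> 0" using det_gram_nonzero[OF b nd] by (simp add: det_transpose)
  define r where "r = (\<chi> i. l (axis i 1))"
  have lr: "l v = r \<bullet> v" for v
    using linear_expand[OF l, of v] by (simp add: r_def inner_vec_def mult.commute)
  have "(\<forall>v. \<beta> w v = l v) \<longleftrightarrow> (\<forall>v. (?M *v w) \<bullet> v = r \<bullet> v)" for w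
    by (intro all_cong1 arg_cong2[where f = "(=)"] e lr)
  then have "(\<forall>v. \<beta> w v = l v) \<longleftrightarrow> w = solve ?M r" for w
    using vector_eq_rdot[of "?M *v w" r] solve[OF d, of w r] by auto
  then show ?thesis by auto
qed

context omfd begin

lemma L_geo_differential:
  fixes f :: "'a \<Rightarrow> 'm::{finite,linorder} bivec"
  assumes f: "smooth_map A f" "\<And>x. x \<in> carrier A \<Longrightarrow> f x \<in> L_geo p \<epsilon>" and eps: "\<epsilon> \<in> {-1, 1}"
    and c: "c \<in> A" "x \<in> fst c" and g: "geodesic p \<epsilon> (f x) a b"
  obtains X Y where "X \<in> perp p a b" "Y \<in> perp p a b" "differential c f x v = wedge a X + wedge b Y"
proof -
  have g': "geodesic p \<epsilon> ((f \<circ> chart_inv c) (snd c x)) a b" using g c by simp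
  show thesis
    by (rule tangent_L_geo[OF smooth_map_has_derivative[OF f(1) c] open_range[OF c(1)] snd_in[OF c(2)] _ g' eps])
      (use f(2) carrierI[OF c(1)] inv_in[OF c(1)] that in auto)
qed

text \<open>The sign \<open>s\<close> that relates \<open>h\<close> and \<open>b\<close> may vary
  with the point, but it factors out of each row of the Gram matrix and disappears in the absolute
  value of the determinant.\<close>

lemma volume_density_kahler:
  fixes f :: "'a \<Rightarrow> 'm::{finite,linorder} bivec"
  assumes KS: "kahler_structure p \<epsilon> h J b" and eps: "\<epsilon> \<in> {-1, 1}"
    and f: "smooth_map A f" "\<And>x. x \<in> carrier A \<Longrightarrow> f x \<in> L_geo p \<epsilon>"
    and c: "c \<in> A" "x \<in> fst c"
  shows "volume_density h c f x = volume_density (\<lambda>_. b) c f x"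
proof -
  obtain y z where g: "geodesic p \<epsilon> (f x) y z" using f(2)[OF carrierI[OF c]] by (auto simp: L_geo_def)
  obtain s where s: "s \<in> {-1, 1}" and hb: "\<And>X Y X' Y'. X \<in> perp p y z \<Longrightarrow> Y \<in> perp p y z \<Longrightarrow> X' \<in> perp p y z \<Longrightarrow> Y' \<in> perp p y z \<Longrightarrow>
      h (f x) (wedge y X + wedge z Y) (wedge y X' + wedge z Y') = s * b (wedge y X + wedge z Y) (wedge y X' + wedge z Y')"
    using KS g unfolding kahler_structure_def Let_def by meson
  have e: "h (f x) (differential c f x v) (differential c f x w) = s * b (differential c f x v) (differential c f x w)" for v w
  proof -
    obtain X Y where "X \<in> perp p y z" "Y \<in> perp p y z" "differential c f x v = wedge y X + wedge z Y"
      using L_geo_differential[OF f eps c g] by blast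
    moreover obtain X' Y' where "X' \<in> perp p y z" "Y' \<in> perp p y z" "differential c f x w = wedge y X' + wedge z Y'"
      using L_geo_differential[OF f eps c g] by blast
    ultimately show ?thesis using hb by simp
  qed
  define M where "M = gram (pullback b c f x)"
  have "(\<chi> i j. induced_metric h c f x (axis i 1) (axis j 1)) = (\<chi> i. s *s M $ i)"
    by (simp add: M_def gram_def pullback_def induced_metric_def e vec_eq_iff)
  moreover have "det (\<chi> i. s *s M $ i) = (\<Prod>i\<in>(UNIV :: 'n set). s) * det M"
    using det_rows_mul[of "\<lambda>_. s" "\<lambda>i. M $ i"] by simp
  moreover have "\<bar>\<Prod>i\<in>(UNIV :: 'n set). s\<bar> = 1" using s by (auto simp: power_abs)
  ultimately show ?thesis
    by (simp add: volume_density_def[of h] volume_density_eq M_def abs_mult)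
qed

lemma volume_measure_kahler:
  fixes f :: "'a \<Rightarrow> 'm::{finite,linorder} bivec"
  assumes "kahler_structure p \<epsilon> h J b" "\<epsilon> \<in> {-1, 1}" "smooth_map A f" "\<And>x. x \<in> carrier A \<Longrightarrow> f x \<in> L_geo p \<epsilon>"
  shows "volume_measure A h f = volume_measure A (\<lambda>_. b) f"
  by (rule volume_measure_cong) (rule volume_density_kahler[OF assms])

lemma velocity_bilinear:
  fixes F :: "real \<Rightarrow> 'a \<Rightarrow> 'e::euclidean_space" and G :: "real \<Rightarrow> 'a \<Rightarrow> 'f::euclidean_space"
  assumes b: "bilinear b" and F: "smooth_family \<delta> F" and G: "smooth_family \<delta> G" and x: "x \<in> carrier A"
  shows "velocity (\<lambda>t x. b (F t x) (G t x)) x = b (F 0 x) (velocity G x) + b (velocity F x) (G 0 x)"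
proof -
  have bb: "bounded_bilinear b" using b by (simp add: bilinear_conv_bounded_bilinear)
  show ?thesis
    unfolding velocity_def[of "\<lambda>t x. b (F t x) (G t x)"]
    by (rule vector_derivative_at[OF bounded_bilinear.has_vector_derivative[OF bb family_velocity[OF F x] family_velocity[OF G x]]])
qed

lemma velocity_locally_const:
  assumes "\<delta> > 0" "\<And>t. \<bar>t\<bar> < \<delta> \<Longrightarrow> F t x = k"
  shows "velocity F x = 0"
proof -
  have "((\<lambda>_. k) has_vector_derivative 0) (at 0)" by simp
  then have "((\<lambda>t. F t x) has_vector_derivative 0) (at 0)"
    by (rule has_vector_derivative_transform_within_open[of _ _ _ "{-\<delta><..<\<delta>}"])
      (use assms in \<open>auto simp: abs_less_iff\<close>)
  then show ?thesis unfolding velocity_def by (rule vector_derivative_at)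
qed

lemma volume_density_cong_map:
  assumes "differential c f x = differential c f' x"
  shows "volume_density (\<lambda>_. b) c f x = volume_density (\<lambda>_. b) c f' x"
  by (simp add: volume_density_eq pullback_cong[OF assms])

text \<open>The volume of the difference of \<open>K'\<close> and \<open>K\<close> is constant in
  time because nothing moves there. This leads back from the support of a variation of \<phi> to the
  possibly smaller support of a variation of the Gauss map.\<close>

lemma volume_derivative_subset:
  fixes G :: "real \<Rightarrow> 'a \<Rightarrow> 'e::euclidean_space"
  assumes V: "variation A T f \<delta> K G" and f: "smooth_map A f" and b: "bilinear b"
    and K': "compact K'" "K' \<subseteq> carrier A" "K \<subseteq> K'"
    and D: "((\<lambda>t. measure (volume_measure A (\<lambda>_. b) (G t)) K') has_real_derivative D) (at 0)"
  shows "((\<lambda>t. measure (volume_measure A (\<lambda>_. b) (G t)) K) has_real_derivative D) (at 0)"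
proof -
  let ?\<mu> = "\<lambda>f. volume_measure A (\<lambda>_. b) f"
  have K: "compact K" "K \<subseteq> carrier A" and \<delta>: "\<delta> > 0" using V by (auto simp: variation_def)
  have fam: "smooth_family \<delta> G" by (rule variation_smooth_family[OF V])
  have B: "K \<in> sets borel" "K' \<in> sets borel" "K' - K \<in> sets borel" using K(1) K'(1) by (auto intro: borel_compact)
  have meas: "X \<in> sets (?\<mu> g)" if "X \<in> sets borel" "X \<subseteq> carrier A" "smooth_map A g" for X and g :: "'a \<Rightarrow> 'e"
    using density_measure_volume[OF that(3) b] that sets_carrier_iff[of X] by (simp add: density_measure_def)
  define C where "C = measure (?\<mu> f) (K' - K)"
  have "measure (?\<mu> (G t)) K = measure (?\<mu> (G t)) K' - C" if t: "\<bar>t\<bar> < \<delta>" for t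
  proof -
    note sm = smooth_family_map[OF fam t]
    have fin: "emeasure (?\<mu> (G t)) K' \<noteq> \<infinity>"
      using density_measure_finite[OF is_density_volume_density[OF sm b] density_measure_volume[OF sm b] K'(1,2)] by simp
    have eq: "volume_density (\<lambda>_. b) c (G t) x = volume_density (\<lambda>_. b) c f x" if "c \<in> A" "x \<in> fst c" "x \<notin> K" for c x
      by (rule volume_density_cong_map[OF variation_constant(2)[OF V t that f]])
    have sub: "K' - K \<subseteq> carrier A" using K' by auto
    have le: "emeasure (?\<mu> g) (K' - K) \<le> emeasure (?\<mu> g') (K' - K) + ennreal 0 * emeasure (?\<mu> g') (K' - K)"
      if g: "smooth_map A g" "smooth_map A g'"
        and eq: "\<And>c x. c \<in> A \<Longrightarrow> x \<in> fst c \<Longrightarrow> x \<notin> K \<Longrightarrow> volume_density (\<lambda>_. b) c g x = volume_density (\<lambda>_. b) c g' x"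
      for g g' :: "'a \<Rightarrow> 'e"
    proof (rule density_measure_le[OF is_density_volume_density[OF g(1) b] is_density_volume_density[OF g(2) b]
          is_density_volume_density[OF g(2) b] density_measure_volume[OF g(1) b] density_measure_volume[OF g(2) b]
          density_measure_volume[OF g(2) b] B(3) sub])
      fix x assume x: "x \<in> K' - K"
      then obtain c where c: "c \<in> A" "x \<in> fst c" using sub carrierE by blast
      then show "\<exists>c\<in>A. x \<in> fst c \<and> volume_density (\<lambda>_. b) c g x \<le> volume_density (\<lambda>_. b) c g' x + 0 * volume_density (\<lambda>_. b) c g' x"
        using eq[OF c] x by (intro bexI[of _ c]) auto
    qed simp
    have "emeasure (?\<mu> (G t)) (K' - K) = emeasure (?\<mu> f) (K' - K)"
      using le[OF sm f eq] le[OF f sm eq[symmetric]] by (intro antisym) auto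
    then have "C = measure (?\<mu> (G t)) (K' - K)" by (simp add: C_def measure_def)
    also have "\<dots> = measure (?\<mu> (G t)) K' - measure (?\<mu> (G t)) K"
      using K' K B by (intro measure_Diff fin meas sm) auto
    finally show ?thesis by simp
  qed
  then have e: "measure (?\<mu> (G t)) K' - C = measure (?\<mu> (G t)) K" if "t \<in> {-\<delta><..<\<delta>}" for t
    using that by (simp add: abs_less_iff)
  have "((\<lambda>t. measure (?\<mu> (G t)) K' - C) has_real_derivative D) (at 0)"
    using DERIV_diff[OF D DERIV_const[of C]] by simp
  then show ?thesis
    by (rule has_field_derivative_transform_within_open[where S = "{-\<delta><..<\<delta>}"]) (use \<delta> e in auto)
qed

end

section \<open>Hamiltonian functions and the symplectic pairing\<close>

context hyp begin

text \<open>The tangent space of \<open>L_geo\<close> at \<open>gauss x\<close>, written with the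
  representative that the hypersurface provides.\<close>

definition tang :: "'a \<Rightarrow> 'm bivec \<Rightarrow> bool" where
  "tang x V \<longleftrightarrow> (\<exists>X\<in>perp p (\<phi> x) (N x). \<exists>Y\<in>perp p (\<phi> x) (N x). V = wedge (\<phi> x) X + wedge (N x) Y)"

lemma tang_differential:
  assumes c: "c \<in> A" "x \<in> fst c"
  shows "tang x (differential c gauss x v)"
proof -
  obtain X Y where "X \<in> perp p (\<phi> x) (N x)" "Y \<in> perp p (\<phi> x) (N x)"
      "differential c gauss x v = wedge (\<phi> x) X + wedge (N x) Y"
    by (rule L_geo_differential[OF smooth_gauss gauss_in eps c geodesic_gauss[OF c]])
  then show ?thesis unfolding tang_def by blast
qed

lemma tang_velocity:
  assumes G: "smooth_family \<delta> G" and L: "\<And>t x. \<bar>t\<bar> < \<delta> \<Longrightarrow> x \<in> carrier A \<Longrightarrow> G t x \<in> L_geo p \<epsilon>"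
    and G0: "\<And>x. x \<in> carrier A \<Longrightarrow> G 0 x = gauss x" and x: "x \<in> carrier A"
  shows "tang x (velocity G x)"
proof -
  obtain c where c: "c \<in> A" "x \<in> fst c" using carrierE[OF x] .
  have d: "((\<lambda>t. G t x) has_derivative (\<lambda>t. t *\<^sub>R velocity G x)) (at 0)"
    using family_velocity[OF G x] by (simp add: has_vector_derivative_def)
  have g: "geodesic p \<epsilon> (G 0 x) (\<phi> x) (N x)" using geodesic_gauss[OF c] G0[OF x] by simp
  obtain X Y where XY: "X \<in> perp p (\<phi> x) (N x)" "Y \<in> perp p (\<phi> x) (N x)" "1 *\<^sub>R velocity G x = wedge (\<phi> x) X + wedge (N x) Y"
  proof (rule tangent_L_geo[OF d, of "{-\<delta><..<\<delta>}" p \<epsilon> "\<phi> x" "N x" 1])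
    show "G t x \<in> L_geo p \<epsilon>" if "t \<in> {-\<delta><..<\<delta>}" for t using that by (intro L x) (auto simp: abs_less_iff)
  qed (use zero_less[OF G] g eps in auto)
  then show ?thesis unfolding tang_def scaleR_one by blast
qed

context
  fixes h :: "'m bivec \<Rightarrow> 'm bivec \<Rightarrow> 'm bivec \<Rightarrow> real" and J :: "'m bivec \<Rightarrow> 'm bivec \<Rightarrow> 'm bivec"
    and b :: "'m bivec \<Rightarrow> 'm bivec \<Rightarrow> real"
  assumes KS: "kahler_structure p \<epsilon> h J b" and ND: "nondegenerate_metric A h gauss"
begin

lemma bilinear_b: "bilinear b"
  using KS by (simp add: kahler_structure_def)

lemma structure_at:
  assumes c: "c \<in> A" "x \<in> fst c"
  shows "\<exists>s\<in>{-1, 1}. \<exists>\<kappa>. \<forall>V W. tang x V \<longrightarrow> tang x W \<longrightarrow> h (gauss x) V W = s * b V W \<and>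
    tang x (J (gauss x) V) \<and> Omega p \<epsilon> (gauss x) (J (gauss x) V) W = - h (gauss x) V W \<and>
    h (gauss x) (J (gauss x) V) W = \<kappa> * Omega p \<epsilon> (gauss x) V W"
proof -
  note K = KS[unfolded kahler_structure_def, THEN conjunct2, THEN spec, THEN spec, THEN spec, THEN mp, OF geodesic_gauss[OF c]]
  show ?thesis
  proof (rule bexE[OF K], elim exE, intro bexI exI allI impI)
    fix s \<kappa> V W
    assume H: "\<forall>X\<in>perp p (\<phi> x) (N x). \<forall>Y\<in>perp p (\<phi> x) (N x). \<forall>X'\<in>perp p (\<phi> x) (N x). \<forall>Y'\<in>perp p (\<phi> x) (N x).
         let V = wedge (\<phi> x) X + wedge (N x) Y; W = wedge (\<phi> x) X' + wedge (N x) Y' in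
           h (gauss x) V W = s * b V W \<and>
           (\<exists>Z\<in>perp p (\<phi> x) (N x). \<exists>Z'\<in>perp p (\<phi> x) (N x). J (gauss x) V = wedge (\<phi> x) Z + wedge (N x) Z') \<and>
           Omega p \<epsilon> (gauss x) (J (gauss x) V) W = - h (gauss x) V W \<and>
           h (gauss x) (J (gauss x) V) W = \<kappa> * Omega p \<epsilon> (gauss x) V W"
      and "tang x V" "tang x W"
    from this(2,3) obtain X Y X' Y' where X: "X \<in> perp p (\<phi> x) (N x)" "Y \<in> perp p (\<phi> x) (N x)"
        "X' \<in> perp p (\<phi> x) (N x)" "Y' \<in> perp p (\<phi> x) (N x)"
      and VW: "V = wedge (\<phi> x) X + wedge (N x) Y" "W = wedge (\<phi> x) X' + wedge (N x) Y'"
      unfolding tang_def by (elim bexE)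
    from H[THEN bspec, OF X(1), THEN bspec, OF X(2), THEN bspec, OF X(3), THEN bspec, OF X(4), unfolded Let_def, folded VW]
    show "h (gauss x) V W = s * b V W \<and>
      tang x (J (gauss x) V) \<and> Omega p \<epsilon> (gauss x) (J (gauss x) V) W = - h (gauss x) V W \<and>
      h (gauss x) (J (gauss x) V) W = \<kappa> * Omega p \<epsilon> (gauss x) V W"
      unfolding tang_def[of x "J (gauss x) V"] by (elim conjE, intro conjI) assumption+
  qed assumption
qed

lemma h_b:
  assumes c: "c \<in> A" "x \<in> fst c"
  obtains s where "\<And>V W. tang x V \<Longrightarrow> tang x W \<Longrightarrow> h (gauss x) V W = s * b V W"
  using structure_at[OF c] by metis

lemma J_tang: "c \<in> A \<Longrightarrow> x \<in> fst c \<Longrightarrow> tang x V \<Longrightarrow> tang x (J (gauss x) V)"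
  using structure_at[of c x] by metis

lemma Omega_J: "c \<in> A \<Longrightarrow> x \<in> fst c \<Longrightarrow> tang x V \<Longrightarrow> tang x W \<Longrightarrow>
    Omega p \<epsilon> (gauss x) (J (gauss x) V) W = - h (gauss x) V W"
  using structure_at[of c x] by metis

lemma h_J:
  assumes c: "c \<in> A" "x \<in> fst c" and V: "tang x V" "tang x W"
  obtains \<kappa> where "h (gauss x) (J (gauss x) V) W = \<kappa> * Omega p \<epsilon> (gauss x) V W"
  using structure_at[OF c] V by metis

lemma differential_nondegenerate:
  assumes c: "c \<in> A" "x \<in> fst c" and 0: "\<And>w. h (gauss x) (differential c gauss x v) (differential c gauss x w) = 0"
  shows "v = 0"
  using ND c 0 unfolding nondegenerate_metric_def induced_metric_def by blast

text \<open>On tangent vectors \<open>h\<close> and \<open>b\<close> differ by a sign, so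
  nondegeneracy passes to \<open>b\<close>, the form whose volume is differentiated.\<close>

lemma det_gram_gauss:
  assumes c: "c \<in> A" "x \<in> fst c"
  shows "det (gram (pullback b c gauss x)) \<noteq> 0"
proof (rule det_gram_nonzero[OF bilinear_pullback[OF smooth_gauss bilinear_b c]])
  obtain s where hb: "\<And>V W. tang x V \<Longrightarrow> tang x W \<Longrightarrow> h (gauss x) V W = s * b V W"
    using h_b[OF c] by metis
  fix v assume "\<And>w. pullback b c gauss x v w = 0"
  then have "h (gauss x) (differential c gauss x v) (differential c gauss x w) = 0" for w
    using hb[OF tang_differential[OF c] tang_differential[OF c]] by (simp add: pullback_def)
  then show "v = 0" by (rule differential_nondegenerate[OF c])
qed

lemma gradient:
  assumes c: "c \<in> A" "x \<in> fst c" and u: "smooth_map A (u :: 'a \<Rightarrow> real)"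
  shows "h (gauss x) (differential c gauss x (induced_gradient h c gauss u x)) (differential c gauss x v)
    = differential c u x v"
proof -
  obtain s where hb: "\<And>V W. tang x V \<Longrightarrow> tang x W \<Longrightarrow> h (gauss x) V W = s * b V W"
    using h_b[OF c] by metis
  define \<beta> where "\<beta> v w = s * pullback b c gauss x v w" for v w
  have \<beta>: "induced_metric h c gauss x v w = \<beta> v w" for v w
    using hb[OF tang_differential[OF c] tang_differential[OF c]] by (simp add: \<beta>_def pullback_def induced_metric_def)
  note pb = bilinear_pullback[OF smooth_gauss bilinear_b c]
  have bil: "bilinear \<beta>"
    unfolding bilinear_def \<beta>_def
    by (auto intro!: linearI simp: bilinear_ladd[OF pb] bilinear_radd[OF pb] bilinear_lmul[OF pb]
        bilinear_rmul[OF pb] distrib_left)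
  have "\<exists>!w. \<forall>v. \<beta> w v = differential c u x v"
  proof (rule ex1_representing_vector[OF bil _ linear_differential[OF u c]])
    fix v assume "\<And>w. \<beta> v w = 0"
    then show "v = 0" using differential_nondegenerate[OF c, of v] \<beta> by (simp add: induced_metric_def)
  qed
  from theI'[OF this] have "\<beta> (induced_gradient h c gauss u x) v = differential c u x v"
    unfolding induced_gradient_def \<beta> by blast
  then show ?thesis using \<beta> by (simp add: induced_metric_def)
qed

text \<open>The tangential part of \<open>V\<close> does not contribute, because the Gauss map is
  Lagrangian. On the normal part \<Omega> is minus \<open>h\<close> applied to the gradient, that
  is, minus the differential of \<open>u\<close>.\<close>

lemma hamiltonian_Omega:
  assumes c: "c \<in> A" "x \<in> fst c" and u: "smooth_map A (u :: 'a \<Rightarrow> real)"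
    and n: "is_normal_component h c gauss x V (J (gauss x) (differential c gauss x (induced_gradient h c gauss u x)))"
  shows "Omega p \<epsilon> (gauss x) V (differential c gauss x w) = - differential c u x w"
proof -
  interpret f: hframe p \<epsilon> "\<phi> x" "N x" "differential c \<phi> x" "differential c N x" by (rule frame[OF c])
  note dG = differential_gauss[OF c]
  define R where "R = differential c gauss x (induced_gradient h c gauss u x)"
  have R: "tang x R" unfolding R_def by (rule tang_differential[OF c])
  obtain z where z: "V = J (gauss x) R + differential c gauss x z"
    using n unfolding is_normal_component_def R_def[symmetric] by (auto simp: algebra_simps)
  note J1 = J_tang[OF c R] and J2 = Omega_J[OF c R tang_differential[OF c], of w]
  obtain Z Z' where Z: "Z \<in> perp p (\<phi> x) (N x)" "Z' \<in> perp p (\<phi> x) (N x)" "J (gauss x) R = wedge (\<phi> x) Z + wedge (N x) Z'"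
    using J1 unfolding tang_def by blast
  have V: "V = wedge (\<phi> x) (Z + differential c N x z) + wedge (N x) (Z' + - differential c \<phi> x z)"
    unfolding z Z(3) dG f.dG_tangent by (simp add: wedge_simps)
  have "Omega p \<epsilon> (gauss x) V (f.dG w) =
      Omega p \<epsilon> (gauss x) (J (gauss x) R) (f.dG w) + Omega p \<epsilon> (gauss x) (f.dG z) (f.dG w)"
    unfolding V Z(3)[unfolded gauss_def] f.dG_tangent[of z] gauss_def
      f.Omega_dG[OF perp_simps(1)[OF Z(1) f.B_perp] perp_simps(1)[OF Z(2) perp_simps(4)[OF f.L_perp]]]
      f.Omega_dG[OF Z(1,2)] f.Omega_dG[OF f.B_perp perp_simps(4)[OF f.L_perp]] by simp
  also have "Omega p \<epsilon> (gauss x) (f.dG z) (f.dG w) = 0"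
    unfolding gauss_def by (rule f.lagrangian_dG)
  finally show ?thesis
    using J2 gradient[OF c u, of w] unfolding R_def dG by simp
qed

text \<open>The difference of \<open>V\<close> and \<open>J (gauss x) R\<close> is
  \<Omega>-orthogonal to the image of the differential, hence tangent by
  \<open>lagrangian_maximal\<close>. That \<open>J (gauss x) R\<close> is normal follows from the
  clause with \<open>\<kappa>\<close> in \<open>kahler_structure\<close>.\<close>

lemma Omega_hamiltonian:
  assumes c: "c \<in> A" "x \<in> fst c" and u: "smooth_map A (u :: 'a \<Rightarrow> real)" and V: "tang x V"
    and O: "\<And>w. Omega p \<epsilon> (gauss x) V (differential c gauss x w) = - differential c u x w"
  shows "is_normal_component h c gauss x V (J (gauss x) (differential c gauss x (induced_gradient h c gauss u x)))"
proof -
  interpret f: hframe p \<epsilon> "\<phi> x" "N x" "differential c \<phi> x" "differential c N x" by (rule frame[OF c])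
  note dG = differential_gauss[OF c]
  define R where "R = differential c gauss x (induced_gradient h c gauss u x)"
  have R: "tang x R" unfolding R_def by (rule tang_differential[OF c])
  note J1 = J_tang[OF c R] and J2 = Omega_J[OF c R]
  obtain Z Z' where Z: "Z \<in> perp p (\<phi> x) (N x)" "Z' \<in> perp p (\<phi> x) (N x)" "J (gauss x) R = wedge (\<phi> x) Z + wedge (N x) Z'"
    using J1 unfolding tang_def by blast
  obtain X Y where X: "X \<in> perp p (\<phi> x) (N x)" "Y \<in> perp p (\<phi> x) (N x)" "V = wedge (\<phi> x) X + wedge (N x) Y"
    using V unfolding tang_def by blast
  have D: "V - J (gauss x) R = wedge (\<phi> x) (X - Z) + wedge (N x) (Y - Z')"
    unfolding X(3) Z(3) by (simp add: wedge_simps)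
  note perps = perp_simps(2)[OF X(1) Z(1)] perp_simps(2)[OF X(2) Z(2)]
  have "V - J (gauss x) R \<in> range f.dG"
    unfolding D
  proof (rule f.lagrangian_maximal[OF perps])
    fix w
    have "Omega p \<epsilon> (wedge (\<phi> x) (N x)) (wedge (\<phi> x) (X - Z) + wedge (N x) (Y - Z')) (f.dG w)
        = Omega p \<epsilon> (gauss x) V (f.dG w) - Omega p \<epsilon> (gauss x) (J (gauss x) R) (f.dG w)"
      unfolding X(3) Z(3)[unfolded gauss_def] gauss_def f.Omega_dG[OF perps] f.Omega_dG[OF X(1,2)] f.Omega_dG[OF Z(1,2)] by simp
    also have "\<dots> = 0"
      using O[of w] J2[OF tang_differential[OF c], of w] gradient[OF c u, of w] unfolding R_def dG by simp
    finally show "Omega p \<epsilon> (wedge (\<phi> x) (N x)) (wedge (\<phi> x) (X - Z) + wedge (N x) (Y - Z')) (f.dG w) = 0" .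
  qed
  moreover have "h (gauss x) (J (gauss x) R) (differential c gauss x w) = 0" for w
  proof -
    obtain \<kappa> where "h (gauss x) (J (gauss x) R) (differential c gauss x w) = \<kappa> * Omega p \<epsilon> (gauss x) R (differential c gauss x w)"
      by (rule h_J[OF c R tang_differential[OF c]])
    moreover have "Omega p \<epsilon> (gauss x) R (differential c gauss x w) = 0"
      using lagrangian_gauss c unfolding lagrangian_def R_def by blast
    ultimately show ?thesis by simp
  qed
  ultimately show ?thesis unfolding is_normal_component_def unfolding R_def[symmetric] unfolding dG by blast
qed

text \<open>In the last conclusion the pairing consists of a term with the velocity of the normal
  and a term with the derivative of the normal. The first equals the product of \<open>N x\<close>
  with the derivative of \<open>velocity F\<close>, so both together are the product rule for minus
  \<open>u\<close>.\<close>

lemma gauss_variation: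
  assumes V: "variation A (pseudo_sphere p) \<phi> \<delta> K F"
    and \<delta>': "0 < \<delta>'" "\<delta>' \<le> \<delta>" and sN: "smooth_family \<delta>' N'" and N0: "\<forall>x\<in>carrier A. N' 0 x = N x"
    and H': "\<forall>t. \<bar>t\<bar> < \<delta>' \<longrightarrow> hyp A p \<epsilon> (F t) (N' t)"
  defines "\<Psi> \<equiv> \<lambda>t x. wedge (F t x) (N' t x)"
    and "u \<equiv> \<lambda>x. - ip p (velocity F x) (N x)"
  shows "smooth_family \<delta>' \<Psi>" "smooth_map A u"
    and "\<And>t x. \<bar>t\<bar> < \<delta>' \<Longrightarrow> x \<in> carrier A \<Longrightarrow> \<Psi> t x \<in> L_geo p \<epsilon>"
    and "\<And>x. x \<in> carrier A \<Longrightarrow> \<Psi> 0 x = gauss x"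
    and "\<And>x. x \<in> carrier A \<Longrightarrow> ip p (velocity F x) (\<phi> x) = 0"
    and "\<And>x. x \<in> carrier A \<Longrightarrow> ip p (velocity N' x) (N x) = 0"
    and "\<And>x. x \<in> carrier A \<Longrightarrow> velocity \<Psi> x = wedge (velocity F x) (N x) + wedge (\<phi> x) (velocity N' x)"
    and "\<And>c x w. c \<in> A \<Longrightarrow> x \<in> fst c \<Longrightarrow>
      Omega p \<epsilon> (gauss x) (velocity \<Psi> x) (differential c gauss x w) = - differential c u x w"
proof -
  note N' = sN N0[rule_format] and H = H'[rule_format]
  have F: "smooth_family \<delta>' F" by (rule smooth_family_mono[OF family[OF V] \<delta>'])
  show \<Psi>: "smooth_family \<delta>' \<Psi>" unfolding \<Psi>_def by (rule smooth_family_bilinear[OF bilinear_wedge F N'(1)])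
  have iu: "smooth_map A (\<lambda>x. ip p (velocity F x) (N x))"
    by (rule smooth_map_bilinear[OF bilinear_ip smooth_velocity[OF F] smooth_N])
  show "smooth_map A u"
    unfolding smooth_map_def
  proof
    fix c assume c: "c \<in> A"
    have "smooth_on (chart_range c) (\<lambda>y. - ((\<lambda>x. ip p (velocity F x) (N x)) \<circ> chart_inv c) y)"
      by (rule smooth_on_minus[OF open_range[OF c] iu[unfolded smooth_map_def, rule_format, OF c]])
    then show "smooth_on (chart_range c) (u \<circ> chart_inv c)" by (simp add: u_def comp_def)
  qed
  show "\<Psi> t x \<in> L_geo p \<epsilon>" if "\<bar>t\<bar> < \<delta>'" "x \<in> carrier A" for t x
    using hyp.gauss_in[OF H[OF that(1)] that(2)] unfolding hyp.gauss_def[OF H[OF that(1)]] by (simp add: \<Psi>_def)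
  have F0: "F 0 x = \<phi> x" if "x \<in> carrier A" for x by (rule family_start[OF V that])
  show "\<Psi> 0 x = gauss x" if "x \<in> carrier A" for x
    by (simp add: \<Psi>_def gauss_def F0[OF that] N'(2)[OF that])
  have const: "b' (G 0 x) (velocity G' x) + b' (velocity G x) (G' 0 x) = 0"
    if "bilinear b'" "smooth_family \<delta>' G" "smooth_family \<delta>' G'" "x \<in> carrier A" "\<And>t. \<bar>t\<bar> < \<delta>' \<Longrightarrow> b' (G t x) (G' t x) = k"
    for b' :: "'m rvec \<Rightarrow> 'm rvec \<Rightarrow> real" and G G' x k
    using velocity_bilinear[OF that(1-4)] velocity_locally_const[OF \<delta>'(1), of "\<lambda>t x. b' (G t x) (G' t x)" x k] that(5) by simp
  show xx: "ip p (velocity F x) (\<phi> x) = 0" if x: "x \<in> carrier A" for x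
  proof -
    have "ip p (F t x) (F t x) = 1" if "\<bar>t\<bar> < \<delta>'" for t using family_sphere[OF V _ x, of t] that \<delta>'(2) by simp
    from const[OF bilinear_ip F F x this] show ?thesis
      using F0[OF x] ip_commute[of p "\<phi> x" "velocity F x"] by simp
  qed
  show NN: "ip p (velocity N' x) (N x) = 0" if x: "x \<in> carrier A" for x
  proof -
    obtain c where c: "c \<in> A" "x \<in> fst c" using carrierE[OF x] .
    have "ip p (N' t x) (N' t x) = \<epsilon>" if "\<bar>t\<bar> < \<delta>'" for t using hyp.normalD(1)[OF H[OF that] c] .
    from const[OF bilinear_ip N'(1) N'(1) x this] show ?thesis
      using N'(2)[OF x] ip_commute[of p "N x" "velocity N' x"] by simp
  qed
  show vel: "velocity \<Psi> x = wedge (velocity F x) (N x) + wedge (\<phi> x) (velocity N' x)" if x: "x \<in> carrier A" for x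
    unfolding \<Psi>_def velocity_bilinear[OF bilinear_wedge F N'(1) x] F0[OF x] N'(2)[OF x] by simp
  fix c x w assume c: "c \<in> A" "x \<in> fst c"
  interpret f: hframe p \<epsilon> "\<phi> x" "N x" "differential c \<phi> x" "differential c N x" by (rule frame[OF c])
  note x = carrierI[OF c]
  have bb: "bounded_bilinear (ip p :: 'm rvec \<Rightarrow> _)" using bilinear_ip by (simp add: bilinear_conv_bounded_bilinear)
  \<comment> \<open>The time derivative of the relation that \<open>N' t\<close> is normal to
    \<open>F t\<close>; it trades the velocity of the normal for the space derivative of the
    velocity of the hypersurface.\<close>
  have "((\<lambda>t. ip p (N' t x) (differential c (F t) x w)) has_vector_derivative
      ip p (N' 0 x) (differential c (velocity F) x w) + ip p (velocity N' x) (differential c (F 0) x w)) (at 0)"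
    by (rule bounded_bilinear.has_vector_derivative[OF bb family_velocity[OF N'(1) x] differential_velocity[OF F c]])
  moreover have "((\<lambda>t. ip p (N' t x) (differential c (F t) x w)) has_vector_derivative 0) (at 0)"
  proof (rule has_vector_derivative_transform_within_open[of "\<lambda>_. 0" _ _ "{-\<delta>'<..<\<delta>'}"])
    fix t assume "t \<in> {-\<delta>'<..<\<delta>'}"
    then have "\<bar>t\<bar> < \<delta>'" by (simp add: abs_less_iff)
    from hyp.normalD(3)[OF H[OF this] c]
    show "0 = ip p (N' t x) (differential c (F t) x w)" by simp
  qed (use \<delta>' in auto)
  ultimately have 1: "ip p (N x) (differential c (velocity F) x w) + ip p (velocity N' x) (differential c \<phi> x w) = 0"
    using vector_derivative_unique_at F0[OF x] N'(2)[OF x] family_start_differential[OF V c] by fastforce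
  have "((\<lambda>x. ip p (velocity F x) (N x)) \<circ> chart_inv c has_derivative differential c (\<lambda>x. ip p (velocity F x) (N x)) x) (at (snd c x))"
    by (rule smooth_map_has_derivative[OF iu c])
  then have "(u \<circ> chart_inv c has_derivative (\<lambda>v. - differential c (\<lambda>x. ip p (velocity F x) (N x)) x v)) (at (snd c x))"
    using has_derivative_minus unfolding u_def comp_def by blast
  then have "differential c u x w = - differential c (\<lambda>x. ip p (velocity F x) (N x)) x w"
    by (simp add: differential_def[of c u] frechet_eqI)
  then have du: "differential c u x w = - (ip p (velocity F x) (differential c N x w) + ip p (differential c (velocity F) x w) (N x))"
    by (simp add: differential_bilinear[OF bilinear_ip smooth_velocity[OF F] smooth_N c])
  have "Omega p \<epsilon> (gauss x) (velocity \<Psi> x) (differential c gauss x w) =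
      - ip p (velocity N' x) (differential c \<phi> x w) + ip p (velocity F x) (differential c N x w)"
    unfolding vel[OF x] differential_gauss[OF c] gauss_def by (rule f.Omega_variation(4)[OF xx[OF x] NN[OF x]])
  then show "Omega p \<epsilon> (gauss x) (velocity \<Psi> x) (differential c gauss x w) = - differential c u x w"
    using 1 du ip_commute[of p "N x" "differential c (velocity F) x w"] by simp
qed

end

end

section \<open>Hamiltonian minimality and criticality\<close>

lemma (in omfd) variationI:
  assumes "smooth_family \<delta> F" "compact K" "K \<subseteq> carrier A"
    and "\<And>t x. \<bar>t\<bar> < \<delta> \<Longrightarrow> x \<in> carrier A \<Longrightarrow> F t x \<in> T" "\<And>x. x \<in> carrier A \<Longrightarrow> F 0 x = f x"
    and "\<And>t x. \<bar>t\<bar> < \<delta> \<Longrightarrow> x \<in> carrier A \<Longrightarrow> x \<notin> K \<Longrightarrow> F t x = f x"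
  shows "variation A T f \<delta> K F"
  using assms unfolding variation_def smooth_family_def
  by (simp add: fam_def[abs_def] case_prod_beta' abs_less_iff)

lemma real_diagonalizableE:
  fixes A :: "('a::topological_space, 'n::finite) chart set"
  assumes "real_diagonalizable A p \<phi> N" "x \<in> carrier A"
  obtains c V e k where "c \<in> A" "open V" "x \<in> V" "V \<subseteq> fst c"
    "\<And>i :: 'n. smooth_on (snd c ` V) (e i \<circ> chart_inv c)"
    "\<And>y. y \<in> V \<Longrightarrow> orthonormal (induced_metric (\<lambda>_. ip p) c \<phi> y) (\<lambda>i. e i y)"
    "\<And>y i. y \<in> V \<Longrightarrow> shape_operator c \<phi> N y (e i y) = k i y *\<^sub>R e i y"
proof -
  note rd = assms(1)[unfolded real_diagonalizable_def, THEN bspec, OF assms(2)]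
  show thesis
  proof (use rd in \<open>elim bexE exE conjE\<close>)
    fix c V and e :: "'n \<Rightarrow> 'a \<Rightarrow> real ^ 'n" and k :: "'n \<Rightarrow> 'a \<Rightarrow> real"
    assume a: "c \<in> A" "open V" "x \<in> V" "V \<subseteq> fst c" "\<forall>i. smooth_on (snd c ` V) (e i \<circ> chart_inv c)"
      and e: "\<forall>y\<in>V. orthonormal (induced_metric (\<lambda>_. ip p) c \<phi> y) (\<lambda>i. e i y) \<and>
        (\<forall>i. shape_operator c \<phi> N y (e i y) = k i y *\<^sub>R e i y)"
    show thesis
      by (rule that[OF a(1-4), of e k]) (use a(5) e in simp_all)
  qed
qed

context hyp begin

text \<open>The common core for both functionals. Agreement of \<open>E\<close> with the volume of
  the Gauss maps is asked for short times only, since \<open>W'_functional\<close> is shown to be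
  such a volume only while the discriminant stays positive.\<close>

context
  fixes h :: "'m bivec \<Rightarrow> 'm bivec \<Rightarrow> 'm bivec \<Rightarrow> real" and J :: "'m bivec \<Rightarrow> 'm bivec \<Rightarrow> 'm bivec"
    and b :: "'m bivec \<Rightarrow> 'm bivec \<Rightarrow> real" and E :: "'a set \<Rightarrow> ('a \<Rightarrow> 'm rvec) \<Rightarrow> real"
  assumes KS: "kahler_structure p \<epsilon> h J b" and ND: "nondegenerate_metric A h gauss" and IM: "immersion A gauss"
    and E: "\<And>\<delta> K F \<delta>' N'. variation A (pseudo_sphere p) \<phi> \<delta> K F \<Longrightarrow> 0 < \<delta>' \<Longrightarrow> \<delta>' \<le> \<delta> \<Longrightarrow>
      smooth_family \<delta>' N' \<Longrightarrow> (\<And>x. x \<in> carrier A \<Longrightarrow> N' 0 x = N x) \<Longrightarrow>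
      (\<And>t x. \<bar>t\<bar> < \<delta>' \<Longrightarrow> x \<in> carrier A \<Longrightarrow> x \<notin> K \<Longrightarrow> N' t x = N x) \<Longrightarrow>
      (\<And>t. \<bar>t\<bar> < \<delta>' \<Longrightarrow> hyp A p \<epsilon> (F t) (N' t)) \<Longrightarrow>
      \<exists>\<eta>>0. \<forall>t. \<bar>t\<bar> < \<eta> \<longrightarrow> E K (F t) = measure (volume_measure A (\<lambda>_. b) (\<lambda>x. wedge (F t x) (N' t x))) K"
begin

lemma minimal_imp_critical:
  assumes "hamiltonian_minimal A (L_geo p \<epsilon>) h J (Omega p \<epsilon>) gauss"
  shows "critical_point A (pseudo_sphere p) E \<phi>"
  unfolding critical_point_def
proof (intro allI impI)
  fix \<delta> K F assume V: "variation A (pseudo_sphere p) \<phi> \<delta> K F"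
  obtain \<delta>' N' where \<delta>': "0 < \<delta>'" "\<delta>' \<le> \<delta>" and N': "smooth_family \<delta>' N'" "\<And>x. x \<in> carrier A \<Longrightarrow> N' 0 x = N x"
      "\<And>t x. \<bar>t\<bar> < \<delta>' \<Longrightarrow> x \<in> carrier A \<Longrightarrow> x \<notin> K \<Longrightarrow> N' t x = N x"
      and H: "\<And>t. \<bar>t\<bar> < \<delta>' \<Longrightarrow> hyp A p \<epsilon> (F t) (N' t)"
    using normal_variation[OF V] by metis
  define \<Psi> where "\<Psi> t x = wedge (F t x) (N' t x)" for t x
  define u where "u x = - ip p (velocity F x) (N x)" for x
  have N0: "\<forall>x\<in>carrier A. N' 0 x = N x" and H': "\<forall>t. \<bar>t\<bar> < \<delta>' \<longrightarrow> hyp A p \<epsilon> (F t) (N' t)"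
    using N'(2) H by blast+
  note gv = gauss_variation[OF KS ND V \<delta>' N'(1) N0 H', folded \<Psi>_def u_def]
  have K: "compact K" "K \<subseteq> carrier A" using family_compact[OF V] .
  have V\<Psi>: "variation A (L_geo p \<epsilon>) gauss \<delta>' K \<Psi>"
  proof (rule variationI[OF gv(1) K])
    show "\<Psi> t x \<in> L_geo p \<epsilon>" if "\<bar>t\<bar> < \<delta>'" "x \<in> carrier A" for t x using gv(3) that by blast
    show "\<Psi> 0 x = gauss x" if "x \<in> carrier A" for x using gv(4) that by blast
    show "\<Psi> t x = gauss x" if t: "\<bar>t\<bar> < \<delta>'" and x: "x \<in> carrier A" "x \<notin> K" for t x
    proof -
      obtain c where c: "c \<in> A" "x \<in> fst c" using carrierE[OF x(1)] .
      show ?thesis using family_constant(1)[OF V _ c x(2), of t] t \<delta>'(2) N'(3)[OF t x] by (simp add: \<Psi>_def gauss_def)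
    qed
  qed
  have "hamiltonian_variation A (L_geo p \<epsilon>) h J gauss \<delta>' K \<Psi>"
    unfolding hamiltonian_variation_def
  proof (intro conjI exI[of _ u] V\<Psi> exI[of _ K] K ballI)
    show "smooth_map A u" by (rule gv(2))
    show "u x = 0" if x: "x \<in> carrier A - K" for x
    proof -
      obtain c where c: "c \<in> A" "x \<in> fst c" using carrierE x by blast
      have "velocity F x = 0"
        by (rule velocity_locally_const[of \<delta> F x "\<phi> x"]) (use family_constant(1)[OF V _ c] x \<delta>' in auto)
      then show ?thesis by (simp add: u_def)
    qed
    fix c x assume c: "c \<in> A" "x \<in> fst c"
    have "tang x (velocity \<Psi> x)"
      by (rule tang_velocity[OF gv(1)]) (use gv(3,4) carrierI[OF c] in blast)+
    from Omega_hamiltonian[OF KS ND c gv(2) this] gv(8)[OF c]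
    show "is_normal_component h c gauss x (vector_derivative (\<lambda>t. \<Psi> t x) (at 0))
             (J (gauss x) (differential c gauss x (induced_gradient h c gauss u x)))"
      unfolding velocity_def by blast
  qed
  then have D: "((\<lambda>t. measure (volume_measure A h (\<Psi> t)) K) has_real_derivative 0) (at 0)"
    using assms unfolding hamiltonian_minimal_def by blast
  obtain \<eta> where \<eta>: "\<eta> > 0" "\<And>t. \<bar>t\<bar> < \<eta> \<Longrightarrow> E K (F t) = measure (volume_measure A (\<lambda>_. b) (\<Psi> t)) K"
    using E[OF V \<delta>' N' H] unfolding \<Psi>_def[abs_def] by blast
  show "((\<lambda>t. E K (F t)) has_real_derivative 0) (at 0)"
  proof (rule has_field_derivative_transform_within_open[OF D, of "{- min \<eta> \<delta>'<..<min \<eta> \<delta>'}"])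
    fix t assume "t \<in> {- min \<eta> \<delta>'<..<min \<eta> \<delta>'}"
    then have t: "\<bar>t\<bar> < \<eta>" "\<bar>t\<bar> < \<delta>'" by (auto simp: abs_less_iff)
    have "volume_measure A h (\<Psi> t) = volume_measure A (\<lambda>_. b) (\<Psi> t)"
      by (rule volume_measure_kahler[OF KS eps smooth_family_map[OF gv(1) t(2)]]) (rule gv(3)[OF t(2)])
    then show "measure (volume_measure A h (\<Psi> t)) K = E K (F t)" using \<eta>(2)[OF t(1)] by simp
  qed (use \<eta> \<delta>' in auto)
qed

text \<open>If the variation \<open>G\<close> of the Gauss map has initial velocity \<open>\<phi> \<and> X + N \<and> Y\<close> and Hamiltonian
  function \<open>u\<close>, then the velocity \<open>- \<epsilon> u N - Y\<close> of the hypersurface reproduces it exactly, tangential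
  part included: \<open>Y\<close> is matched by construction, and \<open>X\<close> is then determined by \<open>du\<close>, because \<open>\<Omega>\<close>
  pairs the tangent vectors of \<open>L_geo\<close> with the derivative of \<open>\<Phi>\<close>.\<close>

lemma critical_imp_minimal:
  assumes crit: "critical_point A (pseudo_sphere p) E \<phi>"
  shows "hamiltonian_minimal A (L_geo p \<epsilon>) h J (Omega p \<epsilon>) gauss"
  unfolding hamiltonian_minimal_def
proof (intro conjI ballI allI impI)
  show "immersion A gauss" "lagrangian A (Omega p \<epsilon>) gauss" "nondegenerate_metric A h gauss"
    by (fact IM lagrangian_gauss ND)+
  show "gauss x \<in> L_geo p \<epsilon>" if "x \<in> carrier A" for x by (rule gauss_in[OF that])
  fix \<delta> K G assume HV: "hamiltonian_variation A (L_geo p \<epsilon>) h J gauss \<delta> K G"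
  then have VG: "variation A (L_geo p \<epsilon>) gauss \<delta> K G" by (simp add: hamiltonian_variation_def)
  from HV obtain u K1 where u: "smooth_map A (u :: 'a \<Rightarrow> real)" and K1: "compact K1" "K1 \<subseteq> carrier A"
      "\<forall>x\<in>carrier A - K1. u x = 0"
    and nc: "\<forall>c\<in>A. \<forall>x\<in>fst c. is_normal_component h c gauss x (vector_derivative (\<lambda>t. G t x) (at 0))
             (J (gauss x) (differential c gauss x (induced_gradient h c gauss u x)))"
    unfolding hamiltonian_variation_def by blast
  have \<delta>: "\<delta> > 0" and K: "compact K" "K \<subseteq> carrier A"
    and GL: "\<And>t x. \<bar>t\<bar> < \<delta> \<Longrightarrow> x \<in> carrier A \<Longrightarrow> G t x \<in> L_geo p \<epsilon>"
    and G0: "\<And>x. x \<in> carrier A \<Longrightarrow> G 0 x = gauss x"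
    using VG by (auto simp: variation_def abs_less_iff)
  have G: "smooth_family \<delta> G" by (rule variation_smooth_family[OF VG])
  have OG: "Omega p \<epsilon> (gauss x) (velocity G x) (differential c gauss x w) = - differential c u x w"
    if c: "c \<in> A" "x \<in> fst c" for c x w
    by (rule hamiltonian_Omega[OF KS ND c u]) (use nc c in \<open>simp add: velocity_def\<close>)
  have tG: "tang x (velocity G x)" if "x \<in> carrier A" for x
    by (rule tang_velocity[OF G GL G0 that])
  \<comment> \<open>Off \<open>K\<close> the pairing with the velocity shows only that
    \<open>du\<close> vanishes, so \<open>u\<close> may be a nonzero constant on parts of the
    manifold. The hypersurface moves wherever \<open>u\<close> is nonzero, which requires the larger
    compact set.\<close>
  define K2 where "K2 = K \<union> K1"
  have K2: "compact K2" "K2 \<subseteq> carrier A" using K K1 by (auto simp: K2_def)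
  \<comment> \<open>The contraction with \<open>N x\<close> returns \<open>- \<epsilon>\<close>
    times \<open>Y\<close>, so the second summand is \<open>- Y\<close>; in this form
    \<open>w\<close> is visibly smooth and involves no choice of \<open>Y\<close>.\<close>
  define w where "w x = (- \<epsilon> * u x) *\<^sub>R N x + \<epsilon> *\<^sub>R contract p (velocity G x) (N x)" for x
  have sw: "smooth_map A w"
    unfolding smooth_map_def
  proof
    fix c assume c: "c \<in> A"
    note o = open_range[OF c]
    have "smooth_on (chart_range c) (\<lambda>y. (- \<epsilon> * (u \<circ> chart_inv c) y) *\<^sub>R (N \<circ> chart_inv c) y +
        \<epsilon> *\<^sub>R contract p ((velocity G \<circ> chart_inv c) y) ((N \<circ> chart_inv c) y))"
      using u[unfolded smooth_map_def, rule_format, OF c] smooth_N[unfolded smooth_map_def, rule_format, OF c]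
        smooth_velocity[OF G, unfolded smooth_map_def, rule_format, OF c]
      by (intro smooth_on_add smooth_on_scaleR smooth_on_mult smooth_on_const smooth_on_bilinear[OF bilinear_contract] o)
    then show "smooth_on (chart_range c) (w \<circ> chart_inv c)" by (simp add: w_def[abs_def] comp_def)
  qed
  have w0: "w x = 0" if x: "x \<in> carrier A" "x \<notin> K2" for x
  proof -
    obtain c where c: "c \<in> A" "x \<in> fst c" using carrierE[OF x(1)] .
    have xK: "x \<notin> K" "x \<notin> K1" using x(2) by (auto simp: K2_def)
    have "velocity G x = 0"
      by (rule velocity_locally_const[of \<delta> G x "gauss x", OF \<delta>]) (rule variation_constant(1)[OF VG _ c xK(1) smooth_gauss])
    moreover have "u x = 0" using K1(3) x(1) xK(2) by blast
    ultimately show ?thesis by (simp add: w_def bilinear_lzero[OF bilinear_contract])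
  qed
  \<comment> \<open>Since \<open>w\<close> is orthogonal to \<phi>, the point
    \<open>\<phi> x + t *\<^sub>R w x\<close> has square \<open>1 + t\<^sup>2 * r x\<close>. The
    metric is indefinite and \<open>r\<close> can be negative, so the time must be short before the
    point can be scaled back to the sphere.\<close>
  define r where "r x = ip p (w x) (w x)" for x
  have sr: "smooth_map A r" unfolding r_def[abs_def] by (rule smooth_map_bilinear[OF bilinear_ip sw sw])
  obtain \<delta>1 where \<delta>1: "0 < \<delta>1" "\<delta>1 \<le> \<delta>" "\<And>y. y \<in> K2 \<Longrightarrow> \<exists>c\<in>A. y \<in> fst c \<and> (\<forall>t. \<bar>t\<bar> < \<delta>1 \<longrightarrow> 1 + t\<^sup>2 * r y > 0)"
  proof (rule tube[OF K2 \<delta>, of "\<lambda>c t y. 1 + t\<^sup>2 * r y > 0"])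
    fix x assume "x \<in> K2"
    then obtain c where c: "c \<in> A" "x \<in> fst c" using K2 carrierE by blast
    have "continuous_on ({-\<delta><..<\<delta>} \<times> chart_range c) (\<lambda>z. (r \<circ> chart_inv c) (snd z))"
      by (rule continuous_on_compose2[OF smooth_on_imp_continuous_on[OF sr[unfolded smooth_map_def, rule_format, OF c(1)]]])
        (auto intro: continuous_intros)
    then have "continuous_on ({-\<delta><..<\<delta>} \<times> chart_range c) (\<lambda>z. 1 + (fst z)\<^sup>2 * (r \<circ> chart_inv c) (snd z))"
      by (intro continuous_intros)
    then show "\<exists>c\<in>A. x \<in> fst c \<and> (\<exists>q. continuous_on ({-\<delta><..<\<delta>} \<times> chart_range c) q \<and> q (0, snd c x) > (0 :: real) \<and>
      (\<forall>t y. \<bar>t\<bar> < \<delta> \<longrightarrow> y \<in> fst c \<longrightarrow> q (t, snd c y) > 0 \<longrightarrow> 1 + t\<^sup>2 * r y > 0))"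
      using c by (intro bexI[of _ c] conjI exI[of _ "\<lambda>z. 1 + (fst z)\<^sup>2 * (r \<circ> chart_inv c) (snd z)"]) auto
  qed blast
  have pos: "1 + t\<^sup>2 * r x > 0" if "\<bar>t\<bar> < \<delta>1" "x \<in> carrier A" for t x
  proof (cases "x \<in> K2")
    case True
    then show ?thesis using \<delta>1(3) that by blast
  next
    case False
    then show ?thesis using w0[OF that(2)] by (simp add: r_def)
  qed
  define F where "F t x = (1 / sqrt (1 + t\<^sup>2 * r x)) *\<^sub>R (\<phi> x + t *\<^sub>R w x)" for t x
  have sF: "smooth_family \<delta>1 F"
    unfolding smooth_family_def
  proof (intro conjI ballI)
    fix c assume c: "c \<in> A"
    let ?S = "{-\<delta>1<..<\<delta>1} \<times> chart_range c"
    note o = open_box[OF c, of \<delta>1]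
    have cf: "smooth_on ?S (\<lambda>q. f (chart_inv c (snd q)))" if "smooth_map A f" for f :: "'a \<Rightarrow> 'e::euclidean_space"
      using smooth_family_const[OF \<delta>1(1) that] c by (simp add: smooth_family_def fam_def[abs_def])
    have pos': "1 + (fst q)\<^sup>2 * r (chart_inv c (snd q)) > 0" if "q \<in> ?S" for q
      using that c carrierI[OF c inv_in[OF c]] by (intro pos) (auto simp: abs_less_iff)
    have "smooth_on ?S (\<lambda>q. (1 / sqrt (1 + (fst q)\<^sup>2 * r (chart_inv c (snd q)))) *\<^sub>R
        (\<phi> (chart_inv c (snd q)) + fst q *\<^sub>R w (chart_inv c (snd q))))"
    proof (intro smooth_on_scaleR smooth_on_add smooth_on_divide smooth_on_sqrt smooth_on_const smooth_on_mult
        smooth_on_power smooth_on_fst cf smooth_phi sw sr o pos')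
      fix q assume "q \<in> ?S"
      from pos'[OF this] show "sqrt (1 + (fst q)\<^sup>2 * r (chart_inv c (snd q))) \<noteq> 0" by simp
    qed
    then show "smooth_on ?S (fam F c)" by (simp add: fam_def[abs_def] F_def)
  qed (rule \<delta>1(1))
  have wphi: "ip p (w x) (\<phi> x) = 0" and Yw: "\<exists>X\<in>perp p (\<phi> x) (N x). \<exists>Y\<in>perp p (\<phi> x) (N x).
      velocity G x = wedge (\<phi> x) X + wedge (N x) Y \<and> w x = (- \<epsilon> * u x) *\<^sub>R N x - Y"
    if x: "x \<in> carrier A" for x
  proof -
    obtain c where c: "c \<in> A" "x \<in> fst c" using carrierE[OF x] .
    obtain X Y where XY: "X \<in> perp p (\<phi> x) (N x)" "Y \<in> perp p (\<phi> x) (N x)" "velocity G x = wedge (\<phi> x) X + wedge (N x) Y"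
      using tG[OF x] unfolding tang_def by blast
    have w: "w x = (- \<epsilon> * u x) *\<^sub>R N x - Y"
      unfolding w_def XY(3) contract_tangent(2)[OF geodesic_gauss[OF c] XY(1,2)] using eps_square[OF eps] by simp
    then show "\<exists>X\<in>perp p (\<phi> x) (N x). \<exists>Y\<in>perp p (\<phi> x) (N x).
      velocity G x = wedge (\<phi> x) X + wedge (N x) Y \<and> w x = (- \<epsilon> * u x) *\<^sub>R N x - Y" using XY by blast
    show "ip p (w x) (\<phi> x) = 0" unfolding w using normalD(2)[OF c] perpD(1)[OF XY(2)] by simp
  qed
  have V: "variation A (pseudo_sphere p) \<phi> \<delta>1 K2 F"
  proof (rule variationI[OF sF K2])
    fix t x assume t: "\<bar>t\<bar> < \<delta>1" and x: "x \<in> carrier A"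
    have "ip p (\<phi> x + t *\<^sub>R w x) (\<phi> x + t *\<^sub>R w x) = 1 + t\<^sup>2 * r x"
      using sphere[OF x] wphi[OF x] ip_commute[of p "\<phi> x" "w x"] by (simp add: r_def power2_eq_square)
    moreover define s where "s = sqrt (1 + t\<^sup>2 * r x)"
    have ss: "s * s = 1 + t\<^sup>2 * r x" "s > 0" using pos[OF t x] by (simp_all add: s_def)
    ultimately have "ip p (\<phi> x + t *\<^sub>R w x) (\<phi> x + t *\<^sub>R w x) = s * s" by simp
    then have "ip p (F t x) (F t x) = 1"
      by (simp only: F_def s_def[symmetric] ip_scaleR_left ip_scaleR_right) (use ss(2) in simp)
    then show "F t x \<in> pseudo_sphere p" by (simp add: pseudo_sphere_def)
    show "F t x = \<phi> x" if "x \<notin> K2"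
      using w0[OF x that] by (simp add: F_def r_def)
  qed (simp add: F_def)
  have vF: "velocity F x = w x" if x: "x \<in> carrier A" for x
  proof -
    \<comment> \<open>The scaling factor is even in \<open>t\<close>, so it leaves the initial
      velocity unchanged.\<close>
    have "((\<lambda>t. 1 / sqrt (1 + t\<^sup>2 * r x)) has_real_derivative 0) (at 0)"
      by (auto intro!: derivative_eq_intros)
    moreover have "((\<lambda>t. \<phi> x + t *\<^sub>R w x) has_vector_derivative w x) (at 0)"
      by (auto intro!: derivative_eq_intros)
    ultimately have "((\<lambda>t. F t x) has_vector_derivative
        (1 / sqrt (1 + 0\<^sup>2 * r x)) *\<^sub>R w x + 0 *\<^sub>R (\<phi> x + 0 *\<^sub>R w x)) (at 0)"
      unfolding F_def by (rule has_vector_derivative_scaleR)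
    then show ?thesis unfolding velocity_def by (simp add: vector_derivative_at)
  qed
  obtain \<delta>' N' where \<delta>': "0 < \<delta>'" "\<delta>' \<le> \<delta>1" and N': "smooth_family \<delta>' N'" "\<And>x. x \<in> carrier A \<Longrightarrow> N' 0 x = N x"
      "\<And>t x. \<bar>t\<bar> < \<delta>' \<Longrightarrow> x \<in> carrier A \<Longrightarrow> x \<notin> K2 \<Longrightarrow> N' t x = N x"
      and H: "\<And>t. \<bar>t\<bar> < \<delta>' \<Longrightarrow> hyp A p \<epsilon> (F t) (N' t)"
    using normal_variation[OF V] by metis
  define \<Psi> where "\<Psi> t x = wedge (F t x) (N' t x)" for t x
  define u' where "u' x = - ip p (velocity F x) (N x)" for x
  have N0: "\<forall>x\<in>carrier A. N' 0 x = N x" and H': "\<forall>t. \<bar>t\<bar> < \<delta>' \<longrightarrow> hyp A p \<epsilon> (F t) (N' t)"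
    using N'(2) H by blast+
  note gv = gauss_variation[OF KS ND V \<delta>' N'(1) N0 H', folded \<Psi>_def u'_def]
  have uu: "u' x = u x" if x: "x \<in> carrier A" for x
  proof -
    obtain c where c: "c \<in> A" "x \<in> fst c" using carrierE[OF x] .
    obtain Y where Y: "Y \<in> perp p (\<phi> x) (N x)" "w x = (- \<epsilon> * u x) *\<^sub>R N x - Y" using Yw[OF x] by blast
    show ?thesis unfolding u'_def vF[OF x] Y(2)
      using normalD(1)[OF c] perpD(2)[OF Y(1)] eps_square[OF eps] by (simp add: mult.commute mult.left_commute)
  qed
  have v\<Psi>: "velocity G x = velocity \<Psi> x" if x: "x \<in> carrier A" for x
  proof -
    obtain c where c: "c \<in> A" "x \<in> fst c" using carrierE[OF x] .
    interpret f: hframe p \<epsilon> "\<phi> x" "N x" "differential c \<phi> x" "differential c N x" by (rule frame[OF c])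
    obtain X Y where XY: "X \<in> perp p (\<phi> x) (N x)" "Y \<in> perp p (\<phi> x) (N x)" "velocity G x = wedge (\<phi> x) X + wedge (N x) Y"
      "w x = (- \<epsilon> * u x) *\<^sub>R N x - Y" using Yw[OF x] by blast
    note ov = f.Omega_variation[OF gv(5)[OF x] gv(6)[OF x]]
    \<comment> \<open>The velocities have the same second component \<open>Y\<close> by the choice
      of \<open>w\<close>. The first components \<open>X\<close> and \<open>X1\<close> are compared
      through \<Omega>, where both velocities belong to the same function \<open>u\<close>.\<close>
    define X1 where "X1 = velocity N' x - ip p (velocity N' x) (\<phi> x) *\<^sub>R \<phi> x"
    have "ip p (velocity F x) (N x) = - u x" using uu[OF x] unfolding u'_def by simp
    then have "- (velocity F x - (\<epsilon> * ip p (velocity F x) (N x)) *\<^sub>R N x) = Y"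
      using vF[OF x] XY(4) by simp
    then have v: "velocity \<Psi> x = wedge (\<phi> x) X1 + wedge (N x) Y" and X1: "X1 \<in> perp p (\<phi> x) (N x)"
      using gv(7)[OF x] ov(1,2) by (simp_all add: X1_def)
    have "differential c u' x v = differential c u x v" for v
      using differential_cong_open[OF c open_carrier x _ u, of u'] uu by simp
    then have "Omega p \<epsilon> (gauss x) (velocity G x) (differential c gauss x v) = Omega p \<epsilon> (gauss x) (velocity \<Psi> x) (differential c gauss x v)" for v
      using OG[OF c, of v] gv(8)[OF c, of v] by simp
    then have "X = X1"
      by (intro f.tangent_eqI[OF XY(1) X1 XY(2)]) (simp only: v XY(3) differential_gauss[OF c] gauss_def)
    then show ?thesis using v XY(3) by simp
  qed
  have DE: "((\<lambda>t. E K2 (F t)) has_real_derivative 0) (at 0)"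
    using crit V unfolding critical_point_def by blast
  obtain \<eta> where \<eta>: "\<eta> > 0" "\<And>t. \<bar>t\<bar> < \<eta> \<Longrightarrow> E K2 (F t) = measure (volume_measure A (\<lambda>_. b) (\<Psi> t)) K2"
    using E[OF V \<delta>' N' H] unfolding \<Psi>_def[abs_def] by blast
  have D\<Psi>: "((\<lambda>t. measure (volume_measure A (\<lambda>_. b) (\<Psi> t)) K2) has_real_derivative 0) (at 0)"
    by (rule has_field_derivative_transform_within_open[OF DE, of "{-\<eta><..<\<eta>}"]) (use \<eta> in \<open>auto simp: abs_less_iff\<close>)
  have \<delta>'': "0 < \<delta>'" "\<delta>' \<le> \<delta>" using \<delta>' \<delta>1(2) by auto
  have \<Psi>0: "G 0 x = \<Psi> 0 x" if "x \<in> carrier A" for x using G0[OF that] gv(4)[OF that] by simp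
  have nd: "det (gram (pullback b c (\<Psi> 0) x)) \<noteq> 0" if c: "c \<in> A" "x \<in> fst c" for c x
  proof -
    have "differential c (\<Psi> 0) x = differential c gauss x"
      using differential_cong_open[OF c open_carrier carrierI[OF c] _ smooth_gauss, of "\<Psi> 0"] gv(4) by simp
    from pullback_cong[OF this, of b] show ?thesis using det_gram_gauss[OF KS ND c] by simp
  qed
  have DG: "((\<lambda>t. measure (volume_measure A (\<lambda>_. b) (G t)) K2) has_real_derivative 0) (at 0)"
    by (rule volume_derivative_velocity[OF smooth_family_mono[OF G \<delta>''] gv(1) bilinear_b[OF KS ND] \<Psi>0 v\<Psi> nd K2 D\<Psi>])
  have "((\<lambda>t. measure (volume_measure A (\<lambda>_. b) (G t)) K) has_real_derivative 0) (at 0)"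
    by (rule volume_derivative_subset[OF VG smooth_gauss bilinear_b[OF KS ND] K2 _ DG]) (simp add: K2_def)
  then show "((\<lambda>t. measure (volume_measure A h (G t)) K) has_real_derivative 0) (at 0)"
  proof (rule has_field_derivative_transform_within_open[of _ _ _ "{-\<delta><..<\<delta>}"])
    fix t assume "t \<in> {-\<delta><..<\<delta>}"
    then have t: "\<bar>t\<bar> < \<delta>" by (auto simp: abs_less_iff)
    have "volume_measure A h (G t) = volume_measure A (\<lambda>_. b) (G t)"
      by (rule volume_measure_kahler[OF KS eps smooth_family_map[OF G t] GL[OF t]])
    then show "measure (volume_measure A (\<lambda>_. b) (G t)) K = measure (volume_measure A h (G t)) K" by simp
  qed (use \<delta> in auto)
qed

lemma hamiltonian_minimal_iff_critical:
  "hamiltonian_minimal A (L_geo p \<epsilon>) h J (Omega p \<epsilon>) gauss \<longleftrightarrow> critical_point A (pseudo_sphere p) E \<phi>"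
  using minimal_imp_critical critical_imp_minimal by blast

end

theorem hamiltonian_minimal_iff_W:
  assumes "immersion A gauss" "nondegenerate_metric A (G_metric p) gauss"
  shows "hamiltonian_minimal A (L_geo p \<epsilon>) (G_metric p) (J_geo p \<epsilon>) (Omega p \<epsilon>) gauss \<longleftrightarrow>
    critical_point A (pseudo_sphere p) (W_functional A p \<epsilon>) \<phi>"
proof (rule hamiltonian_minimal_iff_critical[OF kahler_structure_G[OF eps] assms(2,1)])
  fix \<delta> \<delta>' K and F N' :: "real \<Rightarrow> 'a \<Rightarrow> 'm rvec"
  assume V: "variation A (pseudo_sphere p) \<phi> \<delta> K F" and \<delta>': "0 < \<delta>'" "\<delta>' \<le> \<delta>"
    and N': "smooth_family \<delta>' N'" "\<And>x. x \<in> carrier A \<Longrightarrow> N' 0 x = N x"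
      "\<And>t x. \<bar>t\<bar> < \<delta>' \<Longrightarrow> x \<in> carrier A \<Longrightarrow> x \<notin> K \<Longrightarrow> N' t x = N x"
    and H: "\<And>t. \<bar>t\<bar> < \<delta>' \<Longrightarrow> hyp A p \<epsilon> (F t) (N' t)"
  show "\<exists>\<eta>>0. \<forall>t. \<bar>t\<bar> < \<eta> \<longrightarrow> W_functional A p \<epsilon> K (F t) = measure (volume_measure A (\<lambda>_. biv_ip p) (\<lambda>x. wedge (F t x) (N' t x))) K"
  proof (intro exI[of _ \<delta>'] conjI \<delta>'(1) allI impI)
    fix t assume "\<bar>t\<bar> < \<delta>'"
    then interpret h: hyp A p \<epsilon> "F t" "N' t" by (rule H)
    show "W_functional A p \<epsilon> K (F t) = measure (volume_measure A (\<lambda>_. biv_ip p) (\<lambda>x. wedge (F t x) (N' t x))) K"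
      using h.W_functional_eq[OF family_compact[OF V]] unfolding h.gauss_def[abs_def] .
  qed
qed

theorem hamiltonian_minimal_iff_W':
  assumes two: "CARD('n) = 2" and "immersion A gauss" "nondegenerate_metric A (G'_metric p \<epsilon>) gauss"
    and d: "\<And>c x. c \<in> A \<Longrightarrow> x \<in> fst c \<Longrightarrow> disc (matrix (shape_operator c \<phi> N x)) > 0"
  shows "hamiltonian_minimal A (L_geo p \<epsilon>) (G'_metric p \<epsilon>) (J'_geo p \<epsilon>) (Omega p \<epsilon>) gauss \<longleftrightarrow>
    critical_point A (pseudo_sphere p) (W'_functional A p \<epsilon>) \<phi>"
proof (rule hamiltonian_minimal_iff_critical[OF kahler_structure_G'[OF _ eps] assms(3,2)])
  show "CARD('m) = 4" using card two by simp
next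
  fix \<delta> \<delta>' K and F N' :: "real \<Rightarrow> 'a \<Rightarrow> 'm rvec"
  assume V: "variation A (pseudo_sphere p) \<phi> \<delta> K F" and \<delta>': "0 < \<delta>'" "\<delta>' \<le> \<delta>"
    and N': "smooth_family \<delta>' N'" "\<And>x. x \<in> carrier A \<Longrightarrow> N' 0 x = N x"
      "\<And>t x. \<bar>t\<bar> < \<delta>' \<Longrightarrow> x \<in> carrier A \<Longrightarrow> x \<notin> K \<Longrightarrow> N' t x = N x"
    and H: "\<And>t. \<bar>t\<bar> < \<delta>' \<Longrightarrow> hyp A p \<epsilon> (F t) (N' t)"
  obtain \<eta> where \<eta>: "0 < \<eta>" "\<eta> \<le> \<delta>'"
      "\<And>t c x. \<bar>t\<bar> < \<eta> \<Longrightarrow> c \<in> A \<Longrightarrow> x \<in> fst c \<Longrightarrow> disc (matrix (shape_operator c (F t) (N' t) x)) > 0"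
    using disc_variation[OF V \<delta>' N' H d] by blast
  show "\<exists>\<eta>>0. \<forall>t. \<bar>t\<bar> < \<eta> \<longrightarrow> W'_functional A p \<epsilon> K (F t) = measure (volume_measure A (\<lambda>_. klein) (\<lambda>x. wedge (F t x) (N' t x))) K"
  proof (intro exI[of _ \<eta>] conjI \<eta>(1) allI impI)
    fix t assume t: "\<bar>t\<bar> < \<eta>"
    then interpret h: hyp A p \<epsilon> "F t" "N' t" using \<eta>(2) by (intro H) simp
    show "W'_functional A p \<epsilon> K (F t) = measure (volume_measure A (\<lambda>_. klein) (\<lambda>x. wedge (F t x) (N' t x))) K"
      using h.W'_functional_eq[OF two family_compact[OF V] \<eta>(3)[OF t]] unfolding h.gauss_def[abs_def] .
  qed
qed

section \<open>The non-umbilic points\<close>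

lemma principal_curvatures_iff:
  assumes c: "c \<in> A" "x \<in> fst c"
  shows "principal_curvatures c p \<phi> N x k \<longleftrightarrow>
    (\<exists>e. orthonormal (hframe.g p (differential c \<phi> x)) e \<and> (\<forall>i. shape_operator c \<phi> N x (e i) = k i *\<^sub>R e i))"
  by (simp add: principal_curvatures_def metric_eq(2)[OF c])

text \<open>The definition ranges over all charts and all families of principal curvatures.
  Diagonalizability provides at least one family, and being a multiple of the identity is
  independent of the chart.\<close>

lemma non_umbilic_iff:
  assumes rd: "real_diagonalizable A p \<phi> N" and c: "c \<in> A" "x \<in> fst c"
  shows "x \<in> non_umbilic A p \<phi> N \<longleftrightarrow> \<not> (\<exists>l. \<forall>v. shape_operator c \<phi> N x v = l *\<^sub>R v)"
proof -
  have scalar: "\<forall>v. shape_operator c' \<phi> N x v = l *\<^sub>R v"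
    if c': "c1 \<in> A" "x \<in> fst c1" "c' \<in> A" "x \<in> fst c'" and l: "\<forall>v. shape_operator c1 \<phi> N x v = l *\<^sub>R v" for c1 c' l
  proof
    fix v
    obtain v' where v': "trans c1 c' x v' = v" using trans_onto[OF c'(1,3,2,4)] by blast
    show "shape_operator c' \<phi> N x v = l *\<^sub>R v"
      using shape_change[OF c'(1,3,2,4), of v'] l linear_cmul[OF linear_trans[OF c'(1,3,2,4)], of l v'] v' by simp
  qed
  show ?thesis
  proof
    assume nu: "x \<in> non_umbilic A p \<phi> N"
    show "\<not> (\<exists>l. \<forall>v. shape_operator c \<phi> N x v = l *\<^sub>R v)"
    proof
      assume "\<exists>l. \<forall>v. shape_operator c \<phi> N x v = l *\<^sub>R v"
      then obtain l where l: "\<forall>v. shape_operator c \<phi> N x v = l *\<^sub>R v" by blast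
      obtain c' V e k where c': "c' \<in> A" "x \<in> V" "V \<subseteq> fst c'"
        and e: "\<And>y. y \<in> V \<Longrightarrow> orthonormal (induced_metric (\<lambda>_. ip p) c' \<phi> y) (\<lambda>i. e i y)"
          "\<And>y i. y \<in> V \<Longrightarrow> shape_operator c' \<phi> N y (e i y) = k i y *\<^sub>R e i y"
        by (rule real_diagonalizableE[OF rd carrierI[OF c]]) (rule that)
      have x: "x \<in> fst c'" using c' by blast
      have pc: "principal_curvatures c' p \<phi> N x (\<lambda>i. k i x)"
        unfolding principal_curvatures_def using e c'(2) by blast
      then obtain i j where ij: "k i x \<noteq> k j x"
        using nu c'(1) x unfolding non_umbilic_def by blast
      interpret f: hframe p \<epsilon> "\<phi> x" "N x" "differential c' \<phi> x" "differential c' N x" by (rule frame[OF c'(1) x])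
      have o: "orthonormal f.g (\<lambda>i. e i x)" using e(1)[OF c'(2)] metric_eq(2)[OF c'(1) x] by simp
      have "k q x = l" for q
      proof -
        have "k q x *\<^sub>R e q x = l *\<^sub>R e q x"
          using e c'(2) scalar[OF c c'(1) x l] by metis
        moreover have "f.g (e q x) (e q x) \<in> {-1, 1}" using o unfolding orthonormal_def by blast
        then have "e q x \<noteq> 0" using bilinear_lzero[OF f.bilinear_g] by auto
        ultimately show ?thesis by simp
      qed
      then show False using ij by simp
    qed
  next
    assume ns: "\<not> (\<exists>l. \<forall>v. shape_operator c \<phi> N x v = l *\<^sub>R v)"
    have "\<exists>i j. k i \<noteq> k j" if c': "c' \<in> A" "x \<in> fst c'" and pc: "principal_curvatures c' p \<phi> N x k" for c' and k :: "'n \<Rightarrow> real"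
    proof (rule ccontr)
      assume "\<not> (\<exists>i j. k i \<noteq> k j)"
      then obtain l where l: "\<And>i. k i = l" by metis
      interpret f: hframe p \<epsilon> "\<phi> x" "N x" "differential c' \<phi> x" "differential c' N x" by (rule frame[OF c'])
      obtain e where e: "orthonormal f.g e" "\<And>i. f.S (e i) = l *\<^sub>R e i"
        using pc unfolding principal_curvatures_iff[OF c'] shape_eq[OF c'] l by blast
      have "\<forall>v. shape_operator c' \<phi> N x v = l *\<^sub>R v" using f.frame_scalar[OF e] by (simp add: shape_eq[OF c'])
      from scalar[OF c' c this] show False using ns by blast
    qed
    then show "x \<in> non_umbilic A p \<phi> N" using carrierI[OF c] unfolding non_umbilic_def by blast
  qed
qed

text \<open>The curvature functions come without any regularity. Expressing them through the smooth
  frame makes them continuous, so two curvatures that differ at a point differ nearby.\<close>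

lemma open_non_umbilic:
  assumes rd: "real_diagonalizable A p \<phi> N"
  shows "open (non_umbilic A p \<phi> N)"
proof (subst open_subopen, intro ballI)
  fix x assume nu: "x \<in> non_umbilic A p \<phi> N"
  then have x: "x \<in> carrier A" by (simp add: non_umbilic_def)
  obtain c V e k where c: "c \<in> A" and V: "open V" "x \<in> V" "V \<subseteq> fst c"
    and sm: "\<And>i :: 'n. smooth_on (snd c ` V) (e i \<circ> chart_inv c)"
    and e: "\<And>y. y \<in> V \<Longrightarrow> orthonormal (induced_metric (\<lambda>_. ip p) c \<phi> y) (\<lambda>i. e i y)"
      "\<And>y i. y \<in> V \<Longrightarrow> shape_operator c \<phi> N y (e i y) = k i y *\<^sub>R e i y"
    by (rule real_diagonalizableE[OF rd x]) (rule that)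
  have "principal_curvatures c p \<phi> N x (\<lambda>i. k i x)" unfolding principal_curvatures_def using e V(2) by blast
  then obtain i j where ij: "k i x \<noteq> k j x" using nu c V unfolding non_umbilic_def by blast
  define B where "B a y = ip p (differential c \<phi> y (e a y)) (differential c \<phi> y (e a y))" for a y
  define D where "D a y = ip p (differential c N y (e a y)) (differential c \<phi> y (e a y))" for a y
  \<comment> \<open>The square \<open>B\<close> of a frame vector is 1 or -1, so multiplication by
    it serves as division.\<close>
  have kBD: "k a y = - B a y * D a y" if y: "y \<in> V" for a y
  proof -
    have yc: "y \<in> fst c" using y V by blast
    interpret f: hframe p \<epsilon> "\<phi> y" "N y" "differential c \<phi> y" "differential c N y" by (rule frame[OF c yc])
    have S: "f.S (e a y) = k a y *\<^sub>R e a y" using e(2)[OF y] shape_eq[OF c yc] by simp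
    have "orthonormal f.g (\<lambda>i. e i y)" using e(1)[OF y] metric_eq(2)[OF c yc] by simp
    then have "B a y \<in> {-1, 1}" unfolding orthonormal_def f.g_def B_def by blast
    moreover have "D a y = - k a y * B a y"
      using f.B_eq[of "e a y"] unfolding D_def B_def S by (simp add: linear_cmul[OF f.linear_L])
    ultimately show ?thesis by auto
  qed
  have oV: "open (snd c ` V)" by (rule open_image[OF c V(1,3)])
  have sub: "snd c ` V \<subseteq> chart_range c" using V(3) by (auto simp: chart_range_def)
  have sd: "smooth_on (snd c ` V) (\<lambda>u. differential c f (chart_inv c u) (e a (chart_inv c u)))"
    if f: "smooth_map A f" for f :: "'a \<Rightarrow> 'm rvec" and a
  proof (rule smooth_on_cong[OF oV])
    show "smooth_on (snd c ` V) (\<lambda>u. frechet_derivative (f \<circ> chart_inv c) (at u) ((e a \<circ> chart_inv c) u))"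
      by (rule smooth_on_frechet[OF f[unfolded smooth_map_def, rule_format, OF c] open_range[OF c] oV _ smooth_on_id[OF oV] sm])
        (use sub in blast)
    show "frechet_derivative (f \<circ> chart_inv c) (at u) ((e a \<circ> chart_inv c) u) = differential c f (chart_inv c u) (e a (chart_inv c u))"
      if "u \<in> snd c ` V" for u using that sub c by (auto simp: differential_def subset_iff)
  qed
  have "smooth_on (snd c ` V) (\<lambda>u. - B a (chart_inv c u) * D a (chart_inv c u))" for a
    unfolding B_def D_def
    by (intro smooth_on_mult smooth_on_minus smooth_on_bilinear[OF bilinear_ip] oV sd smooth_phi smooth_N)
  from smooth_on_imp_continuous_on[OF this]
  have "continuous_on (snd c ` V) (\<lambda>u. - B i (chart_inv c u) * D i (chart_inv c u) - - B j (chart_inv c u) * D j (chart_inv c u))"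
    by (intro continuous_on_diff)
  then have "continuous_on V (\<lambda>y. - B i (chart_inv c (snd c y)) * D i (chart_inv c (snd c y)) -
      - B j (chart_inv c (snd c y)) * D j (chart_inv c (snd c y)))"
    by (rule continuous_on_compose2[OF _ continuous_on_subset[OF cont_snd[OF c] V(3)]]) simp
  then have "continuous_on V (\<lambda>y. k i y - k j y)"
  proof (rule continuous_on_eq)
    fix y assume y: "y \<in> V"
    then have "chart_inv c (snd c y) = y" using V(3) c by auto
    then show "- B i (chart_inv c (snd c y)) * D i (chart_inv c (snd c y)) -
      - B j (chart_inv c (snd c y)) * D j (chart_inv c (snd c y)) = k i y - k j y"
      using kBD[OF y] by simp
  qed
  from continuous_open_preimage[OF this V(1), of "- {0}"]
  have o: "open (V \<inter> (\<lambda>y. k i y - k j y) -` (- {0}))" by (simp add: open_Compl)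
  show "\<exists>T. open T \<and> x \<in> T \<and> T \<subseteq> non_umbilic A p \<phi> N"
  proof (intro exI[of _ "V \<inter> (\<lambda>y. k i y - k j y) -` (- {0})"] conjI subsetI)
    show "open (V \<inter> (\<lambda>y. k i y - k j y) -` (- {0}))" by (rule o)
    show "x \<in> V \<inter> (\<lambda>y. k i y - k j y) -` (- {0})" using V ij by simp
    fix y assume y: "y \<in> V \<inter> (\<lambda>y. k i y - k j y) -` (- {0})"
    then have yc: "y \<in> fst c" "y \<in> V" "k i y \<noteq> k j y" using V by auto
    interpret f: hframe p \<epsilon> "\<phi> y" "N y" "differential c \<phi> y" "differential c N y" by (rule frame[OF c yc(1)])
    have o: "orthonormal f.g (\<lambda>i. e i y)" using e(1)[OF yc(2)] metric_eq(2)[OF c yc(1)] by simp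
    have nz: "e q y \<noteq> 0" for q
    proof -
      have "f.g (e q y) (e q y) \<in> {-1, 1}" using o unfolding orthonormal_def by blast
      then show ?thesis using bilinear_lzero[OF f.bilinear_g] by auto
    qed
    show "y \<in> non_umbilic A p \<phi> N"
      unfolding non_umbilic_iff[OF rd c yc(1)]
    proof
      assume "\<exists>l. \<forall>v. shape_operator c \<phi> N y v = l *\<^sub>R v"
      then obtain l where "\<And>v. shape_operator c \<phi> N y v = l *\<^sub>R v" by blast
      then have "k q y *\<^sub>R e q y = l *\<^sub>R e q y" for q using e yc by metis
      then have "k q y = l" for q using nz[of q] by (metis scaleR_cancel_right)
      then show False using yc(3) by simp
    qed
  qed
qed

lemma disc_non_umbilic:
  assumes two: "CARD('n) = 2" and rd: "real_diagonalizable A p \<phi> N" and c: "c \<in> A" "x \<in> fst c"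
    and nu: "x \<in> non_umbilic A p \<phi> N"
  shows "disc (matrix (shape_operator c \<phi> N x)) > 0"
proof -
  obtain c' V e k where c': "c' \<in> A" "x \<in> V" "V \<subseteq> fst c'"
    and e: "\<And>y. y \<in> V \<Longrightarrow> orthonormal (induced_metric (\<lambda>_. ip p) c' \<phi> y) (\<lambda>i. e i y)"
      "\<And>y i. y \<in> V \<Longrightarrow> shape_operator c' \<phi> N y (e i y) = k i y *\<^sub>R e i y"
    by (rule real_diagonalizableE[OF rd carrierI[OF c]]) (rule that)
  have x: "x \<in> fst c'" using c' by blast
  have "principal_curvatures c' p \<phi> N x (\<lambda>i. k i x)"
    unfolding principal_curvatures_def using e c'(2) by blast
  then obtain i j where ij: "k i x \<noteq> k j x" using nu c'(1) x unfolding non_umbilic_def by blast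
  then have "i \<noteq> j" by auto
  interpret f: hframe p \<epsilon> "\<phi> x" "N x" "differential c' \<phi> x" "differential c' N x" by (rule frame[OF c'(1) x])
  have o: "orthonormal f.g (\<lambda>i. e i x)" using e(1)[OF c'(2)] metric_eq(2)[OF c'(1) x] by simp
  have "disc (matrix f.S) = (k i x - k j x)\<^sup>2"
    by (rule f.disc_principal[OF two o _ \<open>i \<noteq> j\<close>]) (use e(2)[OF c'(2)] shape_eq[OF c'(1) x] in simp)
  then show ?thesis using disc_change[OF c(1) c'(1) c(2) x] ij by (simp add: shape_eq[OF c'(1) x])
qed

end

theorem theorem1p2:
  fixes \<Sigma> :: "('a::{t2_space,second_countable_topology}, 'n::finite) chart set"
    and p :: nat and \<epsilon> :: real
    and \<phi> N :: "'a \<Rightarrow> real ^ 'm::{finite,linorder}"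
  defines "\<Phi> \<equiv> (\<lambda>x. wedge (\<phi> x) (N x))"
    and "\<Sigma>\<^sub>0 \<equiv> restrict_atlas \<Sigma> (non_umbilic \<Sigma> p \<phi> N)"
  assumes "CARD('m) = CARD('n) + 2" and "p \<le> CARD('n) + 2"
    and "oriented_manifold \<Sigma>"
    and "\<forall>x\<in>carrier \<Sigma>. \<phi> x \<in> pseudo_sphere p"
    and "immersion \<Sigma> \<phi>" and "nondegenerate_metric \<Sigma> (\<lambda>_. ip p) \<phi>"
    and "\<epsilon> \<in> {-1, 1}" and "unit_normal \<Sigma> p \<epsilon> \<phi> N"
    and "real_diagonalizable \<Sigma> p \<phi> N"
  shows "(immersion \<Sigma>\<^sub>0 \<Phi> \<and> nondegenerate_metric \<Sigma>\<^sub>0 (G_metric p) \<Phi> \<longrightarrow>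
      (hamiltonian_minimal \<Sigma>\<^sub>0 (L_geo p \<epsilon>) (G_metric p) (J_geo p \<epsilon>) (Omega p \<epsilon>) \<Phi> \<longleftrightarrow>
       critical_point \<Sigma>\<^sub>0 (pseudo_sphere p) (W_functional \<Sigma>\<^sub>0 p \<epsilon>) \<phi>)) \<and>
    (CARD('n) = 2 \<longrightarrow>
     immersion \<Sigma>\<^sub>0 \<Phi> \<and> nondegenerate_metric \<Sigma>\<^sub>0 (G'_metric p \<epsilon>) \<Phi> \<longrightarrow>
      (hamiltonian_minimal \<Sigma>\<^sub>0 (L_geo p \<epsilon>) (G'_metric p \<epsilon>) (J'_geo p \<epsilon>) (Omega p \<epsilon>) \<Phi> \<longleftrightarrow>
       critical_point \<Sigma>\<^sub>0 (pseudo_sphere p) (W'_functional \<Sigma>\<^sub>0 p \<epsilon>) \<phi>))"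
proof -
  \<comment> \<open>The whole of \<Sigma> is considered first: openness of the non-umbilic set is a
    statement about \<Sigma>, and it is what makes \<open>\<Sigma>\<^sub>0\<close> an oriented
    manifold.\<close>
  interpret M: hyp \<Sigma> p \<epsilon> \<phi> N
    by (intro hyp.intro hyp_axioms.intro omfd.intro)
      (use assms in \<open>auto simp: immersion_def pseudo_sphere_def\<close>)
  define W where "W = non_umbilic \<Sigma> p \<phi> N"
  have W: "open W" unfolding W_def by (rule M.open_non_umbilic) (fact assms)
  have S0: "\<Sigma>\<^sub>0 = restrict_atlas \<Sigma> W" by (simp add: \<Sigma>\<^sub>0_def W_def)
  interpret O: omfd \<Sigma>\<^sub>0 unfolding S0 by (rule M.omfd_restrict[OF W])
  have chart: "\<exists>d\<in>\<Sigma>. c = (fst d \<inter> W, snd d)" if "c \<in> \<Sigma>\<^sub>0" for c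
    using that unfolding S0 restrict_atlas_iff .
  have dr: "differential (fst d \<inter> W, snd d) f x = differential d f x" if "d \<in> \<Sigma>" "x \<in> fst d \<inter> W"
    for d x and f :: "'a \<Rightarrow> 'm rvec"
    by (rule M.differential_restrict[OF that(1) W that(2)])
  interpret H: hyp \<Sigma>\<^sub>0 p \<epsilon> \<phi> N
  proof (intro hyp.intro hyp_axioms.intro)
    show "omfd \<Sigma>\<^sub>0" by (rule O.omfd_axioms)
    show "CARD('m) = CARD('n) + 2" "\<epsilon> \<in> {-1, 1}" by (fact assms)+
    show "ip p (\<phi> x) (\<phi> x) = 1" if "x \<in> carrier \<Sigma>\<^sub>0" for x
      using that M.sphere unfolding S0 carrier_restrict by blast
    show "smooth_map \<Sigma>\<^sub>0 \<phi>" unfolding S0 by (rule M.smooth_map_restrict[OF W M.smooth_phi])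
    show "nondegenerate_metric \<Sigma>\<^sub>0 (\<lambda>_. ip p) \<phi>"
      unfolding nondegenerate_metric_def induced_metric_def
    proof (intro ballI allI impI)
      fix c x v assume "c \<in> \<Sigma>\<^sub>0" and x: "x \<in> fst c"
        and 0: "\<forall>w. ip p (differential c \<phi> x v) (differential c \<phi> x w) = 0"
      then obtain d where d: "d \<in> \<Sigma>" "c = (fst d \<inter> W, snd d)" using chart by blast
      then have x': "x \<in> fst d \<inter> W" using x by simp
      show "v = 0"
        by (rule M.nondegD[OF d(1)]) (use x' 0 dr[OF d(1) x'] d(2) in auto)
    qed
    show "unit_normal \<Sigma>\<^sub>0 p \<epsilon> \<phi> N"
      unfolding unit_normal_def
    proof (intro conjI ballI allI)
      show "smooth_map \<Sigma>\<^sub>0 N" unfolding S0 by (rule M.smooth_map_restrict[OF W M.smooth_N])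
      fix c x v assume "c \<in> \<Sigma>\<^sub>0" and x: "x \<in> fst c"
      then obtain d where d: "d \<in> \<Sigma>" "c = (fst d \<inter> W, snd d)" using chart by blast
      then have x': "x \<in> fst d \<inter> W" using x by simp
      show "ip p (N x) (N x) = \<epsilon>" "ip p (N x) (\<phi> x) = 0" "ip p (N x) (differential c \<phi> x v) = 0"
        unfolding d(2) dr[OF d(1) x'] using M.normalD[OF d(1)] x' by blast+
    qed
  qed
  have \<Phi>: "\<Phi> = H.gauss" by (simp add: \<Phi>_def H.gauss_def fun_eq_iff)
  \<comment> \<open>A restricted chart has the same differentials, hence the same shape operator, so
    the sign of the discriminant can be taken from \<Sigma>.\<close>
  have disc: "disc (matrix (shape_operator c \<phi> N x)) > 0" if two: "CARD('n) = 2" and c: "c \<in> \<Sigma>\<^sub>0" "x \<in> fst c" for c x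
  proof -
    obtain d where d: "d \<in> \<Sigma>" "c = (fst d \<inter> W, snd d)" using chart[OF c(1)] by blast
    then have x': "x \<in> fst d \<inter> W" using c by simp
    have "shape_operator c \<phi> N x = shape_operator d \<phi> N x"
      by (simp add: shape_operator_def[abs_def] d(2) dr[OF d(1) x'])
    then show ?thesis using M.disc_non_umbilic[OF two _ d(1)] x' assms(11) unfolding W_def by simp
  qed
  show ?thesis
    unfolding \<Phi> using H.hamiltonian_minimal_iff_W H.hamiltonian_minimal_iff_W'[OF _ _ _ disc] by blast
qed

end
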